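(* Assume that $f\in C^3(\mathcal{Y})$ is $\omega_f$-strongly convex with $\omega_f>0$, that $g\in C^1(\mathcal{X})$ with $\nabla g$ Lipschitz continuous with constant $L_{\nabla g}>0$, that $g,f^\ast$ are $\omega_g$- and $\omega_{f^\ast}$-strongly convex, respectively ($\omega_g,\omega_{f^\ast}>0$), and that $$D_1:=\mathbb{E}_{X\sim\mu^\ast}\left[\|\nabla(\nabla f\circ K)(X)\|_F^2\right]<\infty,\qquad D_2:=\mathbb{E}_{X\sim\mu^\ast}\left[\|\nabla\cdot\nabla(\nabla f\circ K)(X)\|^2\right]<\infty,$$ $$D_3:=\mathbb{E}_{X\sim\mu^\ast}\left[\|\nabla(\nabla f\circ K)(X)(\nabla g(X)+K^T\nabla f(KX))\|^2\right]<\infty .$$ Let $\lambda>\omega_g/\omega_{f^\ast}$, let $\pi_\lambda$ be the stationary distribution of the primal-dual diffusion $$\mathrm{d}X_t=-(\nabla g(X_t)+K^TY_t)\,\mathrm{d}t+\sqrt2\,\mathrm{d}W_t,\qquad\mathrm{d}Y_t=-\lambda(\nabla f^\ast(Y_t)-KX_t)\,\mathrm{d}t,$$ and assume there is a constant $D_4$ with $\mathbb{E}_{Z\sim\pi_\lambda}[\|A_{\mathrm{PD}}(Z)\|^2]\le D_4$. Let $\sigma,\tau>0$ with $\sigma=\lambda\tau$ and $\theta$ satisfy $\theta\sigma\tau L^2\le1$, where $L=\|K\|$, and $\max\{(1+\omega_g\tau)^{-1},(1+\omega_{f^\ast}\sigma)^{-1}\}\le\theta<1$. Let $\pi^n$ be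 the law of $(X^n,Y^n)$ generated by $$\left\{\begin{array}{l}\xi^{n+1}\sim\mathrm{N}(0,I_d)\\ Y^{n+1}=\mathrm{prox}_{\sigma f^\ast}(Y^n+\sigma KX_\theta^n)\\ X^{n+1}=\mathrm{prox}_{\tau g}(X^n-\tau K^TY^{n+1})+\sqrt{2\tau}\,\xi^{n+1}\\ X_\theta^{n+1}=X^{n+1}+\theta(X^{n+1}-X^n)\end{array}\right.$$ with $X_\theta^0=X^0$ and $(X^0,Y^0)\sim\pi^0$. Then the $x$-marginal $\mu^N$ of $\pi^N$ obeys, for all $N$, $$\mathcal{W}_2(\mu^N,\mu^\ast)\le\theta^{N/2}\,\mathcal{T}_{1,\bar\lambda^{-1}}(\pi^0,\pi_\lambda)+C_1(\lambda)+C_2(\tau),\qquad\bar\lambda=\frac{1+\omega_g\tau}{1+\omega_{f^\ast}\sigma}\lambda,$$ with constants that decay asymptotically like $$C_1(\lambda)=D_5\lambda^{-1/2}+\mathcal{O}(\lambda^{-3/2})\ \text{as }\lambda\to\infty,\qquad C_2(\tau)=D_6\tau+\mathcal{O}(\tau^{3/2})\ \text{as }\tau\to0,$$ where $D_5=(D_1/\omega_g)^{1/2}$ and $D_6=\left(4dL_{\nabla g}^2\omega_g^{-1}+6dL^2(1+2\theta^2)\omega_{f^\ast}^{-1}\right)^{1/2}(1-\theta)^{-1/2}$. It follows that the $x$-marginal $\mu_{\lambda,\tau}$ of the stationary distribution $\pi_{\lambda,\tau}$ of the iteration satisfies $\mathcal{W}_2(\mu_{\lambda,\tau},\mu^\ast)\le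 C_1(\lambda)+C_2(\tau)$.
   Context: $\mathcal{X}=\mathbb{R}^d$, $\mathcal{Y}=\mathbb{R}^m$, $\mathcal{Z}=\mathcal{X}\times\mathcal{Y}$; $K:\mathcal{X}\to\mathcal{Y}$ is linear with Euclidean operator norm $\|K\|$; $f,g$ are convex and lower semicontinuous with $0<\int\exp(-f(Kx)-g(x))dx<\infty$, and $\mu^\ast$ is the probability distribution on $\mathcal{X}$ with density proportional to $\exp(-f(Kx)-g(x))$; $f^\ast(y)=\sup_x\{\langle x,y\rangle-f(x)\}$; $\mathrm{prox}_{\gamma\phi}=(\mathrm{id}+\gamma\partial\phi)^{-1}$. $\nabla(\nabla f\circ K)(x)=H_f(Kx)K$ is the Jacobian of $x\mapsto\nabla f(Kx)$, $\nabla\cdot\nabla$ is the componentwise Laplacian, $\|\cdot\|_F$ the Frobenius norm. $A_{\mathrm{PD}}(x,y)=(\nabla g(x)+K^Ty,\ \lambda(\nabla f^\ast(y)-Kx))$. $W_t$ is Brownian motion in $\mathbb{R}^d$; the $\xi^n$ are i.i.d. and independent of the initial values; $\pi^0$ has finite second moment. The diffusion has a unique stationary distribution $\pi_\lambda$; when $\theta\sigma\tau L^2<1$ the law of $(X^n,Y^n)$ converges to a limit $\pi_{\lambda,\tau}$ independent of $\pi^0$, the stationary distribution of the iteration. $\mathcal{W}_2$ is the 2-Wasserstein distance, and for $a,b>0$, $\mathcal{T}_{a,b}(\pi,\tilde\pi)=\inf(\mathbb{E}[a\|x-\tilde x\|^2+b\|y-\tilde y\|^2])^{1/2}$ over all couplings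 of $(x,y)\sim\pi$, $(\tilde x,\tilde y)\sim\tilde\pi$. $C_1(\lambda)$ and $C_2(\tau)$ do not depend on $N$ or $\pi^0$; implied constants in $\mathcal{O}(\tau^{3/2})$ may depend on the problem data, $\lambda$ and $\theta$. The bound on $\mu_{\lambda,\tau}$ refers to the case $\theta\sigma\tau L^2<1$, in which $\pi_{\lambda,\tau}$ exists. *)

theory Defs
  imports "HOL-Probability.Probability" "HOL-Library.Landau_Symbols"
begin

section \<open>Convex analysis and derivatives\<close>

text \<open>\<open>C_k n F\<close>: the function F is n times continuously differentiable on the whole space.\<close>

primrec C_k :: "nat \<Rightarrow> ('a::euclidean_space \<Rightarrow> 'b::real_normed_vector) \<Rightarrow> bool" where
  "C_k 0 F \<longleftrightarrow> continuous_on UNIV F"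
| "C_k (Suc n) F \<longleftrightarrow>
     (\<forall>x. F differentiable at x) \<and> (\<forall>v. C_k n (\<lambda>x. frechet_derivative F (at x) v))"

definition grad :: "('a::real_inner \<Rightarrow> real) \<Rightarrow> 'a \<Rightarrow> 'a" where
  "grad \<phi> x = (THE v. GDERIV \<phi> x :> v)"

definition strongly_convex :: "real \<Rightarrow> ('a::real_inner \<Rightarrow> real) \<Rightarrow> bool" where
  "strongly_convex \<omega> \<phi> \<longleftrightarrow>
     (\<forall>x y. \<forall>t\<in>{0..1}. \<phi> (t *\<^sub>R x + (1 - t) *\<^sub>R y)
        \<le> t * \<phi> x + (1 - t) * \<phi> y - \<omega> / 2 * t * (1 - t) * (norm (x - y))\<^sup>2)"

text \<open>The supremum is taken in the reals, so it is meaningful only if it is finite. This is the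
  case at every point if \<phi> is strongly convex on a Euclidean space, the only case in which the
  conjugate is used.\<close>

definition convex_conjugate :: "('a::real_inner \<Rightarrow> real) \<Rightarrow> 'a \<Rightarrow> real" where
  "convex_conjugate \<phi> y = (SUP x. x \<bullet> y - \<phi> x)"

definition subdifferential :: "('a::real_inner \<Rightarrow> real) \<Rightarrow> 'a \<Rightarrow> 'a set" where
  "subdifferential \<phi> p = {v. \<forall>z. \<phi> z \<ge> \<phi> p + v \<bullet> (z - p)}"

text \<open>The resolvent of \<gamma> times the subdifferential of \<phi>.\<close>

definition prox :: "real \<Rightarrow> ('a::real_inner \<Rightarrow> real) \<Rightarrow> 'a \<Rightarrow> 'a" where
  "prox \<gamma> \<phi> x = (THE p. \<exists>v\<in>subdifferential \<phi> p. p + \<gamma> *\<^sub>R v = x)"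

definition frobenius_norm :: "real ^ 'd ^ 'm \<Rightarrow> real" where
  "frobenius_norm A = sqrt (\<Sum>i\<in>UNIV. \<Sum>j\<in>UNIV. (A $ i $ j)\<^sup>2)"

text \<open>Sum of the pure second partial derivatives; for a vector-valued F this is the
  componentwise Laplacian.\<close>

definition laplacian :: "('a::euclidean_space \<Rightarrow> 'b::real_normed_vector) \<Rightarrow> 'a \<Rightarrow> 'b" where
  "laplacian F x =
     (\<Sum>e\<in>Basis. frechet_derivative (\<lambda>z. frechet_derivative F (at z) e) (at x) e)"

section \<open>Probability distributions and transport distances\<close>

definition prob_distribution :: "'a::topological_space measure \<Rightarrow> bool" where
  "prob_distribution \<pi> \<longleftrightarrow> prob_space \<pi> \<and> sets \<pi> = sets borel"

definition finite_second_moment :: "'a::real_normed_vector measure \<Rightarrow> bool" where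
  "finite_second_moment \<pi> \<longleftrightarrow> (\<integral>\<^sup>+ z. ennreal ((norm z)\<^sup>2) \<partial>\<pi>) < \<infinity>"

definition target ::
    "(real ^ 'm \<Rightarrow> real) \<Rightarrow> (real ^ 'd \<Rightarrow> real) \<Rightarrow> (real ^ 'd \<Rightarrow> real ^ 'm) \<Rightarrow> (real ^ 'd) measure" where
  "target f g K = density lborel
     (\<lambda>x. ennreal (exp (- f (K x) - g x) / (LINT u|lborel. exp (- f (K u) - g u))))"

definition couplings :: "'a measure \<Rightarrow> 'b measure \<Rightarrow> ('a \<times> 'b) measure set" where
  "couplings \<mu> \<nu> = {P. prob_space P \<and> sets P = sets (\<mu> \<Otimes>\<^sub>M \<nu>) \<and>
     distr P \<mu> fst = \<mu> \<and> distr P \<nu> snd = \<nu>}"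

definition ennreal_sqrt :: "ennreal \<Rightarrow> ennreal" where
  "ennreal_sqrt x = (if x = \<infinity> then \<infinity> else ennreal (sqrt (enn2real x)))"

definition wasserstein2 :: "'a::real_normed_vector measure \<Rightarrow> 'a measure \<Rightarrow> ennreal" where
  "wasserstein2 \<mu> \<nu> = (INF P\<in>couplings \<mu> \<nu>.
     ennreal_sqrt (\<integral>\<^sup>+ (x, x'). ennreal ((norm (x - x'))\<^sup>2) \<partial>P))"

definition transport_dist :: "real \<Rightarrow> real \<Rightarrow>
    ('a::real_normed_vector \<times> 'b::real_normed_vector) measure \<Rightarrow> ('a \<times> 'b) measure \<Rightarrow> ennreal" where
  "transport_dist a b \<pi> \<pi>' = (INF P\<in>couplings \<pi> \<pi>'. ennreal_sqrt
     (\<integral>\<^sup>+ ((x, y), (x', y')). ennreal (a * (norm (x - x'))\<^sup>2 + b * (norm (y - y'))\<^sup>2) \<partial>P))"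

definition x_marginal :: "('a::topological_space \<times> 'b) measure \<Rightarrow> 'a measure" where
  "x_marginal \<pi> = distr \<pi> borel fst"

text \<open>The centred Gaussian distribution with covariance v times the identity, for v > 0.\<close>

definition gaussian :: "real \<Rightarrow> (real ^ 'd) measure" where
  "gaussian v = density lborel (\<lambda>x. ennreal (\<Prod>i\<in>UNIV. normal_density 0 (sqrt v) (x $ i)))"

definition converges_weakly :: "(nat \<Rightarrow> 'a::topological_space measure) \<Rightarrow> 'a measure \<Rightarrow> bool" where
  "converges_weakly \<mu> \<nu> \<longleftrightarrow>
     (\<forall>h::'a \<Rightarrow> real. continuous_on UNIV h \<and> bounded (range h) \<longrightarrow>
        (\<lambda>n. LINT z|\<mu> n. h z) \<longlonglongrightarrow> (LINT z|\<nu>. h z))"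

section \<open>The primal-dual diffusion\<close>

definition brownian_motion :: "'w measure \<Rightarrow> (real \<Rightarrow> 'w \<Rightarrow> real ^ 'd) \<Rightarrow> bool" where
  "brownian_motion M W \<longleftrightarrow>
     prob_space M \<and>
     (\<forall>t\<ge>0. W t \<in> borel_measurable M) \<and>
     (AE \<omega> in M. W 0 \<omega> = 0 \<and> continuous_on {0..} (\<lambda>t. W t \<omega>)) \<and>
     (\<forall>s t. 0 \<le> s \<and> s < t \<longrightarrow> distr M borel (\<lambda>\<omega>. W t \<omega> - W s \<omega>) = gaussian (t - s)) \<and>
     (\<forall>n (t::nat \<Rightarrow> real). 0 \<le> t 0 \<and> (\<forall>i<n. t i < t (Suc i)) \<longrightarrow>
        prob_space.indep_vars M (\<lambda>_. borel) (\<lambda>i \<omega>. W (t (Suc i)) \<omega> - W (t i) \<omega>) {..<n})"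

definition A_PD :: "(real ^ 'm \<Rightarrow> real) \<Rightarrow> (real ^ 'd \<Rightarrow> real) \<Rightarrow> (real ^ 'd \<Rightarrow> real ^ 'm) \<Rightarrow> real \<Rightarrow>
    (real ^ 'd) \<times> (real ^ 'm) \<Rightarrow> (real ^ 'd) \<times> (real ^ 'm)" where
  "A_PD f g K lam = (\<lambda>(x, y).
     (grad g x + adjoint K y, lam *\<^sub>R (grad (convex_conjugate f) y - K x)))"

text \<open>Only the x-equation is driven by noise, with the constant coefficient sqrt 2, so no
  stochastic integral is needed: the equation is an integral equation for almost every path.\<close>

definition pd_diffusion ::
    "(real ^ 'm \<Rightarrow> real) \<Rightarrow> (real ^ 'd \<Rightarrow> real) \<Rightarrow> (real ^ 'd \<Rightarrow> real ^ 'm) \<Rightarrow> real \<Rightarrow> 'w measure \<Rightarrow>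
     (real \<Rightarrow> 'w \<Rightarrow> real ^ 'd) \<Rightarrow> (real \<Rightarrow> 'w \<Rightarrow> real ^ 'd) \<Rightarrow> (real \<Rightarrow> 'w \<Rightarrow> real ^ 'm) \<Rightarrow> bool" where
  "pd_diffusion f g K lam M W X Y \<longleftrightarrow>
     brownian_motion M W \<and>
     (\<forall>t\<ge>0. X t \<in> borel_measurable M \<and> Y t \<in> borel_measurable M) \<and>
     prob_space.indep_set M
       (sets (vimage_algebra (space M) (\<lambda>\<omega>. (X 0 \<omega>, Y 0 \<omega>)) borel))
       (sets (vimage_algebra (space M) (\<lambda>\<omega>. \<lambda>t\<in>{0..}. W t \<omega>) (\<Pi>\<^sub>M t\<in>{0..}. borel))) \<and>
     (AE \<omega> in M. continuous_on {0..} (\<lambda>t. X t \<omega>) \<and> continuous_on {0..} (\<lambda>t. Y t \<omega>) \<and>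
        (\<forall>t\<ge>0.
           X t \<omega> = X 0 \<omega> - integral {0..t} (\<lambda>s. fst (A_PD f g K lam (X s \<omega>, Y s \<omega>)))
                     + sqrt 2 *\<^sub>R W t \<omega> \<and>
           Y t \<omega> = Y 0 \<omega> - integral {0..t} (\<lambda>s. snd (A_PD f g K lam (X s \<omega>, Y s \<omega>)))))"

text \<open>A distribution is stationary if a solution started from it has this law at all times. The
  sample space consists of pairs of an initial value and a driving path. This is no restriction
  if the drift is Lipschitz continuous: the solution is then a function of these data, unique in
  law.\<close>

definition pd_stationary ::
    "(real ^ 'm \<Rightarrow> real) \<Rightarrow> (real ^ 'd \<Rightarrow> real) \<Rightarrow> (real ^ 'd \<Rightarrow> real ^ 'm) \<Rightarrow> real \<Rightarrow>
     ((real ^ 'd) \<times> (real ^ 'm)) measure \<Rightarrow> bool" where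
  "pd_stationary f g K lam \<pi> \<longleftrightarrow>
     (\<exists>(M :: (((real ^ 'd) \<times> (real ^ 'm)) \<times> (real \<Rightarrow> real ^ 'd)) measure) W X Y.
        pd_diffusion f g K lam M W X Y \<and>
        (\<forall>t\<ge>0. distr M borel (\<lambda>\<omega>. (X t \<omega>, Y t \<omega>)) = \<pi>))"

section \<open>The primal-dual Langevin iteration\<close>

text \<open>The state is (X n, X_theta n, Y n), and \<open>\<xi> n\<close> is the noise entering step n + 1.\<close>

primrec pd_iterate ::
    "(real ^ 'm \<Rightarrow> real) \<Rightarrow> (real ^ 'd \<Rightarrow> real) \<Rightarrow> (real ^ 'd \<Rightarrow> real ^ 'm) \<Rightarrow> real \<Rightarrow> real \<Rightarrow> real \<Rightarrow>
     (real ^ 'd) \<times> (real ^ 'm) \<Rightarrow> (nat \<Rightarrow> real ^ 'd) \<Rightarrow> nat \<Rightarrow> (real ^ 'd) \<times> (real ^ 'd) \<times> (real ^ 'm)" where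
  "pd_iterate f g K \<sigma> \<tau> \<theta> z \<xi> 0 = (fst z, fst z, snd z)"
| "pd_iterate f g K \<sigma> \<tau> \<theta> z \<xi> (Suc n) =
     (let (x, x\<theta>, y) = pd_iterate f g K \<sigma> \<tau> \<theta> z \<xi> n;
          y' = prox \<sigma> (convex_conjugate f) (y + \<sigma> *\<^sub>R K x\<theta>);
          x' = prox \<tau> g (x - \<tau> *\<^sub>R adjoint K y') + sqrt (2 * \<tau>) *\<^sub>R \<xi> n
      in (x', x' + \<theta> *\<^sub>R (x' - x), y'))"

text \<open>The law of (X n, Y n), with the initial value and the noise realised on the product space.\<close>

definition pd_law ::
    "(real ^ 'm \<Rightarrow> real) \<Rightarrow> (real ^ 'd \<Rightarrow> real) \<Rightarrow> (real ^ 'd \<Rightarrow> real ^ 'm) \<Rightarrow> real \<Rightarrow> real \<Rightarrow> real \<Rightarrow>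
     ((real ^ 'd) \<times> (real ^ 'm)) measure \<Rightarrow> nat \<Rightarrow> ((real ^ 'd) \<times> (real ^ 'm)) measure" where
  "pd_law f g K \<sigma> \<tau> \<theta> \<pi>0 n =
     distr (\<pi>0 \<Otimes>\<^sub>M (\<Pi>\<^sub>M k\<in>(UNIV::nat set). gaussian 1)) borel
       (\<lambda>(z, \<xi>). case pd_iterate f g K \<sigma> \<tau> \<theta> z \<xi> n of (x, x\<theta>, y) \<Rightarrow> (x, y))"

text \<open>Since X_theta depends on the two latest values of X, the pair (X n, Y n) alone is not a
  Markov chain; its stationary distribution is the common limit of its laws.\<close>

definition pd_law_limit ::
    "(real ^ 'm \<Rightarrow> real) \<Rightarrow> (real ^ 'd \<Rightarrow> real) \<Rightarrow> (real ^ 'd \<Rightarrow> real ^ 'm) \<Rightarrow> real \<Rightarrow> real \<Rightarrow> real \<Rightarrow>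
     ((real ^ 'd) \<times> (real ^ 'm)) measure \<Rightarrow> bool" where
  "pd_law_limit f g K \<sigma> \<tau> \<theta> \<pi> \<longleftrightarrow> prob_distribution \<pi> \<and>
     (\<forall>\<pi>0. prob_distribution \<pi>0 \<and> finite_second_moment \<pi>0 \<longrightarrow>
        converges_weakly (pd_law f g K \<sigma> \<tau> \<theta> \<pi>0) \<pi>)"

end

theory Submission
  imports Defs
begin

text \<open>
Three distances add up: from the iterate to the stationary diffusion at the same time, from the
stationary law of the diffusion to the target, and, for the last claim, from the limit law to the
iterates.

The iteration and the diffusion are driven by the same Brownian increments. Read at the grid
times, the diffusion satisfies the recursion of the iteration up to consistency errors, whose mean
squares follow from stationarity and the moment of the drift. The energy
of Chambolle and Pock contracts by the factor \<open>\<theta>\<close> in each step up to these errors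
(\<open>energy_step\<close>, \<open>discretisation_coupling\<close>), and a geometric sum gives the
term in the step size and the weighted initial distance.

For the bias, a point of the stationary law and a point \<open>x\<close> of the target are compared
through the cost \<open>|X - x|^2 + |Y - ph x|^2 / lam\<close>, where \<open>ph\<close> truncates
the map \<open>F x = grad f (K x)\<close>. Both laws are invariant: the first under the diffusion, the
second under a random walk Metropolis step whose proposal is the same Brownian increment. One short
step therefore turns a coupling into a coupling of the same two laws. By strong monotonicity it
lowers the cost at the rate \<open>2 \<omega>g\<close>, up to the derivatives of \<open>ph\<close>
along the Langevin dynamics (\<open>step_cost_contracts\<close>). A nearly optimal coupling cannot be
improved, which bounds the optimal cost by a mean over the target (\<open>optimal_cost_le\<close>);
letting the truncation tend to \<open>F\<close> leaves the Jacobian term of order \<open>1 / lam\<close> and a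
generator term of order \<open>1 / lam^2\<close>. If the Jacobian term vanishes, so does the generator term,
and the bias is zero.

Couplings are composed by an approximate gluing that keeps the Brownian increment independent of
the given coupling (\<open>approximate_gluing\<close>). The limit law is reached by running the iteration
with its noise in reversed order, which converges almost surely (\<open>weak_limit_of_iteration\<close>).
\<close>

text \<open>Short forms of frequent expressions.\<close>

abbreviation "NI == nn_integral"
abbreviation "NN M u == nn_integral M (%x. ennreal (u x))"
abbreviation "bmeas == borel_measurable"
abbreviation inner_short (infixl "<.>" 70) where "x <.> y == inner x y"
abbreviation scaleR_short (infixr "*." 75) where "r *. x == scaleR r x"
abbreviation pair_short (infixr "><" 80) where "M >< N == pair_measure M N"

section \<open>Strongly convex differentiable functions\<close>

lemma grad_eq: "GDERIV ph x :> v ==> grad ph x = v"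
proof -
 assume a: "GDERIV ph x :> v"
 have "w = v" if "GDERIV ph x :> w" for w
 proof -
  have "(%h. h <.> w) = (%h. h <.> v)"
   using that a unfolding gderiv_def by (rule has_derivative_unique)
  hence "(w - v) <.> w = (w - v) <.> v" by metis
  hence "(w - v) <.> (w - v) = 0" by (simp add: inner_diff_right)
  thus ?thesis by simp
 qed
 with a show ?thesis unfolding grad_def by (intro the_equality)
qed

lemma has_derivative_imp_GDERIV:
 fixes ph :: "'a::euclidean_space => real"
 assumes "(ph has_derivative D) (at x)"
 shows "GDERIV ph x :> (\<Sum>e\<in>Basis. D e *. e)"
proof -
 have lin: "linear D" using assms has_derivative_linear by blast
 have "D h = h <.> (\<Sum>e\<in>Basis. D e *. e)" for h
 proof -
  have "D h = D (\<Sum>e\<in>Basis. (h <.> e) *. e)" by (simp add: euclidean_representation)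
  also have "... = (\<Sum>e\<in>Basis. (h <.> e) * D e)"
   by (simp add: linear_sum[OF lin] linear_scale[OF lin])
  finally show ?thesis by (simp add: inner_sum_right mult.commute)
 qed
 hence "D = (%h. h <.> (\<Sum>e\<in>Basis. D e *. e))" by (rule ext)
 with assms show ?thesis unfolding gderiv_def by simp
qed

lemma differentiable_imp_GDERIV_grad:
 fixes ph :: "'a::euclidean_space => real"
 assumes "ph differentiable at x"
 shows "GDERIV ph x :> grad ph x"
 using assms has_derivative_imp_GDERIV grad_eq unfolding differentiable_def by metis

lemma strongly_convex_ge_tangent:
 assumes sc: "strongly_convex om ph" and d: "GDERIV ph x :> v"
 shows "ph z >= ph x + v <.> (z - x) + om / 2 * (norm (z - x))^2"
proof -
 define q where "q t = ph (x + t *. (z - x))" for t :: real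
 have "((%t. x + t *. (z - x)) has_derivative (%t. t *. (z - x))) (at 0)"
  by (auto intro!: derivative_eq_intros)
 moreover have "(ph has_derivative (%h. h <.> v)) (at (x + 0 *. (z - x)))"
  using d by (simp add: gderiv_def)
 ultimately have "(q has_derivative (%t. (t *. (z - x)) <.> v)) (at 0)"
  unfolding q_def by (rule has_derivative_compose)
 hence "(q has_real_derivative (z - x) <.> v) (at 0)"
  by (auto simp: has_field_derivative_def mult_commute_abs elim!: has_derivative_eq_rhs)
 hence "((%t. (q t - q 0) / t) \<longlongrightarrow> (z - x) <.> v) (at 0)"
  by (simp add: has_field_derivative_iff)
 hence lim: "((%t. (q t - q 0) / t) \<longlongrightarrow> (z - x) <.> v) (at_right 0)"
  by (rule filterlim_mono) (auto simp: at_within_le_at)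
 have lim2: "((%t. ph z - ph x - om / 2 * (1 - t) * (norm (z - x))^2)
   \<longlongrightarrow> ph z - ph x - om / 2 * (1 - 0) * (norm (z - x))^2) (at_right 0)"
  by (intro tendsto_intros)
 have "eventually (%t. t : {0<..<1}) (at_right (0::real))"
  by (rule eventually_at_right_real) simp
 hence "eventually (%t. (q t - q 0) / t <= ph z - ph x - om / 2 * (1 - t) * (norm (z - x))^2) (at_right 0)"
 proof eventually_elim
  case (elim t)
  have "ph (t *. z + (1 - t) *. x) <= t * ph z + (1 - t) * ph x - om / 2 * t * (1 - t) * (norm (z - x))^2"
   using sc elim by (auto simp: strongly_convex_def)
  moreover have "t *. z + (1 - t) *. x = x + t *. (z - x)" by (simp add: algebra_simps)
  ultimately have "q t - q 0 <= t * (ph z - ph x - om / 2 * (1 - t) * (norm (z - x))^2)"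
   by (simp add: q_def algebra_simps)
  thus ?case using elim by (simp add: divide_le_eq mult.commute)
 qed
 from tendsto_le[OF _ lim2 lim this] show ?thesis by (simp add: inner_commute)
qed

lemma strongly_convex_monotone_grad:
 assumes sc: "strongly_convex om ph" and "GDERIV ph x :> v" "GDERIV ph z :> w"
 shows "(v - w) <.> (x - z) >= om * (norm (x - z))^2"
proof -
 have 1: "ph z >= ph x + v <.> (z - x) + om / 2 * (norm (z - x))^2"
  using strongly_convex_ge_tangent[OF sc assms(2)] .
 have 2: "ph x >= ph z + w <.> (x - z) + om / 2 * (norm (x - z))^2"
  using strongly_convex_ge_tangent[OF sc assms(3)] .
 have "v <.> (z - x) = - (v <.> (x - z))" by (simp add: inner_diff_right)
 with 1 2 show ?thesis by (simp add: norm_minus_commute[of z x] inner_diff_left)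
qed

text \<open>A strongly convex function minus a linear one is coercive, so it has a minimiser, and the
 gradient at a minimiser vanishes.\<close>

lemma strongly_convex_grad_surj:
 fixes ph :: "'a::euclidean_space => real"
 assumes sc: "strongly_convex om ph" and "om > 0" and d: "\<And>x. GDERIV ph x :> G x"
 shows "\<exists>x. G x = y"
proof -
 define ps where "ps x = ph x - x <.> y" for x
 have dpsi: "GDERIV ps x :> G x - y" for x
  unfolding ps_def by (rule GDERIV_diff[OF d]) (auto simp: gderiv_def intro!: derivative_eq_intros)
 have cont: "continuous_on S ps" for S
  using dpsi unfolding gderiv_def
  by (meson continuous_at_imp_continuous_on has_derivative_continuous)
 define r where "r = 2 * norm (G 0 - y) / om"
 have far: "ps x > ps 0" if "norm x > r" for x
 proof -
  have "ps x >= ps 0 + (G 0 - y) <.> x + om / 2 * (norm x)^2"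
   using strongly_convex_ge_tangent[OF sc d, of 0 x] by (simp add: ps_def inner_diff_left inner_diff_right inner_commute)
  moreover have "(G 0 - y) <.> x >= - (norm (G 0 - y) * norm x)"
   using norm_cauchy_schwarz[of "- (G 0 - y)" x] by (simp add: inner_diff_left norm_minus_commute)
  moreover have "norm (G 0 - y) < om / 2 * norm x" using that \<open>om > 0\<close>
   by (simp add: r_def field_simps)
  moreover have "norm x > 0" using that r_def \<open>om > 0\<close>
   by (smt (verit) divide_nonneg_nonneg norm_ge_zero)
  ultimately have "norm (G 0 - y) * norm x < om / 2 * norm x * norm x" by simp
  with \<open>ps x >= _\<close> \<open>(G 0 - y) <.> x >= _\<close> show ?thesis by (simp add: power2_eq_square)
 qed
 have "r >= 0" using \<open>om > 0\<close> by (simp add: r_def)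
 obtain x0 where x0: "x0 : cball 0 r" "\<And>x. x : cball 0 r ==> ps x0 <= ps x"
  using continuous_attains_inf[of "cball 0 r" ps] cont \<open>r >= 0\<close> by (metis cball_eq_empty compact_cball not_le)
 have min: "ps x0 <= ps x" for x
 proof (cases "norm x <= r")
  case True thus ?thesis using x0 by simp
 next
  case False
  hence "ps x > ps 0" using far by simp
  moreover have "ps x0 <= ps 0" using x0 \<open>r >= 0\<close> by simp
  ultimately show ?thesis by simp
 qed
 have "(%h. h <.> (G x0 - y)) = (%h. 0)"
  using dpsi[of x0] min unfolding gderiv_def
  by (intro differential_zero_maxmin[of x0 UNIV ps]) auto
 hence "(G x0 - y) <.> (G x0 - y) = 0" by metis
 thus ?thesis by auto
qed

section \<open>The convex conjugate\<close>

lemma convex_conjugate_grad: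
 fixes f :: "'a::euclidean_space => real"
 assumes sc: "strongly_convex om f" and "om > 0" and d: "\<And>x. GDERIV f x :> G x"
 shows "convex_conjugate f (G x) = x <.> G x - f x"
  and "z <.> G x - f z <= convex_conjugate f (G x)"
proof -
 have le: "z <.> G x - f z <= x <.> G x - f x" for z
 proof -
  have "f z >= f x + G x <.> (z - x) + om / 2 * (norm (z - x))^2"
   using strongly_convex_ge_tangent[OF sc d] .
  moreover have "om / 2 * (norm (z - x))^2 >= 0" using \<open>om > 0\<close> by simp
  ultimately show ?thesis by (simp add: inner_diff_right inner_commute)
 qed
 show e: "convex_conjugate f (G x) = x <.> G x - f x"
  unfolding convex_conjugate_def by (rule cSup_eq_maximum) (auto intro: le)
 show "z <.> G x - f z <= convex_conjugate f (G x)" using le e by simp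
qed

text \<open>Both tangent inequalities, at y and at a nearby point, squeeze the increment of the
 conjugate between linear functions whose slopes differ by a Lipschitz amount.\<close>

lemma grad_convex_conjugate:
 fixes f :: "'a::euclidean_space => real"
 assumes sc: "strongly_convex om f" and pos: "om > 0" and d: "\<And>x. GDERIV f x :> G x"
 shows "GDERIV (convex_conjugate f) (G x) :> x" "grad (convex_conjugate f) (G x) = x"
  "GDERIV (convex_conjugate f) y :> grad (convex_conjugate f) y"
  "(1/om)-lipschitz_on UNIV (grad (convex_conjugate f))"
  "G (grad (convex_conjugate f) y) = y"
proof -
 note cc = convex_conjugate_grad[OF assms]
 have lip: "norm (x - z) <= norm (G x - G z) / om" for x z
 proof -
  have "om * (norm (x - z))^2 <= (G x - G z) <.> (x - z)"
   using strongly_convex_monotone_grad[OF sc d d] .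
  also have "... <= norm (G x - G z) * norm (x - z)" by (rule norm_cauchy_schwarz)
  finally have "om * norm (x - z) * norm (x - z) <= norm (G x - G z) * norm (x - z)"
   by (simp add: power2_eq_square)
  hence "norm (x - z) = 0 \<or> om * norm (x - z) <= norm (G x - G z)"
   by (metis mult_right_le_imp_le norm_ge_zero order_le_less)
  thus ?thesis using pos by (auto simp: field_simps)
 qed
 have G: "GDERIV (convex_conjugate f) (G x) :> x" for x
 proof -
  have b: "\<bar>convex_conjugate f y' - convex_conjugate f (G x) - (y' - G x) <.> x\<bar> <= (norm (y' - G x))^2 / om" for y'
  proof -
   obtain z where z: "G z = y'" using strongly_convex_grad_surj[OF sc pos d] by blast
   have 1: "convex_conjugate f y' - convex_conjugate f (G x) >= (y' - G x) <.> x"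
    using cc(2)[of x z] cc(1)[of x] z by (simp add: inner_diff_left inner_diff_right inner_commute)
   have 2: "convex_conjugate f y' - convex_conjugate f (G x) <= (y' - G x) <.> z"
    using cc(2)[of z x] cc(1)[of z] z by (simp add: inner_diff_left inner_diff_right inner_commute)
   have "(y' - G x) <.> z - (y' - G x) <.> x = (y' - G x) <.> (z - x)" by (simp add: inner_diff_right)
   also have "... <= norm (y' - G x) * norm (z - x)" by (rule norm_cauchy_schwarz)
   also have "... <= norm (y' - G x) * (norm (y' - G x) / om)"
    using lip[of z x] z by (intro mult_left_mono) auto
   finally show ?thesis using 1 2 by (simp add: power2_eq_square)
  qed
  show ?thesis unfolding gderiv_def has_derivative_at
  proof (intro conjI)
   show "bounded_linear (%h. h <.> x)" by (rule bounded_linear_inner_left)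
   have l: "((\<lambda>h::'a. norm h / om) \<longlongrightarrow> 0) (at 0)"
    by (intro tendsto_divide_zero tendsto_norm_zero tendsto_ident_at)
   show "(%h. norm (convex_conjugate f (G x + h) - convex_conjugate f (G x) - h <.> x) / norm h) \<midarrow>0\<rightarrow> 0"
   proof (rule Lim_null_comparison[OF _ l], rule always_eventually, rule allI)
    fix h :: 'a
    show "norm (norm (convex_conjugate f (G x + h) - convex_conjugate f (G x) - h <.> x) / norm h) <= norm h / om"
     using b[of "G x + h"] pos by (cases "h = 0") (auto simp: divide_simps power2_eq_square)
   qed
  qed
 qed
 show "GDERIV (convex_conjugate f) (G x) :> x" by (rule G)
 show g: "grad (convex_conjugate f) (G x) = x" for x by (rule grad_eq[OF G])
 have ex: "\<exists>x. y = G x" for y using strongly_convex_grad_surj[OF sc pos d] by metis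
 show "GDERIV (convex_conjugate f) y :> grad (convex_conjugate f) y" "G (grad (convex_conjugate f) y) = y"
  using ex[of y] G g by auto
 show "(1/om)-lipschitz_on UNIV (grad (convex_conjugate f))"
 proof (rule lipschitz_onI)
  fix y y' :: 'a
  show "dist (grad (convex_conjugate f) y) (grad (convex_conjugate f) y') <= 1 / om * dist y y'"
   using ex[of y] ex[of y'] g lip by (auto simp: dist_norm)
 qed (use pos in auto)
qed

lemma strongly_convex_conjugate_lipschitz_grad:
 fixes f :: "'a::euclidean_space => real"
 assumes sc: "strongly_convex om f" and pos: "om > 0" and d: "\<And>x. GDERIV f x :> G x"
  and scs: "strongly_convex oms (convex_conjugate f)" and "oms > 0"
 shows "(1/oms)-lipschitz_on UNIV G"
proof (rule lipschitz_onI)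
 fix x z
 have "oms * (norm (G x - G z))^2 <= (x - z) <.> (G x - G z)"
  using strongly_convex_monotone_grad[OF scs grad_convex_conjugate(1)[OF sc pos d] grad_convex_conjugate(1)[OF sc pos d]] .
 also have "... <= norm (x - z) * norm (G x - G z)" by (rule norm_cauchy_schwarz)
 finally have "oms * norm (G x - G z) * norm (G x - G z) <= norm (x - z) * norm (G x - G z)"
  by (simp add: power2_eq_square)
 hence "norm (G x - G z) = 0 \<or> oms * norm (G x - G z) <= norm (x - z)"
  by (metis mult_right_le_imp_le norm_ge_zero order_le_less)
 thus "dist (G x) (G z) <= 1 / oms * dist x z" using \<open>oms > 0\<close>
  by (auto simp: field_simps dist_norm)
qed (use \<open>oms > 0\<close> in auto)

section \<open>Proximal maps\<close>

lemma prox_eqn: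
 fixes ph :: "'a::euclidean_space => real"
 assumes sc: "strongly_convex om ph" and pos: "om > 0" "ga > 0" and d: "\<And>x. GDERIV ph x :> G x"
 shows "prox ga ph x + ga *. G (prox ga ph x) = x"
  and "1-lipschitz_on UNIV (prox ga ph)"
proof -
 have sub: "subdifferential ph p = {G p}" for p
 proof -
  have "v = G p" if "v : subdifferential ph p" for v
  proof -
   have "GDERIV (%z. ph z - v <.> z) p :> G p - v"
    by (rule GDERIV_diff[OF d]) (auto simp: gderiv_def inner_commute intro!: derivative_eq_intros)
   moreover have "ph p - v <.> p <= ph z - v <.> z" for z
    using that by (auto simp: subdifferential_def inner_diff_right) (metis add_diff_eq add_le_imp_le_diff le_diff_eq diff_add_eq)
   ultimately have "(%h. h <.> (G p - v)) = (%h. 0)"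
    unfolding gderiv_def by (intro differential_zero_maxmin[of p UNIV "%z. ph z - v <.> z"]) auto
   hence "(G p - v) <.> (G p - v) = 0" by metis
   thus ?thesis by auto
  qed
  moreover have "ph z >= ph p + G p <.> (z - p)" for z
   using strongly_convex_ge_tangent[OF sc d, of p z] pos
   by (smt (verit) divide_nonneg_nonneg mult_nonneg_nonneg zero_le_power2)
  hence "G p : subdifferential ph p" by (simp add: subdifferential_def)
  ultimately show ?thesis by blast
 qed
 have mono: "(norm (p - q))^2 <= ((p + ga *. G p) - (q + ga *. G q)) <.> (p - q)" for p q
 proof -
  have "(G p - G q) <.> (p - q) >= 0" using strongly_convex_monotone_grad[OF sc d d, of p q] pos
   by (smt (verit) mult_nonneg_nonneg zero_le_power2)
  hence "ga * ((G p - G q) <.> (p - q)) >= 0" using pos by simp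
  moreover have "((p + ga *. G p) - (q + ga *. G q)) <.> (p - q)
    = (p - q) <.> (p - q) + ga * ((G p - G q) <.> (p - q))"
   by (simp add: algebra_simps inner_diff_left inner_diff_right)
  ultimately show ?thesis by (simp add: power2_norm_eq_inner)
 qed
 have nonexp: "norm (p - q) <= norm ((p + ga *. G p) - (q + ga *. G q))" for p q
 proof -
  have "norm (p - q) * norm (p - q) <= norm ((p + ga *. G p) - (q + ga *. G q)) * norm (p - q)"
   using mono[of p q] norm_cauchy_schwarz order_trans unfolding power2_eq_square by blast
  thus ?thesis by (metis mult_right_le_imp_le norm_ge_zero order_le_less)
 qed
 have "\<exists>p. p + ga *. G p = x" for x
 proof -
  have "strongly_convex 1 (%x. ga * ph x + (x <.> x) / 2)"
   unfolding strongly_convex_def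
  proof (intro allI ballI)
   fix x y :: 'a and t :: real assume t: "t : {0..1}"
   have "ph (t *. x + (1 - t) *. y) <= t * ph x + (1 - t) * ph y - om / 2 * t * (1 - t) * (norm (x - y))^2"
    using sc t by (auto simp: strongly_convex_def)
   moreover have "om / 2 * t * (1 - t) * (norm (x - y))^2 >= 0" using pos t by simp
   ultimately have "ph (t *. x + (1 - t) *. y) <= t * ph x + (1 - t) * ph y" by linarith
   hence 1: "ga * ph (t *. x + (1 - t) *. y) <= ga * (t * ph x + (1 - t) * ph y)" using pos by simp
   have "(t *. x + (1 - t) *. y) <.> (t *. x + (1 - t) *. y)
     = t * (x <.> x) + (1 - t) * (y <.> y) - t * (1 - t) * (norm (x - y))^2"
    unfolding power2_norm_eq_inner
    by (simp add: inner_diff_left inner_diff_right inner_add_left inner_add_right inner_commute[of y x]) (simp add: algebra_simps)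
   moreover have "t * (ga * A + a / 2) + (1 - t) * (ga * B + b / 2) - 1 / 2 * t * (1 - t) * N
     = ga * (t * A + (1 - t) * B) + (t * a + (1 - t) * b - t * (1 - t) * N) / 2" for A B a b N
    by (simp add: field_simps)
   ultimately show "ga * ph (t *. x + (1 - t) *. y) + (t *. x + (1 - t) *. y) <.> (t *. x + (1 - t) *. y) / 2
    <= t * (ga * ph x + x <.> x / 2) + (1 - t) * (ga * ph y + y <.> y / 2) - 1 / 2 * t * (1 - t) * (norm (x - y))^2"
    using 1 by simp
  qed
  moreover have "0 < (1::real)" by simp
  moreover have "GDERIV (%x. ga * ph x + (x <.> x) / 2) x :> x + ga *. G x" for x
   using d[of x] unfolding gderiv_def
   by (auto intro!: derivative_eq_intros simp: inner_add_right algebra_simps inner_commute)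
  ultimately show ?thesis by (rule strongly_convex_grad_surj)
 qed
 hence e: "\<exists>!p. \<exists>v\<in>subdifferential ph p. p + ga *. v = x" for x
  unfolding sub by (metis (no_types, opaque_lifting) singletonD singletonI nonexp diff_self norm_zero norm_le_zero_iff eq_iff_diff_eq_0)
 show eq: "prox ga ph x + ga *. G (prox ga ph x) = x" for x
  using theI'[OF e[of x]] unfolding sub prox_def by auto
 show "1-lipschitz_on UNIV (prox ga ph)"
  using nonexp eq by (intro lipschitz_onI) (auto simp: dist_norm, metis)
qed

section \<open>The centred Gaussian distribution\<close>

lemma range_axis_Basis: "(Basis :: (real ^ 'd) set) = range (%i. axis i 1)"
 by (auto simp: Basis_vec_def)

lemma gaussian_density:
 "(gaussian v :: (real ^ 'd) measure) =
  density lborel (%x. \<Prod>b\<in>Basis. ennreal (normal_density 0 (sqrt v) (x <.> b)))"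
proof -
 have "(\<Prod>b\<in>Basis. ennreal (normal_density 0 (sqrt v) (x <.> b)))
   = ennreal (\<Prod>i\<in>UNIV. normal_density 0 (sqrt v) (x $ i))" for x :: "real ^ 'd"
  unfolding range_axis_Basis
  by (subst prod.reindex) (auto simp: inj_on_def axis_eq_axis inner_axis prod_ennreal)
 thus ?thesis unfolding gaussian_def by simp
qed

lemma sets_gaussian [simp, measurable_cong]: "sets (gaussian v) = sets borel"
 by (simp add: gaussian_def)

lemma space_gaussian [simp]: "space (gaussian v) = UNIV"
 by (simp add: gaussian_def)

lemma nn_integral_gaussian_prod:
 fixes q :: "real ^ 'd => real => ennreal"
 assumes "v > 0" and [measurable]: "\<And>b. b : Basis ==> q b : bmeas borel"
 shows "(NI (gaussian v) (%x. (\<Prod>b\<in>Basis. q b (x <.> b))))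
   = (\<Prod>b\<in>Basis. \<integral>\<^sup>+ t. ennreal (normal_density 0 (sqrt v) t) * q b t \<partial>lborel)"
proof -
 have "(NI (gaussian v) (%x. (\<Prod>b\<in>Basis. q b (x <.> b))))
   = (NI lborel (%x. (\<Prod>b\<in>Basis. ennreal (normal_density 0 (sqrt v) (x <.> b)) * q b (x <.> b))))"
  unfolding gaussian_density by (subst nn_integral_density) (auto simp: prod.distrib)
 also have "... = (\<Prod>b\<in>Basis. \<integral>\<^sup>+ t. ennreal (normal_density 0 (sqrt v) t) * q b t \<partial>lborel)"
  by (rule nn_integral_lborel_prod) auto
 finally show ?thesis .
qed

lemma nn_integral_normal_density:
 assumes "s > 0" shows "NN lborel (%t. normal_density m s t) = 1"
proof -
 interpret prob_space "density lborel (normal_density m s)" by (rule prob_space_normal_density[OF assms])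
 show ?thesis using emeasure_space_1 by (simp add: emeasure_density)
qed

lemma prob_space_gaussian:
 assumes "v > 0" shows "prob_space (gaussian v :: (real ^ 'd) measure)"
proof
 have "(NI ((gaussian v :: (real ^ 'd) measure)) (%x. 1)) = 1"
  using nn_integral_gaussian_prod[of v "%(_ :: real ^ 'd) _. 1"] assms
  by (simp add: nn_integral_normal_density)
 thus "emeasure (gaussian v :: (real ^ 'd) measure) (space (gaussian v)) = 1" by simp
qed

text \<open>The one transformation rule behind the scaling, the reflection and the sign symmetry.\<close>

lemma gaussian_scale_coordinates:
 fixes c :: "real ^ 'd => real"
 assumes "v > 0" "s > 0" and c: "\<And>b. b : Basis ==> \<bar>c b\<bar> = s"
 shows "distr (gaussian v) borel (%x. \<Sum>b\<in>Basis. (c b * (x <.> b)) *. b) = gaussian (s^2 * v)"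
proof (rule measure_eqI)
 let ?T = "%x. \<Sum>b\<in>Basis. (c b * (x <.> b)) *. b"
 have [measurable]: "?T : bmeas borel" by simp
 show "sets (distr (gaussian v) borel ?T) = sets (gaussian (s^2 * v))" by simp
 fix A :: "(real ^ 'd) set" assume "A : sets (distr (gaussian v) borel ?T)"
 hence [measurable]: "A : sets borel" by simp
 let ?p = "%v x. \<Prod>b\<in>Basis. ennreal (normal_density 0 (sqrt v) (x <.> b))"
 have nz: "\<And>b. b : Basis ==> c b ~= 0" using c \<open>s > 0\<close> by fastforce
 have inn: "?T x <.> b = c b * (x <.> b)" if "b : Basis" for x b :: "real ^ 'd"
  using that by (simp add: inner_sum_left inner_Basis if_distrib sum.delta cong: if_cong)
 have dens: "ennreal s * ennreal (normal_density 0 (sqrt (s^2 * v)) (c b * t)) = ennreal (normal_density 0 (sqrt v) t)"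
  if "b : Basis" for b t
 proof -
  have "(c b)^2 = s^2" using c[OF that] by (metis power2_abs)
  hence "s * normal_density 0 (sqrt (s^2 * v)) (c b * t) = normal_density 0 (sqrt v) t"
   using \<open>s > 0\<close> \<open>v > 0\<close>
   by (simp add: normal_density_def real_sqrt_mult power_mult_distrib)
  thus ?thesis using \<open>s > 0\<close> by (simp add: ennreal_mult'[symmetric])
 qed
 have "emeasure (gaussian (s^2 * v)) A = (NI lborel (%x. ?p (s^2 * v) x * indicator A x))"
  unfolding gaussian_density by (simp add: emeasure_density)
 also have "... = (NI (density (distr lborel borel (%x. 0 + ?T x)) (%_. (\<Prod>j\<in>Basis. \<bar>c j\<bar>))) (%x. ?p (s^2 * v) x * indicator A x))"
  by (subst lborel_affine_euclidean[of c 0]) (use nz in simp_all)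
 also have "... = (NI lborel (%x. ennreal (\<Prod>j\<in>Basis. \<bar>c j\<bar>) * (?p (s^2 * v) (?T x) * indicator A (?T x))))"
  by (subst nn_integral_density) (auto simp: nn_integral_distr)
 also have "... = (NI lborel (%x. ?p v x * indicator A (?T x)))"
 proof (rule nn_integral_cong)
  fix x :: "real ^ 'd"
  have "ennreal (\<Prod>j\<in>Basis. \<bar>c j\<bar>) = (\<Prod>j\<in>(Basis :: (real ^ 'd) set). ennreal s)"
   using c \<open>s > 0\<close> by (simp add: ennreal_power)
  hence "ennreal (\<Prod>j\<in>Basis. \<bar>c j\<bar>) * ?p (s^2 * v) (?T x)
    = (\<Prod>b\<in>Basis. ennreal s * ennreal (normal_density 0 (sqrt (s^2 * v)) (?T x <.> b)))"
   by (simp only: prod.distrib)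
  also have "... = ?p v x" by (rule prod.cong[OF refl]) (simp only: inn dens)
  finally show "ennreal (\<Prod>j\<in>Basis. \<bar>c j\<bar>) * (?p (s^2 * v) (?T x) * indicator A (?T x)) = ?p v x * indicator A (?T x)"
   by (simp add: mult.assoc[symmetric])
 qed
 also have "... = emeasure (gaussian v) (?T -` A)"
 proof -
  have "?T -` A : sets borel" using measurable_sets[of ?T borel borel A] by simp
  thus ?thesis
   unfolding gaussian_density by (subst emeasure_density) (auto simp: indicator_def intro!: nn_integral_cong)
 qed
 also have "... = emeasure (distr (gaussian v) borel ?T) A"
  by (subst emeasure_distr) auto
 finally show "emeasure (distr (gaussian v) borel ?T) A = emeasure (gaussian (s^2 * v)) A" ..
qed

lemma gaussian_scaleR:
 assumes "v > 0" "s > 0"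
 shows "distr (gaussian v :: (real ^ 'd) measure) borel (%x. s *. x) = gaussian (s^2 * v)"
proof -
 have "(\<Sum>b\<in>Basis. (s * (x <.> b)) *. b) = s *. x" for x :: "real ^ 'd"
  by (simp add: scaleR_scaleR[symmetric] scaleR_sum_right[symmetric] euclidean_representation del: scaleR_scaleR)
 with gaussian_scale_coordinates[OF assms, of "%_ :: real ^ 'd. s"] show ?thesis using assms by simp
qed

lemma gaussian_uminus:
 assumes "v > 0"
 shows "distr (gaussian v :: (real ^ 'd) measure) borel uminus = gaussian v"
proof -
 have "(\<Sum>b\<in>Basis. (- 1 * (x <.> b)) *. b) = - x" for x :: "real ^ 'd"
  by (simp add: sum_negf euclidean_representation)
 with gaussian_scale_coordinates[OF assms, of 1 "%_ :: real ^ 'd. - 1"] show ?thesis by simp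
qed

lemma gaussian_abs_moment:
 assumes "v > 0"
 shows "integrable (gaussian v :: (real ^ 'd) measure) (%x. norm x ^ k)"
proof (rule integrableI_bounded)
 show "(%x. norm x ^ k) : bmeas (gaussian v :: (real ^ 'd) measure)" by simp
 have fin: "NN (gaussian v :: (real ^ 'd) measure) (%x. \<bar>x <.> e\<bar> ^ k) < \<infinity>"
  if e: "e : Basis" for e :: "real ^ 'd"
 proof -
  let ?q = "%b t. if b = e then ennreal (\<bar>t\<bar> ^ k) else 1"
  have "(\<Prod>b\<in>Basis. ?q b (x <.> b)) = ennreal (\<bar>x <.> e\<bar> ^ k)" for x :: "real ^ 'd"
   using e by (simp add: prod.delta)
  hence "NN (gaussian v :: (real ^ 'd) measure) (%x. \<bar>x <.> e\<bar> ^ k)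
    = (\<Prod>b\<in>Basis. \<integral>\<^sup>+ t. ennreal (normal_density 0 (sqrt v) t) * ?q b t \<partial>lborel)"
   using nn_integral_gaussian_prod[of v ?q] assms by simp
  moreover have "(NI lborel (%t. ennreal (normal_density 0 (sqrt v) t) * ?q b t)) < \<infinity>" for b
  proof (cases "b = e")
   case True
   have "integrable lborel (%x. normal_density 0 (sqrt v) x * \<bar>x\<bar>^k)"
    using integrable_normal_moment_abs[of "sqrt v" 0 k] assms by simp
   thus ?thesis using True
    by (auto simp: integrable_iff_bounded abs_mult ennreal_mult'[symmetric])
  qed (use assms in "simp add: nn_integral_normal_density")
  ultimately show ?thesis by (metis (no_types, lifting) ennreal_prod_eq_top infinity_ennreal_def less_top)
 qed
 have le: "norm x ^ k <= real DIM(real ^ 'd) ^ k * (\<Sum>e\<in>Basis. \<bar>x <.> e\<bar> ^ k)" for x :: "real ^ 'd"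
 proof -
  let ?S = "(%e. \<bar>x <.> e\<bar>) ` Basis"
  have "Max ?S : ?S" by (rule Max_in) auto
  then obtain e where e1: "e : Basis" "Max ?S = \<bar>x <.> e\<bar>" by blast
  have "\<bar>x <.> e'\<bar> <= Max ?S" if "e' : Basis" for e' by (rule Max_ge) (use that in auto)
  note e = e1(1) this[unfolded e1(2)]
  have "norm x <= (\<Sum>e\<in>Basis. \<bar>x <.> e\<bar>)" by (rule norm_le_l1)
  also have "... <= (\<Sum>e'\<in>(Basis :: (real ^ 'd) set). \<bar>x <.> e\<bar>)" by (rule sum_mono) (rule e(2))
  finally have "norm x <= real DIM(real ^ 'd) * \<bar>x <.> e\<bar>" by simp
  hence "norm x ^ k <= real DIM(real ^ 'd) ^ k * \<bar>x <.> e\<bar> ^ k"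
   by (metis norm_ge_zero power_mono power_mult_distrib)
  also have "\<bar>x <.> e\<bar> ^ k <= (\<Sum>e\<in>Basis. \<bar>x <.> e\<bar> ^ k)"
   using e(1) by (intro member_le_sum) auto
  finally show ?thesis by (simp add: mult_left_mono)
 qed
 have "NN (gaussian v :: (real ^ 'd) measure) (%x. norm (norm x ^ k))
   <= (NI ((gaussian v :: (real ^ 'd) measure)) (%x. ennreal (real DIM(real ^ 'd) ^ k) * (\<Sum>e\<in>Basis. ennreal (\<bar>x <.> e\<bar> ^ k))))"
 proof (rule nn_integral_mono)
  fix x :: "real ^ 'd"
  have "ennreal (norm (norm x ^ k)) <= ennreal (real DIM(real ^ 'd) ^ k * (\<Sum>e\<in>Basis. \<bar>x <.> e\<bar> ^ k))"
   using le[of x] by (intro ennreal_leI) simp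
  thus "ennreal (norm (norm x ^ k)) <= ennreal (real DIM(real ^ 'd) ^ k) * (\<Sum>e\<in>Basis. ennreal (\<bar>x <.> e\<bar> ^ k))"
   by (simp add: ennreal_mult' sum_nonneg)
 qed
 also have "... = ennreal (real DIM(real ^ 'd) ^ k) * (\<Sum>e\<in>Basis. \<integral>\<^sup>+ x. ennreal (\<bar>x <.> e\<bar> ^ k) \<partial>(gaussian v :: (real ^ 'd) measure))"
  by (simp add: nn_integral_cmult nn_integral_sum del: sum_ennreal)
 also have "... < \<infinity>" using fin by (simp add: ennreal_mult_less_top)
 finally show "NN (gaussian v :: (real ^ 'd) measure) (%x. norm (norm x ^ k)) < \<infinity>" .
qed

definition gauss_moment :: "'d::finite itself => nat => real" where
 "gauss_moment _ k = (LINT x|gaussian 1. norm (x :: real ^ 'd) ^ k)"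

lemma gauss_moment_nonneg: "gauss_moment TYPE('d::finite) k >= 0"
 unfolding gauss_moment_def by (rule Bochner_Integration.integral_nonneg) simp

lemma gaussian_abs_moment_eq:
 assumes "v > 0"
 shows "(LINT x|gaussian v. norm (x :: real ^ 'd) ^ k) = sqrt v ^ k * gauss_moment TYPE('d) k"
proof -
 have "(LINT x|gaussian v. norm (x :: real ^ 'd) ^ k)
   = (LINT x|distr (gaussian 1) borel (%x. sqrt v *. x). norm (x :: real ^ 'd) ^ k)"
  using gaussian_scaleR[where 'd='d, of 1 "sqrt v"] assms by simp
 also have "... = (LINT x|gaussian 1. sqrt v ^ k * norm (x :: real ^ 'd) ^ k)"
  using assms by (subst integral_distr) (auto simp: power_mult_distrib)
 finally show ?thesis by (simp add: gauss_moment_def)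
qed

lemma gaussian_covariance:
 fixes a b :: "real ^ 'd"
 assumes "v > 0"
 shows "integrable (gaussian v) (%x. (x <.> a) * (x <.> b))"
  and "(LINT x|gaussian v. (x <.> a) * (x <.> b)) = v * (a <.> b)"
proof -
 have int: "integrable (gaussian v) (%x. (x <.> a) * (x <.> b))" for a b :: "real ^ 'd"
 proof (rule Bochner_Integration.integrable_bound)
  show "integrable (gaussian v) (\<lambda>x :: real ^ 'd. norm x ^ 2 * (norm a * norm b))"
   using gaussian_abs_moment[OF assms, of 2] by (rule integrable_mult_left)
  have "\<bar>x <.> a\<bar> * \<bar>x <.> b\<bar> <= (norm x * norm a) * (norm x * norm b)" for x
   by (intro mult_mono Cauchy_Schwarz_ineq2) auto
  thus "AE x in gaussian v. norm ((x <.> a) * (x <.> b)) <= norm (norm x ^ 2 * (norm a * norm b))"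
   by (auto simp: abs_mult power2_eq_square algebra_simps)
 qed simp
 show "integrable (gaussian v) (%x. (x <.> a) * (x <.> b))" by (rule int)
 have basis: "(LINT x|gaussian v. (x <.> e) * (x <.> e')) = (if e = e' then v else 0)"
  if e: "e : Basis" "e' : Basis" for e e' :: "real ^ 'd"
 proof (cases "e = e'")
  case True
  let ?q = "%b t. if b = e then ennreal (t^2) else 1"
  have hb: "has_bochner_integral lborel (%x. normal_density 0 (sqrt v) x * (x - 0)^(2*1)) v"
   using normal_moment_even[of "sqrt v" 0 1] assms by (simp add: fact_numeral field_simps)
  have one: "(NI lborel (%t. ennreal (normal_density 0 (sqrt v) t) * ennreal (t^2))) = ennreal v"
   using hb assms by (simp add: ennreal_mult'[symmetric] nn_integral_eq_integral has_bochner_integral_iff)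
  have "(\<Prod>b\<in>Basis. ?q b (x <.> b)) = ennreal ((x <.> e)^2)" for x :: "real ^ 'd"
   using e by (simp add: prod.delta)
  hence "NN (gaussian v) (%x. (x <.> e)^2)
    = (\<Prod>b\<in>Basis. \<integral>\<^sup>+ t. ennreal (normal_density 0 (sqrt v) t) * ?q b t \<partial>lborel)"
   using nn_integral_gaussian_prod[of v ?q] assms by simp
  also have "... = (\<Prod>b\<in>Basis. if b = e then ennreal v else 1)"
   by (rule prod.cong) (use one assms in "auto simp: nn_integral_normal_density")
  also have "... = ennreal v" using e by (simp add: prod.delta)
  finally have "(LINT x|gaussian v. (x <.> e)^2) = v"
   using assms by (subst integral_eq_nn_integral) auto
  with True show ?thesis by (simp add: power2_eq_square)
 next
  case False
  let ?c = "%b. if b = e then - 1 else 1 :: real"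
  let ?T = "%x. \<Sum>b\<in>Basis. (?c b * (x <.> b)) *. b"
  have inn: "?T x <.> b = ?c b * (x <.> b)" if "b : Basis" for x b :: "real ^ 'd"
   using that by (simp add: inner_sum_left inner_Basis if_distrib sum.delta cong: if_cong)
  have "(LINT x|gaussian v. (x <.> e) * (x <.> e')) = (LINT x|distr (gaussian v) borel ?T. (x <.> e) * (x <.> e'))"
   using gaussian_scale_coordinates[of v 1 ?c] assms by simp
  also have "... = (LINT x|gaussian v. - ((x <.> e) * (x <.> e')))"
   by (subst integral_distr) (use e False inn in "auto intro!: Bochner_Integration.integral_cong")
  finally show ?thesis using False by simp
 qed
 have "(x <.> a) * (x <.> b) = (\<Sum>e\<in>Basis. \<Sum>e'\<in>Basis. (a <.> e) * (b <.> e') * ((x <.> e) * (x <.> e')))" for x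
  by (subst (1 2) euclidean_inner) (simp add: sum_product algebra_simps)
 hence "(LINT x|gaussian v. (x <.> a) * (x <.> b))
   = (\<Sum>e\<in>Basis. \<Sum>e'\<in>Basis. (a <.> e) * (b <.> e') * (LINT x|gaussian v. (x <.> e) * (x <.> e')))"
  by (simp add: int)
 also have "... = (\<Sum>e\<in>Basis. (a <.> e) * (b <.> e) * v)"
  by (intro sum.cong refl) (simp add: basis if_distrib sum.delta' sum.delta cong: if_cong)
 also have "... = v * (a <.> b)" by (subst euclidean_inner) (simp add: sum_distrib_left algebra_simps)
 finally show "(LINT x|gaussian v. (x <.> a) * (x <.> b)) = v * (a <.> b)" .
qed

lemma gaussian_norm2:
 assumes "v > 0"
 shows "(LINT x|gaussian v. (norm (x :: real ^ 'd))^2) = v * CARD('d)"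
proof -
 have "(norm x)^2 = (\<Sum>e\<in>Basis. (x <.> e) * (x <.> e))" for x :: "real ^ 'd"
  unfolding power2_norm_eq_inner by (rule euclidean_inner)
 hence "(LINT x|gaussian v. (norm (x :: real ^ 'd))^2) = (\<Sum>e\<in>(Basis :: (real ^ 'd) set). v * (e <.> e))"
  using assms by (simp add: gaussian_covariance)
 thus ?thesis by simp
qed

section \<open>Transport distances\<close>

lemma ennreal_sqrt_mono: "x <= y ==> ennreal_sqrt x <= ennreal_sqrt y"
 unfolding ennreal_sqrt_def
 by (auto simp: top_unique less_top[symmetric] intro!: ennreal_leI enn2real_mono)

lemma ennreal_sqrt_ennreal: "r >= 0 ==> ennreal_sqrt (ennreal r) = ennreal (sqrt r)"
 by (simp add: ennreal_sqrt_def)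

lemma INF_ennreal_sqrt_le:
 assumes r: "r >= 0" and P: "\<And>de. de > 0 ==> \<exists>P\<in>S. c P <= ennreal (r^2 + de)"
 shows "(INF P\<in>S. ennreal_sqrt (c P)) <= ennreal r"
proof (rule ennreal_le_epsilon)
 fix e :: real assume e: "0 < e"
 obtain P where "P : S" "c P <= ennreal (r^2 + e^2)" using P[of "e^2"] e by auto
 hence "(INF P\<in>S. ennreal_sqrt (c P)) <= ennreal_sqrt (ennreal (r^2 + e^2))"
  by (intro INF_lower2[of P] ennreal_sqrt_mono) auto
 also have "... = ennreal (sqrt (r^2 + e^2))" by (rule ennreal_sqrt_ennreal) simp
 also have "sqrt (r^2 + e^2) <= r + e" using r e by (intro real_le_lsqrt) (auto simp: power2_sum)
 finally show "(INF P\<in>S. ennreal_sqrt (c P)) <= ennreal r + ennreal e"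
  using r e by (simp add: ennreal_leI flip: ennreal_plus)
qed

lemma INF_ennreal_sqrt_less:
 assumes "(INF P\<in>S. ennreal_sqrt (c P)) < ennreal r"
 shows "\<exists>P\<in>S. c P <= ennreal (r^2)"
proof -
 obtain P where P: "P : S" "ennreal_sqrt (c P) < ennreal r"
  using assms by (auto simp: INF_less_iff)
 hence fin: "c P ~= \<infinity>" by (auto simp: ennreal_sqrt_def)
 have lt: "sqrt (enn2real (c P)) < r" using P fin by (auto simp: ennreal_sqrt_def ennreal_less_iff)
 have "c P = ennreal (enn2real (c P))" using fin by (simp add: less_top)
 also have "... <= ennreal (r^2)"
  using lt by (intro ennreal_leI) (metis less_eq_real_def real_sqrt_le_iff real_sqrt_abs abs_ge_self order_trans)
 finally show ?thesis using P(1) by blast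
qed

lemma couplings_distr:
 assumes R: "prob_space R" and X[measurable]: "X : measurable R mu" and Y[measurable]: "Y : measurable R nu"
  and "distr R mu X = mu" "distr R nu Y = nu"
 shows "distr R (mu >< nu) (%om. (X om, Y om)) : couplings mu nu"
proof -
 have "distr (distr R (mu >< nu) (%om. (X om, Y om))) mu fst = mu"
  "distr (distr R (mu >< nu) (%om. (X om, Y om))) nu snd = nu"
  using assms(4,5) by (simp_all add: distr_distr comp_def)
 thus ?thesis using prob_space.prob_space_distr[OF R, of "%om. (X om, Y om)" "mu >< nu"]
  by (simp add: couplings_def)
qed

lemma distr_sets_cong: "sets N = sets N' ==> distr M N f = distr M N' f"
 by (rule distr_cong) auto

lemma couplingsD:
 fixes mu :: "'a::second_countable_topology measure" and nu :: "'b::second_countable_topology measure"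
 assumes "P : couplings mu nu" "sets mu = sets borel" "sets nu = sets borel"
 shows "prob_space P" "sets P = sets borel" "distr P borel fst = mu" "distr P borel snd = nu"
proof -
 show "prob_space P" using assms by (simp add: couplings_def)
 have "sets (mu >< nu) = sets (borel >< borel)" by (rule sets_pair_measure_cong) (use assms in auto)
 also have "... = sets (borel :: ('a \<times> 'b) measure)" by (simp only: borel_prod)
 finally show "sets P = sets borel" using assms(1) by (simp add: couplings_def)
 show "distr P borel fst = mu" "distr P borel snd = nu"
  using assms distr_sets_cong[of mu borel P fst] distr_sets_cong[of nu borel P snd]
  by (auto simp: couplings_def)
qed

lemma wasserstein2_le:
 fixes mu nu :: "'a::euclidean_space measure"
 assumes r: "r >= 0" and sets: "sets mu = sets borel" "sets nu = sets borel"
  and R: "\<And>de. de > 0 ==> \<exists>R :: 'w measure. \<exists>X Y. prob_space R \<and> X : bmeas R \<and> Y : bmeas R \<and>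
    distr R borel X = mu \<and> distr R borel Y = nu \<and>
    (NN R (%om. (norm (X om - Y om))^2)) <= ennreal (r^2 + de)"
 shows "wasserstein2 mu nu <= ennreal r"
 unfolding wasserstein2_def
proof (rule INF_ennreal_sqrt_le[OF r])
 fix de :: real assume "de > 0"
 from R[OF this] obtain R :: "'w measure" and X Y where R: "prob_space R"
  and [measurable]: "X : bmeas R" "Y : bmeas R"
  and d: "distr R borel X = mu" "distr R borel Y = nu"
  and le: "NN R (%om. (norm (X om - Y om))^2) <= ennreal (r^2 + de)" by blast
 have m[measurable]: "X : measurable R mu" "Y : measurable R nu"
  by (subst measurable_cong_sets[OF refl sets(1)], fact) (subst measurable_cong_sets[OF refl sets(2)], fact)
 have d': "distr R mu X = mu" "distr R nu Y = nu" using d distr_sets_cong sets by metis+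
 let ?P = "distr R (mu >< nu) (%om. (X om, Y om))"
 have s: "sets (mu >< nu) = sets (borel >< borel)" by (rule sets_pair_measure_cong) (use sets in auto)
 have [measurable]: "(%(x, x'). ennreal ((norm (x - x'))^2)) : bmeas (mu >< nu)"
  by (subst measurable_cong_sets[OF s refl]) measurable
 have e: "(\<integral>\<^sup>+ (x, x'). ennreal ((norm (x - x'))^2) \<partial>?P) = NN R (%om. (norm (X om - Y om))^2)"
  by (subst nn_integral_distr) auto
 show "\<exists>P\<in>couplings mu nu. (\<integral>\<^sup>+ (x, x'). ennreal ((norm (x - x'))^2) \<partial>P) <= ennreal (r^2 + de)"
  by (rule bexI[of _ ?P]) (use le in "simp add: e", rule couplings_distr[OF R m d'])
qed

section \<open>Gluing couplings\<close>

text \<open>Two probability spaces that carry the same marginal can be glued along it. An exact gluing is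
 built from conditional laws; an approximate one has an explicit density:
 cut the space of the common marginal into countably many small cells and make the two factors
 independent given the cell. An independent component of the second space stays independent of
 the whole first space.\<close>

lemma approximate_gluing:
 fixes Y :: "'n => 'b::{second_countable_topology, metric_space}" and Z :: "'w => 'b"
 assumes N: "prob_space N" and M: "prob_space M" and ep: "ep > 0"
  and [measurable]: "Y : bmeas N" "Z : bmeas M" "W : measurable M S"
  and law: "distr N borel Y = distr M borel Z"
  and indep: "distr M (borel >< S) (%om. (Z om, W om)) = distr M borel Z >< distr M S W"
 shows "\<exists>R. prob_space R \<and> sets R = sets (N >< M) \<and> distr R N fst = N \<and> distr R M snd = M \<and>
   (AE (n, om) in R. dist (Y n) (Z om) < ep) \<and>
   distr R (N >< S) (%(n, om). (n, W om)) = N >< distr M S W"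
proof -
 interpret N: prob_space N by fact
 interpret M: prob_space M by fact
 interpret NM: pair_sigma_finite N M ..
 obtain D :: "'b set" where D: "countable D" "\<And>X. open X ==> X ~= {} ==> \<exists>d\<in>D. d : X"
  using countable_dense_setE by blast
 define d where "d i = from_nat_into D i" for i
 have ex: "\<exists>i. dist b (d i) < ep / 2" for b
 proof -
  obtain x where x: "x : D" "x : ball b (ep / 2)" using D(2)[of "ball b (ep / 2)"] ep by auto
  then obtain i where "d i = x" using D(1) from_nat_into_surj d_def by metis
  thus ?thesis using x by auto
 qed
 define c :: "'b => nat" where "c b = (LEAST i. dist b (d i) < ep / 2)" for b
 have c: "dist b (d (c b)) < ep / 2" for b unfolding c_def by (rule LeastI_ex[OF ex])
 have cc: "dist b b' < ep" if "c b = c b'" for b b'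
  using c[of b] c[of b'] that dist_triangle[of b b' "d (c b)"] by (simp add: dist_commute)
 have [measurable]: "c : borel \<rightarrow>\<^sub>M count_space UNIV"
  unfolding c_def by measurable
 define m where "m i = emeasure (distr M borel Z) {b. c b = i}" for i
 have [measurable]: "{b. c b = i} : sets borel" for i by measurable
 have mM: "m i = emeasure M {om\<in>space M. c (Z om) = i}" for i
  unfolding m_def by (subst emeasure_distr) (auto intro!: arg_cong2[where f=emeasure])
 have mN: "m i = emeasure N {n\<in>space N. c (Y n) = i}" for i
  unfolding m_def law[symmetric] by (subst emeasure_distr) (auto intro!: arg_cong2[where f=emeasure])
 have mfin: "m i ~= \<infinity>" for i unfolding mM by simp
 have minv: "m i ~= 0 ==> m i * inverse (m i) = 1" for i
  using mfin by (simp add: ennreal_mult_divide_eq divide_ennreal_def[symmetric] ennreal_divide_self less_top)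
 define k where "k = (%(n, om). inverse (m (c (Y n))) * indicator {(n, om). c (Y n) = c (Z om)} (n, om))"
 have [measurable]: "(%i. inverse (m i)) : count_space UNIV \<rightarrow>\<^sub>M borel" by simp
 have k[measurable]: "k : bmeas (N >< M)"
 proof -
  have "(%x. (%i x. inverse (m i) * (if c (Z (snd x)) = i then 1 else 0)) (c (Y (fst x))) x)
    : bmeas (N >< M)"
   by (rule measurable_compose_countable[where g="%x. c (Y (fst x))"]) measurable
  hence "(%x. inverse (m (c (Y (fst x)))) * (if c (Y (fst x)) = c (Z (snd x)) then 1 else 0)) : bmeas (N >< M)"
   by (simp add: eq_commute)
  thus ?thesis unfolding k_def by (simp add: indicator_def of_bool_def case_prod_unfold)
 qed
 have posN: "AE n in N. m (c (Y n)) ~= 0"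
 proof -
  have "AE n in N. \<forall>i. m i = 0 --> c (Y n) ~= i"
  proof (subst AE_all_countable, rule allI)
   fix i show "AE n in N. m i = 0 --> c (Y n) ~= i"
   proof (cases "m i = 0")
    case True
    hence "{n\<in>space N. c (Y n) = i} : null_sets N" using mN[of i] by (auto simp: null_sets_def)
    from AE_not_in[OF this] show ?thesis using AE_space by eventually_elim auto
   qed simp
  qed
  thus ?thesis by eventually_elim auto
 qed
 have posM: "AE om in M. m (c (Z om)) ~= 0"
 proof -
  have "AE om in M. \<forall>i. m i = 0 --> c (Z om) ~= i"
  proof (subst AE_all_countable, rule allI)
   fix i show "AE om in M. m i = 0 --> c (Z om) ~= i"
   proof (cases "m i = 0")
    case True
    hence "{om\<in>space M. c (Z om) = i} : null_sets M" using mM[of i] by (auto simp: null_sets_def)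
    from AE_not_in[OF this] show ?thesis using AE_space by eventually_elim auto
   qed simp
  qed
  thus ?thesis by eventually_elim auto
 qed
 let ?R = "density (N >< M) k"
 \<comment> \<open>Given the first component, the second factor is conditioned on one cell, which does not
  affect the law of the independent component.\<close>
 have inner: "AE n in N. (NI M (%om. k (n, om) * H n (W om))) = (NI (distr M S W) (%w. H n w))"
  if H[measurable]: "(%(n, w). H n w) : bmeas (N >< S)" for H
  using posN AE_space
 proof eventually_elim
  case (elim n)
  let ?i = "c (Y n)"
  have [measurable]: "H n : bmeas S" using H elim(2) by measurable
  interpret W: prob_space "distr M S W" by (rule M.prob_space_distr) simp
  interpret ZZ: prob_space "distr M borel Z" by (rule M.prob_space_distr) simp
  interpret ZW: pair_sigma_finite "distr M borel Z" "distr M S W" ..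
  have "(NI M (%om. k (n, om) * H n (W om)))
    = (NI M (%om. inverse (m ?i) * (indicator {b. c b = ?i} (Z om) * H n (W om))))"
   by (rule nn_integral_cong) (auto simp: k_def indicator_def)
  also have "... = inverse (m ?i) * (NI M (%om. indicator {b. c b = ?i} (Z om) * H n (W om)))"
   by (rule nn_integral_cmult) measurable
  also have "(NI M (%om. indicator {b. c b = ?i} (Z om) * H n (W om)))
    = (NI (distr M (borel >< S) (%om. (Z om, W om))) (%x. indicator {b. c b = ?i} (fst x) * H n (snd x)))"
   by (subst nn_integral_distr) auto
  also have "... = (\<integral>\<^sup>+ b. \<integral>\<^sup>+ w. indicator {b. c b = ?i} b * H n w \<partial>distr M S W \<partial>distr M borel Z)"
   unfolding indep by (subst W.nn_integral_fst[symmetric]) auto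
  also have "... = (NI (distr M borel Z) (%b. indicator {b. c b = ?i} b * (NI (distr M S W) (%w. H n w))))"
   by (intro nn_integral_cong nn_integral_cmult) simp
  also have "... = m ?i * (NI (distr M S W) (%w. H n w))"
   by (subst nn_integral_multc) (auto simp: m_def)
  finally have "(NI M (%om. k (n, om) * H n (W om)))
    = (m ?i * inverse (m ?i)) * (NI (distr M S W) (%w. H n w))" by (simp only: ac_simps)
  thus ?case unfolding minv[OF elim(1)] by simp
 qed
 have W: "distr ?R (N >< S) (%(n, om). (n, W om)) = N >< distr M S W"
 proof (rule measure_eqI)
  show "sets (distr ?R (N >< S) (%(n, om). (n, W om))) = sets (N >< distr M S W)"
   unfolding sets_distr by (rule sets_pair_measure_cong) auto
  have sc: "sets (N >< distr M S W) = sets (N >< S)" by (rule sets_pair_measure_cong) auto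
  fix A assume "A : sets (distr ?R (N >< S) (%(n, om). (n, W om)))"
  hence A[measurable]: "A : sets (N >< S)" by simp
  hence A'[measurable]: "A : sets (N >< distr M S W)" by (simp only: sc)
  interpret W: prob_space "distr M S W" by (rule M.prob_space_distr) simp
  have "emeasure (distr ?R (N >< S) (%(n, om). (n, W om))) A
    = (NI (distr ?R (N >< S) (%(n, om). (n, W om))) (%x. indicator A x))" by simp
  also have "... = (NI ?R (%x. indicator A (fst x, W (snd x))))"
   by (subst nn_integral_distr) (auto simp: case_prod_unfold)
  also have "... = (NI (N >< M) (%x. k x * indicator A (fst x, W (snd x))))"
   by (subst nn_integral_density) auto
  also have "... = (\<integral>\<^sup>+ n. \<integral>\<^sup>+ om. k (n, om) * indicator A (n, W om) \<partial>M \<partial>N)"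
   by (subst M.nn_integral_fst[symmetric]) auto
  also have "... = (\<integral>\<^sup>+ n. \<integral>\<^sup>+ w. indicator A (n, w) \<partial>distr M S W \<partial>N)"
   by (intro nn_integral_cong_AE inner) measurable
  also have "... = emeasure (N >< distr M S W) A"
   by (subst W.emeasure_pair_measure) auto
  finally show "emeasure (distr ?R (N >< S) (%(n, om). (n, W om))) A = emeasure (N >< distr M S W) A" .
 qed
 have 1: "distr ?R N fst = N"
 proof (rule measure_eqI)
  fix A assume "A : sets (distr ?R N fst)"
  hence [measurable]: "A : sets N" by simp
  have "emeasure (distr ?R N fst) A = (NI (distr ?R N fst) (%x. indicator A x))" by simp
  also have "... = (NI ?R (%x. indicator A (fst x)))" by (subst nn_integral_distr) auto
  also have "... = (NI (N >< M) (%x. k x * indicator A (fst x)))"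
   by (subst nn_integral_density) auto
  also have "... = (\<integral>\<^sup>+ n. \<integral>\<^sup>+ om. k (n, om) * indicator A n \<partial>M \<partial>N)"
   by (subst M.nn_integral_fst[symmetric]) auto
  also have "... = (\<integral>\<^sup>+ n. \<integral>\<^sup>+ w. indicator A n \<partial>distr M S W \<partial>N)"
   by (intro nn_integral_cong_AE inner[of "%n w. indicator A n"]) measurable
  also have "... = emeasure N A"
   using prob_space.emeasure_space_1[OF M.prob_space_distr, of W S] by simp
  finally show "emeasure (distr ?R N fst) A = emeasure N A" .
 qed simp
 have 2: "distr ?R M snd = M"
 proof (rule measure_eqI)
  fix A assume "A : sets (distr ?R M snd)"
  hence [measurable]: "A : sets M" by simp
  have "emeasure (distr ?R M snd) A = (NI (distr ?R M snd) (%x. indicator A x))" by simp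
  also have "... = (NI ?R (%x. indicator A (snd x)))" by (subst nn_integral_distr) auto
  also have "... = (NI (N >< M) (%x. k x * indicator A (snd x)))"
   by (subst nn_integral_density) auto
  also have "... = (\<integral>\<^sup>+ om. \<integral>\<^sup>+ n. k (n, om) * indicator A om \<partial>N \<partial>M)"
   by (subst NM.nn_integral_snd[symmetric]) auto
  also have "... = (NI M (%om. indicator A om))"
  proof (rule nn_integral_cong_AE, use posM in eventually_elim)
   case (elim om)
   let ?i = "c (Z om)"
   have "(NI N (%n. k (n, om) * indicator A om))
    = (NI N (%n. inverse (m ?i) * indicator A om * indicator {n\<in>space N. c (Y n) = ?i} n))"
    by (rule nn_integral_cong) (auto simp: k_def indicator_def)
   also have "... = inverse (m ?i) * indicator A om * m ?i"
    unfolding mN by (subst nn_integral_cmult_indicator) auto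
   finally have "(NI N (%n. k (n, om) * indicator A om)) = (m ?i * inverse (m ?i)) * indicator A om"
    by (simp only: ac_simps)
   thus ?case unfolding minv[OF elim] by simp
  qed
  finally show "emeasure (distr ?R M snd) A = emeasure M A" by simp
 qed simp
 have "prob_space ?R"
 proof
  have "emeasure ?R (space ?R) = emeasure (distr ?R N fst) (space N)"
   by (subst emeasure_distr) (auto intro!: arg_cong2[where f=emeasure] simp: space_pair_measure)
  thus "emeasure ?R (space ?R) = 1" unfolding 1 by (simp add: N.emeasure_space_1)
 qed
 moreover have "AE (n, om) in ?R. dist (Y n) (Z om) < ep"
  unfolding AE_density[OF k]
  by (auto simp: k_def indicator_def of_bool_def intro!: AE_I2 cc split: if_splits)
 ultimately show ?thesis using 1 2 W by (intro exI[of _ ?R]) auto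
qed

lemma sum3_square_le:
 fixes a b c p q r :: real
 assumes "p > 0" "q > 0" "r > 0"
 shows "(a + b + c)^2 <= (p + q + r) * (a^2 / p + b^2 / q + c^2 / r)"
proof -
 have "(p + q + r) * (a^2 / p + b^2 / q + c^2 / r) - (a + b + c)^2
   = (q * a - p * b)^2 / (p * q) + (r * a - p * c)^2 / (p * r) + (r * b - q * c)^2 / (q * r)"
  using assms by (simp add: field_simps power2_eq_square)
 also have "... >= 0" using assms by (intro add_nonneg_nonneg divide_nonneg_nonneg) auto
 finally show ?thesis by simp
qed

lemma wasserstein2_triangle:
 fixes mu nu rr :: "'a::euclidean_space measure"
 assumes "prob_distribution mu" "prob_distribution nu" "prob_distribution rr"
 shows "wasserstein2 mu rr <= wasserstein2 mu nu + wasserstein2 nu rr"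
proof (rule ennreal_le_epsilon)
 fix e0 :: real assume e0: "0 < e0"
  and fin: "wasserstein2 mu nu + wasserstein2 nu rr < top"
 define e where "e = e0 / 3"
 have e: "e > 0" using e0 by (simp add: e_def)
 obtain a b where ab: "wasserstein2 mu nu = ennreal a" "wasserstein2 nu rr = ennreal b" "a >= 0" "b >= 0"
  using fin by (metis ennreal_add_less_top ennreal_cases order_less_irrefl top.not_eq_extremum)
 have s: "sets mu = sets borel" "sets nu = sets borel" "sets rr = sets borel"
  using assms by (auto simp: prob_distribution_def)
 have "(INF P\<in>couplings mu nu. ennreal_sqrt (\<integral>\<^sup>+ (x, x'). ennreal ((norm (x - x'))^2) \<partial>P)) < ennreal (a + e)"
  using ab e unfolding wasserstein2_def by (simp add: ennreal_less_iff)
 from INF_ennreal_sqrt_less[OF this] obtain P where P: "P : couplings mu nu"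
  "(\<integral>\<^sup>+ (x, x'). ennreal ((norm (x - x'))^2) \<partial>P) <= ennreal ((a + e)^2)" by blast
 have "(INF P\<in>couplings nu rr. ennreal_sqrt (\<integral>\<^sup>+ (x, x'). ennreal ((norm (x - x'))^2) \<partial>P)) < ennreal (b + e)"
  using ab e unfolding wasserstein2_def by (simp add: ennreal_less_iff)
 from INF_ennreal_sqrt_less[OF this] obtain Q where Q: "Q : couplings nu rr"
  "(\<integral>\<^sup>+ (x, x'). ennreal ((norm (x - x'))^2) \<partial>Q) <= ennreal ((b + e)^2)" by blast
 note Pp = couplingsD[OF P(1) s(1,2)] and Qp = couplingsD[OF Q(1) s(2,3)]
 note [measurable_cong] = Pp(2) Qp(2)
 interpret QQ: prob_space Q by (rule Qp)
 have [measurable]: "snd : bmeas P" "fst : bmeas Q" "fst : bmeas P" "snd : bmeas Q"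
  by (simp_all add: borel_prod[symmetric] measurable_cong_sets[OF Pp(2) refl] measurable_cong_sets[OF Qp(2) refl])
 have "\<exists>R. prob_space R \<and> sets R = sets (P >< Q) \<and> distr R P fst = P \<and> distr R Q snd = Q \<and>
   (AE (n, om) in R. dist (snd n) (fst om) < e) \<and>
   distr R (P >< count_space UNIV) (%(n, om). (n, ())) = P >< distr Q (count_space UNIV) (%_. ())"
 proof (rule approximate_gluing[OF Pp(1) Qp(1) e])
  show "distr P borel snd = distr Q borel fst" using Pp Qp by simp
  interpret U: prob_space "distr Q (count_space UNIV) (%_. ())" by (rule QQ.prob_space_distr) simp
  interpret F: prob_space "distr Q borel fst" by (rule QQ.prob_space_distr) simp
  have "distr Q borel fst >< distr Q (count_space UNIV) (%_. ())
    = distr Q (borel >< count_space UNIV) (%om. (fst om, ()))"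
  proof (rule pair_measure_eqI)
   fix A and B :: "unit set" assume AB: "A : sets (distr Q borel fst)" "B : sets (distr Q (count_space UNIV) (%_. ()))"
   have "B = {} \<or> B = UNIV" by auto
   thus "emeasure (distr Q borel fst) A * emeasure (distr Q (count_space UNIV) (%_. ())) B
    = emeasure (distr Q (borel >< count_space UNIV) (%om. (fst om, ()))) (A \<times> B)"
    using AB QQ.emeasure_space_1 by (auto simp: emeasure_distr intro!: arg_cong2[where f=emeasure])
  next
   show "sigma_finite_measure (distr Q borel fst)" ..
   show "sigma_finite_measure (distr Q (count_space UNIV) (%_. ()))" ..
   show "sets (distr Q borel fst >< distr Q (count_space UNIV) (%_. ()))
    = sets (distr Q (borel >< count_space UNIV) (%om. (fst om, ())))"
    unfolding sets_distr by (rule sets_pair_measure_cong) auto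
  qed
  thus "distr Q (borel >< count_space UNIV) (%om. (fst om, ()))
   = distr Q borel fst >< distr Q (count_space UNIV) (%_. ())" ..
 qed auto
 then obtain R where R: "prob_space R" and [measurable_cong]: "sets R = sets (P >< Q)"
  and R1: "distr R P fst = P" and R2: "distr R Q snd = Q"
  and Rd: "AE (n, om) in R. dist (snd n) (fst om) < e" by blast
 interpret R: prob_space R by fact
 let ?s = "(a + e) + e + (b + e)"
 have spos: "a + e > 0" "b + e > 0" using ab e by auto
 have "wasserstein2 mu rr <= ennreal ?s"
 proof (rule wasserstein2_le[OF _ s(1,3)])
  show "?s >= 0" using ab e by simp
  fix de :: real assume "de > 0"
  have i1: "NN R (%w. (norm (fst (fst w) - snd (fst w)))^2) <= ennreal ((a + e)^2)"
  proof -
   have "NN R (%w. (norm (fst (fst w) - snd (fst w)))^2)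
    = NN (distr R P fst) (%w. (norm (fst w - snd w))^2)"
    by (subst nn_integral_distr) auto
   thus ?thesis using P(2) unfolding R1 by (simp add: case_prod_unfold)
  qed
  have i2: "NN R (%w. (norm (fst (snd w) - snd (snd w)))^2) <= ennreal ((b + e)^2)"
  proof -
   have "NN R (%w. (norm (fst (snd w) - snd (snd w)))^2)
    = NN (distr R Q snd) (%w. (norm (fst w - snd w))^2)"
    by (subst nn_integral_distr) auto
   thus ?thesis using Q(2) unfolding R2 by (simp add: case_prod_unfold)
  qed
  have lin: "ennreal (\<alpha> * u + (bt + ga * v)) = ennreal \<alpha> * ennreal u + (ennreal bt + ennreal ga * ennreal v)"
    if "\<alpha> >= 0" "bt >= 0" "ga >= 0" "u >= 0" "v >= 0" for \<alpha> bt ga u v :: real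
    using that by (simp add: ennreal_mult')
  have "NN R (%w. (norm (fst (fst w) - snd (snd w)))^2)
   <= (NI R (%w. ennreal (?s / (a + e)) * ennreal ((norm (fst (fst w) - snd (fst w)))^2)
      + (ennreal (?s * e) + ennreal (?s / (b + e)) * ennreal ((norm (fst (snd w) - snd (snd w)))^2))))"
  proof (rule nn_integral_mono_AE, use Rd in eventually_elim)
   case (elim w)
   obtain x y y' z where w: "w = ((x, y), (y', z))" by (metis prod.collapse)
   have d: "norm (y - y') < e" using elim by (simp add: w dist_norm)
   have "norm (x - z) <= norm (x - y) + norm (y - y') + norm (y' - z)"
    using norm_triangle_ineq[of "(x - y) + (y - y')" "y' - z"] norm_triangle_ineq[of "x - y" "y - y'"] by simp
   hence "(norm (x - z))^2 <= (norm (x - y) + norm (y - y') + norm (y' - z))^2" by (rule power_mono) simp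
   also have "... <= ?s * ((norm (x - y))^2 / (a + e) + (norm (y - y'))^2 / e + (norm (y' - z))^2 / (b + e))"
    by (rule sum3_square_le) (use spos e in auto)
   also have "(norm (y - y'))^2 / e <= e"
   proof -
    have "norm (y - y') * norm (y - y') <= e * e" using d e by (intro mult_mono) auto
    thus ?thesis using e by (simp add: power2_eq_square divide_le_eq)
   qed
   finally have "(norm (x - z))^2 <= ?s * ((norm (x - y))^2 / (a + e) + e + (norm (y' - z))^2 / (b + e))"
    using ab e by (simp add: mult_left_mono)
   also have "... = ?s / (a + e) * (norm (x - y))^2 + (?s * e + ?s / (b + e) * (norm (y' - z))^2)"
    by (simp add: distrib_left)
   finally have le: "ennreal ((norm (x - z))^2) <= ennreal ..." by (rule ennreal_leI)
   show ?case using le unfolding w fst_conv snd_conv by (subst (asm) lin) (use ab e in auto)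
  qed
  also have "... = ennreal (?s / (a + e)) * NN R (%w. (norm (fst (fst w) - snd (fst w)))^2)
    + (ennreal (?s * e) + ennreal (?s / (b + e)) * NN R (%w. (norm (fst (snd w) - snd (snd w)))^2))"
   by (simp add: nn_integral_add nn_integral_cmult R.emeasure_space_1)
  also have "... <= ennreal (?s / (a + e)) * ennreal ((a + e)^2) + (ennreal (?s * e) + ennreal (?s / (b + e)) * ennreal ((b + e)^2))"
   by (intro add_mono mult_left_mono i1 i2 order_refl) auto
  also have "... = ennreal (?s / (a + e) * (a + e)^2 + (?s * e + ?s / (b + e) * (b + e)^2))"
   by (subst lin) (use ab e in auto)
  also have "?s / (a + e) * (a + e)^2 + (?s * e + ?s / (b + e) * (b + e)^2) = ?s^2"
   using spos by (simp add: power2_eq_square distrib_left)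
  finally have le: "NN R (%w. (norm (fst (fst w) - snd (snd w)))^2) <= ennreal (?s^2 + de)"
   using \<open>de > 0\<close> by (meson ennreal_leI le_add_same_cancel1 less_imp_le order_trans)
  have "distr R borel (%w. fst (fst w)) = distr (distr R P fst) borel fst"
   by (subst distr_distr) (auto simp: comp_def)
  moreover have "distr R borel (%w. snd (snd w)) = distr (distr R Q snd) borel snd"
   by (subst distr_distr) (auto simp: comp_def)
  ultimately show "\<exists>R :: (('a \<times> 'a) \<times> ('a \<times> 'a)) measure. \<exists>X Y. prob_space R \<and> X : bmeas R \<and> Y : bmeas R \<and>
    distr R borel X = mu \<and> distr R borel Y = rr \<and>
    (NN R (%om. (norm (X om - Y om))^2)) <= ennreal (?s^2 + de)"
   using R le Pp Qp unfolding R1 R2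
   by (intro exI[of _ R] exI[of _ "%w. fst (fst w)"] exI[of _ "%w. snd (snd w)"]) auto
 qed
 also have "ennreal ?s = wasserstein2 mu nu + wasserstein2 nu rr + ennreal e0"
  using ab e e0 by (simp add: e_def flip: ennreal_plus)
 finally show "wasserstein2 mu rr <= wasserstein2 mu nu + wasserstein2 nu rr + ennreal e0" .
qed

section \<open>The primal-dual problem\<close>

locale pd_problem =
 fixes f :: "real ^ 'm => real" and g :: "real ^ 'd => real" and K :: "real ^ 'd => real ^ 'm"
  and wf wg wfs Lg :: real
 assumes linear_K: "linear K"
  and df: "GDERIV f y :> grad f y" and dg: "GDERIV g x :> grad g x"
  and wf: "wf > 0" and scf: "strongly_convex wf f"
  and wg: "wg > 0" and scg: "strongly_convex wg g"
  and wfs: "wfs > 0" and scfs: "strongly_convex wfs (convex_conjugate f)"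
  and Lg: "Lg > 0" and lipg: "Lg-lipschitz_on UNIV (grad g)"
begin

abbreviation "L \<equiv> onorm K"
abbreviation "gfs \<equiv> grad (convex_conjugate f)"
abbreviation "KT \<equiv> adjoint K"

definition "Ax z = grad g (fst z) + KT (snd z)"
definition "Ay z = gfs (snd z) - K (fst z)"

lemma A_PD_eq: "A_PD f g K lam z = (Ax z, lam *. Ay z)"
 by (simp add: A_PD_def Ax_def Ay_def case_prod_unfold)

lemma bl_K: "bounded_linear K" using linear_K linear_conv_bounded_linear by blast
lemma linear_KT: "linear KT" by (rule adjoint_linear[OF linear_K])
lemma bl_KT: "bounded_linear KT" using linear_KT linear_conv_bounded_linear by blast

lemma L_nonneg: "L >= 0" by (rule onorm_pos_le[OF bl_K])

lemma KT_inner: "KT y <.> x = y <.> K x" "x <.> KT y = K x <.> y"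
 using adjoint_works[OF linear_K] by (simp_all add: inner_commute)

lemma norm_K: "norm (K x) <= L * norm x" by (rule onorm[OF bl_K])

lemma norm_KT: "norm (KT y) <= L * norm y"
proof -
 have "norm (KT y) * norm (KT y) = y <.> K (KT y)"
  using KT_inner(1)[of y "KT y"] by (simp add: power2_norm_eq_inner[symmetric] power2_eq_square)
 also have "... <= norm y * norm (K (KT y))" by (rule norm_cauchy_schwarz)
 also have "... <= norm y * (L * norm (KT y))" by (intro mult_left_mono norm_K) auto
 finally have "norm (KT y) * norm (KT y) <= (L * norm y) * norm (KT y)" by (simp add: ac_simps)
 thus ?thesis using L_nonneg
  by (metis mult_le_cancel_right mult_nonneg_nonneg norm_ge_zero order_le_less)
qed

lemma lipfs: "norm (gfs y - gfs y') <= norm (y - y') / wf"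
 using lipschitz_onD[OF grad_convex_conjugate(4)[OF scf wf df], of y y'] by (simp add: dist_norm)

lemma lip_grad_g: "norm (grad g x - grad g x') <= Lg * norm (x - x')"
 using lipschitz_onD[OF lipg, of x x'] by (simp add: dist_norm)

lemma lip_grad_f: "norm (grad f y - grad f y') <= norm (y - y') / wfs"
 using lipschitz_onD[OF strongly_convex_conjugate_lipschitz_grad[OF scf wf df scfs wfs], of y y']
 by (simp add: dist_norm)

lemma gfs_grad_f [simp]: "gfs (grad f y) = y"
 by (rule grad_convex_conjugate(2)[OF scf wf df])

lemma mono_g: "(grad g x - grad g x') <.> (x - x') >= wg * (norm (x - x'))^2"
 by (rule strongly_convex_monotone_grad[OF scg dg dg])

lemma mono_fs: "(gfs y - gfs y') <.> (y - y') >= wfs * (norm (y - y'))^2"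
 by (rule strongly_convex_monotone_grad[OF scfs])
   (rule grad_convex_conjugate(3)[OF scf wf df])+

lemma continuous_grad_g: "continuous_on S (grad g)"
 using lipschitz_on_continuous_on[OF lipg] continuous_on_subset by blast

lemma continuous_gfs: "continuous_on S gfs"
 using lipschitz_on_continuous_on[OF grad_convex_conjugate(4)[OF scf wf df]] continuous_on_subset by blast

lemma continuous_K: "continuous_on S K" by (rule linear_continuous_on[OF bl_K])
lemma continuous_KT: "continuous_on S KT" by (rule linear_continuous_on[OF bl_KT])

lemma continuous_grad_f: "continuous_on S (grad f)"
 using lipschitz_on_continuous_on[OF strongly_convex_conjugate_lipschitz_grad[OF scf wf df scfs wfs]]
  continuous_on_subset by blast

lemma borel_grads [measurable]:
 "grad g : bmeas borel" "gfs : bmeas borel" "K : bmeas borel"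
 "KT : bmeas borel" "grad f : bmeas borel"
 by (intro borel_measurable_continuous_onI continuous_grad_g continuous_gfs continuous_K continuous_KT continuous_grad_f)+

lemma continuous_Ax: "continuous_on S Ax" and continuous_Ay: "continuous_on S Ay"
proof -
 show "continuous_on S Ax" unfolding Ax_def
  by (intro continuous_on_add continuous_on_compose2[OF continuous_grad_g[of UNIV]]
    continuous_on_compose2[OF continuous_KT[of UNIV]] continuous_intros) auto
 show "continuous_on S Ay" unfolding Ay_def
  by (intro continuous_on_diff continuous_on_compose2[OF continuous_gfs[of UNIV]]
    continuous_on_compose2[OF continuous_K[of UNIV]] continuous_intros) auto
qed

lemma borel_A [measurable]: "Ax : bmeas borel" "Ay : bmeas borel"
 by (intro borel_measurable_continuous_onI continuous_Ax continuous_Ay)+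

lemma lip_Ax: "norm (Ax z - Ax z') <= Lg * norm (fst z - fst z') + L * norm (snd z - snd z')"
proof -
 have "Ax z - Ax z' = (grad g (fst z) - grad g (fst z')) + KT (snd z - snd z')"
  by (simp add: Ax_def linear_diff[OF linear_KT])
 also have "norm ... <= norm (grad g (fst z) - grad g (fst z')) + norm (KT (snd z - snd z'))"
  by (rule norm_triangle_ineq)
 finally show ?thesis using lip_grad_g[of "fst z" "fst z'"] norm_KT[of "snd z - snd z'"] by simp
qed

lemma lip_Ay: "norm (Ay z - Ay z') <= norm (snd z - snd z') / wf + L * norm (fst z - fst z')"
proof -
 have "Ay z - Ay z' = (gfs (snd z) - gfs (snd z')) - K (fst z - fst z')"
  by (simp add: Ay_def linear_diff[OF linear_K])
 also have "norm ... <= norm (gfs (snd z) - gfs (snd z')) + norm (K (fst z - fst z'))"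
  by (rule norm_triangle_ineq4)
 finally show ?thesis using lipfs[of "snd z" "snd z'"] norm_K[of "fst z - fst z'"] by simp
qed

text \<open>The coupling terms cancel, so the drift is strongly monotone.\<close>

lemma mono_A:
 "(Ax z - Ax z') <.> (fst z - fst z') + (Ay z - Ay z') <.> (snd z - snd z')
   >= wg * (norm (fst z - fst z'))^2 + wfs * (norm (snd z - snd z'))^2"
proof -
 have "(Ax z - Ax z') <.> (fst z - fst z') + (Ay z - Ay z') <.> (snd z - snd z')
   = (grad g (fst z) - grad g (fst z')) <.> (fst z - fst z') + (gfs (snd z) - gfs (snd z')) <.> (snd z - snd z')
    + (KT (snd z - snd z') <.> (fst z - fst z') - K (fst z - fst z') <.> (snd z - snd z'))"
  by (simp add: Ax_def Ay_def linear_diff[OF linear_K] linear_diff[OF linear_KT] inner_diff_left inner_add_left)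
 moreover have "KT (snd z - snd z') <.> (fst z - fst z') = K (fst z - fst z') <.> (snd z - snd z')"
  unfolding KT_inner by (rule inner_commute)
 ultimately show ?thesis using mono_g[of "fst z" "fst z'"] mono_fs[of "snd z" "snd z'"] by simp
qed

text \<open>By strong monotonicity, square integrability of the drift controls second moments.\<close>

lemma norm_le_A:
 "wg * (norm (fst z))^2 + wfs * (norm (snd z))^2
   <= 2 * ((norm (Ax z))^2 + (norm (Ax 0))^2) / wg + 2 * ((norm (Ay z))^2 + (norm (Ay 0))^2) / wfs"
proof -
 have y: "a <.> b <= om / 2 * (norm b)^2 + (norm a)^2 / (2 * om)" if "om > 0" for a b :: "'z::real_inner" and om :: real
 proof -
  have "0 <= (om * norm b - norm a)^2" by simp
  hence "2 * om * (norm a * norm b) <= om^2 * (norm b)^2 + (norm a)^2"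
   by (simp add: power2_eq_square algebra_simps)
  hence "norm a * norm b <= om / 2 * (norm b)^2 + (norm a)^2 / (2 * om)"
   using that by (simp add: field_simps power2_eq_square)
  with norm_cauchy_schwarz[of a b] show ?thesis by linarith
 qed
 have sq: "(norm (a - b))^2 <= 2 * ((norm a)^2 + (norm b)^2)" for a b :: "'z::real_inner"
 proof -
  have "(norm (a - b))^2 + (norm (a + b))^2 = 2 * ((norm a)^2 + (norm b)^2)"
   by (simp add: power2_norm_eq_inner inner_diff_left inner_diff_right inner_add_left inner_add_right)
  thus ?thesis by (smt (verit) zero_le_power2)
 qed
 have "wg * (norm (fst z))^2 + wfs * (norm (snd z))^2
   <= (Ax z - Ax 0) <.> fst z + (Ay z - Ay 0) <.> snd z"
  using mono_A[of z 0] by simp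
 moreover have "(Ax z - Ax 0) <.> fst z <= wg / 2 * (norm (fst z))^2 + (norm (Ax z - Ax 0))^2 / (2 * wg)"
  by (rule y[OF wg])
 moreover have "(Ay z - Ay 0) <.> snd z <= wfs / 2 * (norm (snd z))^2 + (norm (Ay z - Ay 0))^2 / (2 * wfs)"
  by (rule y[OF wfs])
 ultimately have "wg * (norm (fst z))^2 + wfs * (norm (snd z))^2
   <= (norm (Ax z - Ax 0))^2 / wg + (norm (Ay z - Ay 0))^2 / wfs" by (simp add: field_simps)
 also have "... <= 2 * ((norm (Ax z))^2 + (norm (Ax 0))^2) / wg + 2 * ((norm (Ay z))^2 + (norm (Ay 0))^2) / wfs"
  using wg wfs by (intro add_mono divide_right_mono sq) auto
 finally show ?thesis .
qed

end

section \<open>Mean square bounds for path integrals\<close>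

lemma riemann_sum_tendsto_integral:
 fixes ph :: "real => 'e::euclidean_space" and a b :: real
 assumes ab: "a <= b" and cont: "continuous_on {a..b} ph"
 shows "(%n. ((b - a) / Suc n) *. (\<Sum>i<Suc n. ph (a + (b - a) * real i / Suc n))) \<longlonglongrightarrow> integral {a..b} ph"
proof (rule LIMSEQ_I)
 fix e0 :: real assume e0: "0 < e0"
 define e where "e = e0 / (b - a + 1)"
 have e: "e > 0" using e0 ab by (simp add: e_def)
 have "uniformly_continuous_on {a..b} ph" using cont by (intro compact_uniformly_continuous) auto
 then obtain de where de: "de > 0" "\<And>s t. s : {a..b} ==> t : {a..b} ==> dist t s < de ==> dist (ph t) (ph s) < e"
  using e unfolding uniformly_continuous_on_def by metis
 obtain n0 where n0: "(b - a) / de < real n0" using reals_Archimedean2 by blast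
 show "\<exists>no. \<forall>n\<ge>no. norm (((b - a) / Suc n) *. (\<Sum>i<Suc n. ph (a + (b - a) * real i / Suc n)) - integral {a..b} ph) < e0"
 proof (intro exI allI impI)
  fix n assume n: "n0 <= n"
  define m where "m = Suc n"
  define h where "h = (b - a) / m"
  have m: "m > 0" by (simp add: m_def)
  have h: "h >= 0" "h < de"
  proof -
   show "h >= 0" using ab by (simp add: h_def)
   have "(b - a) / de < m" using n0 n by (simp add: m_def)
   thus "h < de" using de(1) m by (simp add: h_def field_simps)
  qed
  define t where "t i = a + h * real i" for i
  have tm: "t m = b" using m by (simp add: t_def h_def)
  have t0: "t 0 = a" by (simp add: t_def)
  have trange: "t i : {a..b}" if "i <= m" for i
  proof -
   have "h * real i <= h * real m" using h that by (intro mult_left_mono) auto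
   also have "... = b - a" using m by (simp add: h_def)
   finally show ?thesis using h by (simp add: t_def)
  qed
  define \<Phi> where "\<Phi> s = integral {a..s} ph" for s
  have int: "ph integrable_on {s..u}" if "a <= s" "u <= b" for s u
   by (rule integrable_continuous_real) (use cont that in "auto intro: continuous_on_subset")
  have step: "norm (h *. ph (t i) - (\<Phi> (t (Suc i)) - \<Phi> (t i))) <= h * e" if "i < m" for i
  proof -
   have tt: "t i : {a..b}" "t (Suc i) : {a..b}" using trange that by auto
   have ts: "t (Suc i) = t i + h" by (simp add: t_def algebra_simps)
   have "\<Phi> (t i) + integral {t i..t (Suc i)} ph = \<Phi> (t (Suc i))"
    unfolding \<Phi>_def using tt h int[of a "t (Suc i)"]
    by (intro Henstock_Kurzweil_Integration.integral_combine) (auto simp: ts)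
   hence "\<Phi> (t (Suc i)) - \<Phi> (t i) = integral {t i..t (Suc i)} ph" by (simp add: algebra_simps)
   moreover have "integral {t i..t (Suc i)} (%_. ph (t i)) = h *. ph (t i)"
    using h by (simp add: ts)
   ultimately have "h *. ph (t i) - (\<Phi> (t (Suc i)) - \<Phi> (t i)) = integral {t i..t (Suc i)} (%s. ph (t i) - ph s)"
    using int[of "t i" "t (Suc i)"] tt by (subst Henstock_Kurzweil_Integration.integral_diff) auto
   also have "norm ... <= e * (t (Suc i) - t i)"
   proof (rule integral_bound)
    show "t i <= t (Suc i)" using h by (simp add: ts)
    show "continuous_on {t i..t (Suc i)} (%s. ph (t i) - ph s)"
     using cont tt by (intro continuous_intros) (auto intro: continuous_on_subset)
    fix s assume s: "s : {t i..t (Suc i)}"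
    have "dist (ph (t i)) (ph s) < e"
     using s tt h by (intro de(2)) (auto simp: ts dist_real_def)
    thus "norm (ph (t i) - ph s) <= e" by (simp add: dist_norm)
   qed
   finally show ?thesis by (simp add: ts mult.commute)
  qed
  have "(\<Sum>i<m. \<Phi> (t (Suc i)) - \<Phi> (t i)) = \<Phi> (t m) - \<Phi> (t 0)" by (rule sum_lessThan_telescope)
  also have "... = integral {a..b} ph" by (simp add: tm t0 \<Phi>_def)
  finally have "h *. (\<Sum>i<m. ph (t i)) - integral {a..b} ph = (\<Sum>i<m. h *. ph (t i) - (\<Phi> (t (Suc i)) - \<Phi> (t i)))"
   by (simp add: sum_subtractf scaleR_sum_right)
  also have "norm ... <= (\<Sum>i<m. h * e)" by (rule sum_norm_le) (use step in auto)
  also have "... = (b - a) * e" using m by (simp add: h_def)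
  also have "... < e0" using e0 ab by (simp add: e_def field_simps)
  finally have "norm (h *. (\<Sum>i<m. ph (t i)) - integral {a..b} ph) < e0" .
  thus "norm (((b - a) / Suc n) *. (\<Sum>i<Suc n. ph (a + (b - a) * real i / Suc n)) - integral {a..b} ph) < e0"
   unfolding h_def t_def m_def by simp
 qed
qed

lemma norm_sum_square_le:
 fixes v :: "nat => 'e::real_normed_vector"
 shows "(norm (\<Sum>i<n. v i))^2 <= real n * (\<Sum>i<n. (norm (v i))^2)"
proof -
 have "(norm (\<Sum>i<n. v i))^2 <= (\<Sum>i<n. norm (v i))^2"
  by (intro power_mono norm_sum) simp
 also have "... <= (\<Sum>i<n. (norm (v i))^2) * card {..<n}"
  by (rule sum_squared_le_sum_of_squares)
 finally show ?thesis by (simp add: mult.commute)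
qed

text \<open>A pathwise integral is a limit of Riemann sums, so Fatou's lemma transfers the bound from the
 integrand. Only measurability at each fixed time enters.\<close>

lemma nn_integral_path_integral_square_le:
 fixes ph :: "real => 'w => 'e::euclidean_space" and a b B :: real
 assumes ab: "a <= b" and [measurable]: "\<And>s. s : {a..b} ==> ph s : bmeas M"
  and cont: "AE om in M. continuous_on {a..b} (%s. ph s om)"
  and B: "\<And>s. s : {a..b} ==> (NN M (%om. (norm (ph s om))^2)) <= ennreal B"
 shows "NN M (%om. (norm (integral {a..b} (%s. ph s om)))^2) <= ennreal ((b - a)^2 * B)"
proof -
 define S where "S n om = ((b - a) / Suc n) *. (\<Sum>i<Suc n. ph (a + (b - a) * real i / Suc n) om)" for n om
 have inab: "a + (b - a) * real i / Suc n : {a..b}" if "i < Suc n" for i n :: nat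
 proof -
  have "(b - a) * real i / Suc n <= (b - a) * Suc n / Suc n"
   using ab that by (intro divide_right_mono mult_left_mono) auto
  thus ?thesis using ab by simp
 qed
 have [measurable]: "S n : bmeas M" for n
  unfolding S_def by (intro borel_measurable_scaleR borel_measurable_const borel_measurable_sum assms(2) inab) auto
 have "NN M (%om. (norm (integral {a..b} (%s. ph s om)))^2)
   <= (NI M (%om. liminf (%n. ennreal ((norm (S n om))^2))))"
 proof (rule nn_integral_mono_AE, use cont in eventually_elim)
  case (elim om)
  have "(%n. S n om) \<longlonglongrightarrow> integral {a..b} (%s. ph s om)"
   unfolding S_def by (rule riemann_sum_tendsto_integral[OF ab elim])
  hence "(%n. ennreal ((norm (S n om))^2)) \<longlonglongrightarrow> ennreal ((norm (integral {a..b} (%s. ph s om)))^2)"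
   by (intro tendsto_ennrealI tendsto_intros)
  from lim_imp_Liminf[OF _ this] show ?case by simp
 qed
 also have "... <= liminf (%n. \<integral>\<^sup>+ om. ennreal ((norm (S n om))^2) \<partial>M)"
  by (rule nn_integral_liminf) simp
 also have "... <= ennreal ((b - a)^2 * B)"
 proof -
  have "NN M (%om. (norm (S n om))^2) <= ennreal ((b - a)^2 * B)" for n
  proof -
   let ?c = "(b - a)^2 / Suc n"
   have "(norm (S n om))^2 <= ?c * (\<Sum>i<Suc n. (norm (ph (a + (b - a) * real i / Suc n) om))^2)" for om
   proof -
    have "(norm (S n om))^2 = ((b - a) / Suc n)^2 * (norm (\<Sum>i<Suc n. ph (a + (b - a) * real i / Suc n) om))^2"
     unfolding S_def norm_scaleR power_mult_distrib power2_abs real_norm_def by simp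
    also have "... <= ((b - a) / Suc n)^2 * (real (Suc n) * (\<Sum>i<Suc n. (norm (ph (a + (b - a) * real i / Suc n) om))^2))"
     by (intro mult_left_mono norm_sum_square_le) simp
    also have "... = ?c * (\<Sum>i<Suc n. (norm (ph (a + (b - a) * real i / Suc n) om))^2)"
     by (simp add: power2_eq_square field_simps del: sum.lessThan_Suc of_nat_Suc)
    finally show ?thesis .
   qed
   hence "NN M (%om. (norm (S n om))^2)
    <= (NI M (%om. ennreal ?c * (\<Sum>i<Suc n. ennreal ((norm (ph (a + (b - a) * real i / Suc n) om))^2))))"
    by (intro nn_integral_mono) (simp add: ennreal_leI sum_nonneg flip: ennreal_mult' del: sum.lessThan_Suc)
   also have "... = ennreal ?c * (\<Sum>i<Suc n. \<integral>\<^sup>+ om. ennreal ((norm (ph (a + (b - a) * real i / Suc n) om))^2) \<partial>M)"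
   proof -
    have bm: "(%om. ennreal ((norm (ph (a + (b - a) * real i / Suc n) om))^2)) : bmeas M"
     if "i : {..<Suc n}" for i
    proof -
     have [measurable]: "ph (a + (b - a) * real i / Suc n) : bmeas M"
      by (intro assms(2) inab) (use that in simp)
     show ?thesis by measurable
    qed
    show ?thesis
     using nn_integral_cmult[OF borel_measurable_sum[where S="{..<Suc n}", OF bm], where c="ennreal ?c"]
      nn_integral_sum[where P="{..<Suc n}", OF bm] by (simp del: sum.lessThan_Suc of_nat_Suc)
   qed
   also have "... <= ennreal ?c * (\<Sum>i<Suc n. ennreal B)"
    by (intro mult_left_mono sum_mono B inab) auto
   also have "... = ennreal ?c * (ennreal (real (Suc n)) * ennreal B)"
    by (simp add: ennreal_of_nat_eq_real_of_nat[symmetric] del: sum.lessThan_Suc of_nat_Suc)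
   also have "... = ennreal ((b - a)^2 * B)"
    by (simp add: ennreal_mult'[symmetric] mult.assoc[symmetric] del: of_nat_Suc)
   finally show ?thesis .
  qed
  thus ?thesis by (intro Liminf_le always_eventually) auto
 qed
 finally show ?thesis .
qed

section \<open>The stationary diffusion\<close>

locale pd_stationary_process = pd_problem +
 fixes lam D4 :: real and M :: "'w measure" and W X :: "real => 'w => real ^ 'b" and Y :: "real => 'w => real ^ 'a"
  and pp :: "((real ^ 'b) \<times> (real ^ 'a)) measure"
 assumes lam: "lam > 0" and D4: "D4 >= 0"
  and diffusion: "pd_diffusion f g K lam M W X Y"
  and law: "t >= 0 ==> distr M borel (%om. (X t om, Y t om)) = pp"
  and drift_moment: "NN pp (%z. (norm (A_PD f g K lam z))^2) <= ennreal D4"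
begin

abbreviation "Z t om \<equiv> (X t om, Y t om)"

lemma prob_space_M: "prob_space M"
 using diffusion by (simp add: pd_diffusion_def brownian_motion_def)

sublocale prob_space M by (rule prob_space_M)

lemma measurable_path [measurable]:
 "t >= 0 ==> X t : bmeas M" "t >= 0 ==> Y t : bmeas M"
 "t >= 0 ==> W t : bmeas M"
 using diffusion by (simp_all add: pd_diffusion_def brownian_motion_def)

lemma measurable_Z [measurable]: "t >= 0 ==> Z t : bmeas M"
 by simp

lemma sets_pp [simp, measurable_cong]: "sets pp = sets borel"
 using law[of 0, symmetric] by simp

lemma prob_distribution_pp: "prob_distribution pp"
 unfolding prob_distribution_def using law[of 0, symmetric] by (auto intro!: prob_space_distr)

lemma nn_integral_law:
 assumes "t >= 0" and [measurable]: "h : bmeas borel"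
 shows "(NI M (%om. h (Z t om))) = (NI pp (%z. h z))"
 unfolding law[OF assms(1), symmetric] using assms(1) by (subst nn_integral_distr) auto

lemma drift_moments:
 "NN pp (%z. (norm (Ax z))^2) <= ennreal D4"
 "NN pp (%z. (norm (lam *. Ay z))^2) <= ennreal D4"
 by (rule order_trans[OF nn_integral_mono drift_moment],
   simp add: A_PD_eq norm_Pair ennreal_leI)+

lemma finite_second_moment_pp: "finite_second_moment pp"
proof -
 define c where "c = min wg wfs"
 have c: "c > 0" using wg wfs by (simp add: c_def)
 interpret P: prob_space pp using prob_distribution_pp by (simp add: prob_distribution_def)
 define b1 b2 b3 where "b1 = 2 / wg / c" and "b2 = 2 / wfs / c / lam^2"
  and "b3 = (2 * (norm (Ax 0))^2 / wg + 2 * (norm (Ay 0))^2 / wfs) / c"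
 have b: "b1 >= 0" "b2 >= 0" "b3 >= 0" using c wg wfs lam by (auto simp: b1_def b2_def b3_def)
 have le: "(norm z)^2 <= b1 * (norm (Ax z))^2 + (b2 * (norm (lam *. Ay z))^2 + b3)" for z
 proof -
  have "c * (norm z)^2 = c * (norm (fst z))^2 + c * (norm (snd z))^2"
   by (cases z) (simp add: norm_Pair distrib_left)
  also have "... <= wg * (norm (fst z))^2 + wfs * (norm (snd z))^2"
   by (intro add_mono mult_right_mono) (auto simp: c_def)
  also have "... <= 2 * ((norm (Ax z))^2 + (norm (Ax 0))^2) / wg + 2 * ((norm (Ay z))^2 + (norm (Ay 0))^2) / wfs"
   by (rule norm_le_A)
  also have "... = c * (b1 * (norm (Ax z))^2 + (b2 * (norm (lam *. Ay z))^2 + b3))"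
   using c lam wg wfs by (simp add: b1_def b2_def b3_def field_simps power_mult_distrib)
  finally show ?thesis using c by simp
 qed
 have "NN pp (%z. (norm z)^2)
   <= (NI pp (%z. ennreal b1 * ennreal ((norm (Ax z))^2) + (ennreal b2 * ennreal ((norm (lam *. Ay z))^2) + ennreal b3)))"
 proof (rule nn_integral_mono)
  fix z
  have "ennreal ((norm z)^2) <= ennreal (b1 * (norm (Ax z))^2 + (b2 * (norm (lam *. Ay z))^2 + b3))"
   by (rule ennreal_leI[OF le])
  also have "... = ennreal b1 * ennreal ((norm (Ax z))^2) + (ennreal b2 * ennreal ((norm (lam *. Ay z))^2) + ennreal b3)"
   using b by (simp only: ennreal_plus ennreal_mult' mult_nonneg_nonneg zero_le_power2 add_nonneg_nonneg)
  finally show "ennreal ((norm z)^2) <= ..." .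
 qed
 also have "... = ennreal b1 * NN pp (%z. (norm (Ax z))^2)
   + (ennreal b2 * NN pp (%z. (norm (lam *. Ay z))^2) + ennreal b3)"
  using P.emeasure_space_1 by (simp add: nn_integral_add nn_integral_cmult del: norm_scaleR)
 also have "... <= ennreal b1 * ennreal D4 + (ennreal b2 * ennreal D4 + ennreal b3)"
  by (intro add_mono mult_left_mono drift_moments order_refl) auto
 also have "... < \<infinity>" by (simp add: ennreal_mult_less_top)
 finally show ?thesis by (simp add: finite_second_moment_def)
qed

lemma path_equation:
 "AE om in M. continuous_on {0..} (%t. X t om) \<and> continuous_on {0..} (%t. Y t om) \<and>
   (\<forall>s t. 0 <= s \<and> s <= t -->
    X t om = X s om - integral {s..t} (%r. Ax (Z r om)) + sqrt 2 *. (W t om - W s om) \<and>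
    Y t om = Y s om - integral {s..t} (%r. lam *. Ay (Z r om)))"
proof -
 have "AE om in M. continuous_on {0..} (%t. X t om) \<and> continuous_on {0..} (%t. Y t om) \<and>
    (\<forall>t\<ge>0.
      X t om = X 0 om - integral {0..t} (%s. fst (A_PD f g K lam (X s om, Y s om)))
           + sqrt 2 *. W t om \<and>
      Y t om = Y 0 om - integral {0..t} (%s. snd (A_PD f g K lam (X s om, Y s om))))"
  using diffusion by (simp add: pd_diffusion_def)
 thus ?thesis
 proof eventually_elim
  case (elim om)
  hence c: "continuous_on {0..} (%t. X t om)" "continuous_on {0..} (%t. Y t om)" by auto
  have cA: "continuous_on {0..} (%r. Ax (Z r om))" "continuous_on {0..} (%r. lam *. Ay (Z r om))"
   by (intro continuous_on_scaleR continuous_on_const continuous_on_compose2[OF continuous_Ax[of UNIV]]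
     continuous_on_compose2[OF continuous_Ay[of UNIV]] continuous_on_Pair c; simp)+
  have int: "(%r. Ax (Z r om)) integrable_on {0..t}" "(%r. lam *. Ay (Z r om)) integrable_on {0..t}" for t
   by (rule integrable_continuous_real, rule continuous_on_subset[OF cA(1)], auto)
     (rule integrable_continuous_real, rule continuous_on_subset[OF cA(2)], auto)
  have eq: "X t om = X 0 om - integral {0..t} (%s. Ax (Z s om)) + sqrt 2 *. W t om"
   "Y t om = Y 0 om - integral {0..t} (%s. lam *. Ay (Z s om))" if "t >= 0" for t
   using elim[unfolded A_PD_eq fst_conv snd_conv] that by blast+
  have comb: "integral {0..t} (%s. Ax (Z s om)) = integral {0..s} (%s. Ax (Z s om)) + integral {s..t} (%s. Ax (Z s om))"
   "integral {0..t} (%s. lam *. Ay (Z s om)) = integral {0..s} (%s. lam *. Ay (Z s om)) + integral {s..t} (%s. lam *. Ay (Z s om))"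
   if "0 <= s" "s <= t" for s t
   by (rule Henstock_Kurzweil_Integration.integral_combine[OF that int(1), symmetric])
     (rule Henstock_Kurzweil_Integration.integral_combine[OF that int(2), symmetric])
  show ?case
  proof (intro conjI c allI impI; elim conjE)
   fix s t :: real assume st: "0 <= s" "s <= t"
   show "X t om = X s om - integral {s..t} (%r. Ax (Z r om)) + sqrt 2 *. (W t om - W s om)"
   proof -
    have "xt = xs - b + c *. (wt - ws)" if "xt = x0 - (a + b) + c *. wt" "xs = x0 - a + c *. ws"
     for xt xs x0 a b wt ws :: "real ^ 'b" and c :: real
     unfolding that by (simp add: algebra_simps)
    from this[OF eq(1)[of t, unfolded comb(1)[OF st]] eq(1)[of s]] show ?thesis using st by simp
   qed
   show "Y t om = Y s om - integral {s..t} (%r. lam *. Ay (Z r om))"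
   proof -
    have "yt = ys - b" if "yt = y0 - (a + b)" "ys = y0 - a" for yt ys y0 a b :: "real ^ 'a"
     unfolding that by (simp add: algebra_simps)
    from this[OF eq(2)[of t, unfolded comb(2)[OF st]] eq(2)[of s]] show ?thesis using st by simp
   qed
  qed
 qed
qed

lemma continuous_drift_path:
 assumes "continuous_on {0..} (%t. X t om)" "continuous_on {0..} (%t. Y t om)" "0 <= s"
 shows "continuous_on {s..t} (%r. Ax (Z r om))" "continuous_on {s..t} (%r. Ay (Z r om))"
proof -
 have c: "continuous_on {s..t} (%t. X t om)" "continuous_on {s..t} (%t. Y t om)"
  using assms by (auto intro: continuous_on_subset)
 show "continuous_on {s..t} (%r. Ax (Z r om))" "continuous_on {s..t} (%r. Ay (Z r om))"
  by (intro continuous_on_compose2[OF continuous_Ax[of UNIV]]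
     continuous_on_compose2[OF continuous_Ay[of UNIV]] continuous_on_Pair c; simp)+
qed

lemma drift_increment:
 assumes st: "0 <= s" "s <= t"
 shows "NN M (%om. (norm (X t om - X s om - sqrt 2 *. (W t om - W s om)))^2) <= ennreal ((t - s)^2 * D4)"
  and "NN M (%om. (norm (Y t om - Y s om))^2) <= ennreal ((t - s)^2 * D4)"
proof -
 have "NN M (%om. (norm (X t om - X s om - sqrt 2 *. (W t om - W s om)))^2)
   = NN M (%om. (norm (integral {s..t} (%r. Ax (Z r om))))^2)"
  by (rule nn_integral_cong_AE, use path_equation in eventually_elim)
    (use st in "auto simp: norm_minus_commute")
 also have "... <= ennreal ((t - s)^2 * D4)"
 proof (rule nn_integral_path_integral_square_le[OF st(2)])
  show "AE om in M. continuous_on {s..t} (%r. Ax (Z r om))"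
   using path_equation by eventually_elim (use st in "auto intro: continuous_drift_path")
  fix r assume r: "r : {s..t}"
  hence r0: "r >= 0" using st by auto
  have [measurable]: "Z r : bmeas M" using r0 by simp
  show "(%om. Ax (Z r om)) : bmeas M" by (rule measurable_compose[OF _ borel_A(1)]) measurable
  show "NN M (%om. (norm (Ax (Z r om)))^2) <= ennreal D4"
   using drift_moments(1) nn_integral_law[OF r0, of "%z. ennreal ((norm (Ax z))^2)"] by simp
 qed
 finally show "NN M (%om. (norm (X t om - X s om - sqrt 2 *. (W t om - W s om)))^2) <= ennreal ((t - s)^2 * D4)" .
 have "NN M (%om. (norm (Y t om - Y s om))^2)
   = NN M (%om. (norm (integral {s..t} (%r. lam *. Ay (Z r om))))^2)"
  by (rule nn_integral_cong_AE, use path_equation in eventually_elim)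
    (use st in "auto simp: norm_minus_commute")
 also have "... <= ennreal ((t - s)^2 * D4)"
 proof (rule nn_integral_path_integral_square_le[OF st(2)])
  show "AE om in M. continuous_on {s..t} (%r. lam *. Ay (Z r om))"
   using path_equation by eventually_elim
    (use st in "auto intro!: continuous_on_scaleR continuous_on_const continuous_drift_path")
  fix r assume r: "r : {s..t}"
  hence r0: "r >= 0" using st by auto
  have [measurable]: "Z r : bmeas M" using r0 by simp
  show "(%om. lam *. Ay (Z r om)) : bmeas M"
   by (intro borel_measurable_scaleR borel_measurable_const measurable_compose[OF _ borel_A(2)]) measurable
  show "NN M (%om. (norm (lam *. Ay (Z r om)))^2) <= ennreal D4"
   using drift_moments(2) nn_integral_law[OF r0, of "%z. ennreal ((norm (lam *. Ay z))^2)"]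
   by (simp del: norm_scaleR)
 qed
 finally show "NN M (%om. (norm (Y t om - Y s om))^2) <= ennreal ((t - s)^2 * D4)" .
qed

lemma W_increment_law: "0 <= s ==> s < t ==> distr M borel (%om. W t om - W s om) = gaussian (t - s)"
 using diffusion by (simp add: pd_diffusion_def brownian_motion_def)

lemma W_increment_moment:
 assumes "0 <= s" "s <= t"
 shows "NN M (%om. (norm (W t om - W s om))^2) = ennreal ((t - s) * CARD('b))"
proof (cases "s = t")
 case False
 hence st: "s < t" using assms by simp
 have [measurable]: "W t : bmeas M" "W s : bmeas M" using assms by auto
 have "NN M (%om. (norm (W t om - W s om))^2)
   = NN (gaussian (t - s)) (%w. (norm (w :: real ^ 'b))^2)"
  unfolding W_increment_law[OF assms(1) st, symmetric] by (subst nn_integral_distr) auto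
 also have "... = ennreal (LINT w|gaussian (t - s). (norm (w :: real ^ 'b))^2)"
  using st by (intro nn_integral_eq_integral gaussian_abs_moment) auto
 finally show ?thesis using st by (simp add: gaussian_norm2)
qed (use assms in simp)

lemma indep_initial_functional:
 assumes H[measurable]: "H : (\<Pi>\<^sub>M t\<in>{0..}. borel) \<rightarrow>\<^sub>M S"
 shows "distr M (borel >< S) (%om. (Z 0 om, H (\<lambda>t\<in>{0..}. W t om)))
   = distr M borel (Z 0) >< distr M S (%om. H (\<lambda>t\<in>{0..}. W t om))"
proof -
 let ?P = "%om. \<lambda>t\<in>{0..}. W t om"
 have P[measurable]: "?P : M \<rightarrow>\<^sub>M (\<Pi>\<^sub>M t\<in>{0..}. borel)" by (rule measurable_restrict) simp
 interpret Z: prob_space "distr M borel (Z 0)" by (rule prob_space_distr) simp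
 interpret S: prob_space "distr M S (%om. H (?P om))" by (rule prob_space_distr) simp
 have "distr M borel (Z 0) >< distr M S (%om. H (?P om)) = distr M (borel >< S) (%om. (Z 0 om, H (?P om)))"
 proof (rule pair_measure_eqI)
  show "sigma_finite_measure (distr M borel (Z 0))" "sigma_finite_measure (distr M S (%om. H (?P om)))" ..
  show "sets (distr M borel (Z 0) >< distr M S (%om. H (?P om)))
    = sets (distr M (borel >< S) (%om. (Z 0 om, H (?P om))))"
   unfolding sets_distr by (rule sets_pair_measure_cong) auto
  fix A B assume "A : sets (distr M borel (Z 0))" "B : sets (distr M S (%om. H (?P om)))"
  hence [measurable]: "A : sets borel" "B : sets S" by auto
  have B': "H -` B \<inter> space (\<Pi>\<^sub>M t\<in>{0..}. borel) : sets (\<Pi>\<^sub>M t\<in>{0..}. borel)" by measurable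
  have eq: "(%om. H (?P om)) -` B \<inter> space M = ?P -` (H -` B \<inter> space (\<Pi>\<^sub>M t\<in>{0..}. borel)) \<inter> space M"
   using measurable_space[OF P] by auto
  have "(%om. H (?P om)) -` B \<inter> space M : sets (vimage_algebra (space M) ?P (\<Pi>\<^sub>M t\<in>{0..}. borel))"
   unfolding sets_vimage_algebra by (rule sigma_sets.Basic, rule CollectI, rule exI, rule conjI[OF eq B'])
  moreover have "Z 0 -` A \<inter> space M : sets (vimage_algebra (space M) (Z 0) borel)"
   unfolding sets_vimage_algebra by (auto intro!: sigma_sets.Basic)
  moreover have "indep_set (sets (vimage_algebra (space M) (Z 0) borel))
    (sets (vimage_algebra (space M) ?P (\<Pi>\<^sub>M t\<in>{0..}. borel)))"
   using diffusion by (simp add: pd_diffusion_def)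
  ultimately have "prob ((Z 0 -` A \<inter> space M) \<inter> ((%om. H (?P om)) -` B \<inter> space M))
    = prob (Z 0 -` A \<inter> space M) * prob ((%om. H (?P om)) -` B \<inter> space M)"
   by (intro indep_setD)
  moreover have "(%om. (Z 0 om, H (?P om))) -` (A \<times> B) \<inter> space M
    = (Z 0 -` A \<inter> space M) \<inter> ((%om. H (?P om)) -` B \<inter> space M)" by auto
  ultimately show "emeasure (distr M borel (Z 0)) A * emeasure (distr M S (%om. H (?P om))) B
    = emeasure (distr M (borel >< S) (%om. (Z 0 om, H (?P om)))) (A \<times> B)"
   by (simp add: emeasure_distr emeasure_eq_measure ennreal_mult'[symmetric])
 qed
 thus ?thesis ..
qed

lemma W_0: "AE om in M. W 0 om = 0"
 using diffusion unfolding pd_diffusion_def brownian_motion_def by (auto elim: eventually_mono)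

lemma increments_law:
 assumes ta: "ta > 0"
 shows "distr M (\<Pi>\<^sub>M k\<in>(UNIV::nat set). borel) (%om k. (W (real (Suc k) * ta) om - W (real k * ta) om) /\<^sub>R sqrt ta)
   = (\<Pi>\<^sub>M k\<in>(UNIV::nat set). gaussian 1)"
proof -
 let ?D = "%k om. W (real (Suc k) * ta) om - W (real k * ta) om"
 let ?N = "%k om. ?D k om /\<^sub>R sqrt ta"
 have m[measurable]: "W (real k * ta) : bmeas M" for k :: nat using ta by simp
 have rD[measurable]: "random_variable borel (?D k)" for k by (rule borel_measurable_diff) (rule m)+
 have rN: "random_variable borel (?N k)" for k by measurable
 have n: "indep_vars (%_. borel) ?D {..<n}" for n
 proof -
  have A: "\<forall>n (t::nat => real). 0 <= t 0 \<and> (\<forall>i<n. t i < t (Suc i)) -->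
    indep_vars (%_. borel) (%i om. W (t (Suc i)) om - W (t i) om) {..<n}"
   using diffusion unfolding pd_diffusion_def brownian_motion_def by (elim conjE) assumption
  show ?thesis
   by (rule A[THEN spec[of _ n], THEN spec[of _ "%i. real i * ta"], THEN mp]) (use ta in simp)
 qed
 have "indep_vars (%_. borel) ?D UNIV"
 proof -
  have "indep_sets (%i. {?D i -` A \<inter> space M | A. A : sets borel}) J" if J: "finite J" for J
  proof -
   obtain n where "J \<subseteq> {..<n}" using J by (meson finite_nat_iff_bounded)
   thus ?thesis using n[of n] unfolding indep_vars_def2
    by (auto intro: indep_sets_mono_index)
  qed
  thus ?thesis unfolding indep_vars_def2 by (subst indep_sets_finite_index_sets) (use rD in auto)
 qed
 hence "indep_vars (%_. borel) (%k om. ?D k om /\<^sub>R sqrt ta) UNIV"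
  by (rule indep_vars_compose2[where Y="%_ x. x /\<^sub>R sqrt ta"]) simp
 hence "distr M (\<Pi>\<^sub>M k\<in>(UNIV::nat set). borel) (%om. \<lambda>k\<in>UNIV. ?N k om) = (\<Pi>\<^sub>M k\<in>(UNIV::nat set). distr M borel (?N k))"
  by (subst (asm) indep_vars_iff_distr_eq_PiM') (use rN in auto)
 moreover have "distr M borel (?N k) = gaussian 1" for k
 proof -
  have st: "real k * ta < real (Suc k) * ta" using ta by simp
  have "distr M borel (?N k) = distr (distr M borel (?D k)) borel (%x. (1 / sqrt ta) *. x)"
   by (subst distr_distr[OF _ rD]) (simp_all add: comp_def inverse_eq_divide)
  also have "distr M borel (?D k) = gaussian ta"
   using W_increment_law[OF _ st] ta by (simp add: algebra_simps)
  also have "distr (gaussian ta) borel (%x. (1 / sqrt ta) *. x) = gaussian 1"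
   using gaussian_scaleR[OF ta, of "1 / sqrt ta"] ta by (simp add: power_divide)
  finally show ?thesis .
 qed
 ultimately show ?thesis by (simp add: restrict_def)
qed

end

section \<open>The discretisation error\<close>

lemma inner_young:
 fixes a b :: "'z::real_inner"
 assumes "om > 0"
 shows "2 * (a <.> b) <= om * (norm b)^2 + (norm a)^2 / om"
proof -
 have "0 <= (om * norm b - norm a)^2" by simp
 hence "2 * om * (norm a * norm b) <= om^2 * (norm b)^2 + (norm a)^2"
  by (simp add: power2_eq_square algebra_simps)
 hence "2 * (norm a * norm b) <= om * (norm b)^2 + (norm a)^2 / om"
  using assms by (simp add: field_simps power2_eq_square)
 with norm_cauchy_schwarz[of a b] show ?thesis by linarith
qed

lemma inner_young_neg:
 fixes a b :: "'z::real_inner"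
 assumes "om > 0"
 shows "- (2 * (a <.> b)) <= om * (norm b)^2 + (norm a)^2 / om"
 using inner_young[OF assms, of "- a" b] by simp

lemma borel_measurable_fst_snd [measurable]:
 "fst : bmeas (borel :: ('a::second_countable_topology \<times> 'b::second_countable_topology) measure)"
 "snd : bmeas (borel :: ('a::second_countable_topology \<times> 'b::second_countable_topology) measure)"
 by (simp_all flip: borel_prod)

context pd_problem
begin

definition "energy si ta u0 u1 v = (1 + wg * ta) / ta * (norm u1)^2 + (1 + wfs * si) / si * (norm v)^2
  + (norm (u1 - u0))^2 / ta + 2 * (K (u1 - u0) <.> v)"

lemma energy_ge:
 assumes "ta > 0" "si > 0" "tht > 0" "tht * si * ta * L^2 <= 1" "inverse (1 + wfs * si) <= tht"
 shows "energy si ta u0 u1 v >= (1 + wg * ta) / ta * (norm u1)^2"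
proof -
 let ?w = "u1 - u0"
 have pos: "1 + wfs * si > 0" using wfs assms by (simp add: add_pos_nonneg)
 have "1 <= tht * (1 + wfs * si)" using assms(5) pos by (simp add: field_simps)
 hence "tht * (si * ta * L^2) <= tht * (1 + wfs * si)" using assms(4) by (simp add: mult.assoc)
 hence "si * ta * L^2 <= 1 + wfs * si" using assms(3) by simp
 hence c: "ta * L^2 <= (1 + wfs * si) / si" using assms(2) by (simp add: field_simps)
 have "- (2 * (v <.> K ?w)) <= ta * L^2 * (norm v)^2 + (norm ?w)^2 / ta"
 proof -
  have "- (2 * (v <.> K ?w)) = - (2 * (?w <.> KT v))" by (simp add: KT_inner inner_commute)
  also have "... <= ta * (norm (KT v))^2 + (norm ?w)^2 / ta" by (rule inner_young_neg[OF assms(1)])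
  also have "(norm (KT v))^2 <= (L * norm v)^2" by (intro power_mono norm_KT) simp
  finally show ?thesis using assms(1) by (simp add: power_mult_distrib mult.assoc)
 qed
 moreover have "ta * L^2 * (norm v)^2 <= (1 + wfs * si) / si * (norm v)^2"
  using c by (rule mult_right_mono) simp
 ultimately show ?thesis unfolding energy_def by (simp add: inner_commute)
qed

text \<open>One step of the primal-dual iteration contracts the energy, up to the consistency errors
 \<open>ex\<close> and \<open>ey\<close>. The extrapolation is what makes the coupling term telescope: what it leaves over
 is absorbed by the two squared increments as soon as \<open>tht * si * ta * L^2 <= 1\<close>.\<close>

lemma energy_step:
 assumes ta: "ta > 0" and si: "si > 0" and tht: "tht > 0" and st: "tht * si * ta * L^2 <= 1"
  and th: "inverse (1 + wg * ta) <= tht" "inverse (1 + wfs * si) <= tht"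
  and u: "(p - q) + ta *. (grad g p - grad g q) + ta *. KT (y - y') = u1 - ta *. ex"
  and v: "(y - y') + si *. (gfs y - gfs y') - si *. K (u1 + tht *. (u1 - u0)) = v1 - si *. ey"
 shows "energy si ta u1 (p - q) (y - y') <= tht * energy si ta u0 u1 v1 + (norm ex)^2 / wg + (norm ey)^2 / wfs"
proof -
 define u2 v2 w dg dfs where "u2 = p - q" and "v2 = y - y'" and "w = u1 - u0"
  and "dg = grad g p - grad g q" and "dfs = gfs y - gfs y'"
 have mg: "dg <.> u2 >= wg * (norm u2)^2" unfolding dg_def u2_def by (rule mono_g)
 have mf: "dfs <.> v2 >= wfs * (norm v2)^2" unfolding dfs_def v2_def by (rule mono_fs)
 have U: "u1 - u2 = ta *. (dg + KT v2 + ex)"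
  using u unfolding u2_def[symmetric] v2_def[symmetric] dg_def[symmetric] by (simp add: algebra_simps)
 have V: "v1 - v2 = si *. (dfs - K (u1 + tht *. w) + ey)"
  using v unfolding v2_def[symmetric] dfs_def[symmetric] w_def[symmetric] by (simp add: algebra_simps)
 have 1: "(1 + wg * ta) / ta * (norm u2)^2 + (norm (u2 - u1))^2 / ta + 2 * (K u2 <.> v2)
   <= (norm u1)^2 / ta + (norm ex)^2 / wg"
 proof -
  have "(norm u2)^2 - (norm u1)^2 + (norm (u2 - u1))^2 = - 2 * ((u1 - u2) <.> u2)"
   by (simp add: power2_norm_eq_inner algebra_simps inner_diff_left inner_diff_right inner_commute)
  also have "... = - 2 * ta * (dg <.> u2 + K u2 <.> v2 + ex <.> u2)"
  proof -
   have "KT v2 <.> u2 = K u2 <.> v2" unfolding KT_inner by (rule inner_commute)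
   thus ?thesis unfolding U by (simp add: inner_add_left)
  qed
  also have "... <= - 2 * ta * (wg * (norm u2)^2 + K u2 <.> v2) + ta * (wg * (norm u2)^2 + (norm ex)^2 / wg)"
  proof -
   have "ta * (wg * (norm u2)^2) <= ta * (dg <.> u2)" using mg ta by simp
   moreover have "ta * (- (2 * (ex <.> u2))) <= ta * (wg * (norm u2)^2 + (norm ex)^2 / wg)"
    using inner_young_neg[OF wg, of ex u2] ta by (intro mult_left_mono) auto
   ultimately show ?thesis by (simp add: algebra_simps)
  qed
  finally have "(norm u2)^2 - (norm u1)^2 + (norm (u2 - u1))^2
   <= - 2 * ta * (wg * (norm u2)^2 + K u2 <.> v2) + ta * (wg * (norm u2)^2 + (norm ex)^2 / wg)" .
  hence "((norm u2)^2 - (norm u1)^2 + (norm (u2 - u1))^2) / ta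
   <= (- 2 * ta * (wg * (norm u2)^2 + K u2 <.> v2) + ta * (wg * (norm u2)^2 + (norm ex)^2 / wg)) / ta"
   using ta by (intro divide_right_mono) auto
  also have "... = - wg * (norm u2)^2 - 2 * (K u2 <.> v2) + (norm ex)^2 / wg"
   using ta by (simp add: field_simps)
  finally show ?thesis using ta by (simp add: add_divide_distrib diff_divide_distrib distrib_right)
 qed
 have 2: "(1 + wfs * si) / si * (norm v2)^2 + (norm (v2 - v1))^2 / si - 2 * (K u1 <.> v2) - 2 * tht * (K w <.> v2)
   <= (norm v1)^2 / si + (norm ey)^2 / wfs"
 proof -
  have "(norm v2)^2 - (norm v1)^2 + (norm (v2 - v1))^2 = - 2 * ((v1 - v2) <.> v2)"
   by (simp add: power2_norm_eq_inner algebra_simps inner_diff_left inner_diff_right inner_commute)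
  also have "... = - 2 * si * (dfs <.> v2 - (K u1 <.> v2 + tht * (K w <.> v2)) + ey <.> v2)"
   unfolding V by (simp add: inner_add_left inner_diff_left linear_add[OF linear_K] linear_scale[OF linear_K])
  also have "... <= - 2 * si * (wfs * (norm v2)^2 - (K u1 <.> v2 + tht * (K w <.> v2))) + si * (wfs * (norm v2)^2 + (norm ey)^2 / wfs)"
  proof -
   have "si * (wfs * (norm v2)^2) <= si * (dfs <.> v2)" using mf si by simp
   moreover have "si * (- (2 * (ey <.> v2))) <= si * (wfs * (norm v2)^2 + (norm ey)^2 / wfs)"
    using inner_young_neg[OF wfs, of ey v2] si by (intro mult_left_mono) auto
   ultimately show ?thesis by (simp add: algebra_simps)
  qed
  finally have "((norm v2)^2 - (norm v1)^2 + (norm (v2 - v1))^2) / si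
   <= (- 2 * si * (wfs * (norm v2)^2 - (K u1 <.> v2 + tht * (K w <.> v2))) + si * (wfs * (norm v2)^2 + (norm ey)^2 / wfs)) / si"
   using si by (intro divide_right_mono) auto
  also have "... = - wfs * (norm v2)^2 + 2 * (K u1 <.> v2) + 2 * tht * (K w <.> v2) + (norm ey)^2 / wfs"
   using si by (simp add: field_simps)
  finally show ?thesis using si by (simp add: add_divide_distrib diff_divide_distrib distrib_right)
 qed
 have 3: "2 * tht * (K w <.> (v2 - v1)) <= (norm (v2 - v1))^2 / si + tht * ((norm w)^2 / ta)"
 proof -
  have "2 * (K (tht *. w) <.> (v2 - v1)) <= 1 / si * (norm (v2 - v1))^2 + (norm (K (tht *. w)))^2 / (1 / si)"
   using si by (intro inner_young) auto
  also have "(norm (K (tht *. w)))^2 / (1 / si) <= tht * ((norm w)^2 / ta)"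
  proof -
   have "(norm (K (tht *. w)))^2 <= (L * norm (tht *. w))^2" by (intro power_mono norm_K) simp
   also have "... = tht^2 * L^2 * (norm w)^2" by (simp add: power_mult_distrib)
   finally have "(norm (K (tht *. w)))^2 * si <= tht^2 * L^2 * (norm w)^2 * si" using si by (intro mult_right_mono) auto
   also have "... = (tht * si * ta * L^2) * (tht * ((norm w)^2 / ta))"
    using ta by (simp add: power2_eq_square field_simps)
   also have "... <= 1 * (tht * ((norm w)^2 / ta))" using st tht ta by (intro mult_right_mono) auto
   finally show ?thesis by simp
  qed
  finally show ?thesis by (simp add: linear_scale[OF linear_K])
 qed
 have 4: "(norm u1)^2 / ta <= tht * ((1 + wg * ta) / ta * (norm u1)^2)"
 proof -
  have "1 <= tht * (1 + wg * ta)" using th(1) wg ta by (simp add: field_simps add_pos_nonneg)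
  hence "1 * ((norm u1)^2 / ta) <= (tht * (1 + wg * ta)) * ((norm u1)^2 / ta)" using ta by (intro mult_right_mono) auto
  thus ?thesis by (simp add: mult.assoc)
 qed
 have 5: "(norm v1)^2 / si <= tht * ((1 + wfs * si) / si * (norm v1)^2)"
 proof -
  have "1 <= tht * (1 + wfs * si)" using th(2) wfs si by (simp add: field_simps add_pos_nonneg)
  hence "1 * ((norm v1)^2 / si) <= (tht * (1 + wfs * si)) * ((norm v1)^2 / si)" using si by (intro mult_right_mono) auto
  thus ?thesis by (simp add: mult.assoc)
 qed
 have 6: "K (u2 - u1) <.> v2 = K u2 <.> v2 - K u1 <.> v2" by (simp add: linear_diff[OF linear_K] inner_diff_left)
 have 7: "2 * tht * (K w <.> (v2 - v1)) = 2 * tht * (K w <.> v2) - 2 * tht * (K w <.> v1)"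
  by (simp add: inner_diff_right algebra_simps)
 have "energy si ta u1 u2 v2 <= tht * ((1 + wg * ta) / ta * (norm u1)^2) + tht * ((1 + wfs * si) / si * (norm v1)^2)
   + tht * ((norm w)^2 / ta) + 2 * tht * (K w <.> v1) + (norm ex)^2 / wg + (norm ey)^2 / wfs"
  unfolding energy_def 6 using 1 2 3 4 5 7 by argo
 thus ?thesis unfolding energy_def u2_def v2_def w_def by (simp add: distrib_left)
qed

lemma lipschitz_prox_g: "ta > 0 ==> 1-lipschitz_on UNIV (prox ta g)"
 and prox_g_eqn: "ta > 0 ==> prox ta g x + ta *. grad g (prox ta g x) = x"
 using prox_eqn[OF scg wg _ dg] by auto

lemma lipschitz_prox_fs: "si > 0 ==> 1-lipschitz_on UNIV (prox si (convex_conjugate f))"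
 and prox_fs_eqn: "si > 0 ==> prox si (convex_conjugate f) y + si *. gfs (prox si (convex_conjugate f) y) = y"
 using prox_eqn[OF scfs wfs _ grad_convex_conjugate(3)[OF scf wf df]] by auto

lemma measurable_prox [measurable]:
 assumes "ga > 0"
 shows "prox ga g : bmeas borel" "prox ga (convex_conjugate f) : bmeas borel"
 using assms by (auto intro!: borel_measurable_continuous_onI lipschitz_on_continuous_on
   lipschitz_prox_g lipschitz_prox_fs)

lemma measurable_pd_iterate:
 assumes "ta > 0" "si > 0"
 shows "(%(z, xi). pd_iterate f g K si ta tht z xi n) : bmeas (borel >< (\<Pi>\<^sub>M k\<in>(UNIV::nat set). borel))"
proof (induction n)
 case 0
 have "(%p. (fst (fst p), fst (fst p), snd (fst p)))
   : bmeas ((borel :: ((real ^ 'd) \<times> (real ^ 'm)) measure) >< (\<Pi>\<^sub>M k\<in>(UNIV::nat set). borel :: (real ^ 'd) measure))"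
  by (intro borel_measurable_Pair) measurable
 thus ?case by (simp add: case_prod_unfold)
next
 case (Suc n)
 note [measurable] = measurable_prox[OF assms(1)] measurable_prox[OF assms(2)]
 let ?S = "borel >< (\<Pi>\<^sub>M k\<in>(UNIV::nat set). borel :: (real ^ 'd) measure)"
 let ?s = "%p. pd_iterate f g K si ta tht (fst p) (snd p) n"
 have s: "?s : bmeas ?S" using Suc by (simp add: case_prod_unfold)
 have [measurable]: "(%p. fst (?s p)) : bmeas ?S" "(%p. fst (snd (?s p))) : bmeas ?S"
   "(%p. snd (snd (?s p))) : bmeas ?S"
  using s by measurable
 have [measurable]: "(%p. snd p n) : bmeas ?S" by measurable
 have "(%p. let y' = prox si (convex_conjugate f) (snd (snd (?s p)) + si *. K (fst (snd (?s p))));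
       x' = prox ta g (fst (?s p) - ta *. KT y') + sqrt (2 * ta) *. snd p n
     in (x', x' + tht *. (x' - fst (?s p)), y')) : bmeas ?S"
  unfolding Let_def by (intro borel_measurable_Pair) measurable
 thus ?case by (simp add: case_prod_unfold Let_def)
qed

end

lemma nn_integral_add_le:
 assumes "u : bmeas M" "v : bmeas M" "\<And>om. u om >= 0" "\<And>om. v om >= 0" "A >= 0" "B >= 0"
  and "NN M (%om. u om) <= ennreal A" "NN M (%om. v om) <= ennreal B"
 shows "NN M (%om. u om + v om) <= ennreal (A + B)"
proof -
 have "NN M (%om. u om + v om) = NN M (%om. u om) + NN M (%om. v om)"
  using assms(1-4) by (simp add: nn_integral_add)
 also have "... <= ennreal A + ennreal B" by (intro add_mono assms)
 finally show ?thesis using assms(5,6) by simp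
qed

lemma nn_integral_cmult_le:
 assumes "u : bmeas M" "c >= 0" and "NN M (%om. u om) <= ennreal A"
 shows "NN M (%om. c * u om) <= ennreal (c * A)"
proof -
 have "NN M (%om. c * u om) = ennreal c * NN M (%om. u om)"
  using assms(1,2) by (simp add: nn_integral_cmult ennreal_mult')
 also have "... <= ennreal c * ennreal A" by (intro mult_left_mono assms) auto
 finally show ?thesis using assms(2) by (simp add: ennreal_mult')
qed

lemma square_le_2: "0 <= x ==> x <= a + b ==> x^2 <= 2 * a^2 + 2 * (b::real)^2"
proof -
 assume "0 <= x" "x <= a + b"
 hence "x^2 <= (a + b)^2" by (intro power_mono)
 also have "... <= 2 * a^2 + 2 * b^2"
  using zero_le_power2[of "a - b"] by (simp add: power2_eq_square algebra_simps)
 finally show ?thesis .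
qed

lemma square_le_3: "0 <= x ==> x <= a + b + c ==> x^2 <= 3 * a^2 + 3 * b^2 + 3 * (c::real)^2"
proof -
 assume "0 <= x" "x <= a + b + c"
 hence "x^2 <= (a + b + c)^2" by (intro power_mono)
 also have "... <= (1 + 1 + 1) * (a^2 / 1 + b^2 / 1 + c^2 / 1)" by (rule sum3_square_le) auto
 finally show ?thesis by simp
qed

lemma square_le_prod: "0 <= x ==> x <= c * n ==> x^2 <= c^2 * (n::real)^2"
 using power_mono[of x "c * n" 2] by (simp add: power_mult_distrib)

context pd_stationary_process
begin

text \<open>The stationary diffusion solves the recursion of the iteration at the grid points, up to the
 consistency errors \<open>x_error\<close> and \<open>y_error\<close>.\<close>

definition "grid_prev ta n = (case n of 0 => X 0 | Suc k => X (real k * ta))"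
definition "drift_part ta n om = X (real (Suc n) * ta) om - sqrt 2 *. (W (real (Suc n) * ta) om - W (real n * ta) om)"
definition "x_error ta n om = grad g (drift_part ta n om) + KT (Y (real (Suc n) * ta) om)
  + (drift_part ta n om - X (real n * ta) om) /\<^sub>R ta"
definition "extrapolated ta tht n om = X (real n * ta) om + tht *. (X (real n * ta) om - grid_prev ta n om)"
definition "y_error ta tht n om = gfs (Y (real (Suc n) * ta) om) - K (extrapolated ta tht n om)
  + (Y (real (Suc n) * ta) om - Y (real n * ta) om) /\<^sub>R (lam * ta)"

lemma measurable_grid:
 assumes "ta > 0"
 shows "X (real n * ta) : bmeas M" "Y (real n * ta) : bmeas M" "W (real n * ta) : bmeas M"
  "grid_prev ta n : bmeas M" "drift_part ta n : bmeas M" "x_error ta n : bmeas M"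
  "extrapolated ta tht n : bmeas M" "y_error ta tht n : bmeas M"
proof -
 have m[measurable]: "X (real n * ta) : bmeas M" "Y (real n * ta) : bmeas M"
  "W (real n * ta) : bmeas M" for n using assms by auto
 show "X (real n * ta) : bmeas M" "Y (real n * ta) : bmeas M" "W (real n * ta) : bmeas M"
  by (rule m)+
 show g[measurable]: "grid_prev ta n : bmeas M"
  unfolding grid_prev_def by (cases n) (simp_all add: m)
 note ms = m[of "Suc n"]
 show d[measurable]: "drift_part ta n : bmeas M"
  unfolding drift_part_def using ms m[of n]
  by (intro borel_measurable_diff borel_measurable_scaleR borel_measurable_const)
 show e[measurable]: "extrapolated ta tht n : bmeas M"
  unfolding extrapolated_def by measurable
 show "x_error ta n : bmeas M"
  unfolding x_error_def by (intro borel_measurable_add borel_measurable_diff borel_measurable_scaleR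
    borel_measurable_const d m(1) measurable_compose[OF d borel_grads(1)] measurable_compose[OF ms(2) borel_grads(4)])
 show "y_error ta tht n : bmeas M"
  unfolding y_error_def by (intro borel_measurable_add borel_measurable_diff borel_measurable_scaleR
    borel_measurable_const m(2) ms(2) measurable_compose[OF e borel_grads(3)] measurable_compose[OF ms(2) borel_grads(2)])
qed

lemma nn_integral_average_le:
 fixes e :: "'w => 'z::euclidean_space"
 assumes st: "s < t" and meas: "\<And>r. r : {s..t} ==> ph r : bmeas M"
  and cont: "AE om in M. continuous_on {s..t} (%r. ph r om)"
  and eq: "AE om in M. integral {s..t} (%r. ph r om) = (t - s) *. e om"
  and B: "\<And>r. r : {s..t} ==> (NN M (%om. (norm (ph r om))^2)) <= ennreal B"
  and e: "e : bmeas M"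
 shows "NN M (%om. (norm (e om))^2) <= ennreal B"
proof -
 have "NN M (%om. (norm (e om))^2) = NN M (%om. 1 / (t - s)^2 * (norm ((t - s) *. e om))^2)"
  using st by (simp add: power_mult_distrib)
 also have "... <= ennreal (1 / (t - s)^2 * ((t - s)^2 * B))"
 proof (rule nn_integral_cmult_le)
  show "(%om. (norm ((t - s) *. e om))^2) : bmeas M" using e by measurable
  have "NN M (%om. (norm ((t - s) *. e om))^2)
    = NN M (%om. (norm (integral {s..t} (%r. ph r om)))^2)"
   by (rule nn_integral_cong_AE, use eq in eventually_elim) simp
  also have "... <= ennreal ((t - s)^2 * B)"
   using st by (intro nn_integral_path_integral_square_le meas cont B) auto
  finally show "NN M (%om. (norm ((t - s) *. e om))^2) <= ennreal ((t - s)^2 * B)" .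
 qed simp
 finally show ?thesis using st by simp
qed

lemma x_error_moment:
 assumes ta: "ta > 0"
 shows "NN M (%om. (norm (x_error ta n om))^2)
  <= ennreal (4 * Lg^2 * (ta * CARD('b)) + (4 * Lg^2 * (ta^2 * D4) + 4 * L^2 * (ta^2 * D4)))"
proof -
 define s t where "s = real n * ta" and "t = real (Suc n) * ta"
 have st: "0 <= s" "s < t" "t - s = ta" using ta by (auto simp: s_def t_def algebra_simps)
 have [measurable]: "X r : bmeas M" "Y r : bmeas M" "W r : bmeas M" if "r : {s..t}" for r
  using st that by auto
 have ends: "s : {s..t}" "t : {s..t}" using st by auto
 define c where "c om = grad g (drift_part ta n om) + KT (Y t om)" for om
 have cm: "c : bmeas M"
  unfolding c_def using measurable_grid[OF ta, of n] measurable_grid[OF ta, of "Suc n"]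
  by (auto simp: t_def intro!: borel_measurable_add measurable_compose[OF _ borel_grads(1)] measurable_compose[OF _ borel_grads(4)])
 have dp: "drift_part ta n om = X t om - sqrt 2 *. (W t om - W s om)" for om
  by (simp add: drift_part_def s_def t_def)
 show ?thesis
 proof (rule nn_integral_average_le[OF st(2), where ph = "%r om. c om - Ax (Z r om)"])
  fix r assume r: "r : {s..t}"
  hence r0: "0 <= r" "s <= r" "r <= t" using st by auto
  have mZ: "Z r : bmeas M" using r by measurable
  show "(%om. c om - Ax (Z r om)) : bmeas M"
   by (intro borel_measurable_diff cm measurable_compose[OF mZ borel_A(1)])
  let ?a = "%om. norm (W r om - W s om)"
  let ?b = "%om. norm (X t om - X r om - sqrt 2 *. (W t om - W r om))"
  let ?e = "%om. norm (Y t om - Y r om)"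
  have le: "(norm (c om - Ax (Z r om)))^2 <= 4 * Lg^2 * (?a om)^2 + (4 * Lg^2 * (?b om)^2 + 4 * L^2 * (?e om)^2)" for om
  proof -
   have "c om - Ax (Z r om) = (grad g (drift_part ta n om) - grad g (X r om)) + KT (Y t om - Y r om)"
    by (simp add: c_def Ax_def linear_diff[OF linear_KT])
   also have "norm ... <= norm (grad g (drift_part ta n om) - grad g (X r om)) + norm (KT (Y t om - Y r om))"
    by (rule norm_triangle_ineq)
   also have "... <= Lg * norm (drift_part ta n om - X r om) + L * ?e om"
    by (intro add_mono lip_grad_g norm_KT)
   also have "norm (drift_part ta n om - X r om) <= ?b om + sqrt 2 * ?a om"
   proof -
    have "drift_part ta n om - X r om = (X t om - X r om - sqrt 2 *. (W t om - W r om)) - sqrt 2 *. (W r om - W s om)"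
     by (simp add: dp algebra_simps)
    also have "norm ... <= ?b om + norm (sqrt 2 *. (W r om - W s om))" by (rule norm_triangle_ineq4)
    finally show ?thesis by simp
   qed
   finally have n: "norm (c om - Ax (Z r om)) <= Lg * (sqrt 2 * ?a om) + (Lg * ?b om + L * ?e om)"
    using Lg by (simp add: algebra_simps)
   have "(norm (c om - Ax (Z r om)))^2 <= 2 * (Lg * (sqrt 2 * ?a om))^2 + 2 * (Lg * ?b om + L * ?e om)^2"
    by (rule square_le_2[OF _ n]) simp
   also have "(Lg * ?b om + L * ?e om)^2 <= 2 * (Lg * ?b om)^2 + 2 * (L * ?e om)^2"
    by (rule square_le_2) (use Lg L_nonneg in auto)
   finally show ?thesis by (simp add: power_mult_distrib)
  qed
  have ma: "(%om. (?a om)^2) : bmeas M" "(%om. (?b om)^2) : bmeas M" "(%om. (?e om)^2) : bmeas M"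
   using r ends by measurable
  have W: "NN M (%om. (?a om)^2) <= ennreal (ta * CARD('b))"
   unfolding W_increment_moment[OF st(1) r0(2)] using r0 st by (intro ennreal_leI mult_right_mono) auto
  have mono: "ennreal ((t - r)^2 * D4) <= ennreal (ta^2 * D4)"
   using r0 st D4 by (intro ennreal_leI mult_right_mono power_mono) auto
  have "NN M (%om. (norm (c om - Ax (Z r om)))^2)
   <= NN M (%om. 4 * Lg^2 * (?a om)^2 + (4 * Lg^2 * (?b om)^2 + 4 * L^2 * (?e om)^2))"
   by (intro nn_integral_mono ennreal_leI le)
  also have "... <= ennreal (4 * Lg^2 * (ta * CARD('b)) + (4 * Lg^2 * (ta^2 * D4) + 4 * L^2 * (ta^2 * D4)))"
   using ta D4 ma
   by (intro nn_integral_add_le nn_integral_cmult_le borel_measurable_times borel_measurable_add borel_measurable_const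
     W order_trans[OF drift_increment(1)[OF r0(1,3)] mono] order_trans[OF drift_increment(2)[OF r0(1,3)] mono]) auto
  finally show "NN M (%om. (norm (c om - Ax (Z r om)))^2)
   <= ennreal (4 * Lg^2 * (ta * CARD('b)) + (4 * Lg^2 * (ta^2 * D4) + 4 * L^2 * (ta^2 * D4)))" .
 next
  show "AE om in M. continuous_on {s..t} (%r. c om - Ax (Z r om))"
   using path_equation
   by eventually_elim (use st in "auto intro!: continuous_on_diff continuous_on_const continuous_drift_path")
  show "AE om in M. integral {s..t} (%r. c om - Ax (Z r om)) = (t - s) *. x_error ta n om"
   using path_equation
  proof eventually_elim
   case (elim om)
   have i: "(%r. Ax (Z r om)) integrable_on {s..t}"
    by (rule integrable_continuous_real, rule continuous_drift_path) (use elim st in auto)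
   have "integral {s..t} (%r. c om - Ax (Z r om)) = (t - s) *. c om - integral {s..t} (%r. Ax (Z r om))"
    using st by (subst Henstock_Kurzweil_Integration.integral_diff[OF _ i]) auto
   moreover have "X t om = X s om - integral {s..t} (%r. Ax (Z r om)) + sqrt 2 *. (W t om - W s om)"
    using elim st by auto
   hence "integral {s..t} (%r. Ax (Z r om)) = X s om - drift_part ta n om" by (simp add: dp algebra_simps)
   moreover have "(t - s) *. x_error ta n om = (t - s) *. c om + (drift_part ta n om - X s om)"
    using ta st(3) by (simp add: x_error_def c_def s_def t_def scaleR_add_right)
   ultimately show ?case by simp
  qed
 qed (rule measurable_grid[OF ta])
qed

lemma grid_prev_moment:
 fixes ta :: real
 assumes ta: "ta > 0"
 shows "\<exists>w. w : bmeas M \<and> (NN M (%om. (norm (w om))^2)) <= ennreal (ta * CARD('b)) \<and>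
  (NN M (%om. (norm (X (real n * ta) om - grid_prev ta n om - sqrt 2 *. w om))^2)) <= ennreal (ta^2 * D4)"
proof (cases n)
 case 0
 thus ?thesis using ta D4 by (intro exI[of _ "%_. 0"]) (simp add: grid_prev_def)
next
 case (Suc k)
 have st: "0 <= real k * ta" "real k * ta <= real n * ta" "real n * ta - real k * ta = ta"
  using ta Suc by (auto simp: algebra_simps)
 show ?thesis
  using measurable_grid(3)[OF ta] measurable_grid(3)[OF ta, of "Suc k"] W_increment_moment[OF st(1,2)] drift_increment(1)[OF st(1,2)]
  unfolding st(3)
  by (intro exI[of _ "%om. W (real n * ta) om - W (real k * ta) om"])
    (auto simp: grid_prev_def Suc intro!: borel_measurable_diff)
qed

lemma y_error_moment:
 assumes ta: "ta > 0" and tht: "0 <= tht" "tht <= 1"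
 shows "NN M (%om. (norm (y_error ta tht n om))^2)
  <= ennreal (6 * L^2 * (ta * CARD('b)) + (6 * L^2 * tht^2 * (ta * CARD('b))
    + (9 / wf^2 * (ta^2 * D4) + (9 * L^2 * (ta^2 * D4) + 9 * L^2 * (ta^2 * D4)))))"
proof -
 define s t where "s = real n * ta" and "t = real (Suc n) * ta"
 have st: "0 <= s" "s < t" "t - s = ta" using ta by (auto simp: s_def t_def algebra_simps)
 have [measurable]: "X r : bmeas M" "Y r : bmeas M" "W r : bmeas M" if "r : {s..t}" for r
  using st that by auto
 have ends: "s : {s..t}" "t : {s..t}" using st by auto
 obtain w where w[measurable]: "w : bmeas M"
  and w1: "NN M (%om. (norm (w om))^2) <= ennreal (ta * CARD('b))"
  and w2: "NN M (%om. (norm (X s om - grid_prev ta n om - sqrt 2 *. w om))^2) <= ennreal (ta^2 * D4)"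
  using grid_prev_moment[OF ta, of n] unfolding s_def by blast
 define c where "c om = gfs (Y t om) - K (extrapolated ta tht n om)" for om
 have cm: "c : bmeas M"
  unfolding c_def using measurable_grid(2)[OF ta, of "Suc n"] measurable_grid(7)[OF ta]
  by (auto simp: t_def intro!: borel_measurable_diff measurable_compose[OF _ borel_grads(2)] measurable_compose[OF _ borel_grads(3)])
 have [measurable]: "grid_prev ta n : bmeas M" by (rule measurable_grid[OF ta])
 show ?thesis
 proof (rule nn_integral_average_le[OF st(2), where ph = "%r om. c om - Ay (Z r om)"])
  fix r assume r: "r : {s..t}"
  hence r0: "0 <= r" "s <= r" "r <= t" using st by auto
  have mZ: "Z r : bmeas M" using r by measurable
  show "(%om. c om - Ay (Z r om)) : bmeas M"
   by (intro borel_measurable_diff cm measurable_compose[OF mZ borel_A(2)])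
  let ?a = "%om. norm (W r om - W s om)"
  let ?a' = "%om. norm (w om)"
  let ?b = "%om. norm (X r om - X s om - sqrt 2 *. (W r om - W s om))"
  let ?b' = "%om. norm (X s om - grid_prev ta n om - sqrt 2 *. w om)"
  let ?e = "%om. norm (Y t om - Y r om)"
  have le: "(norm (c om - Ay (Z r om)))^2 <= 6 * L^2 * (?a om)^2 + (6 * L^2 * tht^2 * (?a' om)^2
    + (9 / wf^2 * (?e om)^2 + (9 * L^2 * (?b om)^2 + 9 * L^2 * (?b' om)^2)))" for om
  proof -
   have "c om - Ay (Z r om) = (gfs (Y t om) - gfs (Y r om)) + K (X r om - extrapolated ta tht n om)"
    by (simp add: c_def Ay_def linear_diff[OF linear_K])
   also have "norm ... <= norm (gfs (Y t om) - gfs (Y r om)) + norm (K (X r om - extrapolated ta tht n om))"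
    by (rule norm_triangle_ineq)
   also have "... <= ?e om / wf + L * norm (X r om - extrapolated ta tht n om)"
    by (intro add_mono lipfs norm_K)
   finally have n0: "norm (c om - Ay (Z r om)) <= ?e om / wf + L * norm (X r om - extrapolated ta tht n om)" .
   have x: "norm (X r om - extrapolated ta tht n om) <= sqrt 2 * ?a om + (tht * (sqrt 2 * ?a' om) + (?b om + tht * ?b' om))"
   proof -
    have e: "X r om - extrapolated ta tht n om
      = (X r om - X s om - sqrt 2 *. (W r om - W s om)) + sqrt 2 *. (W r om - W s om)
       - tht *. ((X s om - grid_prev ta n om - sqrt 2 *. w om) + sqrt 2 *. w om)"
     by (simp add: extrapolated_def s_def)
    have a1: "norm (X r om - extrapolated ta tht n om) <= (?b om + norm (sqrt 2 *. (W r om - W s om))) + norm (tht *. ((X s om - grid_prev ta n om - sqrt 2 *. w om) + sqrt 2 *. w om))"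
     unfolding e by (rule order_trans[OF norm_triangle_ineq4]) (intro add_mono norm_triangle_ineq order_refl)
    have "norm (tht *. ((X s om - grid_prev ta n om - sqrt 2 *. w om) + sqrt 2 *. w om))
      <= tht * (?b' om + norm (sqrt 2 *. w om))"
     using tht norm_triangle_ineq[of "X s om - grid_prev ta n om - sqrt 2 *. w om" "sqrt 2 *. w om"]
     unfolding norm_scaleR by (intro mult_mono) auto
    with a1 show ?thesis by (simp add: distrib_left)
   qed
   have "L * norm (X r om - extrapolated ta tht n om) <= L * (sqrt 2 * ?a om + (tht * (sqrt 2 * ?a' om) + (?b om + tht * ?b' om)))"
    by (rule mult_left_mono[OF x L_nonneg])
   with n0 have n: "norm (c om - Ay (Z r om))
     <= L * (sqrt 2 * ?a om) + L * (tht * (sqrt 2 * ?a' om)) + (?e om / wf + L * ?b om + L * (tht * ?b' om))"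
    by (simp only: distrib_left)
   have "(norm (c om - Ay (Z r om)))^2
     <= 3 * (L * (sqrt 2 * ?a om))^2 + 3 * (L * (tht * (sqrt 2 * ?a' om)))^2 + 3 * (?e om / wf + L * ?b om + L * (tht * ?b' om))^2"
    by (rule square_le_3[OF _ n]) simp
   also have "(?e om / wf + L * ?b om + L * (tht * ?b' om))^2
     <= 3 * (?e om / wf)^2 + 3 * (L * ?b om)^2 + 3 * (L * (tht * ?b' om))^2"
    by (rule square_le_3) (use tht L_nonneg wf in auto)
   also have "(L * (tht * ?b' om))^2 <= (L * (1 * ?b' om))^2"
    using tht L_nonneg by (intro power_mono mult_left_mono mult_right_mono) auto
   finally show ?thesis by (simp add: power_mult_distrib power_divide)
  qed
  have ma: "(%om. (?a om)^2) : bmeas M" "(%om. (?b om)^2) : bmeas M" "(%om. (?e om)^2) : bmeas M"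
   "(%om. (?a' om)^2) : bmeas M" "(%om. (?b' om)^2) : bmeas M"
   using r ends by measurable
  have W: "NN M (%om. (?a om)^2) <= ennreal (ta * CARD('b))"
   unfolding W_increment_moment[OF st(1) r0(2)] using r0 st by (intro ennreal_leI mult_right_mono) auto
  have mono: "ennreal ((t - r)^2 * D4) <= ennreal (ta^2 * D4)" "ennreal ((r - s)^2 * D4) <= ennreal (ta^2 * D4)"
   using r0 st D4 by (intro ennreal_leI mult_right_mono power_mono; simp)+
  have "NN M (%om. (norm (c om - Ay (Z r om)))^2)
   <= NN M (%om. 6 * L^2 * (?a om)^2 + (6 * L^2 * tht^2 * (?a' om)^2
    + (9 / wf^2 * (?e om)^2 + (9 * L^2 * (?b om)^2 + 9 * L^2 * (?b' om)^2))))"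
   by (intro nn_integral_mono ennreal_leI le)
  also have "... <= ennreal (6 * L^2 * (ta * CARD('b)) + (6 * L^2 * tht^2 * (ta * CARD('b))
    + (9 / wf^2 * (ta^2 * D4) + (9 * L^2 * (ta^2 * D4) + 9 * L^2 * (ta^2 * D4)))))"
   using ta D4 ma
   by (intro nn_integral_add_le nn_integral_cmult_le borel_measurable_times borel_measurable_add borel_measurable_const
     W w1 w2 order_trans[OF drift_increment(1)[OF st(1) r0(2)] mono(2)] order_trans[OF drift_increment(2)[OF r0(1,3)] mono(1)]) auto
  finally show "NN M (%om. (norm (c om - Ay (Z r om)))^2)
   <= ennreal (6 * L^2 * (ta * CARD('b)) + (6 * L^2 * tht^2 * (ta * CARD('b))
    + (9 / wf^2 * (ta^2 * D4) + (9 * L^2 * (ta^2 * D4) + 9 * L^2 * (ta^2 * D4)))))" .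
 next
  show "AE om in M. continuous_on {s..t} (%r. c om - Ay (Z r om))"
   using path_equation
   by eventually_elim (use st in "auto intro!: continuous_on_diff continuous_on_const continuous_drift_path")
  show "AE om in M. integral {s..t} (%r. c om - Ay (Z r om)) = (t - s) *. y_error ta tht n om"
   using path_equation
  proof eventually_elim
   case (elim om)
   have i: "(%r. Ay (Z r om)) integrable_on {s..t}"
    by (rule integrable_continuous_real, rule continuous_drift_path) (use elim st in auto)
   have "integral {s..t} (%r. c om - Ay (Z r om)) = (t - s) *. c om - integral {s..t} (%r. Ay (Z r om))"
    using st by (subst Henstock_Kurzweil_Integration.integral_diff[OF _ i]) auto
   moreover have "Y t om = Y s om - lam *. integral {s..t} (%r. Ay (Z r om))"
    using elim st by auto
   hence "integral {s..t} (%r. Ay (Z r om)) = (Y s om - Y t om) /\<^sub>R lam" using lam by simp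
   moreover have "(t - s) *. y_error ta tht n om = (t - s) *. c om + (Y t om - Y s om) /\<^sub>R lam"
    using ta st(3) lam by (simp add: y_error_def c_def s_def t_def scaleR_add_right)
   ultimately show ?case by (simp add: scaleR_diff_right)
  qed
 qed (rule measurable_grid[OF ta])
qed

end

section \<open>The law of the iteration against the stationary diffusion\<close>

lemma square_perturb_le:
 fixes a b s :: real
 assumes "s > 0"
 shows "(a + b)^2 <= (1 + s) * a^2 + (1 + 1 / s) * b^2"
proof -
 have "0 <= (s * a - b)^2 / s" using assms by simp
 also have "... = s * a^2 - 2 * (a * b) + b^2 / s" using assms by (simp add: power2_eq_square field_simps)
 finally show ?thesis by (simp add: power2_eq_square algebra_simps)
qed

context pd_stationary_process
begin

definition "noise ta om k = (W (real (Suc k) * ta) om - W (real k * ta) om) /\<^sub>R sqrt ta"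

lemma noise_facts:
 assumes ta: "ta > 0"
 shows measurable_noise: "noise ta : M \<rightarrow>\<^sub>M (\<Pi>\<^sub>M k\<in>(UNIV::nat set). borel)"
  and noise_law: "distr M (\<Pi>\<^sub>M k\<in>(UNIV::nat set). borel) (noise ta) = (\<Pi>\<^sub>M k\<in>(UNIV::nat set). gaussian 1)"
  and indep_noise: "distr M (borel >< (\<Pi>\<^sub>M k\<in>(UNIV::nat set). borel)) (%om. (Z 0 om, noise ta om))
   = distr M borel (Z 0) >< distr M (\<Pi>\<^sub>M k\<in>(UNIV::nat set). borel) (noise ta)"
proof -
 define H :: "(real => real ^ 'b) => nat => real ^ 'b"
  where "H p k = (p (real (Suc k) * ta) - p (real k * ta)) /\<^sub>R sqrt ta" for p k
 have Hk: "(%p. H p k) : (\<Pi>\<^sub>M t\<in>{0..}. borel) \<rightarrow>\<^sub>M borel" for k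
  unfolding H_def using ta
  by (intro borel_measurable_scaleR borel_measurable_const borel_measurable_diff measurable_component_singleton) auto
 have H: "H : (\<Pi>\<^sub>M t\<in>{0..}. borel) \<rightarrow>\<^sub>M (\<Pi>\<^sub>M k\<in>(UNIV::nat set). borel)"
  by (rule measurable_PiM_single') (use Hk in "auto simp: PiE_def extensional_def")
 have path: "(%om. \<lambda>t\<in>{0..}. W t om) : M \<rightarrow>\<^sub>M (\<Pi>\<^sub>M t\<in>{0..}. borel)" by (rule measurable_restrict) simp
 have eq: "(%om. H (\<lambda>t\<in>{0..}. W t om)) = noise ta"
  using ta by (auto simp: fun_eq_iff H_def noise_def)
 show "noise ta : M \<rightarrow>\<^sub>M (\<Pi>\<^sub>M k\<in>(UNIV::nat set). borel)"
  using measurable_compose[OF path H] unfolding eq .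
 have "(%om k. noise ta om k) = noise ta" by simp
 thus "distr M (\<Pi>\<^sub>M k\<in>(UNIV::nat set). borel) (noise ta) = (\<Pi>\<^sub>M k\<in>(UNIV::nat set). gaussian 1)"
  using increments_law[OF ta] unfolding noise_def by simp
 show "distr M (borel >< (\<Pi>\<^sub>M k\<in>(UNIV::nat set). borel)) (%om. (Z 0 om, noise ta om))
   = distr M borel (Z 0) >< distr M (\<Pi>\<^sub>M k\<in>(UNIV::nat set). borel) (noise ta)"
  using indep_initial_functional[OF H] unfolding fun_cong[OF eq] eq .
qed

definition "weight ta = inverse ((1 + wg * ta) / (1 + wfs * (lam * ta)) * lam)"

definition "err_A tht = 4 * real CARD('b) * Lg^2 / wg + 6 * real CARD('b) * L^2 * (1 + 2 * tht^2) / wfs"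
definition "err_B = 4 * (Lg^2 + L^2) * D4 / wg + (9 / wf^2 + 18 * L^2) * D4 / wfs"

text \<open>Pathwise comparison: the iteration and the diffusion are driven by the same increments.\<close>

lemma energy_along_path:
 fixes z :: "(real ^ 'b) \<times> (real ^ 'a)" and om :: 'w
 assumes ta: "ta > 0" and tht: "tht > 0" and st: "tht * (lam * ta) * ta * L^2 <= 1"
  and th: "inverse (1 + wg * ta) <= tht" "inverse (1 + wfs * (lam * ta)) <= tht"
 defines "s \<equiv> %n. pd_iterate f g K (lam * ta) ta tht z (noise ta om) n"
 shows "energy (lam * ta) ta (case n of 0 => fst z - X 0 om | Suc k => fst (s k) - X (real k * ta) om)
    (fst (s n) - X (real n * ta) om) (snd (snd (s n)) - Y (real n * ta) om)
   <= tht ^ n * energy (lam * ta) ta (fst z - X 0 om) (fst z - X 0 om) (snd z - Y 0 om)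
    + (\<Sum>k<n. tht ^ (n - Suc k) * ((norm (x_error ta k om))^2 / wg + (norm (y_error ta tht k om))^2 / wfs))"
  (is "?E n <= _ + ?S n")
  and "fst (snd (s n)) - extrapolated ta tht n om = (fst (s n) - X (real n * ta) om) + tht *. ((fst (s n) - X (real n * ta) om)
    - (case n of 0 => fst z - X 0 om | Suc k => fst (s k) - X (real k * ta) om))"
proof -
 have si: "lam * ta > 0" using lam ta by simp
 let ?u = "%n. fst (s n) - X (real n * ta) om" and ?v = "%n. snd (snd (s n)) - Y (real n * ta) om"
 let ?up = "%n. case n of 0 => fst z - X 0 om | Suc k => fst (s k) - X (real k * ta) om"
 have sn: "s (Suc n) = (let y' = prox (lam * ta) (convex_conjugate f) (snd (snd (s n)) + (lam * ta) *. K (fst (snd (s n))));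
     x' = prox ta g (fst (s n) - ta *. KT y') + sqrt (2 * ta) *. noise ta om n
   in (x', x' + tht *. (x' - fst (s n)), y'))" for n
  unfolding s_def by (simp add: case_prod_unfold Let_def)
 have s0: "s 0 = (fst z, fst z, snd z)" by (simp add: s_def)
 have ext: "fst (snd (s n)) - extrapolated ta tht n om = ?u n + tht *. (?u n - ?up n)" for n
 proof (cases n)
  case 0
  thus ?thesis by (simp add: s0 extrapolated_def grid_prev_def)
 next
  case (Suc k)
  have "fst (snd (s (Suc k))) = fst (s (Suc k)) + tht *. (fst (s (Suc k)) - fst (s k))" by (simp add: sn Let_def)
  thus ?thesis unfolding Suc by (simp add: extrapolated_def grid_prev_def algebra_simps)
 qed
 show "fst (snd (s n)) - extrapolated ta tht n om = ?u n + tht *. (?u n - ?up n)" by (rule ext)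
 have noise_eq: "sqrt (2 * ta) *. noise ta om n = sqrt 2 *. (W (real (Suc n) * ta) om - W (real n * ta) om)" for n
  using ta by (simp add: noise_def real_sqrt_mult)
 have step: "energy (lam * ta) ta (?u n) (?u (Suc n)) (?v (Suc n))
   <= tht * energy (lam * ta) ta (?up n) (?u n) (?v n) + (norm (x_error ta n om))^2 / wg + (norm (y_error ta tht n om))^2 / wfs" for n
 proof -
  define y' p where "y' = snd (snd (s (Suc n)))" and "p = prox ta g (fst (s n) - ta *. KT y')"
  define q where "q = drift_part ta n om"
  define Y' where "Y' = Y (real (Suc n) * ta) om"
  have y': "y' = prox (lam * ta) (convex_conjugate f) (snd (snd (s n)) + (lam * ta) *. K (fst (snd (s n))))"
   by (simp add: y'_def sn Let_def)
  have x': "fst (s (Suc n)) = p + sqrt (2 * ta) *. noise ta om n"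
   unfolding p_def y' by (simp add: sn Let_def)
  have pq: "?u (Suc n) = p - q"
   unfolding x' noise_eq q_def drift_part_def by simp
  have yy: "?v (Suc n) = y' - Y'" by (simp add: y'_def Y'_def)
  have pe: "p + ta *. grad g p = fst (s n) - ta *. KT y'" unfolding p_def by (rule prox_g_eqn[OF ta])
  have ye: "y' + (lam * ta) *. gfs y' = snd (snd (s n)) + (lam * ta) *. K (fst (snd (s n)))"
   unfolding y' by (rule prox_fs_eqn[OF si])
  have qe: "q + ta *. grad g q + ta *. KT Y' = X (real n * ta) om + ta *. x_error ta n om + (ta *. grad g q - ta *. grad g q)"
   using ta by (simp add: x_error_def q_def Y'_def scaleR_add_right)
  have Ye: "Y' + (lam * ta) *. gfs Y' - (lam * ta) *. K (extrapolated ta tht n om) = Y (real n * ta) om + (lam * ta) *. y_error ta tht n om"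
  proof -
   have "lam * ta * inverse (lam * ta) = 1" using lam ta by (intro right_inverse) simp
   thus ?thesis by (simp add: y_error_def Y'_def scaleR_add_right scaleR_diff_right del: inverse_mult_distrib)
  qed
  have kx: "K (fst (snd (s n))) - K (extrapolated ta tht n om) = K (?u n + tht *. (?u n - ?up n))"
   unfolding ext[symmetric] by (simp add: linear_diff[OF linear_K])
  show ?thesis unfolding pq yy
  proof (rule energy_step[OF ta si tht st th])
   have "(p - q) + ta *. (grad g p - grad g q) + ta *. KT (y' - Y')
     = (p + ta *. grad g p) + ta *. KT y' - (q + ta *. grad g q + ta *. KT Y')"
    by (simp add: linear_diff[OF linear_KT] algebra_simps)
   also have "... = ?u n - ta *. x_error ta n om" unfolding pe qe by simp
   finally show "(p - q) + ta *. (grad g p - grad g q) + ta *. KT (y' - Y') = ?u n - ta *. x_error ta n om" .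
   have "(y' - Y') + (lam * ta) *. (gfs y' - gfs Y') - (lam * ta) *. K (?u n + tht *. (?u n - ?up n))
    = (y' + (lam * ta) *. gfs y') - (lam * ta) *. K (fst (snd (s n)))
     - (Y' + (lam * ta) *. gfs Y' - (lam * ta) *. K (extrapolated ta tht n om))"
    unfolding kx[symmetric] by (simp add: algebra_simps)
   also have "... = ?v n - (lam * ta) *. y_error ta tht n om" unfolding ye Ye by simp
   finally show "(y' - Y') + (lam * ta) *. (gfs y' - gfs Y') - (lam * ta) *. K (?u n + tht *. (?u n - ?up n))
    = ?v n - (lam * ta) *. y_error ta tht n om" .
  qed
 qed
 show "?E n <= tht ^ n * energy (lam * ta) ta (fst z - X 0 om) (fst z - X 0 om) (snd z - Y 0 om) + ?S n"
 proof (induction n)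
  case 0
  show ?case by (simp add: s0)
 next
  case (Suc n)
  let ?e = "(norm (x_error ta n om))^2 / wg + (norm (y_error ta tht n om))^2 / wfs"
  have "?E (Suc n) <= tht * ?E n + ?e" using step[of n] by simp
  also have "tht * ?E n <= tht * (tht ^ n * energy (lam * ta) ta (fst z - X 0 om) (fst z - X 0 om) (snd z - Y 0 om) + ?S n)"
   using tht by (intro mult_left_mono Suc) auto
  finally have "?E (Suc n) <= tht ^ Suc n * energy (lam * ta) ta (fst z - X 0 om) (fst z - X 0 om) (snd z - Y 0 om) + (tht * ?S n + ?e)"
   by (simp add: distrib_left mult.assoc)
  also have "tht * ?S n + ?e = ?S (Suc n)"
  proof -
   have "tht ^ (Suc n - Suc k) = tht * tht ^ (n - Suc k)" if "k < n" for k
    using that by (simp add: Suc_diff_Suc flip: power_Suc)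
   hence "(\<Sum>k<n. tht * tht ^ (n - Suc k) * e k) = (\<Sum>k<n. tht ^ (Suc n - Suc k) * e k)" for e :: "nat => real"
    by (intro sum.cong) auto
   thus ?thesis by (simp add: sum_distrib_left mult.assoc del: diff_Suc_Suc)
  qed
  finally show ?case .
 qed
qed

lemma geometric_sum_le: "0 <= tht ==> tht < 1 ==> (\<Sum>k<n. tht ^ (n - Suc k)) <= 1 / (1 - tht :: real)"
proof -
 assume th: "0 <= tht" "tht < 1"
 have "(\<Sum>k<n. tht ^ (n - Suc k)) = (\<Sum>k<n. tht ^ k)" by (rule sum.nat_diff_reindex)
 also have "... = (1 - tht ^ n) / (1 - tht)" using th by (simp add: sum_gp_strict)
 also have "... <= 1 / (1 - tht)" using th by (intro divide_right_mono) auto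
 finally show ?thesis .
qed

lemma position_error_along_path:
 fixes z :: "(real ^ 'b) \<times> (real ^ 'a)" and om :: 'w
 assumes ta: "ta > 0" and tht: "tht > 0" "tht < 1" and st: "tht * (lam * ta) * ta * L^2 <= 1"
  and th: "inverse (1 + wg * ta) <= tht" "inverse (1 + wfs * (lam * ta)) <= tht"
 shows "(norm (fst (pd_iterate f g K (lam * ta) ta tht z (noise ta om) n) - X (real n * ta) om))^2
   <= tht ^ n * ((norm (fst z - X 0 om))^2 + weight ta * (norm (snd z - Y 0 om))^2)
    + (\<Sum>k<n. ta * tht ^ (n - Suc k) * (1 / wg * (norm (x_error ta k om))^2 + 1 / wfs * (norm (y_error ta tht k om))^2))"
proof -
 have si: "lam * ta > 0" using lam ta by simp
 define c where "c = ta / (1 + wg * ta)"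
 have pg: "1 + wg * ta > 0" "1 + wfs * (lam * ta) > 0" using wg wfs ta si by (simp_all add: add_pos_pos)
 have c: "0 < c" "c <= ta" using ta pg wg by (auto simp: c_def field_simps)
 let ?u = "fst (pd_iterate f g K (lam * ta) ta tht z (noise ta om) n) - X (real n * ta) om"
 let ?e = "%k. (norm (x_error ta k om))^2 / wg + (norm (y_error ta tht k om))^2 / wfs"
 let ?E0 = "energy (lam * ta) ta (fst z - X 0 om) (fst z - X 0 om) (snd z - Y 0 om)"
 have "(1 + wg * ta) / ta * (norm ?u)^2 <= tht ^ n * ?E0 + (\<Sum>k<n. tht ^ (n - Suc k) * ?e k)"
  by (rule order_trans[OF energy_ge[OF ta si tht(1) st th(2)] energy_along_path(1)[OF ta tht(1) st th]])
 hence "c * ((1 + wg * ta) / ta * (norm ?u)^2) <= c * (tht ^ n * ?E0 + (\<Sum>k<n. tht ^ (n - Suc k) * ?e k))"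
  using c by (intro mult_left_mono) auto
 also have "c * ((1 + wg * ta) / ta * (norm ?u)^2) = (norm ?u)^2" using ta pg by (simp add: c_def)
 also have "c * (tht ^ n * ?E0 + (\<Sum>k<n. tht ^ (n - Suc k) * ?e k))
   = tht ^ n * (c * ?E0) + c * (\<Sum>k<n. tht ^ (n - Suc k) * ?e k)" by (simp add: algebra_simps)
 also have "c * ?E0 = (norm (fst z - X 0 om))^2 + weight ta * (norm (snd z - Y 0 om))^2"
 proof -
  have "c * ((1 + wg * ta) / ta) = 1" using ta pg by (simp add: c_def)
  moreover have "c * ((1 + wfs * (lam * ta)) / (lam * ta)) = weight ta"
  proof -
   have "ta / a * (b / (lam * ta)) = inverse (a / b * lam)" if "a > 0" "b > 0" for a b :: real
    using that ta lam by (simp add: field_simps)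
   from this[OF pg] show ?thesis by (simp add: c_def weight_def)
  qed
  moreover have "K 0 = 0" using linear_0[OF linear_K] .
  ultimately show ?thesis
  proof -
   let ?G = "(1 + wg * ta) / ta" and ?H = "(1 + wfs * (lam * ta)) / (lam * ta)"
   assume GH: "c * ?G = 1" "c * ?H = weight ta" and K0: "K 0 = 0"
   have E: "?E0 = ?G * (norm (fst z - X 0 om))^2 + ?H * (norm (snd z - Y 0 om))^2"
    unfolding energy_def by (simp add: K0)
   have "c * (G * a + H * b) = (c * G) * a + (c * H) * b" for G H a b by (simp add: distrib_left)
   from this[of ?G _ ?H] show ?thesis unfolding E GH by simp
  qed
 qed
 also have "c * (\<Sum>k<n. tht ^ (n - Suc k) * ?e k) <= ta * (\<Sum>k<n. tht ^ (n - Suc k) * ?e k)"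
  using c tht wg wfs by (intro mult_right_mono sum_nonneg mult_nonneg_nonneg add_nonneg_nonneg) auto
 finally show ?thesis by (simp add: sum_distrib_left mult.assoc)
qed

lemma error_moment:
 assumes ta: "ta > 0" and tht: "tht > 0" "tht < 1"
 shows "NN M (%om. 1 / wg * (norm (x_error ta k om))^2 + 1 / wfs * (norm (y_error ta tht k om))^2)
   <= ennreal (err_A tht * ta + err_B * ta^2)"
proof -
 have [measurable]: "x_error ta k : bmeas M" "y_error ta tht k : bmeas M"
  by (rule measurable_grid[OF ta])+
 let ?d = "real CARD('b)"
 have "NN M (%om. 1 / wg * (norm (x_error ta k om))^2 + 1 / wfs * (norm (y_error ta tht k om))^2)
  <= ennreal (1 / wg * (4 * Lg^2 * (ta * ?d) + (4 * Lg^2 * (ta^2 * D4) + 4 * L^2 * (ta^2 * D4)))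
   + 1 / wfs * (6 * L^2 * (ta * ?d) + (6 * L^2 * tht^2 * (ta * ?d)
    + (9 / wf^2 * (ta^2 * D4) + (9 * L^2 * (ta^2 * D4) + 9 * L^2 * (ta^2 * D4))))))"
  using wg wfs ta D4 tht
  by (intro nn_integral_add_le nn_integral_cmult_le x_error_moment y_error_moment) (auto intro!: add_nonneg_nonneg)
 also have "... <= ennreal (err_A tht * ta + err_B * ta^2)"
 proof (rule ennreal_leI)
  have "6 * L^2 * tht^2 * (ta * ?d) <= 12 * L^2 * tht^2 * (ta * ?d)" using ta by (intro mult_right_mono) auto
  hence "1 / wfs * (6 * L^2 * (ta * ?d) + (6 * L^2 * tht^2 * (ta * ?d)
    + (9 / wf^2 * (ta^2 * D4) + (9 * L^2 * (ta^2 * D4) + 9 * L^2 * (ta^2 * D4)))))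
   <= 1 / wfs * (6 * L^2 * (ta * ?d) + (12 * L^2 * tht^2 * (ta * ?d)
    + (9 / wf^2 * (ta^2 * D4) + (9 * L^2 * (ta^2 * D4) + 9 * L^2 * (ta^2 * D4)))))"
   using wfs by (intro mult_left_mono) auto
  also have "1 / wg * (4 * Lg^2 * (ta * ?d) + (4 * Lg^2 * (ta^2 * D4) + 4 * L^2 * (ta^2 * D4))) + ...
    = err_A tht * ta + err_B * ta^2"
   by (simp add: err_A_def err_B_def algebra_simps add_divide_distrib)
  finally show "1 / wg * (4 * Lg^2 * (ta * ?d) + (4 * Lg^2 * (ta^2 * D4) + 4 * L^2 * (ta^2 * D4)))
   + 1 / wfs * (6 * L^2 * (ta * ?d) + (6 * L^2 * tht^2 * (ta * ?d)
    + (9 / wf^2 * (ta^2 * D4) + (9 * L^2 * (ta^2 * D4) + 9 * L^2 * (ta^2 * D4)))))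
   <= err_A tht * ta + err_B * ta^2" by simp
 qed
 finally show ?thesis .
qed

lemma err_nonneg: "err_A tht >= 0" "err_B >= 0"
 using wg wfs D4 by (auto simp: err_A_def err_B_def)

lemma weight_nonneg: "ta > 0 ==> weight ta >= 0"
 unfolding weight_def using wg wfs lam by (auto intro!: mult_nonneg_nonneg divide_nonneg_nonneg add_nonneg_nonneg)

lemma discretisation_coupling:
 assumes ta: "ta > 0" and tht: "tht > 0" "tht < 1" and st: "tht * (lam * ta) * ta * L^2 <= 1"
  and th: "inverse (1 + wg * ta) <= tht" "inverse (1 + wfs * (lam * ta)) <= tht"
  and pp0: "prob_distribution pp0" and P: "P : couplings pp0 pp"
  and cost: "(\<integral>\<^sup>+ ((x, y), (x', y')). ennreal (1 * (norm (x - x'))^2 + weight ta * (norm (y - y'))^2) \<partial>P) <= ennreal (t^2)"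
  and de: "de > 0"
 shows "\<exists>R :: ((((real ^ 'b) \<times> (real ^ 'a)) \<times> ((real ^ 'b) \<times> (real ^ 'a))) \<times> 'w) measure. \<exists>x' x.
   prob_space R \<and> x' : bmeas R \<and> x : bmeas R \<and>
   distr R borel x' = x_marginal (pd_law f g K (lam * ta) ta tht pp0 N) \<and> distr R borel x = x_marginal pp \<and>
   (NN R (%om. (norm (x' om - x om))^2))
    <= ennreal (tht ^ N * (t^2 + de) + ta / (1 - tht) * (err_A tht * ta + err_B * ta^2))"
proof -
 have si: "lam * ta > 0" using lam ta by simp
 let ?S = "\<Pi>\<^sub>M k\<in>(UNIV::nat set). borel :: (real ^ 'b) measure"
 let ?Q = "\<Pi>\<^sub>M k\<in>(UNIV::nat set). gaussian 1 :: (real ^ 'b) measure"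
 define w where "w = weight ta"
 have w: "w >= 0" using weight_nonneg[OF ta] by (simp add: w_def)
 have s0: "sets pp0 = sets borel" using pp0 by (simp add: prob_distribution_def)
 note Pp = couplingsD[OF P s0 sets_pp]
 note [measurable_cong] = Pp(2)
 interpret PP: prob_space P by (rule Pp)
 have [measurable]: "fst : bmeas P" "snd : bmeas P"
  by (simp_all add: measurable_cong_sets[OF Pp(2) refl] borel_measurable_fst_snd)
 note [measurable] = measurable_noise[OF ta]
 have mZ0: "Z 0 : bmeas M" by simp
 \<comment> \<open>the tolerance that a gluing error costs\<close>
 define s where "s = de / (2 * (t^2 + 1))"
 have s: "s > 0" using de by (simp add: s_def add_nonneg_pos)
 define c where "c = (1 + 1 / s) * (1 + w)"
 have c: "c > 0" using s w by (simp add: c_def add_pos_nonneg)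
 define ep where "ep = sqrt (de / (2 * c))"
 have ep: "ep > 0" "ep^2 = de / (2 * c)" using de c by (auto simp: ep_def)
 have "\<exists>R. prob_space R \<and> sets R = sets (P >< M) \<and> distr R P fst = P \<and> distr R M snd = M \<and>
   (AE (n, om) in R. dist (snd n) (Z 0 om) < ep) \<and>
   distr R (P >< ?S) (%(n, om). (n, noise ta om)) = P >< distr M ?S (noise ta)"
 proof (rule approximate_gluing[OF Pp(1) prob_space_M ep(1)])
  show "distr P borel snd = distr M borel (Z 0)" using Pp law[of 0] by simp
  show "distr M (borel >< ?S) (%om. (Z 0 om, noise ta om)) = distr M borel (Z 0) >< distr M ?S (noise ta)"
   by (rule indep_noise[OF ta])
  show "Z 0 : bmeas M" by (rule mZ0)
 qed measurable
 then obtain R where R: "prob_space R" and [measurable_cong]: "sets R = sets (P >< M)"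
  and R1: "distr R P fst = P" and R2: "distr R M snd = M"
  and Rd: "AE (n, om) in R. dist (snd n) (Z 0 om) < ep"
  and RW: "distr R (P >< ?S) (%(n, om). (n, noise ta om)) = P >< distr M ?S (noise ta)" by blast
 interpret R: prob_space R by fact
 define it where "it z xi = fst (pd_iterate f g K (lam * ta) ta tht z xi N)" for z xi
 have itm0: "(%p. pd_iterate f g K (lam * ta) ta tht (fst p) (snd p) N) : bmeas (borel >< ?S)"
  using measurable_pd_iterate[OF ta si, of tht N] by (simp add: case_prod_unfold)
 have itm: "(%p. it (fst p) (snd p)) : bmeas (borel >< ?S)"
  unfolding it_def by (rule measurable_compose[OF itm0]) measurable
 define x' where "x' p = it (fst (fst p)) (noise ta (snd p))" for p :: "(((real ^ 'b) \<times> (real ^ 'a)) \<times> ((real ^ 'b) \<times> (real ^ 'a))) \<times> 'w"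
 define x where "x p = X (real N * ta) (snd p)" for p :: "(((real ^ 'b) \<times> (real ^ 'a)) \<times> ((real ^ 'b) \<times> (real ^ 'a))) \<times> 'w"
 have XN[measurable]: "X (real N * ta) : bmeas M" using ta by simp
 have x: "x : bmeas R" unfolding x_def by measurable
 have m1: "(%p. (fst (fst p), noise ta (snd p))) : R \<rightarrow>\<^sub>M borel >< ?S" by measurable
 have x': "x' : bmeas R" unfolding x'_def using measurable_compose[OF m1 itm] by simp
 have lx: "distr R borel x = x_marginal pp"
 proof -
  have "distr R borel x = distr (distr R M snd) borel (X (real N * ta))"
   by (subst distr_distr) (auto simp: comp_def x_def[abs_def])
  also have "... = distr (distr M borel (Z (real N * ta))) borel fst"
   unfolding R2 using ta by (subst distr_distr) (auto simp: comp_def)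
  finally show ?thesis using law[of "real N * ta"] ta by (simp add: x_marginal_def)
 qed
 have lx': "distr R borel x' = x_marginal (pd_law f g K (lam * ta) ta tht pp0 N)"
 proof -
  have fm: "(%(n, xi). (fst n, xi)) : P >< ?Q \<rightarrow>\<^sub>M pp0 >< ?Q"
   unfolding measurable_cong_sets[OF refl sets_pair_measure_cong[OF s0 refl]] by measurable
  have "pp0 >< ?Q = distr P pp0 fst >< distr ?Q ?Q (%xi. xi)"
   using Pp(3) distr_sets_cong[OF s0, of P fst] by simp
  also have "... = distr (P >< ?Q) (pp0 >< ?Q) (%(n, xi). (fst n, xi))"
  proof (rule pair_measure_distr)
   interpret Q: product_prob_space "%_::nat. gaussian 1 :: (real ^ 'b) measure" UNIV
    by (rule product_prob_spaceI) (simp add: prob_space_gaussian)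
   have "prob_space ?Q" by (rule prob_space_PiM) (simp add: prob_space_gaussian)
   thus "sigma_finite_measure (distr ?Q ?Q (%xi. xi))" by (simp add: prob_space_imp_sigma_finite)
   show "fst : P \<rightarrow>\<^sub>M pp0" by (subst measurable_cong_sets[OF refl s0]) measurable
  qed simp
  finally have pp0Q: "pp0 >< ?Q = distr (P >< ?Q) (pp0 >< ?Q) (%(n, xi). (fst n, xi))" .
  have sQ: "sets ?Q = sets ?S" by (rule sets_PiM_cong) auto
  have sc: "sets (pp0 >< ?Q) = sets (borel >< ?S)" by (rule sets_pair_measure_cong[OF s0 sQ])
  have pm: "(%(z, xi). case pd_iterate f g K (lam * ta) ta tht z xi N of (x, xtht, y) => (x, y)) : bmeas (pp0 >< ?Q)"
   unfolding measurable_cong_sets[OF sc refl] case_prod_unfold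
   by (intro borel_measurable_Pair measurable_compose[OF itm0]) measurable
  have itm': "(%p. it (fst p) (snd p)) : bmeas (pp0 >< ?Q)"
   unfolding measurable_cong_sets[OF sc refl] by (rule itm)
  have "x_marginal (pd_law f g K (lam * ta) ta tht pp0 N) = distr (pp0 >< ?Q) borel (%p. it (fst p) (snd p))"
   unfolding x_marginal_def pd_law_def
   by (subst distr_distr[OF _ pm]) (auto simp: comp_def case_prod_unfold it_def)
  also have "... = distr (P >< ?Q) borel (%p. it (fst (fst p)) (snd p))"
   by (subst pp0Q, subst distr_distr[OF itm' fm]) (simp add: comp_def case_prod_unfold)
  also have "P >< ?Q = distr R (P >< ?S) (%(n, om). (n, noise ta om))"
   unfolding RW noise_law[OF ta] ..
  also have "distr ... borel (%p. it (fst (fst p)) (snd p)) = distr R borel x'"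
  proof (subst distr_distr)
   have "(%p. (fst (fst p), snd p)) : P >< ?S \<rightarrow>\<^sub>M borel >< ?S" by measurable
   from measurable_compose[OF this itm]
   show "(%p. it (fst (fst p)) (snd p)) : bmeas (P >< ?S)" by simp
  qed (auto simp: comp_def case_prod_unfold x'_def[abs_def])
  finally show ?thesis ..
 qed
 let ?e = "%k p. 1 / wg * (norm (x_error ta k (snd p)))^2 + 1 / wfs * (norm (y_error ta tht k (snd p)))^2"
 let ?B = "err_A tht * ta + err_B * ta^2"
 have B0: "?B >= 0" using err_nonneg ta by simp
 note [measurable] = measurable_grid[OF ta]
 have em[measurable]: "(%p. ?e k p) : bmeas R" for k
 proof -
  have "(%om. 1 / wg * (norm (x_error ta k om))^2 + 1 / wfs * (norm (y_error ta tht k om))^2) : bmeas M" by measurable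
  from measurable_compose[OF _ this, of snd R] show ?thesis by simp
 qed
 have eB: "NN R (%p. ?e k p) <= ennreal ?B" for k
 proof -
  have "NN R (%p. ?e k p)
   = NN (distr R M snd) (%om. 1 / wg * (norm (x_error ta k om))^2 + 1 / wfs * (norm (y_error ta tht k om))^2)"
   by (subst nn_integral_distr) auto
  thus ?thesis unfolding R2 using error_moment[OF ta tht] by simp
 qed
 let ?c0 = "%p. (norm (fst (fst (fst p)) - fst (snd (fst p))))^2 + w * (norm (snd (fst (fst p)) - snd (snd (fst p))))^2"
 have c0m[measurable]: "?c0 : bmeas R" by measurable
 have c0: "NN R (%p. ?c0 p) <= ennreal (t^2)"
 proof -
  have "NN R (%p. ?c0 p)
    = NN (distr R P fst) (%n. (norm (fst (fst n) - fst (snd n)))^2 + w * (norm (snd (fst n) - snd (snd n)))^2)"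
   by (subst nn_integral_distr) auto
  thus ?thesis unfolding R1 using cost by (simp add: w_def case_prod_unfold)
 qed
 have "NN R (%p. (norm (x' p - x p))^2)
   <= NN R (%p. tht ^ N * ((1 + s) * ?c0 p + c * ep^2) + (\<Sum>k<N. ta * tht ^ (N - Suc k) * ?e k p))"
 proof (rule nn_integral_mono_AE, use Rd in eventually_elim)
  case (elim p)
  obtain x0 y0 x1 y1 om where p: "p = (((x0, y0), (x1, y1)), om)" by (metis prod.collapse)
  have d: "dist (x1, y1) (Z 0 om) < ep" using elim by (simp add: p)
  have dx: "norm (x1 - X 0 om) <= ep" and dy: "norm (y1 - Y 0 om) <= ep"
   using d dist_fst_le[of "(x1, y1)" "Z 0 om"] dist_snd_le[of "(x1, y1)" "Z 0 om"] by (auto simp: dist_norm)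
  have q: "(norm (a - b'))^2 <= (1 + s) * (norm (a - b))^2 + (1 + 1 / s) * ep^2" if "norm (b - b') <= ep"
   for a b b' :: "'z::real_normed_vector"
  proof -
   have "norm (a - b') <= norm (a - b) + ep" using norm_triangle_ineq[of "a - b" "b - b'"] that by simp
   hence "(norm (a - b'))^2 <= (norm (a - b) + ep)^2" by (intro power_mono) auto
   also have "... <= (1 + s) * (norm (a - b))^2 + (1 + 1 / s) * ep^2" by (rule square_perturb_le[OF s])
   finally show ?thesis .
  qed
  have "(norm (x0 - X 0 om))^2 + w * (norm (y0 - Y 0 om))^2
    <= ((1 + s) * (norm (x0 - x1))^2 + (1 + 1 / s) * ep^2) + w * ((1 + s) * (norm (y0 - y1))^2 + (1 + 1 / s) * ep^2)"
   by (intro add_mono mult_left_mono q dx dy w)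
  also have "... = (1 + s) * ?c0 p + c * ep^2" by (simp add: p c_def algebra_simps add_divide_distrib)
  finally have 1: "(norm (x0 - X 0 om))^2 + w * (norm (y0 - Y 0 om))^2 <= (1 + s) * ?c0 p + c * ep^2" .
  have "(norm (x' p - x p))^2 <= tht ^ N * ((norm (x0 - X 0 om))^2 + w * (norm (y0 - Y 0 om))^2) + (\<Sum>k<N. ta * tht ^ (N - Suc k) * ?e k p)"
   using position_error_along_path[OF ta tht st th, of "(x0, y0)" om N] by (simp add: x'_def x_def p it_def w_def)
  also have "... <= tht ^ N * ((1 + s) * ?c0 p + c * ep^2) + (\<Sum>k<N. ta * tht ^ (N - Suc k) * ?e k p)"
   using tht by (intro add_mono mult_left_mono 1 order_refl) auto
  finally show ?case by (rule ennreal_leI)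
 qed
 also have "... <= ennreal (tht ^ N * ((1 + s) * t^2 + c * ep^2) + (\<Sum>k<N. ta * tht ^ (N - Suc k) * ?B))"
 proof (rule nn_integral_add_le)
  show "NN R (%p. tht ^ N * ((1 + s) * ?c0 p + c * ep^2)) <= ennreal (tht ^ N * ((1 + s) * t^2 + c * ep^2))"
  proof (intro nn_integral_cmult_le nn_integral_add_le c0)
  qed (use s c w tht in "auto simp: R.emeasure_space_1")
  show "NN R (%p. \<Sum>k<N. ta * tht ^ (N - Suc k) * ?e k p) <= ennreal (\<Sum>k<N. ta * tht ^ (N - Suc k) * ?B)"
  proof (induction N arbitrary: N rule: nat_induct)
   fix N0 :: nat
   have "NN R (%p. \<Sum>k<m. ta * tht ^ (N0 - Suc k) * ?e k p) <= ennreal (\<Sum>k<m. ta * tht ^ (N0 - Suc k) * ?B)" for m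
   proof (induction m)
    case (Suc m)
    show ?case unfolding sum.lessThan_Suc
     by (rule nn_integral_add_le[OF _ _ _ _ _ _ Suc nn_integral_cmult_le[OF em _ eB]])
       (use ta tht wg wfs B0 in "auto intro!: sum_nonneg mult_nonneg_nonneg add_nonneg_nonneg borel_measurable_sum borel_measurable_times em")
   qed simp
   thus "NN R (%p. \<Sum>k<N0. ta * tht ^ (N0 - Suc k) * ?e k p) <= ennreal (\<Sum>k<N0. ta * tht ^ (N0 - Suc k) * ?B)" .
  qed
 qed (use ta tht wg wfs s c w B0 in "auto intro!: sum_nonneg mult_nonneg_nonneg add_nonneg_nonneg borel_measurable_sum borel_measurable_times em")
 also have "... <= ennreal (tht ^ N * (t^2 + de) + ta / (1 - tht) * ?B)"
 proof (rule ennreal_leI, rule add_mono, rule mult_left_mono)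
  have "s * t^2 <= de / 2" using de by (simp add: s_def field_simps add_pos_nonneg)
  moreover have "c * ep^2 = de / 2" using c by (simp add: ep)
  ultimately show "(1 + s) * t^2 + c * ep^2 <= t^2 + de" by (simp add: distrib_right)
  have "(\<Sum>k<N. ta * tht ^ (N - Suc k) * ?B) = ta * (\<Sum>k<N. tht ^ (N - Suc k)) * ?B"
   by (simp add: sum_distrib_left sum_distrib_right)
  also have "... <= ta * (1 / (1 - tht)) * ?B"
   using ta tht B0 geometric_sum_le[of tht N] by (intro mult_right_mono mult_left_mono) auto
  finally show "(\<Sum>k<N. ta * tht ^ (N - Suc k) * ?B) <= ta / (1 - tht) * ?B" by simp
 qed (use tht in auto)
 finally show ?thesis using R x x' lx lx' by blast
qed

end

lemma wasserstein2_le':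
 fixes mu nu :: "'a::euclidean_space measure"
 assumes c: "c >= 0" "r = sqrt c" and sets: "sets mu = sets borel" "sets nu = sets borel"
  and R: "\<And>de. de > 0 ==> \<exists>R :: 'w measure. \<exists>X Y. prob_space R \<and> X : bmeas R \<and> Y : bmeas R \<and>
    distr R borel X = mu \<and> distr R borel Y = nu \<and>
    (NN R (%om. (norm (X om - Y om))^2)) <= ennreal (c + de)"
 shows "wasserstein2 mu nu <= ennreal r"
 using c R by (intro wasserstein2_le sets) auto

lemma (in pd_stationary_process) discretisation_wasserstein:
 assumes ta: "ta > 0" and tht: "tht > 0" "tht < 1" and st: "tht * (lam * ta) * ta * L^2 <= 1"
  and th: "inverse (1 + wg * ta) <= tht" "inverse (1 + wfs * (lam * ta)) <= tht"
  and pp0: "prob_distribution pp0"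
 shows "wasserstein2 (x_marginal (pd_law f g K (lam * ta) ta tht pp0 N)) (x_marginal pp)
  <= ennreal (tht powr (real N / 2)) * transport_dist 1 (weight ta) pp0 pp
   + ennreal (sqrt (ta / (1 - tht) * (err_A tht * ta + err_B * ta^2)))"
proof (cases "transport_dist 1 (weight ta) pp0 pp = \<infinity>")
 case True
 thus ?thesis using tht by (simp add: ennreal_mult_top)
next
 case False
 then obtain T where T: "T >= 0" "transport_dist 1 (weight ta) pp0 pp = ennreal T"
  by (metis ennreal_cases infinity_ennreal_def)
 define c where "c = ta / (1 - tht) * (err_A tht * ta + err_B * ta^2)"
 have c: "c >= 0" using ta tht err_nonneg by (simp add: c_def)
 define k where "k = tht powr (real N / 2)"
 have k: "k > 0" "k <= 1" using tht by (auto simp: k_def powr_le1)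
 have k2: "k^2 = tht ^ N"
 proof -
  have "k^2 = tht powr (real N / 2 + real N / 2)" unfolding k_def power2_eq_square using tht by (simp only: powr_add)
  thus ?thesis using tht by (simp add: powr_realpow)
 qed
 have "wasserstein2 (x_marginal (pd_law f g K (lam * ta) ta tht pp0 N)) (x_marginal pp) <= ennreal (k * T + sqrt c)"
 proof (rule ennreal_le_epsilon)
  fix e :: real assume e: "0 < e"
  have "(INF P\<in>couplings pp0 pp. ennreal_sqrt
   (\<integral>\<^sup>+ ((x, y), (x', y')). ennreal (1 * (norm (x - x'))^2 + weight ta * (norm (y - y'))^2) \<partial>P)) < ennreal (T + e)"
   using T e unfolding transport_dist_def by (simp add: ennreal_less_iff)
  from INF_ennreal_sqrt_less[OF this] obtain P where P: "P : couplings pp0 pp"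
   "(\<integral>\<^sup>+ ((x, y), (x', y')). ennreal (1 * (norm (x - x'))^2 + weight ta * (norm (y - y'))^2) \<partial>P) <= ennreal ((T + e)^2)"
   by blast
  have "wasserstein2 (x_marginal (pd_law f g K (lam * ta) ta tht pp0 N)) (x_marginal pp) <= ennreal (k * (T + e) + sqrt c)"
  proof (rule wasserstein2_le)
   show "0 <= k * (T + e) + sqrt c" using k T e c by simp
   fix de :: real assume de: "de > 0"
   have "ennreal (tht ^ N * ((T + e)^2 + de) + c) <= ennreal ((k * (T + e) + sqrt c)^2 + de)"
   proof (rule ennreal_leI)
    have "(k * (T + e) + sqrt c)^2 = k^2 * (T + e)^2 + c + 2 * (k * (T + e) * sqrt c)"
     using c by (simp add: power2_sum power_mult_distrib)
    moreover have "k * (T + e) * sqrt c >= 0" using k T e c by simp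
    moreover have "tht ^ N * de <= de" using tht de by (simp add: power_le_one mult_left_le_one_le)
    ultimately show "tht ^ N * ((T + e)^2 + de) + c <= (k * (T + e) + sqrt c)^2 + de"
     by (simp add: k2 distrib_left)
   qed
   with discretisation_coupling[OF ta tht st th pp0 P de, of N]
   show "\<exists>R :: ((((real ^ 'b) \<times> (real ^ 'a)) \<times> ((real ^ 'b) \<times> (real ^ 'a))) \<times> 'w) measure. \<exists>X Y.
     prob_space R \<and> X : bmeas R \<and> Y : bmeas R \<and>
     distr R borel X = x_marginal (pd_law f g K (lam * ta) ta tht pp0 N) \<and> distr R borel Y = x_marginal pp \<and>
     (NN R (%om. (norm (X om - Y om))^2)) <= ennreal ((k * (T + e) + sqrt c)^2 + de)"
    unfolding c_def by (meson order_trans)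
  qed (simp_all add: x_marginal_def)
  also have "... <= ennreal (k * T + sqrt c + e)"
   using k e by (intro ennreal_leI) (simp add: distrib_left)
  also have "... = ennreal (k * T + sqrt c) + ennreal e"
   using k T c e by (intro ennreal_plus) auto
  finally show "wasserstein2 (x_marginal (pd_law f g K (lam * ta) ta tht pp0 N)) (x_marginal pp) <= ennreal (k * T + sqrt c) + ennreal e" .
 qed
 also have "... = ennreal k * ennreal T + ennreal (sqrt c)"
  using k T c by (simp add: ennreal_mult')
 finally show ?thesis unfolding T k_def c_def .
qed

section \<open>Randomised choice\<close>

abbreviation "unit_uniform \<equiv> uniform_measure lborel {0..1::real}"

lemma prob_space_unit_uniform: "prob_space unit_uniform"
 by (rule prob_space_uniform_measure) auto

lemma nn_integral_randomised_choice:
 assumes S: "prob_space S" and a[measurable]: "a : bmeas S" and a01: "\<And>s. 0 <= a s \<and> a s <= 1"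
  and [measurable]: "F : bmeas S" "G : bmeas S"
 shows "(NI (S >< unit_uniform) (%p. (if snd p <= a (fst p) then F (fst p) else G (fst p))))
   = (NI S (%s. ennreal (a s) * F s + ennreal (1 - a s) * G s))"
proof -
 interpret S: prob_space S by fact
 interpret U: prob_space unit_uniform by (rule prob_space_unit_uniform)
 have "(NI (S >< unit_uniform) (%p. (if snd p <= a (fst p) then F (fst p) else G (fst p))))
   = (\<integral>\<^sup>+ s. \<integral>\<^sup>+ u. (if u <= a s then F s else G s) \<partial>unit_uniform \<partial>S)"
  by (subst U.nn_integral_fst[symmetric]) (simp_all cong: if_cong)
 also have "... = (NI S (%s. ennreal (a s) * F s + ennreal (1 - a s) * G s))"
 proof (rule nn_integral_cong)
  fix s
  have "(NI (unit_uniform) (%u. (if u <= a s then F s else G s)))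
    = (NI (unit_uniform) (%u. F s * indicator {..a s} u + G s * indicator {a s<..} u))"
   by (rule nn_integral_cong) (auto simp: indicator_def)
  also have "... = F s * emeasure unit_uniform {..a s} + G s * emeasure unit_uniform {a s<..}"
   by (simp add: nn_integral_add nn_integral_cmult)
  also have "emeasure unit_uniform {..a s} = ennreal (a s)"
  proof -
   have "{0..1} \<inter> {..a s} = {0..a s}" using a01[of s] by auto
   thus ?thesis using a01[of s] by (simp add: emeasure_uniform_measure divide_ennreal_def)
  qed
  also have "emeasure unit_uniform {a s<..} = ennreal (1 - a s)"
  proof -
   have "{0..1} \<inter> {a s<..} = {a s<..1}" using a01[of s] by auto
   thus ?thesis using a01[of s] by (simp add: emeasure_uniform_measure divide_ennreal_def)
  qed
  finally show "(NI (unit_uniform) (%u. (if u <= a s then F s else G s))) = ennreal (a s) * F s + ennreal (1 - a s) * G s"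
   by (simp add: mult.commute)
 qed
 finally show ?thesis .
qed

definition gauss_dens :: "real => real ^ 'd => real" where
 "gauss_dens v x = (\<Prod>i\<in>UNIV. normal_density 0 (sqrt v) (x $ i))"

lemma gaussian_eq_density: "gaussian v = density lborel (%x. ennreal (gauss_dens v x))"
 unfolding gaussian_def gauss_dens_def ..

lemma borel_gauss_dens [measurable]: "gauss_dens v : bmeas borel"
 unfolding gauss_dens_def[abs_def] by measurable

lemma distr_eqI:
 assumes "X : bmeas R" "sets ka = sets borel"
  and "\<And>A. A : sets borel ==> (NI R (%om. indicator A (X om))) = emeasure ka A"
 shows "distr R borel X = ka"
proof (rule measure_eqI)
 show "sets (distr R borel X) = sets ka" using assms by simp
 fix A assume "A : sets (distr R borel X)"
 hence [measurable]: "A : sets borel" by simp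
 have "emeasure (distr R borel X) A = (NI (distr R borel X) (%x. indicator A x))" by simp
 also have "... = (NI R (%om. indicator A (X om)))" using assms(1) by (subst nn_integral_distr) auto
 finally show "emeasure (distr R borel X) A = emeasure ka A" using assms(3) by simp
qed

lemma nn_integral_prod_fst:
 assumes "prob_space B" "h : bmeas A"
 shows "(NI (A >< B) (%p. h (fst p))) = (NI A (%a. h a))"
proof -
 interpret B: prob_space B by fact
 have "(NI (A >< B) (%p. h (fst p))) = (\<integral>\<^sup>+ a. \<integral>\<^sup>+ b. h a \<partial>B \<partial>A)"
  using assms(2) by (subst B.nn_integral_fst[symmetric]) auto
 thus ?thesis by (simp add: B.emeasure_space_1)
qed

section \<open>Convergence of the iteration\<close>

lemma measure_eqI_bounded_continuous:
 fixes mu nu :: "'a::metric_space measure"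
 assumes pd: "prob_distribution mu" "prob_distribution nu"
  and eq: "\<And>h :: 'a => real. continuous_on UNIV h ==> bounded (range h) ==> (LINT x|mu. h x) = (LINT x|nu. h x)"
 shows "mu = nu"
proof (rule measure_eqI_generator_eq[where E="{S. open S}" and \<Omega>=UNIV and A="%_. UNIV"])
 show "sets mu = sigma_sets UNIV {S. open S}" "sets nu = sigma_sets UNIV {S. open S}"
  using pd by (auto simp: prob_distribution_def borel_def)
 interpret M: prob_space mu using pd by (simp add: prob_distribution_def)
 interpret N: prob_space nu using pd by (simp add: prob_distribution_def)
 show "emeasure mu UNIV ~= \<infinity>" by simp
 fix U :: "'a set" assume "U : {S. open S}"
 hence U: "open U" by simp
 show "emeasure mu U = emeasure nu U"
 proof (cases "U = UNIV")
  case True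
  have "space mu = UNIV" "space nu = UNIV" using pd sets_eq_imp_space_eq[of mu borel] sets_eq_imp_space_eq[of nu borel]
   by (auto simp: prob_distribution_def)
  thus ?thesis using M.emeasure_space_1 N.emeasure_space_1 True by simp
 next
  case False
  define h where "h n x = min 1 (real n * infdist x (- U))" for n x
  have h: "continuous_on UNIV (h n)" "\<bar>h n x\<bar> <= 1" "(%n. h n x) \<longlonglongrightarrow> indicator U x" for n x
  proof -
   show "continuous_on UNIV (h n)" unfolding h_def[abs_def] by (intro continuous_intros)
   show "\<bar>h n x\<bar> <= 1" using infdist_nonneg[of x "- U"] by (auto simp: h_def min_def)
   show "(%n. h n x) \<longlonglongrightarrow> indicator U x"
   proof (cases "x : U")
    case True
    have "closed (- U)" using U by (simp add: closed_def)
    hence p: "infdist x (- U) > 0" using True False in_closed_iff_infdist_zero[of "- U" x] infdist_nonneg[of x "- U"] by force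
    obtain k :: nat where k: "1 / infdist x (- U) < real k" using reals_Archimedean2 by blast
    have "h n x = 1" if "n >= k" for n
    proof -
     have "1 < real k * infdist x (- U)" using k p by (simp add: field_simps)
     also have "... <= real n * infdist x (- U)" using that p by (intro mult_right_mono) auto
     finally show ?thesis by (simp add: h_def)
    qed
    thus ?thesis using True by (intro tendsto_eventually eventually_sequentiallyI[of k]) auto
   qed (simp add: h_def)
  qed
  have lim: "(%n. LINT x|ka. h n x) \<longlonglongrightarrow> measure ka U" if k: "prob_distribution ka" for ka
  proof -
   interpret K: prob_space ka using k by (simp add: prob_distribution_def)
   have [measurable_cong]: "sets ka = sets borel" using k by (simp add: prob_distribution_def)
   have [measurable]: "h n : bmeas borel" for n by (rule borel_measurable_continuous_onI[OF h(1)])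
   have [measurable]: "U : sets borel" using U by simp
   have "(%n. LINT x|ka. h n x) \<longlonglongrightarrow> (LINT x|ka. indicator U x)"
    by (rule integral_dominated_convergence[where w="%_. 1"]) (use h in auto)
   thus ?thesis by simp
  qed
  have "(LINT x|mu. h n x) = (LINT x|nu. h n x)" for n
   using h(2) by (intro eq h(1)) (auto simp: bounded_iff)
  with lim[OF pd(2)] have "(%n. LINT x|mu. h n x) \<longlonglongrightarrow> measure nu U" by simp
  from LIMSEQ_unique[OF lim[OF pd(1)] this] have "measure mu U = measure nu U" .
  thus ?thesis by (simp add: M.emeasure_eq_measure N.emeasure_eq_measure)
 qed
qed (auto simp: Int_stable_def)

text \<open>A weighted Cauchy-Schwarz inequality turns geometric decay of the mean square increments into
 almost sure convergence, with a rate in mean square.\<close>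

lemma geometric_increments_converge:
 fixes B :: "nat => 'w => 'z::{euclidean_space}" and C q :: real
 assumes [measurable]: "\<And>n. B n : bmeas M" and q: "0 < q" "q < 1" and C: "C >= 0"
  and inc: "\<And>n. (NN M (%om. (norm (B (Suc n) om - B n om))^2)) <= ennreal (C * (q ^ n)^2)"
 shows "\<exists>X. X : bmeas M \<and> (AE om in M. (%n. B n om) \<longlonglongrightarrow> X om) \<and>
  (\<forall>n. (NN M (%om. (norm (X om - B n om))^2)) <= ennreal (q ^ n * (C / (1 - q)^2)))"
proof -
 define d where "d k om = (norm (B (Suc k) om - B k om))^2 / q ^ k" for k om
 have d0: "d k om >= 0" for k om using q by (simp add: d_def)
 have [measurable]: "d k : bmeas M" for k unfolding d_def[abs_def] by measurable
 define G where "G om = (\<Sum>k. ennreal (d k om))" for om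
 have EG: "(NI M (%om. G om)) <= ennreal (C / (1 - q))"
 proof -
  have "NN M (%om. d k om) <= ennreal (C * q ^ k)" for k
  proof -
   have "NN M (%om. 1 / q ^ k * (norm (B (Suc k) om - B k om))^2) <= ennreal (1 / q ^ k * (C * (q ^ k)^2))"
    using q inc[of k] by (intro nn_integral_cmult_le) auto
   moreover have "1 / q ^ k * (C * (q ^ k)^2) = C * q ^ k" using q by (simp add: power2_eq_square)
   ultimately show ?thesis by (simp add: d_def)
  qed
  hence "(NI M (%om. G om)) <= (\<Sum>k. ennreal (C * q ^ k))" unfolding G_def
   by (subst nn_integral_suminf) (auto intro!: suminf_le)
  also have "... = ennreal (\<Sum>k. C * q ^ k)" using q C by (intro suminf_ennreal2 summable_mult summable_geometric) auto
  also have "(\<Sum>k. C * q ^ k) = C / (1 - q)" using q by (subst suminf_mult) (auto simp: suminf_geometric summable_geometric)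
  finally show ?thesis .
 qed
 define X where "X om = lim (%n. B n om)" for om
 have X: "X : bmeas M" unfolding X_def[abs_def] by measurable
 have "(NI M (%om. G om)) ~= \<infinity>" using EG by (auto simp: top_unique)
 hence "AE om in M. G om ~= \<infinity>" unfolding G_def by (intro nn_integral_PInf_AE) auto
 hence conv: "AE om in M. (%n. B n om) \<longlonglongrightarrow> X om \<and> (\<forall>n. ennreal ((norm (X om - B n om))^2) <= ennreal (q ^ n / (1 - q)) * G om)"
 proof eventually_elim
  case (elim om)
  have sm: "summable (%k. d k om)" using elim d0 unfolding G_def by (intro summable_suminf_not_top) auto
  define g where "g = (\<Sum>k. d k om)"
  have g: "G om = ennreal g" "g >= 0" using suminf_ennreal2[OF d0 sm] suminf_nonneg[OF sm d0] by (auto simp: G_def g_def)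
  have le: "(norm (B m om - B n om))^2 <= q ^ n / (1 - q) * g" if "n <= m" for n m
  proof -
   have "B m om - B n om = (\<Sum>k=n..<m. B (Suc k) om - B k om)" using sum_Suc_diff'[OF that, of "%k. B k om"] by simp
   hence "norm (B m om - B n om) <= (\<Sum>k=n..<m. norm (B (Suc k) om - B k om))" by (simp add: norm_sum)
   also have "... = (\<Sum>k=n..<m. sqrt (q ^ k) * sqrt (d k om))" using q by (simp add: d_def real_sqrt_divide)
   finally have "(norm (B m om - B n om))^2 <= (\<Sum>k=n..<m. sqrt (q ^ k) * sqrt (d k om))^2" by (intro power_mono) auto
   also have "... <= (\<Sum>k=n..<m. (sqrt (q ^ k))^2) * (\<Sum>k=n..<m. (sqrt (d k om))^2)" by (rule Cauchy_Schwarz_ineq_sum)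
   also have "... = (\<Sum>k=n..<m. q ^ k) * (\<Sum>k=n..<m. d k om)" using q d0 by simp
   also have "... <= q ^ n / (1 - q) * g"
   proof (rule mult_mono)
    have "(\<Sum>k=n..<m. q ^ k) = (\<Sum>k=n..<m. - (q ^ Suc k / (1 - q)) - - (q ^ k / (1 - q)))"
    proof (rule sum.cong[OF refl])
     fix k
     have "- (q ^ Suc k / (1 - q)) - - (q ^ k / (1 - q)) = (q ^ k - q ^ Suc k) / (1 - q)" by (simp add: diff_divide_distrib)
     also have "q ^ k - q ^ Suc k = q ^ k * (1 - q)" by (simp add: algebra_simps)
     finally show "q ^ k = - (q ^ Suc k / (1 - q)) - - (q ^ k / (1 - q))" using q by simp
    qed
    also have "... = (q ^ n - q ^ m) / (1 - q)"
     using sum_Suc_diff'[OF that, of "%k. - (q ^ k / (1 - q))"] by (simp add: diff_divide_distrib)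
    also have "... <= q ^ n / (1 - q)" using q by (intro divide_right_mono) auto
    finally show "(\<Sum>k=n..<m. q ^ k) <= q ^ n / (1 - q)" .
    show "(\<Sum>k=n..<m. d k om) <= g" unfolding g_def by (rule sum_le_suminf[OF sm]) (auto simp: d0)
   qed (use q d0 in "auto intro: sum_nonneg")
   finally show ?thesis .
  qed
  have qn: "(%n. sqrt (q ^ n / (1 - q) * g)) \<longlonglongrightarrow> 0"
  proof -
   have "(%n. sqrt (q ^ n / (1 - q) * g)) \<longlonglongrightarrow> sqrt (0 / (1 - q) * g)"
    using q by (intro tendsto_intros LIMSEQ_power_zero) auto
   thus ?thesis by simp
  qed
  have "Cauchy (%n. B n om)"
  proof (rule metric_CauchyI)
   fix e :: real assume "0 < e"
   with qn obtain n0 where n0: "\<And>n. n >= n0 ==> norm (sqrt (q ^ n / (1 - q) * g) - 0) < e / 2"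
    using LIMSEQ_D[of _ 0 "e / 2"] by (metis half_gt_zero)
   have b: "dist (B m om) (B n0 om) < e / 2" if "m >= n0" for m
    using real_le_rsqrt[OF le[OF that]] n0[of n0] by (simp add: dist_norm)
   have "dist (B m om) (B n om) < e" if "m >= n0" "n >= n0" for m n
    using dist_triangle_half_r[of "B n0 om" "B m om" e "B n om"] b[OF that(1)] b[OF that(2)] by (simp add: dist_commute)
   thus "\<exists>M. \<forall>m\<ge>M. \<forall>n\<ge>M. dist (B m om) (B n om) < e" by blast
  qed
  hence lim: "(%n. B n om) \<longlonglongrightarrow> X om" unfolding X_def by (simp add: Cauchy_convergent_iff convergent_LIMSEQ_iff)
  have "(norm (X om - B n om))^2 <= q ^ n / (1 - q) * g" for n
   by (rule LIMSEQ_le_const2[of "%m. (norm (B m om - B n om))^2"]) (use le in "auto intro!: tendsto_intros lim exI[of _ n]")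
  hence "ennreal ((norm (X om - B n om))^2) <= ennreal (q ^ n / (1 - q)) * G om" for n
   unfolding g(1) using q g(2) by (subst ennreal_mult[symmetric]) (auto intro: ennreal_leI)
  with lim show ?case by blast
 qed
 have "NN M (%om. (norm (X om - B n om))^2) <= ennreal (q ^ n * (C / (1 - q)^2))" for n
 proof -
  have "NN M (%om. (norm (X om - B n om))^2) <= (NI M (%om. ennreal (q ^ n / (1 - q)) * G om))"
   using conv by (intro nn_integral_mono_AE) (auto elim: eventually_mono)
  also have "... = ennreal (q ^ n / (1 - q)) * (NI M (%om. G om))" unfolding G_def by (rule nn_integral_cmult) measurable
  also have "... <= ennreal (q ^ n / (1 - q)) * ennreal (C / (1 - q))" by (intro mult_left_mono EG) simp
  also have "... = ennreal (q ^ n * (C / (1 - q)^2))" using q C by (simp add: ennreal_mult[symmetric] power2_eq_square)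
  finally show ?thesis .
 qed
 with X conv show ?thesis by (intro exI[of _ X]) (auto elim: eventually_mono)
qed


lemma prob_distribution_x_marginal:
 fixes pp :: "('a::second_countable_topology \<times> 'b::second_countable_topology) measure"
 assumes "prob_distribution pp" shows "prob_distribution (x_marginal pp)"
proof -
 have s: "sets pp = sets borel" and p: "prob_space pp" using assms by (auto simp: prob_distribution_def)
 have "fst : bmeas pp" using borel_measurable_fst_snd(1) by (subst measurable_cong_sets[OF s refl])
 from prob_space.prob_space_distr[OF p this] show ?thesis unfolding prob_distribution_def x_marginal_def by simp
qed

context pd_problem
begin

text \<open>Driven by the same noise, two runs of the iteration approach each other geometrically.\<close>

lemma energy_two_runs:
 fixes z :: "(real ^ 'd) \<times> (real ^ 'm)" and xi ze :: "nat => real ^ 'd" and si ta tht :: real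
 assumes ta: "ta > 0" and si: "si > 0" and tht: "tht > 0" and st: "tht * si * ta * L^2 <= 1"
  and th: "inverse (1 + wg * ta) <= tht" "inverse (1 + wfs * si) <= tht"
  and noise: "\<And>k. k < n ==> xi (Suc k) = ze k"
 defines "a \<equiv> %k. pd_iterate f g K si ta tht z xi (Suc k)" and "b \<equiv> pd_iterate f g K si ta tht z ze"
 shows "\<exists>u0. energy si ta u0 (fst (a n) - fst (b n)) (snd (snd (a n)) - snd (snd (b n)))
   <= tht ^ n * energy si ta 0 (fst (a 0) - fst z) (snd (snd (a 0)) - snd z) \<and>
  fst (snd (a n)) - fst (snd (b n)) = (fst (a n) - fst (b n)) + tht *. ((fst (a n) - fst (b n)) - u0)"
 using noise
proof (induction n)
 case 0
 show ?case by (rule exI[of _ 0]) (simp add: a_def b_def case_prod_unfold Let_def algebra_simps)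
next
 case (Suc n)
 then obtain u0 where u0: "energy si ta u0 (fst (a n) - fst (b n)) (snd (snd (a n)) - snd (snd (b n)))
   <= tht ^ n * energy si ta 0 (fst (a 0) - fst z) (snd (snd (a 0)) - snd z)"
  "fst (snd (a n)) - fst (snd (b n)) = (fst (a n) - fst (b n)) + tht *. ((fst (a n) - fst (b n)) - u0)"
  using less_Suc_eq by blast
 define y where "y s = prox si (convex_conjugate f) (snd (snd s) + si *. K (fst (snd s)))"
  for s :: "(real ^ 'd) \<times> (real ^ 'd) \<times> (real ^ 'm)"
 define p where "p s = prox ta g (fst s - ta *. KT (y s))" for s
 define w where "w = sqrt (2 * ta) *. ze n"
 have an: "a (Suc n) = (p (a n) + w, p (a n) + w + tht *. (p (a n) + w - fst (a n)), y (a n))"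
  using Suc.prems[of n] unfolding a_def by (subst pd_iterate.simps(2)) (simp add: p_def y_def w_def case_prod_unfold Let_def del: pd_iterate.simps)
 have bn: "b (Suc n) = (p (b n) + w, p (b n) + w + tht *. (p (b n) + w - fst (b n)), y (b n))"
  unfolding b_def by (subst pd_iterate.simps(2)) (simp add: p_def y_def w_def case_prod_unfold Let_def del: pd_iterate.simps)
 have pe: "p s + ta *. grad g (p s) = fst s - ta *. KT (y s)" for s unfolding p_def by (rule prox_g_eqn[OF ta])
 have ye: "y s + si *. gfs (y s) = snd (snd s) + si *. K (fst (snd s))" for s unfolding y_def by (rule prox_fs_eqn[OF si])
 let ?u = "fst (a n) - fst (b n)" and ?v = "snd (snd (a n)) - snd (snd (b n))"
 have "energy si ta ?u (p (a n) - p (b n)) (y (a n) - y (b n)) <= tht * energy si ta u0 ?u ?v + (norm (0 :: real ^ 'd))^2 / wg + (norm (0 :: real ^ 'm))^2 / wfs"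
 proof (rule energy_step[OF ta si tht st th])
  have "(p (a n) - p (b n)) + ta *. (grad g (p (a n)) - grad g (p (b n))) + ta *. KT (y (a n) - y (b n))
   = ((p (a n) + ta *. grad g (p (a n))) + ta *. KT (y (a n))) - ((p (b n) + ta *. grad g (p (b n))) + ta *. KT (y (b n)))"
   by (simp add: linear_diff[OF linear_KT] algebra_simps)
  thus "(p (a n) - p (b n)) + ta *. (grad g (p (a n)) - grad g (p (b n))) + ta *. KT (y (a n) - y (b n)) = ?u - ta *. 0"
   unfolding pe by simp
  have "(y (a n) - y (b n)) + si *. (gfs (y (a n)) - gfs (y (b n))) - si *. K (fst (snd (a n)) - fst (snd (b n)))
   = ((y (a n) + si *. gfs (y (a n))) - si *. K (fst (snd (a n)))) - ((y (b n) + si *. gfs (y (b n))) - si *. K (fst (snd (b n))))"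
   by (simp add: linear_diff[OF linear_K] algebra_simps)
  thus "(y (a n) - y (b n)) + si *. (gfs (y (a n)) - gfs (y (b n))) - si *. K (?u + tht *. (?u - u0)) = ?v - si *. 0"
   unfolding u0(2)[symmetric] ye by simp
 qed
 also have "... <= tht ^ Suc n * energy si ta 0 (fst (a 0) - fst z) (snd (snd (a 0)) - snd z)"
  using mult_left_mono[OF u0(1), of tht] tht by (simp add: mult.assoc)
 finally show ?case by (intro exI[of _ ?u] conjI) (simp_all add: an bn algebra_simps)
qed

lemma first_step_energy:
 assumes ta: "ta > 0" and si: "si > 0"
 shows "\<exists>c\<ge>0. \<forall>z xi. energy si ta 0 (fst (pd_iterate f g K si ta tht z xi (Suc 0)) - fst z) (snd (snd (pd_iterate f g K si ta tht z xi (Suc 0))) - snd z)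
   <= c * (1 + (norm z)^2 + (norm (xi 0))^2)"
proof -
 define y where "y z = prox si (convex_conjugate f) (snd z + si *. K (fst z))" for z
 define x where "x z = prox ta g (fst z - ta *. KT (y z))" for z
 define s where "s = sqrt (2 * ta)"
 have s0: "s >= 0" using ta by (simp add: s_def)
 define b1 where "b1 = norm (prox si (convex_conjugate f) 0) + 2 + si * L"
 define b2 where "b2 = norm (prox ta g 0) + 2 + ta * L * (b1 + 1) + s"
 have b: "b1 >= 0" "b2 >= 0" unfolding b1_def b2_def using si ta L_nonneg s0 by (auto intro!: add_nonneg_nonneg mult_nonneg_nonneg)
 define A where "A = (1 + wg * ta) / ta + 1 / ta + L^2" define B where "B = (1 + wfs * si) / si + 1"
 have AB: "A >= 0" "B >= 0" unfolding A_def B_def using ta si wg wfs by (auto intro!: add_nonneg_nonneg)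
 have lip: "norm (P p) <= norm (P 0) + norm p" if "1-lipschitz_on UNIV P" for P :: "'z::real_normed_vector => 'z" and p
 proof -
  have "norm (P p - P 0) <= norm p" using lipschitz_onD[OF that, of p 0] by (simp add: dist_norm)
  thus ?thesis using norm_triangle_ineq2[of "P p" "P 0"] by simp
 qed
 have E: "energy si ta 0 u v <= A * (norm u)^2 + B * (norm v)^2" for u v
 proof -
  have "2 * (K u <.> v) <= (norm (K u))^2 + (norm v)^2" using inner_young[of 1 "K u" v] by simp
  also have "(norm (K u))^2 <= L^2 * (norm u)^2" by (rule square_le_prod[OF _ norm_K]) simp
  finally show ?thesis unfolding energy_def A_def B_def by (simp add: algebra_simps)
 qed
 show ?thesis
 proof (intro exI[of _ "(A * b2^2 + B * b1^2) * 3"] conjI allI)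
  show "0 <= (A * b2^2 + B * b1^2) * 3" using AB by simp
  fix z :: "(real ^ 'd) \<times> (real ^ 'm)" and xi :: "nat => real ^ 'd"
  define r where "r = 1 + norm z + norm (xi 0)"
  have r: "r >= 1" "norm (fst z) <= r" "norm (snd z) <= r" "norm (xi 0) <= r"
   using norm_fst_le[of "fst z" "snd z"] norm_snd_le[of "snd z" "fst z"] by (auto simp: r_def intro: add_nonneg_nonneg order_trans)
  have sum: "a + b * r + c * r <= (a + b + c) * r" if "a >= 0" for a b c
   using mult_left_mono[OF r(1) that] by (simp add: distrib_right)
  have y1: "norm (y z) <= (b1 - 1) * r"
  proof -
   have "norm (y z) <= norm (prox si (convex_conjugate f) 0) + norm (snd z + si *. K (fst z))"
    unfolding y_def by (rule lip[OF lipschitz_prox_fs[OF si]])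
   also have "norm (snd z + si *. K (fst z)) <= norm (snd z) + norm (si *. K (fst z))" by (rule norm_triangle_ineq)
   also have "norm (si *. K (fst z)) <= si * (L * r)"
    using si order_trans[OF norm_K mult_left_mono[OF r(2) L_nonneg]] by simp
   finally show ?thesis using r(3) sum[of "norm (prox si (convex_conjugate f) 0)" 1 "si * L"] by (simp add: b1_def algebra_simps)
  qed
  have v: "norm (y z - snd z) <= b1 * r"
   using norm_triangle_ineq4[of "y z" "snd z"] y1 r(3) by (simp add: algebra_simps)
  have u: "norm (x z + s *. xi 0 - fst z) <= b2 * r"
  proof -
   have "norm (x z) <= norm (prox ta g 0) + norm (fst z - ta *. KT (y z))"
    unfolding x_def by (rule lip[OF lipschitz_prox_g[OF ta]])
   also have "norm (fst z - ta *. KT (y z)) <= norm (fst z) + norm (ta *. KT (y z))" by (rule norm_triangle_ineq4)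
   also have "norm (ta *. KT (y z)) <= ta * (L * ((b1 + 1) * r))"
   proof -
    have "norm (y z) <= (b1 + 1) * r" using y1 r(1) by (simp add: algebra_simps)
    hence "norm (KT (y z)) <= L * ((b1 + 1) * r)" by (intro order_trans[OF norm_KT] mult_left_mono L_nonneg)
    thus ?thesis using ta by simp
   qed
   finally have "norm (x z) <= norm (prox ta g 0) + 1 * r + ta * L * (b1 + 1) * r" using r(2) by (simp add: algebra_simps)
   hence "norm (x z) <= (norm (prox ta g 0) + 1 + ta * L * (b1 + 1)) * r" using sum[of "norm (prox ta g 0)" 1 "ta * L * (b1 + 1)"] by simp
   moreover have "norm (s *. xi 0) <= s * r" using s0 r(4) by (simp add: mult_left_mono)
   moreover have "norm (x z + s *. xi 0 - fst z) <= norm (x z) + norm (s *. xi 0) + norm (fst z)"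
    by (intro order_trans[OF norm_triangle_ineq4] add_right_mono norm_triangle_ineq)
   ultimately show ?thesis using r(2) by (simp add: b2_def algebra_simps)
  qed
  have it: "fst (pd_iterate f g K si ta tht z xi (Suc 0)) = x z + s *. xi 0" "snd (snd (pd_iterate f g K si ta tht z xi (Suc 0))) = y z"
   by (simp_all add: x_def y_def s_def Let_def case_prod_unfold)
  have "r^2 <= 3 * 1^2 + 3 * (norm z)^2 + 3 * (norm (xi 0))^2" unfolding r_def by (rule square_le_3) auto
  hence r2: "r^2 <= 3 * (1 + (norm z)^2 + (norm (xi 0))^2)" by simp
  have "energy si ta 0 (x z + s *. xi 0 - fst z) (y z - snd z) <= A * (b2^2 * r^2) + B * (b1^2 * r^2)"
   by (rule order_trans[OF E]) (intro add_mono mult_left_mono square_le_prod u v AB; simp)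
  also have "... = (A * b2^2 + B * b1^2) * r^2" by (simp add: algebra_simps)
  also have "... <= (A * b2^2 + B * b1^2) * (3 * (1 + (norm z)^2 + (norm (xi 0))^2))"
   using AB by (intro mult_left_mono r2) auto
  finally show "energy si ta 0 (fst (pd_iterate f g K si ta tht z xi (Suc 0)) - fst z) (snd (snd (pd_iterate f g K si ta tht z xi (Suc 0))) - snd z)
   <= (A * b2^2 + B * b1^2) * 3 * (1 + (norm z)^2 + (norm (xi 0))^2)"
   unfolding it by (simp only: mult.assoc)
 qed
qed

lemma prob_distribution_pd_law:
 assumes "ta > 0" "si > 0" and pp0: "prob_distribution pp0"
 shows "prob_distribution (pd_law f g K si ta tht pp0 N)"
proof -
 let ?S = "\<Pi>\<^sub>M k\<in>(UNIV::nat set). (borel :: (real ^ 'd) measure)"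
 let ?Q = "\<Pi>\<^sub>M k\<in>(UNIV::nat set). (gaussian 1 :: (real ^ 'd) measure)"
 have s0: "sets pp0 = sets borel" and p0: "prob_space pp0" using pp0 by (auto simp: prob_distribution_def)
 have sQ: "sets ?Q = sets ?S" by (rule sets_PiM_cong) auto
 have sc: "sets (pp0 >< ?Q) = sets (borel >< ?S)" by (rule sets_pair_measure_cong[OF s0 sQ])
 have itm0: "(%p. pd_iterate f g K si ta tht (fst p) (snd p) N) : bmeas (borel >< ?S)"
  using measurable_pd_iterate[OF assms(1,2), of tht N] by (simp add: case_prod_unfold)
 have pm: "(%(z, xi). case pd_iterate f g K si ta tht z xi N of (x, xtht, y) => (x, y)) : bmeas (pp0 >< ?Q)"
  unfolding measurable_cong_sets[OF sc refl] case_prod_unfold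
  by (intro borel_measurable_Pair measurable_compose[OF itm0]) measurable
 have pQ: "prob_space ?Q" by (rule prob_space_PiM) (simp add: prob_space_gaussian)
 have "prob_space (pp0 >< ?Q)" using p0 pQ by (rule prob_space_pair)
 from prob_space.prob_space_distr[OF this pm] show ?thesis
  unfolding prob_distribution_def pd_law_def by simp
qed

text \<open>The iteration depends on its noise only through the law of the noise, so the order in which the
 noise is used may be reversed. In reversed order consecutive runs differ by their first step only,
 the iterates converge almost surely, and the distance of their laws to the limit tends to zero.\<close>

lemma weak_limit_of_iteration:
 fixes si ta tht r :: real
 assumes ta: "ta > 0" and si: "si > 0" and tht: "tht > 0" "tht < 1" and st: "tht * si * ta * L^2 <= 1"
  and th: "inverse (1 + wg * ta) <= tht" "inverse (1 + wfs * si) <= tht"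
  and pp0: "prob_distribution pp0" "finite_second_moment pp0" and mu': "prob_distribution mu'" and nu: "prob_distribution nu"
  and weak: "converges_weakly (%n. x_marginal (pd_law f g K si ta tht pp0 n)) mu'"
  and W: "\<And>n. wasserstein2 (x_marginal (pd_law f g K si ta tht pp0 n)) nu <= ennreal r"
 shows "wasserstein2 mu' nu <= ennreal r"
proof -
 let ?S = "\<Pi>\<^sub>M k\<in>(UNIV::nat set). (borel :: (real ^ 'd) measure)"
 let ?Q = "\<Pi>\<^sub>M k\<in>(UNIV::nat set). (gaussian 1 :: (real ^ 'd) measure)"
 let ?M = "pp0 >< ?Q"
 let ?it = "pd_iterate f g K si ta tht"
 let ?mu = "%n. x_marginal (pd_law f g K si ta tht pp0 n)"
 have s0: "sets pp0 = sets borel" and p0: "prob_space pp0" using pp0 by (auto simp: prob_distribution_def)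
 have sQ: "sets ?Q = sets ?S" by (rule sets_PiM_cong) auto
 have sc: "sets ?M = sets (borel >< ?S)" by (rule sets_pair_measure_cong[OF s0 sQ])
 have g1: "prob_space (gaussian 1 :: (real ^ 'd) measure)" by (simp add: prob_space_gaussian)
 interpret Q: product_prob_space "%_::nat. gaussian 1 :: (real ^ 'd) measure" UNIV by (rule product_prob_spaceI[OF g1])
 have pQ: "prob_space ?Q" by (rule prob_space_PiM[OF g1])
 have pM: "prob_space ?M" using p0 pQ by (rule prob_space_pair)
 interpret M: prob_space ?M by (rule pM)
 have itm0: "(%p. fst (?it (fst p) (snd p) n)) : bmeas (borel >< ?S)" for n
  using measurable_compose[OF measurable_pd_iterate[OF ta si, of tht n] borel_measurable_fst_snd(1)] by (simp add: case_prod_unfold)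
 have itm: "(%p. fst (?it (fst p) (snd p) n)) : bmeas ?M" for n
  by (subst measurable_cong_sets[OF sc refl]) (rule itm0)
 have law: "?mu n = distr ?M borel (%p. fst (?it (fst p) (snd p) n))" for n
 proof -
  have it1: "(%p. ?it (fst p) (snd p) n) : bmeas (borel >< ?S)"
   using measurable_pd_iterate[OF ta si, of tht n] by (simp add: case_prod_unfold)
  have pm: "(%(z, xi). case ?it z xi n of (x, xtht, y) => (x, y)) : bmeas ?M"
   unfolding measurable_cong_sets[OF sc refl] case_prod_unfold
   by (intro borel_measurable_Pair measurable_compose[OF it1]) measurable
  show ?thesis unfolding x_marginal_def pd_law_def
   by (subst distr_distr[OF _ pm]) (auto simp: comp_def case_prod_unfold)
 qed
 define rv where "rv n k = (if k < n then n - Suc k else k)" for n k :: nat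
 define T where "T n p = (fst p, %k. snd p (rv n k))" for n and p :: "((real ^ 'd) \<times> (real ^ 'm)) \<times> (nat => real ^ 'd)"
 have rm: "(%xi k. xi (rv n k)) : ?Q \<rightarrow>\<^sub>M ?Q" for n
 proof -
  have "(%xi. \<lambda>k\<in>UNIV. xi (rv n k)) : ?Q \<rightarrow>\<^sub>M ?Q" by (intro measurable_restrict measurable_component_singleton) simp
  thus ?thesis unfolding restrict_UNIV .
 qed
 have Tm: "T n : ?M \<rightarrow>\<^sub>M ?M" for n unfolding T_def by (intro measurable_Pair measurable_fst measurable_compose[OF measurable_snd rm])
 have Tlaw: "distr ?M ?M (T n) = ?M" for n
 proof -
  have "inj (rv n)" by (auto simp: inj_def rv_def split: if_splits)
  hence "distr ?Q ?Q (%xi k. xi (rv n k)) = ?Q"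
   using distr_PiM_reindex[of UNIV "%_. gaussian 1 :: (real ^ 'd) measure" "rv n" UNIV] g1
   unfolding restrict_UNIV by simp
  hence "?M = distr pp0 pp0 (%z. z) >< distr ?Q ?Q (%xi k. xi (rv n k))" by simp
  also have "... = distr ?M ?M (%(z, xi). (z, %k. xi (rv n k)))"
   using rm pQ by (intro pair_measure_distr) (auto simp: prob_space.prob_space_distr prob_space_imp_sigma_finite)
  finally show ?thesis by (simp add: T_def[abs_def] case_prod_unfold)
 qed
 define B where "B n p = fst (?it (fst (T n p)) (snd (T n p)) n)" for n p
 have Bm: "B n : bmeas ?M" for n unfolding B_def[abs_def] by (rule measurable_compose[OF Tm itm])
 have Blaw: "distr ?M borel (B n) = ?mu n" for n
  using distr_distr[OF itm Tm, of n n] unfolding Tlaw law by (simp add: comp_def B_def[abs_def])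
 obtain c where c: "c >= 0" "\<forall>z xi. energy si ta 0 (fst (?it z xi (Suc 0)) - fst z) (snd (snd (?it z xi (Suc 0))) - snd z)
   <= c * (1 + (norm z)^2 + (norm (xi 0))^2)"
  using first_step_energy[OF ta si] by blast
 have step: "(norm (B (Suc n) p - B n p))^2 <= ta * tht ^ n * c * (1 + (norm (fst p))^2 + (norm (snd p n))^2)" for n p
 proof -
  let ?xi = "snd (T (Suc n) p)" and ?z = "fst p"
  obtain u0 where u0: "energy si ta u0 (B (Suc n) p - B n p) (snd (snd (?it ?z ?xi (Suc n))) - snd (snd (?it ?z (snd (T n p)) n)))
   <= tht ^ n * energy si ta 0 (fst (?it ?z ?xi (Suc 0)) - fst ?z) (snd (snd (?it ?z ?xi (Suc 0))) - snd ?z)"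
   using energy_two_runs[OF ta si tht(1) st th, of n ?xi "snd (T n p)" ?z] unfolding B_def
   by (auto simp: T_def rv_def simp del: pd_iterate.simps)
  have "1 / ta * (norm (B (Suc n) p - B n p))^2 <= (1 + wg * ta) / ta * (norm (B (Suc n) p - B n p))^2"
   using ta wg by (intro mult_right_mono divide_right_mono) auto
  also have "... <= tht ^ n * energy si ta 0 (fst (?it ?z ?xi (Suc 0)) - fst ?z) (snd (snd (?it ?z ?xi (Suc 0))) - snd ?z)"
   by (rule order_trans[OF energy_ge[OF ta si tht(1) st th(2)] u0])
  also have "... <= tht ^ n * (c * (1 + (norm ?z)^2 + (norm (?xi 0))^2))"
   using tht by (intro mult_left_mono c(2)[rule_format]) auto
  also have "?xi 0 = snd p n" by (simp add: T_def rv_def)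
  finally show ?thesis using ta by (simp add: field_simps)
 qed
 obtain m2 where m2: "m2 >= 0" "NN pp0 (%z. (norm z)^2) = ennreal m2"
  using pp0(2) unfolding finite_second_moment_def by (cases "\<integral>\<^sup>+ z. ennreal ((norm z)^2) \<partial>pp0") auto
 define q where "q = sqrt tht"
 have q: "0 < q" "q < 1" "(q ^ n)^2 = tht ^ n" for n
 proof -
  show "0 < q" "q < 1" using tht by (auto simp: q_def)
  have "(q ^ n)^2 = (q^2) ^ n" by (simp only: power_mult[symmetric] mult.commute)
  thus "(q ^ n)^2 = tht ^ n" using tht by (simp add: q_def)
 qed
 define C where "C = ta * c * (1 + (m2 + CARD('d)))"
 have C: "C >= 0" unfolding C_def using ta c m2 by (intro mult_nonneg_nonneg) auto
 have inc: "NN ?M (%p. (norm (B (Suc n) p - B n p))^2) <= ennreal (C * (q ^ n)^2)" for n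
 proof -
  have zm: "(%z. ennreal ((norm z)^2)) : bmeas pp0" by (subst measurable_cong_sets[OF s0 refl]) measurable
  have m1: "(%p. (norm (fst p))^2) : bmeas ?M" "(%p. (norm (snd p n))^2) : bmeas ?M"
   unfolding measurable_cong_sets[OF sc refl] by measurable
  have e1: "NN ?M (%p. (norm (fst p))^2) <= ennreal m2"
   unfolding m2(2)[symmetric] by (subst nn_integral_prod_fst[OF pQ zm]) simp
  have e2: "NN ?M (%p. (norm (snd p n))^2) <= ennreal (real CARD('d))"
  proof -
   have cm: "(%xi. xi n) : ?Q \<rightarrow>\<^sub>M gaussian 1" by (rule measurable_component_singleton) simp
   interpret P0: prob_space pp0 by (rule p0)
   have "NN ?M (%p. (norm (snd p n))^2) = (\<integral>\<^sup>+ z. \<integral>\<^sup>+ xi. ennreal ((norm (xi n))^2) \<partial>?Q \<partial>pp0)"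
    using m1(2) by (subst Q.P.nn_integral_fst[symmetric]) auto
   also have "NN ?Q (%xi. (norm (xi n))^2) = NN (distr ?Q (gaussian 1) (%xi. xi n)) (%w. (norm w)^2)"
    using cm by (subst nn_integral_distr) auto
   also have "distr ?Q (gaussian 1) (%xi. xi n) = gaussian 1" by (rule Q.PiM_component) simp
   also have "NN (gaussian 1) (%w. (norm (w :: real ^ 'd))^2) = ennreal (real CARD('d))"
    using gaussian_norm2[of 1, where 'd='d] by (subst nn_integral_eq_integral[OF gaussian_abs_moment]) auto
   finally show ?thesis by (simp add: P0.emeasure_space_1)
  qed
  have one: "(NI ?M (%p. ennreal 1)) <= ennreal 1" by (simp add: M.emeasure_space_1)
  have "NN ?M (%p. (norm (B (Suc n) p - B n p))^2)
   <= NN ?M (%p. ta * tht ^ n * c * (1 + ((norm (fst p))^2 + (norm (snd p n))^2)))"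
   using step[of n] by (intro nn_integral_mono ennreal_leI) (simp add: add.assoc)
  also have "... <= ennreal (ta * tht ^ n * c * (1 + (m2 + CARD('d))))"
   using ta tht c m2 m1
   by (intro nn_integral_cmult_le nn_integral_add_le one e1 e2 borel_measurable_add borel_measurable_const) auto
  finally show ?thesis by (simp add: C_def q(3) ac_simps)
 qed
 obtain X where X: "X : bmeas ?M" "AE p in ?M. (%n. B n p) \<longlonglongrightarrow> X p"
  and XB: "\<And>n. (NN ?M (%p. (norm (X p - B n p))^2)) <= ennreal (q ^ n * (C / (1 - q)^2))"
  using geometric_increments_converge[OF Bm q(1,2) C inc] by blast
 have Xlaw: "distr ?M borel X = mu'"
 proof (rule measure_eqI_bounded_continuous[OF _ mu'])
  show "prob_distribution (distr ?M borel X)" unfolding prob_distribution_def using M.prob_space_distr[OF X(1)] by simp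
  fix h :: "real ^ 'd => real" assume h: "continuous_on UNIV h" "bounded (range h)"
  then obtain b where b: "\<And>x. \<bar>h x\<bar> <= b" by (auto simp: bounded_iff)
  have hm: "h : bmeas borel" by (rule borel_measurable_continuous_onI[OF h(1)])
  have "(%n. LINT p|?M. h (B n p)) \<longlonglongrightarrow> (LINT p|?M. h (X p))"
  proof (rule integral_dominated_convergence[where w="%_. b"])
   show "AE p in ?M. (%n. h (B n p)) \<longlonglongrightarrow> h (X p)"
    using X(2) h(1) by (auto elim!: eventually_mono intro: continuous_on_tendsto_compose)
  qed (use b measurable_compose[OF X(1) hm] measurable_compose[OF Bm hm] in auto)
  moreover have "(LINT p|?M. h (B n p)) = (LINT x|?mu n. h x)" for n
   unfolding Blaw[symmetric] using Bm hm by (subst integral_distr) auto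
  moreover have "(%n. LINT x|?mu n. h x) \<longlonglongrightarrow> (LINT x|mu'. h x)" using weak h unfolding converges_weakly_def by blast
  ultimately have "(LINT p|?M. h (X p)) = (LINT x|mu'. h x)" using LIMSEQ_unique by auto
  thus "(LINT x|distr ?M borel X. h x) = (LINT x|mu'. h x)" using X(1) hm by (subst integral_distr) auto
 qed
 have pd: "prob_distribution (?mu n)" for n
  by (intro prob_distribution_x_marginal prob_distribution_pd_law ta si pp0)
 have near: "wasserstein2 mu' (?mu n) <= ennreal (sqrt (q ^ n * (C / (1 - q)^2)))" for n
 proof (rule wasserstein2_le'[OF _ refl])
  show "sets mu' = sets borel" "sets (?mu n) = sets borel" using mu' pd by (auto simp: prob_distribution_def)
  show "\<exists>R :: (((real ^ 'd) \<times> (real ^ 'm)) \<times> (nat => real ^ 'd)) measure. \<exists>X Y. prob_space R \<and> X : bmeas R \<and> Y : bmeas R \<and>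
    distr R borel X = mu' \<and> distr R borel Y = ?mu n \<and>
    (NN R (%om. (norm (X om - Y om))^2)) <= ennreal (q ^ n * (C / (1 - q)^2) + de)" if "de > 0" for de
   using pM X(1) Bm Xlaw Blaw order_trans[OF XB ennreal_leI] that by (intro exI[of _ ?M] exI[of _ X] exI[of _ "B n"]) auto
 qed (use q C in simp)
 have "(%n. ennreal (sqrt (q ^ n * (C / (1 - q)^2))) + ennreal r) \<longlonglongrightarrow> ennreal (sqrt (0 * (C / (1 - q)^2))) + ennreal r"
  using q by (intro tendsto_intros LIMSEQ_power_zero) auto
 moreover have "wasserstein2 mu' nu <= ennreal (sqrt (q ^ n * (C / (1 - q)^2))) + ennreal r" for n
  by (rule order_trans[OF wasserstein2_triangle[OF mu' pd nu] add_mono[OF near W]])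
 ultimately show ?thesis using LIMSEQ_le_const by fastforce
qed

end

section \<open>Calculus of continuously differentiable functions\<close>

abbreviation D1f :: "('a::euclidean_space => 'b::real_normed_vector) => 'a => 'a => 'b" where
 "D1f F x v \<equiv> frechet_derivative F (at x) v"

lemma C_k_has_derivative: "C_k (Suc n) F ==> (F has_derivative D1f F x) (at x)"
 by (simp add: frechet_derivative_works[symmetric])

lemma C_k_D1: "C_k (Suc n) F ==> C_k n (%x. D1f F x v)"
 by simp

lemma C_k_continuous: "C_k n F ==> continuous_on S F"
proof (cases n)
 case 0
 assume "C_k n F" thus ?thesis using 0 continuous_on_subset by fastforce
next
 case (Suc m)
 assume "C_k n F"
 hence "(F has_derivative D1f F x) (at x)" for x using Suc C_k_has_derivative by blast
 thus ?thesis by (meson continuous_at_imp_continuous_on has_derivative_continuous)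
qed

lemma C_k_SucD: "C_k (Suc n) F ==> C_k n F"
proof (induction n arbitrary: F)
 case 0
 thus ?case using C_k_continuous[of 1 F UNIV] by simp
next
 case (Suc n)
 show ?case unfolding C_k.simps(2)[of n F]
  using Suc.prems Suc.IH unfolding C_k.simps(2)[of "Suc n" F] by blast
qed

lemma C_k_SucI:
 assumes "\<And>x. (F has_derivative D x) (at x)" "\<And>v. C_k n (%x. D x v)"
 shows "C_k (Suc n) F"
proof -
 have "D1f F x = D x" for x using frechet_derivative_at[OF assms(1)] by simp
 moreover have "F differentiable (at x)" for x using assms(1) by (auto simp: differentiable_def)
 ultimately show ?thesis using assms(2) by simp
qed

lemma D1f_eq: "(F has_derivative D) (at x) ==> D1f F x = D"
 using frechet_derivative_at by metis

lemma C_k_const: "C_k n (%x. c)"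
proof (induction n arbitrary: c)
 case (Suc n)
 show ?case by (rule C_k_SucI[where D="%_ _. 0"]) (auto intro: Suc)
qed simp

lemma C_k_add: "C_k n F ==> C_k n G ==> C_k n (%x. F x + G x)"
proof (induction n arbitrary: F G)
 case 0
 thus ?case by (auto intro: continuous_on_add)
next
 case (Suc n)
 show ?case
 proof (rule C_k_SucI)
  show "((%x. F x + G x) has_derivative (%v. D1f F x v + D1f G x v)) (at x)" for x
   by (intro has_derivative_add C_k_has_derivative[OF Suc.prems(1)] C_k_has_derivative[OF Suc.prems(2)])
  show "C_k n (%x. D1f F x v + D1f G x v)" for v
   by (intro Suc.IH C_k_D1 Suc.prems)
 qed
qed

lemma C_k_sum: "(\<And>i. i : I ==> C_k n (F i)) ==> C_k n (%x. \<Sum>i\<in>I. F i x)"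
 by (induction I rule: infinite_finite_induct) (auto intro: C_k_const C_k_add)

lemma C_k_scaleR:
 fixes s :: "'a::euclidean_space => real"
 shows "C_k n s ==> C_k n F ==> C_k n (%x. s x *. F x)"
proof (induction n arbitrary: s F)
 case 0
 thus ?case by (auto intro: continuous_on_scaleR)
next
 case (Suc n)
 show ?case
 proof (rule C_k_SucI)
  show "((%x. s x *. F x) has_derivative (%v. s x *. D1f F x v + D1f s x v *. F x)) (at x)" for x
   by (intro has_derivative_scaleR C_k_has_derivative[OF Suc.prems(1)] C_k_has_derivative[OF Suc.prems(2)])
  show "C_k n (%x. s x *. D1f F x v + D1f s x v *. F x)" for v
   by (intro Suc.IH C_k_D1 Suc.prems C_k_add C_k_SucD)
 qed
qed

lemma C_k_compose_linear:
 fixes K :: "'a::euclidean_space => 'b::euclidean_space"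
 assumes K: "linear K"
 shows "C_k n F ==> C_k n (%x. F (K x))"
proof (induction n arbitrary: F)
 case 0
 have "continuous_on UNIV K" by (rule linear_continuous_on) (use K linear_conv_bounded_linear in blast)
 thus ?case using 0 continuous_on_compose2[of UNIV F UNIV K] by simp
next
 case (Suc n)
 have dK: "(K has_derivative K) (at x)" for x
  by (rule bounded_linear_imp_has_derivative) (use K linear_conv_bounded_linear in blast)
 show ?case
 proof (rule C_k_SucI)
  show "((%x. F (K x)) has_derivative (%v. D1f F (K x) (K v))) (at x)" for x
   using has_derivative_compose[OF dK C_k_has_derivative[OF Suc.prems]] .
  show "C_k n (%x. D1f F (K x) (K v))" for v by (intro Suc.IH[of "%x. D1f F x (K v)"] C_k_D1 Suc.prems)
 qed
qed

lemma linear_D1f: "C_k (Suc n) F ==> linear (D1f F x)"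
 using C_k_has_derivative has_derivative_linear by blast

lemma D1f_expand:
 assumes "C_k (Suc n) F"
 shows "D1f F x v = (\<Sum>e\<in>Basis. (v <.> e) *. D1f F x e)"
proof -
 have "D1f F x v = D1f F x (\<Sum>e\<in>Basis. (v <.> e) *. e)" by (simp add: euclidean_representation)
 thus ?thesis using linear_D1f[OF assms, of x] by (simp add: linear_sum linear_scale)
qed

abbreviation D2f :: "('a::euclidean_space => 'b::real_normed_vector) => 'a => 'a => 'a => 'b" where
 "D2f F x v w \<equiv> D1f (%z. D1f F z v) x w"

lemma D2f_expand:
 assumes F: "C_k 2 F"
 shows "D2f F x v v = (\<Sum>e\<in>Basis. \<Sum>e'\<in>Basis. ((v <.> e) * (v <.> e')) *. D2f F x e e')"
proof -
 have F': "C_k (Suc (Suc 0)) F" using F by (simp add: numeral_2_eq_2)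
 have "(%z. D1f F z v) = (%z. \<Sum>e\<in>Basis. (v <.> e) *. D1f F z e)" by (rule ext, rule D1f_expand[OF F'])
 moreover have "((%z. \<Sum>e\<in>Basis. (v <.> e) *. D1f F z e) has_derivative (%w. \<Sum>e\<in>Basis. (v <.> e) *. D2f F x e w)) (at x)"
  by (intro has_derivative_sum has_derivative_scaleR_right C_k_has_derivative[OF C_k_D1[OF F']])
 ultimately have "D2f F x v = (%w. \<Sum>e\<in>Basis. (v <.> e) *. D2f F x e w)"
  by (simp only: D1f_eq)
 hence "D2f F x v v = (\<Sum>e\<in>Basis. (v <.> e) *. D2f F x e v)" by (rule fun_cong)
 also have "... = (\<Sum>e\<in>Basis. (v <.> e) *. (\<Sum>e'\<in>Basis. (v <.> e') *. D2f F x e e'))"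
  by (intro sum.cong refl arg_cong2[where f=scaleR] D1f_expand[OF C_k_D1[OF F']])
 finally show ?thesis by (simp add: scaleR_sum_right)
qed

lemma continuous_D1f: "C_k (Suc n) F ==> continuous_on S (%x. D1f F x v)"
 by (rule C_k_continuous[OF C_k_D1])

lemma continuous_D2f: "C_k 2 F ==> continuous_on S (%x. D2f F x v w)"
 unfolding numeral_2_eq_2 by (intro continuous_D1f C_k_D1)

lemma continuous_laplacian: "C_k 2 F ==> continuous_on S (laplacian F)"
 unfolding laplacian_def[abs_def] by (intro continuous_on_sum continuous_D2f)

lemma laplacian_scaleR:
 fixes s :: "'a::euclidean_space => real"
 assumes "C_k 2 s" "C_k 2 F"
 shows "laplacian (%x. s x *. F x) x = s x *. laplacian F x + 2 *. (\<Sum>e\<in>Basis. D1f s x e *. D1f F x e) + laplacian s x *. F x"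
  and "D1f (%x. s x *. F x) x v = s x *. D1f F x v + D1f s x v *. F x"
proof -
 have c: "C_k (Suc (Suc 0)) s" "C_k (Suc (Suc 0)) F" using assms by (simp_all add: numeral_2_eq_2)
 have d: "D1f (%x. s x *. F x) z = (%v. s z *. D1f F z v + D1f s z v *. F z)" for z
  by (intro D1f_eq has_derivative_scaleR C_k_has_derivative[OF c(1)] C_k_has_derivative[OF c(2)])
 show "D1f (%x. s x *. F x) x v = s x *. D1f F x v + D1f s x v *. F x" by (simp add: d)
 have d2: "D1f (%z. s z *. D1f F z e + D1f s z e *. F z) x
   = (%v. (s x *. D2f F x e v + D1f s x v *. D1f F x e) + (D1f s x e *. D1f F x v + D2f s x e v *. F x))" for e
  by (intro D1f_eq has_derivative_add has_derivative_scaleR C_k_has_derivative[OF c(1)] C_k_has_derivative[OF c(2)]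
    C_k_has_derivative[OF C_k_D1[OF c(1)]] C_k_has_derivative[OF C_k_D1[OF c(2)]])
 show "laplacian (%x. s x *. F x) x = s x *. laplacian F x + 2 *. (\<Sum>e\<in>Basis. D1f s x e *. D1f F x e) + laplacian s x *. F x"
  unfolding laplacian_def d d2
  by (simp add: sum.distrib scaleR_sum_right scaleR_sum_left scaleR_2[symmetric] algebra_simps)
qed

section \<open>Second order Taylor expansion\<close>

lemma C_k_2_outside_support:
 assumes F: "C_k 2 F" and supp: "\<And>x. norm x >= R ==> F x = 0" and x: "norm x > R"
 shows "D1f F x v = 0" "D2f F x v w = 0" "laplacian F x = 0"
proof -
 have op: "open {x. norm x > R}" by (intro open_Collect_less continuous_intros)
 have 1: "D1f F x = (%_. 0)" if "norm x > R" for x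
 proof (rule D1f_eq)
  have "((%_. 0) has_derivative (%_. 0)) (at x)" by simp
  thus "(F has_derivative (%_. 0)) (at x)"
   by (rule has_derivative_transform_within_open[OF _ op]) (use that supp in auto)
 qed
 have 2: "D2f F x v = (%_. 0)" for v
 proof (rule D1f_eq)
  have "((%_. 0) has_derivative (%_. 0)) (at x)" by simp
  thus "((%z. D1f F z v) has_derivative (%_. 0)) (at x)"
   by (rule has_derivative_transform_within_open[OF _ op]) (use x 1 in auto)
 qed
 show "D1f F x v = 0" "D2f F x v w = 0" "laplacian F x = 0" using 1[OF x] 2 by (simp_all add: laplacian_def)
qed

lemma compact_support_bounded:
 fixes G :: "'a::euclidean_space => 'b::real_normed_vector"
 assumes "continuous_on UNIV G" "\<And>x. norm x > R ==> G x = 0"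
 shows "\<exists>B\<ge>0. \<forall>x. norm (G x) <= B"
proof -
 have "compact (G ` cball 0 R)" using assms(1) by (intro compact_continuous_image continuous_on_subset[OF assms(1)]) auto
 then obtain B where B: "\<And>x. x : cball 0 R ==> norm (G x) <= B"
  using compact_imp_bounded[THEN bounded_iff[THEN iffD1]] by (metis imageI)
 have "norm (G x) <= max 0 B" for x using B[of x] assms(2)[of x] by (cases "norm x <= R") auto
 thus ?thesis by (intro exI[of _ "max 0 B"]) auto
qed

lemma compact_support_modulus:
 fixes G :: "'a::euclidean_space => 'b::real_normed_vector"
 assumes cont: "continuous_on UNIV G" and supp: "\<And>x. norm x > R ==> G x = 0" and et: "et > 0"
 shows "\<exists>C\<ge>0. \<forall>x y. norm (G y - G x) <= et + C * norm (y - x)"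
proof -
 obtain B where B: "B >= 0" "\<And>x. norm (G x) <= B" using compact_support_bounded[OF cont supp] by metis
 have "uniformly_continuous_on (cball 0 (R + 2)) G"
  by (rule compact_uniformly_continuous) (auto intro: continuous_on_subset[OF cont])
 then obtain de where de: "de > 0" "\<And>x y. x : cball 0 (R + 2) ==> y : cball 0 (R + 2) ==> dist y x < de ==> dist (G y) (G x) < et"
  using et unfolding uniformly_continuous_on_def by metis
 define d where "d = min de 1"
 have d: "d > 0" using de(1) by (simp add: d_def)
 have near: "norm (G y - G x) <= et" if "norm (y - x) < d" for x y
 proof (cases "norm x <= R + 1")
  case True
  hence "norm y <= R + 2" using that norm_triangle_ineq2[of y x] by (simp add: d_def)
  thus ?thesis using de(2)[of x y] True that by (auto simp: d_def dist_norm)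
 next
  case False
  hence "norm y > R" using that norm_triangle_ineq2[of x y] by (simp add: d_def norm_minus_commute)
  thus ?thesis using supp[of x] supp[of y] False et by auto
 qed
 show ?thesis
 proof (intro exI conjI allI)
  show "0 <= 2 * B / d" using B d by simp
  fix x y
  show "norm (G y - G x) <= et + 2 * B / d * norm (y - x)"
  proof (cases "norm (y - x) < d")
   case True
   thus ?thesis using near[OF True] B d by (smt (verit) divide_nonneg_pos mult_nonneg_nonneg norm_ge_zero)
  next
   case False
   have "norm (G y - G x) <= 2 * B" using B(2)[of x] B(2)[of y] norm_triangle_ineq4[of "G y" "G x"] by simp
   also have "... = 2 * B / d * d" using d by simp
   also have "... <= 2 * B / d * norm (y - x)" using False B d by (intro mult_left_mono) auto
   finally show ?thesis using et by simp
  qed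
 qed
qed

lemma second_difference_bound:
 fixes ps :: "real => 'b::real_normed_vector"
 assumes d1: "\<And>s. (ps has_vector_derivative ps' s) (at s)" and d2: "\<And>s. (ps' has_vector_derivative ps'' s) (at s)"
  and B: "\<And>s. s : {0..1} ==> norm (ps'' s - ps'' 0) <= B"
 shows "norm (ps 1 - ps 0 - ps' 0 - (1/2) *. ps'' 0) <= B"
proof -
 have B0: "B >= 0" using B[of 0] by simp
 define r1 where "r1 s = ps' s - ps' 0 - s *. ps'' 0" for s
 have dchi': "(r1 has_vector_derivative (ps'' s - ps'' 0)) (at s)" for s
  unfolding r1_def by (auto intro!: derivative_eq_intros d2)
 have ch': "norm (r1 s) <= B" if s: "s : {0..1}" for s
 proof -
  have "norm (r1 s - r1 0) <= B * norm (s - 0)"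
  proof (rule differentiable_bound[of "{0..1}" r1 "%s h. h *. (ps'' s - ps'' 0)"])
   show "(r1 has_derivative (%h. h *. (ps'' t - ps'' 0))) (at t within {0..1})" for t
    using dchi'[of t] unfolding has_vector_derivative_def by (rule has_derivative_at_withinI)
   show "onorm (%h. h *. (ps'' t - ps'' 0)) <= B" if "t : {0..1}" for t
    by (rule onorm_le) (use B[OF that] in "auto simp: mult.commute[of B] intro!: mult_left_mono")
  qed (use s in auto)
  also have "... <= B" using s B0 by (simp add: mult_left_le)
  finally show ?thesis by (simp add: r1_def)
 qed
 define r0 where "r0 s = ps s - s *. ps' 0 - (s^2 / 2) *. ps'' 0" for s
 have dchi: "(r0 has_vector_derivative r1 s) (at s)" for s
  unfolding r0_def r1_def by (auto intro!: derivative_eq_intros d1)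
 have "norm (r0 1 - r0 0) <= B * norm (1 - 0 :: real)"
 proof (rule differentiable_bound[of "{0..1}" r0 "%s h. h *. r1 s"])
  show "(r0 has_derivative (%h. h *. r1 t)) (at t within {0..1})" for t
   using dchi[of t] unfolding has_vector_derivative_def by (rule has_derivative_at_withinI)
  show "onorm (%h. h *. r1 t) <= B" if "t : {0..1}" for t
   by (rule onorm_le) (use ch'[OF that] in "auto simp: mult.commute[of B] intro!: mult_left_mono")
 qed auto
 moreover have "r0 1 - r0 0 = ps 1 - ps 0 - ps' 0 - (1/2) *. ps'' 0" by (simp add: r0_def)
 ultimately show ?thesis by simp
qed

lemma abs_inner_Basis_le: "e : Basis ==> \<bar>v <.> e\<bar> <= norm v"
 by (rule Basis_le_norm)

lemma D2f_diff_bound: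
 fixes F :: "'a::euclidean_space => 'b::real_normed_vector"
 assumes F: "C_k 2 F" and supp: "\<And>x. norm x >= R ==> F x = 0" and et: "et > 0"
 shows "\<exists>C\<ge>0. \<forall>x y v. norm (D2f F y v v - D2f F x v v) <= (norm v)^2 * (et + C * norm (y - x))"
proof -
 let ?N = "real (card (Basis :: 'a set))"
 define et' where "et' = et / (?N * ?N)"
 have N: "?N > 0" by simp
 have et': "et' > 0" using et N by (simp add: et'_def)
 have "\<forall>e\<in>Basis. \<forall>e'\<in>Basis. \<exists>C\<ge>0. \<forall>x y. norm (D2f F y e e' - D2f F x e e') <= et' + C * norm (y - x)"
  using C_k_2_outside_support(2)[OF F supp]
  by (intro ballI compact_support_modulus[OF continuous_D2f[OF F] _ et']) auto
 then obtain C where C: "\<And>e e'. e : Basis ==> e' : Basis ==> C e e' >= 0 \<and> (\<forall>x y. norm (D2f F y e e' - D2f F x e e') <= et' + C e e' * norm (y - x))"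
  by metis
 define C0 where "C0 = (\<Sum>e\<in>Basis. \<Sum>e'\<in>Basis. C e e')"
 show ?thesis
 proof (intro exI conjI allI)
  show "C0 >= 0" unfolding C0_def using C by (intro sum_nonneg) auto
  fix x y v
  have "D2f F y v v - D2f F x v v = (\<Sum>e\<in>Basis. \<Sum>e'\<in>Basis. ((v <.> e) * (v <.> e')) *. (D2f F y e e' - D2f F x e e'))"
   unfolding D2f_expand[OF F, where x=y and v=v] D2f_expand[OF F, where x=x and v=v]
   by (simp add: sum_subtractf scaleR_diff_right)
  also have "norm ... <= (\<Sum>e\<in>Basis. \<Sum>e'\<in>Basis. (norm v)^2 * (et' + C e e' * norm (y - x)))"
  proof (intro sum_norm_le)
   fix e e' :: 'a assume e: "e : Basis" "e' : Basis"
   have "norm (((v <.> e) * (v <.> e')) *. (D2f F y e e' - D2f F x e e')) = \<bar>v <.> e\<bar> * \<bar>v <.> e'\<bar> * norm (D2f F y e e' - D2f F x e e')"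
    by (simp add: abs_mult)
   also have "... <= norm v * norm v * (et' + C e e' * norm (y - x))"
    using C[OF e] e by (intro mult_mono abs_inner_Basis_le) auto
   finally show "norm (((v <.> e) * (v <.> e')) *. (D2f F y e e' - D2f F x e e')) <= (norm v)^2 * (et' + C e e' * norm (y - x))"
    by (simp add: power2_eq_square)
  qed
  also have "... = (norm v)^2 * (?N * ?N * et' + C0 * norm (y - x))"
   by (simp add: C0_def sum_distrib_left[symmetric] sum.distrib sum_distrib_right[symmetric])
  also have "?N * ?N * et' = et" using N by (simp add: et'_def)
  finally show "norm (D2f F y v v - D2f F x v v) <= (norm v)^2 * (et + C0 * norm (y - x))" .
 qed
qed

lemma taylor_compact_support:
 fixes F :: "'a::euclidean_space => 'b::real_normed_vector"
 assumes F: "C_k 2 F" and supp: "\<And>x. norm x >= R ==> F x = 0" and et: "et > 0"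
 shows "\<exists>C\<ge>0. \<forall>x v. norm (F (x + v) - F x - D1f F x v - (1/2) *. D2f F x v v) <= et * norm v ^ 2 + C * norm v ^ 3"
proof -
 have F': "C_k (Suc (Suc 0)) F" using F by (simp add: numeral_2_eq_2)
 obtain C where C: "C >= 0" "\<And>x y v. norm (D2f F y v v - D2f F x v v) <= (norm v)^2 * (et + C * norm (y - x))"
  using D2f_diff_bound[OF F supp et] by metis
 show ?thesis
 proof (intro exI conjI allI)
  show "C >= 0" by (rule C)
  fix x v :: 'a
  have line: "((%s. x + s *. v) has_vector_derivative v) (at s)" for s :: real
   by (auto intro!: derivative_eq_intros)
  have comp: "((%s. G (x + s *. v)) has_vector_derivative D1f G (x + s *. v) v) (at s)"
   if "C_k (Suc n) G" for G :: "'a => 'b" and s :: real and n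
  proof -
   have l: "((%s. x + s *. v) has_derivative (%h. h *. v)) (at s)"
    using line[of s] by (simp add: has_vector_derivative_def)
   have "((%s. G (x + s *. v)) has_derivative (%h. D1f G (x + s *. v) (h *. v))) (at s)"
    by (rule has_derivative_compose[OF l C_k_has_derivative[OF that]])
   thus ?thesis unfolding has_vector_derivative_def
    by (simp add: linear_scale[OF linear_D1f[OF that]])
  qed
  have "norm (F (x + 1 *. v) - F (x + 0 *. v) - D1f F (x + 0 *. v) v - (1/2) *. D2f F (x + 0 *. v) v v)
    <= (norm v)^2 * (et + C * norm v)"
  proof (rule second_difference_bound[where ps="%s. F (x + s *. v)" and ps'="%s. D1f F (x + s *. v) v"
     and ps''="%s. D2f F (x + s *. v) v v"])
   show "((%s. F (x + s *. v)) has_vector_derivative D1f F (x + s *. v) v) (at s)" for s by (rule comp[OF F'])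
   show "((%s. D1f F (x + s *. v) v) has_vector_derivative D2f F (x + s *. v) v v) (at s)" for s
    by (rule comp[OF C_k_D1[OF F']])
   fix s :: real assume s: "s : {0..1}"
   have "norm (D2f F (x + s *. v) v v - D2f F (x + 0 *. v) v v) <= (norm v)^2 * (et + C * norm (s *. v))"
    using C(2)[where y="x + s *. v" and v=v and x="x + 0 *. v"] by simp
   also have "... <= (norm v)^2 * (et + C * norm v)"
   proof -
    have "norm (s *. v) <= norm v" using s by (simp add: mult_left_le_one_le)
    thus ?thesis using C(1) by (intro mult_left_mono add_left_mono) auto
   qed
   finally show "norm (D2f F (x + s *. v) v v - D2f F (x + 0 *. v) v v) <= (norm v)^2 * (et + C * norm v)" .
  qed
  thus "norm (F (x + v) - F x - D1f F x v - (1/2) *. D2f F x v v) <= et * norm v ^ 2 + C * norm v ^ 3"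
   by (simp add: algebra_simps power2_eq_square power3_eq_cube)
 qed
qed

section \<open>A smooth cutoff\<close>

lemma max_power_derivative:
 assumes k: "k >= 2"
 shows "((\<lambda>t::real. (max 0 t) ^ k) has_real_derivative real k * (max 0 t) ^ (k - 1)) (at t)"
proof -
 consider "t > 0" | "t < 0" | "t = 0" by linarith
 thus ?thesis
 proof cases
  case 1
  have "((%t. t ^ k) has_real_derivative real k * t ^ (k - 1)) (at t)" by (auto intro!: derivative_eq_intros)
  hence "((%t. (max 0 t) ^ k) has_real_derivative real k * t ^ (k - 1)) (at t)"
   by (rule has_field_derivative_transform_within_open[where S="{0<..}"]) (use 1 in auto)
  thus ?thesis using 1 by simp
 next
  case 2
  have "((%t. 0) has_real_derivative 0) (at t)" by simp
  hence "((%t. (max 0 t) ^ k) has_real_derivative 0) (at t)"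
   by (rule has_field_derivative_transform_within_open[where S="{..<0}"]) (use 2 k in auto)
  moreover have "real k * (max 0 t) ^ (k - 1) = 0" using 2 k by (simp add: zero_power)
  ultimately show ?thesis by (simp only:)
 next
  case 3
  have "((\<lambda>h::real. \<bar>h\<bar>) \<longlongrightarrow> \<bar>0\<bar>) (at 0)" by (intro tendsto_intros tendsto_ident_at)
  hence l: "((\<lambda>h::real. \<bar>h\<bar>) \<longlongrightarrow> 0) (at 0)" by simp
  have ev: "eventually (\<lambda>h::real. \<bar>h\<bar> < 1) (at 0)" by (rule order_tendstoD(2)[OF l]) simp
  have "((\<lambda>h::real. (max 0 h) ^ k / h) \<longlongrightarrow> 0) (at 0)"
  proof (rule Lim_null_comparison[OF _ l], use ev in eventually_elim)
   case (elim h)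
   show ?case
   proof (cases "h > 0")
    case True
    have "h ^ k <= h ^ 2" using True elim k by (intro power_decreasing) auto
    thus ?thesis using True by (simp add: divide_le_eq power2_eq_square)
   qed (use k in "auto simp: max_def zero_power")
  qed
  thus ?thesis using 3 k by (simp add: has_field_derivative_iff zero_power)
 qed
qed

definition cutoff :: "real => 'a::euclidean_space => real" where
 "cutoff R x = (max 0 (1 - (x <.> x) / R^2)) ^ 3"

lemma cutoff_bounds: "0 <= cutoff R x" "cutoff R x <= 1"
 unfolding cutoff_def by (auto intro!: power_le_one)

lemma cutoff_outside: "R > 0 ==> norm x >= R ==> cutoff R x = 0"
proof -
 assume "R > 0" "norm x >= R"
 hence "x <.> x >= R^2" by (simp add: power_mono flip: power2_norm_eq_inner)
 hence "(x <.> x) / R^2 >= 1" using \<open>R > 0\<close> by simp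
 thus ?thesis by (simp add: cutoff_def)
qed

lemma cutoff_derivative:
 fixes x :: "'a::euclidean_space"
 shows "(cutoff R has_derivative (%v. 3 * (max 0 (1 - (x <.> x) / R^2)) ^ 2 * (- 2 * (x <.> v) / R^2))) (at x)"
  and "((%x. 3 * (max 0 (1 - (x <.> x) / R^2)) ^ 2 * (- 2 * (x <.> v) / R^2)) has_derivative
   (%w. 3 * (max 0 (1 - (x <.> x) / R^2)) ^ 2 * (- 2 * (w <.> v) / R^2)
    + 3 * (2 * max 0 (1 - (x <.> x) / R^2) * (- 2 * (x <.> w) / R^2)) * (- 2 * (x <.> v) / R^2))) (at x)"
proof -
 have q: "((\<lambda>x::'a. 1 - (x <.> x) / R^2) has_derivative (%v. - 2 * (x <.> v) / R^2)) (at x)"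
 proof -
  have "((\<lambda>x::'a. 1 - (x <.> x) * inverse (R^2)) has_derivative (%v. 0 - (x <.> v + v <.> x) * inverse (R^2))) (at x)"
   by (intro has_derivative_diff has_derivative_const has_derivative_mult_left has_derivative_inner has_derivative_ident)
  thus ?thesis by (simp add: divide_inverse inner_commute mult.commute algebra_simps)
 qed
 have m: "((\<lambda>t::real. (max 0 t) ^ k) has_derivative (%h. real k * (max 0 t) ^ (k - 1) * h)) (at t)" if "k >= 2" for k t
  using max_power_derivative[OF that] by (simp add: has_field_derivative_def)
 show "(cutoff R has_derivative (%v. 3 * (max 0 (1 - (x <.> x) / R^2)) ^ 2 * (- 2 * (x <.> v) / R^2))) (at x)"
  unfolding cutoff_def[abs_def] using has_derivative_compose[OF q m[of 3]] by simp
 have m2: "((\<lambda>x::'a. 3 * (max 0 (1 - (x <.> x) / R^2)) ^ 2) has_derivative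
   (%w. 3 * (2 * max 0 (1 - (x <.> x) / R^2) * (- 2 * (x <.> w) / R^2)))) (at x)"
  using has_derivative_mult_right[OF has_derivative_compose[OF q m[of 2]], of 3] by simp
 have "((%x. - 2 * (x <.> v) / R^2) has_derivative (%w. - 2 * (w <.> v) / R^2)) (at x)"
 proof -
  have "((\<lambda>x::'a. - 2 * (x <.> v) * inverse (R^2)) has_derivative (%w. - 2 * (w <.> v) * inverse (R^2))) (at x)"
   by (intro has_derivative_mult_left has_derivative_mult_right has_derivative_inner_left has_derivative_ident)
  thus ?thesis by (simp add: divide_inverse)
 qed
 from has_derivative_mult[OF m2 this]
 show "((%x. 3 * (max 0 (1 - (x <.> x) / R^2)) ^ 2 * (- 2 * (x <.> v) / R^2)) has_derivative
   (%w. 3 * (max 0 (1 - (x <.> x) / R^2)) ^ 2 * (- 2 * (w <.> v) / R^2)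
    + 3 * (2 * max 0 (1 - (x <.> x) / R^2) * (- 2 * (x <.> w) / R^2)) * (- 2 * (x <.> v) / R^2))) (at x)" .
qed

lemma C_k_cutoff: "R > 0 ==> C_k 2 (cutoff R)"
 unfolding numeral_2_eq_2
proof (rule C_k_SucI[OF cutoff_derivative(1)], rule C_k_SucI[OF cutoff_derivative(2)])
 fix v w :: 'a assume "R > 0"
 show "C_k 0 (%x. 3 * (max 0 (1 - (x <.> x) / R^2)) ^ 2 * (- 2 * (w <.> v) / R^2)
    + 3 * (2 * max 0 (1 - (x <.> x) / R^2) * (- 2 * (x <.> w) / R^2)) * (- 2 * (x <.> v) / R^2))"
  unfolding C_k.simps by (intro continuous_intros) (use \<open>R > 0\<close> in auto)
qed

lemma cutoff_D_bounds:
 fixes x :: "'a::euclidean_space"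
 assumes R: "R >= 1"
 shows "\<bar>D1f (cutoff R) x v\<bar> <= 6 / R * norm v"
  and "\<bar>laplacian (cutoff R) x\<bar> <= 30 * real DIM('a) / R^2"
  and "\<bar>D1f (cutoff R) x v\<bar> <= 6 * norm x / R^2 * norm v"
  and "norm x > R ==> D1f (cutoff R) x v = 0" "norm x > R ==> laplacian (cutoff R) x = 0"
proof -
 have R0: "R > 0" using R by simp
 let ?m = "max 0 (1 - (x <.> x) / R^2)"
 have m: "0 <= ?m" "?m <= 1" by auto
 have D1: "D1f (cutoff R) z = (%v. 3 * (max 0 (1 - (z <.> z) / R^2)) ^ 2 * (- 2 * (z <.> v) / R^2))" for z :: 'a
  by (rule D1f_eq[OF cutoff_derivative(1)])
 have D2: "D2f (cutoff R) x v = (%w. 3 * ?m ^ 2 * (- 2 * (w <.> v) / R^2)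
    + 3 * (2 * ?m * (- 2 * (x <.> w) / R^2)) * (- 2 * (x <.> v) / R^2))" for v
  unfolding D1 by (rule D1f_eq[OF cutoff_derivative(2)])
 have out: "\<And>z::'a. norm z >= R ==> cutoff R z = 0" using cutoff_outside[OF R0] .
 show o: "norm x > R ==> D1f (cutoff R) x v = 0" for v by (rule C_k_2_outside_support(1)[OF C_k_cutoff[OF R0] out])
 show o2: "norm x > R ==> laplacian (cutoff R) x = 0" by (rule C_k_2_outside_support(3)[OF C_k_cutoff[OF R0] out])
 show b: "\<bar>D1f (cutoff R) x v\<bar> <= 6 * norm x / R^2 * norm v" for v
 proof -
  have "\<bar>D1f (cutoff R) x v\<bar> = ?m ^ 2 * (6 / R^2 * \<bar>x <.> v\<bar>)" unfolding D1 by (simp add: abs_mult)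
  also have "... <= 1 * (6 / R^2 * (norm x * norm v))"
   using m by (intro mult_mono power_le_one Cauchy_Schwarz_ineq2 mult_left_mono) auto
  finally show ?thesis by simp
 qed
 show "\<bar>D1f (cutoff R) x v\<bar> <= 6 / R * norm v"
 proof (cases "norm x > R")
  case False
  have "6 * norm x / R^2 * norm v <= 6 * R / R^2 * norm v"
   using False R0 by (intro mult_right_mono divide_right_mono) auto
  with b[of v] show ?thesis using R0 by (simp add: power2_eq_square)
 qed (use o R0 in simp)
 show "\<bar>laplacian (cutoff R) x\<bar> <= 30 * real DIM('a) / R^2"
 proof (cases "norm x > R")
  case True
  thus ?thesis using o2 by simp
 next
  case False
  have "\<bar>D2f (cutoff R) x e e\<bar> <= 30 / R^2" if e: "e : Basis" for e
  proof -
   have xe: "\<bar>x <.> e\<bar> <= R" using Basis_le_norm[OF e, of x] False by simp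
   have "D2f (cutoff R) x e e = 24 * ?m * (x <.> e)^2 / R^2 / R^2 - 6 * ?m ^ 2 / R^2"
    unfolding D2 using e by (simp add: inner_Basis power2_eq_square)
   moreover have "0 <= 24 * ?m * (x <.> e)^2 / R^2 / R^2" "24 * ?m * (x <.> e)^2 / R^2 / R^2 <= 24 / R^2"
   proof -
    show "0 <= 24 * ?m * (x <.> e)^2 / R^2 / R^2" using m by simp
    have "(x <.> e)^2 <= R^2" using xe R0 by (simp add: abs_le_square_iff[symmetric])
    hence "24 * ?m * (x <.> e)^2 <= 24 * 1 * R^2" using m by (intro mult_mono) auto
    hence "24 * ?m * (x <.> e)^2 / R^2 <= 24" using R0 by (simp add: divide_le_eq)
    thus "24 * ?m * (x <.> e)^2 / R^2 / R^2 <= 24 / R^2" by (rule divide_right_mono) simp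
   qed
   moreover have "0 <= 6 * ?m ^ 2 / R^2" "6 * ?m ^ 2 / R^2 <= 6 / R^2"
    using m by (auto intro!: divide_right_mono simp: power_le_one)
   moreover have "6 / R^2 + 24 / R^2 = 30 / R^2" by simp
   moreover have "6 / R^2 >= 0" "24 / R^2 >= 0" by auto
   ultimately show ?thesis by linarith
  qed
  hence "\<bar>laplacian (cutoff R) x\<bar> <= (\<Sum>e\<in>(Basis :: 'a set). 30 / R^2)"
   unfolding laplacian_def by (intro order_trans[OF sum_abs] sum_mono) auto
  thus ?thesis by (simp add: mult.commute)
 qed
qed

lemma cutoff_tendsto:
 fixes x :: "'a::euclidean_space"
 shows "((%n. cutoff (real (Suc n)) x) \<longlonglongrightarrow> 1)"
proof -
 have "(%n. inverse (real (Suc n))) \<longlonglongrightarrow> 0" by (rule LIMSEQ_inverse_real_of_nat)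
 hence "(%n. (max 0 (1 - (x <.> x) * (inverse (real (Suc n)))^2)) ^ 3) \<longlonglongrightarrow> (max 0 (1 - (x <.> x) * 0^2)) ^ 3"
  by (intro tendsto_intros)
 thus ?thesis unfolding cutoff_def by (simp add: divide_inverse power_inverse)
qed

section \<open>One step of the random walk Metropolis chain\<close>

lemma gauss_integrable:
 fixes ps :: "real ^ 'd => real"
 assumes v: "v > 0" and [measurable]: "ps : bmeas borel" and b: "\<And>w. \<bar>ps w\<bar> <= c * (1 + norm w ^ 6)"
 shows "integrable (gaussian v) ps"
proof -
 interpret prob_space "gaussian v :: (real ^ 'd) measure" by (rule prob_space_gaussian[OF v])
 have "integrable (gaussian v) (\<lambda>w :: real ^ 'd. c * (1 + norm w ^ 6))"
  using gaussian_abs_moment[OF v, of 6, where 'd='d] by simp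
 thus ?thesis by (rule Bochner_Integration.integrable_bound) (use b in "auto intro!: AE_I2 order_trans[OF b abs_ge_self]")
qed

lemma power_le_1_6: "k <= 6 ==> (t::real) >= 0 ==> t ^ k <= 1 + t ^ 6"
proof -
 assume k: "k <= 6" and t: "t >= 0"
 show ?thesis
 proof (cases "t <= 1")
  case True
  thus ?thesis using t by (smt (verit) power_le_one zero_le_power)
 next
  case False
  hence "t ^ k <= t ^ 6" using k by (intro power_increasing) auto
  thus ?thesis by simp
 qed
qed

lemma power_le_3_6: "3 <= k ==> k <= 6 ==> (t::real) >= 0 ==> t ^ k <= t ^ 3 + t ^ 6"
proof -
 assume k: "3 <= k" "k <= 6" and t: "t >= 0"
 show ?thesis
 proof (cases "t <= 1")
  case True
  hence "t ^ k <= t ^ 3" using k t by (intro power_decreasing) auto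
  thus ?thesis using t by (smt (verit) zero_le_power)
 next
  case False
  hence "t ^ k <= t ^ 6" using k by (intro power_increasing) auto
  thus ?thesis using t by (smt (verit) zero_le_power)
 qed
qed

definition "gauss_const (T :: 'd::finite itself) = 8 * gauss_moment T 3 + 64 * gauss_moment T 6"

lemma gauss_const_nonneg: "gauss_const TYPE('d::finite) >= 0"
 unfolding gauss_const_def using gauss_moment_nonneg[where 'd='d] by (simp add: add_nonneg_nonneg)

text \<open>Everything of at least third order in the proposal is negligible against the step size.\<close>

lemma gauss_third_order:
 fixes ps :: "real ^ 'd => real"
 assumes h: "0 < h" "h <= 1" and m[measurable]: "ps : bmeas borel"
  and b: "\<And>w. \<bar>ps w\<bar> <= c * (norm w ^ 3 + norm w ^ 6)" and c: "c >= 0"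
 shows "integrable (gaussian (2 * h)) ps" "\<bar>\<integral> w. ps w \<partial>gaussian (2 * h)\<bar> <= c * gauss_const TYPE('d) * (h * sqrt h)"
proof -
 have v: "2 * h > 0" using h by simp
 have s: "sqrt (2 * h) ^ k <= 2 ^ k * (h * sqrt h)" if k: "k >= 3" for k
 proof -
  have "sqrt (2 * h) ^ k = sqrt 2 ^ k * sqrt h ^ k" by (simp add: real_sqrt_mult power_mult_distrib)
  also have "... <= 2 ^ k * sqrt h ^ 3"
  proof (intro mult_mono)
   show "sqrt 2 ^ k <= (2::real) ^ k" by (intro power_mono) (auto intro: real_le_lsqrt)
   show "sqrt h ^ k <= sqrt h ^ 3" using h k by (intro power_decreasing) auto
  qed (use h in auto)
  also have "sqrt h ^ 3 = h * sqrt h" using h by (simp add: power3_eq_cube)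
  finally show ?thesis .
 qed
 have i: "integrable (gaussian (2 * h)) (\<lambda>w :: real ^ 'd. norm w ^ k)" for k by (rule gaussian_abs_moment[OF v])
 have i2: "integrable (gaussian (2 * h)) (\<lambda>w :: real ^ 'd. c * (norm w ^ 3 + norm w ^ 6))" using i by simp
 show int: "integrable (gaussian (2 * h)) ps"
  by (rule Bochner_Integration.integrable_bound[OF i2]) (use b in "auto intro!: AE_I2 order_trans[OF b abs_ge_self]")
 have "\<bar>\<integral> w. ps w \<partial>gaussian (2 * h)\<bar> <= (LINT w|gaussian (2 * h). \<bar>ps w\<bar>)"
  using integral_norm_bound[of "gaussian (2 * h)" ps] by simp
 also have "... <= (LINT w|(gaussian (2 * h) :: (real ^ 'd) measure). c * (norm w ^ 3 + norm w ^ 6))"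
  by (intro Bochner_Integration.integral_mono i2 integrable_abs int b)
 also have "... = c * (sqrt (2 * h) ^ 3 * gauss_moment TYPE('d) 3 + sqrt (2 * h) ^ 6 * gauss_moment TYPE('d) 6)"
  using i by (simp add: gaussian_abs_moment_eq[OF v])
 also have "... <= c * (2 ^ 3 * (h * sqrt h) * gauss_moment TYPE('d) 3 + 2 ^ 6 * (h * sqrt h) * gauss_moment TYPE('d) 6)"
  by (intro mult_left_mono add_mono mult_right_mono s gauss_moment_nonneg c) auto
 also have "... = c * gauss_const TYPE('d) * (h * sqrt h)" by (simp add: gauss_const_def algebra_simps)
 finally show "\<bar>\<integral> w. ps w \<partial>gaussian (2 * h)\<bar> <= c * gauss_const TYPE('d) * (h * sqrt h)" .
qed

lemma gauss_odd_integral: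
 fixes ps :: "real ^ 'd => real"
 assumes v: "v > 0" and [measurable]: "ps : bmeas borel" and odd: "\<And>w. ps (- w) = - ps w"
 shows "(LINT w|gaussian v. ps w) = 0"
proof -
 have "(LINT w|gaussian v. ps w) = (LINT w|distr (gaussian v) borel uminus. ps w)" using gaussian_uminus[where 'd='d, OF v] by simp
 also have "... = (LINT w|gaussian v. - ps w)" by (subst integral_distr) (auto simp: odd)
 finally show ?thesis by simp
qed

locale metropolis =
 fixes V :: "real ^ 'd => real" and b :: "real ^ 'd => real ^ 'd" and Lb :: real
 assumes Lb: "Lb >= 0" and taylor: "\<bar>V (x + w) - V x - b x <.> w\<bar> <= Lb * (norm w)^2"
  and V_meas [measurable]: "V : bmeas borel" and b_cont: "continuous_on UNIV b"
begin

definition "acc x w = min 1 (exp (V x - V (x + w)))"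

lemma acc_bounds: "0 <= acc x w" "acc x w <= 1" by (auto simp: acc_def)

lemma measurable_acc [measurable]: "acc x : bmeas borel"
 unfolding acc_def[abs_def] by measurable

lemma acc_le: "1 - acc x w <= norm (b x) * norm w + Lb * norm w ^ 2"
proof -
 have "1 - acc x w <= max 0 (V (x + w) - V x)"
 proof (cases "V x <= V (x + w)")
  case True
  hence "acc x w = exp (V x - V (x + w))" by (simp add: acc_def)
  moreover have "1 + (V x - V (x + w)) <= exp (V x - V (x + w))" by (rule exp_ge_add_one_self)
  ultimately show ?thesis by linarith
 next
  case False
  hence "acc x w = 1" by (simp add: acc_def)
  thus ?thesis by simp
 qed
 also have "... <= norm (b x) * norm w + Lb * norm w ^ 2"
  using taylor[of x w] norm_cauchy_schwarz[of "b x" w] Lb by auto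
 finally show ?thesis .
qed

lemma acc_expansion: "\<bar>1 - acc x w - max 0 (b x <.> w)\<bar> <= 2 * (norm (b x))^2 * norm w ^ 2 + 2 * Lb^2 * norm w ^ 4 + Lb * norm w ^ 2"
proof -
 define t where "t = V (x + w) - V x"
 have a: "acc x w = min 1 (exp (- t))" by (simp add: acc_def t_def)
 have 1: "\<bar>1 - acc x w - max 0 t\<bar> <= t^2"
 proof (cases "t >= 0")
  case True
  have "exp (- t) <= 1 - t + t^2"
  proof -
   have "exp (- t) = 1 / exp t" by (simp add: exp_minus divide_inverse)
   also have "... <= 1 / (1 + t)" using True exp_ge_add_one_self[of t] by (intro divide_left_mono) auto
   also have "... <= 1 - t + t^2"
   proof -
    have "(1 - t + t^2) * (1 + t) = 1 + t ^ 3" by (simp add: power2_eq_square power3_eq_cube algebra_simps)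
    hence "1 <= (1 - t + t^2) * (1 + t)" using True by simp
    thus ?thesis using True by (simp add: divide_le_eq)
   qed
   finally show ?thesis .
  qed
  moreover have "exp (- t) >= 1 - t" using exp_ge_add_one_self[of "- t"] by simp
  moreover have "exp (- t) <= 1" using True by simp
  ultimately show ?thesis using True by (simp add: a)
 next
  case False
  hence "exp (- t) >= 1" by simp
  thus ?thesis using False by (simp add: a)
 qed
 have tb: "\<bar>t - b x <.> w\<bar> <= Lb * norm w ^ 2" using taylor[of x w] by (simp add: t_def)
 have 2: "\<bar>max 0 t - max 0 (b x <.> w)\<bar> <= Lb * norm w ^ 2" using tb by auto
 have "t^2 <= (norm (b x) * norm w + Lb * norm w ^ 2)^2"
 proof (rule abs_le_square_iff[THEN iffD1])
  have "\<bar>t\<bar> <= norm (b x) * norm w + Lb * norm w ^ 2"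
   using tb Cauchy_Schwarz_ineq2[of "b x" w] by linarith
  also have "... <= \<bar>...\<bar>" by simp
  finally show "\<bar>t\<bar> <= \<bar>norm (b x) * norm w + Lb * norm w ^ 2\<bar>" .
 qed
 also have "... <= 2 * (norm (b x) * norm w)^2 + 2 * (Lb * norm w ^ 2)^2"
  using Lb by (intro square_le_2) auto
 finally have "t^2 <= 2 * (norm (b x))^2 * norm w ^ 2 + 2 * Lb^2 * norm w ^ 4"
  by (simp add: power_mult_distrib power_mult[symmetric])
 thus ?thesis using 1 2 by linarith
qed

text \<open>Rejections lean against the proposals that climb the potential. Half of the linear term of
 the rejection probability is even in the proposal and drops out, the other half produces the drift.\<close>

lemma rejection_drift:
 "\<exists>C\<ge>0. \<forall>h x u. 0 < h --> h <= 1 -->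
   \<bar>(LINT w|gaussian (2 * h). (1 - acc x w) * (u <.> w)) - h * (u <.> b x)\<bar> <= C * norm u * (1 + (norm (b x))^2) * (h * sqrt h)"
proof (intro exI conjI allI impI)
 let ?c = "2 + 2 * Lb^2 + Lb"
 let ?C = "?c * gauss_const TYPE('d)"
 have c0: "?c >= 0" using Lb by simp
 show "?C >= 0" using c0 gauss_const_nonneg[where 'd='d] by (intro mult_nonneg_nonneg)
 fix h :: real and x u :: "real ^ 'd" assume h: "0 < h" "h <= 1"
 have v: "2 * h > 0" using h by simp
 let ?r = "%w. (1 - acc x w - max 0 (b x <.> w)) * (u <.> w)"
 have rb: "\<bar>?r w\<bar> <= (norm u * ?c * (1 + (norm (b x))^2)) * (norm w ^ 3 + norm w ^ 6)" for w
 proof -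
  have "\<bar>?r w\<bar> <= (2 * (norm (b x))^2 * norm w ^ 2 + 2 * Lb^2 * norm w ^ 4 + Lb * norm w ^ 2) * (norm u * norm w)"
   unfolding abs_mult by (intro mult_mono acc_expansion Cauchy_Schwarz_ineq2) (use Lb in auto)
  also have "... = norm u * (2 * (norm (b x))^2 * norm w ^ 3 + 2 * Lb^2 * norm w ^ 5 + Lb * norm w ^ 3)"
   by (simp add: power2_eq_square power3_eq_cube algebra_simps eval_nat_numeral)
  also have "... <= norm u * (2 * (norm (b x))^2 * (norm w ^ 3 + norm w ^ 6) + 2 * Lb^2 * (norm w ^ 3 + norm w ^ 6) + Lb * (norm w ^ 3 + norm w ^ 6))"
   using Lb by (intro mult_left_mono add_mono power_le_3_6) auto
  also have "... = (norm u * (2 * (norm (b x))^2 + 2 * Lb^2 + Lb)) * (norm w ^ 3 + norm w ^ 6)" by (simp add: algebra_simps)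
  also have "... <= (norm u * (?c * (1 + (norm (b x))^2))) * (norm w ^ 3 + norm w ^ 6)"
  proof (intro mult_right_mono mult_left_mono)
   have "(2 * Lb^2 + Lb) * (norm (b x))^2 >= 0" using Lb by simp
   thus "2 * (norm (b x))^2 + 2 * Lb^2 + Lb <= ?c * (1 + (norm (b x))^2)" by (simp add: algebra_simps)
  qed auto
  finally show ?thesis by (simp add: mult.assoc)
 qed
 have rm: "?r : bmeas borel" by measurable
 note r = gauss_third_order[OF h rm rb]
 have k0: "norm u * ?c * (1 + (norm (b x))^2) >= 0" using Lb by (intro mult_nonneg_nonneg) auto
 have pol: "max 0 (b x <.> w) * (u <.> w) = (1/2) * ((w <.> b x) * (w <.> u)) + (1/2) * (\<bar>b x <.> w\<bar> * (u <.> w))" for w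
  by (auto simp: max_def inner_commute abs_if field_simps)
 have i1: "integrable (gaussian (2 * h)) (%w. (w <.> b x) * (w <.> u))" by (rule gaussian_covariance[OF v])
 have i2: "integrable (gaussian (2 * h)) (%w. \<bar>b x <.> w\<bar> * (u <.> w))"
  using integrable_abs[OF i1] by (rule Bochner_Integration.integrable_bound) (auto simp: abs_mult inner_commute)
 have main: "(LINT w|gaussian (2 * h). max 0 (b x <.> w) * (u <.> w)) = h * (u <.> b x)"
 proof -
  have "(LINT w|gaussian (2 * h). max 0 (b x <.> w) * (u <.> w))
   = (1/2) * (LINT w|gaussian (2 * h). (w <.> b x) * (w <.> u)) + (1/2) * (LINT w|gaussian (2 * h). \<bar>b x <.> w\<bar> * (u <.> w))"
   unfolding pol by (subst Bochner_Integration.integral_add) (use i1 i2 in auto)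
  also have "(LINT w|gaussian (2 * h). \<bar>b x <.> w\<bar> * (u <.> w)) = 0"
   by (rule gauss_odd_integral[OF v]) auto
  finally show ?thesis using gaussian_covariance(2)[OF v, of "b x" u] by (simp add: inner_commute)
 qed
 have ip: "integrable (gaussian (2 * h)) (%w. max 0 (b x <.> w) * (u <.> w))"
  unfolding pol using i1 i2 by simp
 have "(LINT w|gaussian (2 * h). (1 - acc x w) * (u <.> w))
   = (LINT w|gaussian (2 * h). ?r w + max 0 (b x <.> w) * (u <.> w))"
  by (rule Bochner_Integration.integral_cong) (auto simp: algebra_simps)
 also have "... = (LINT w|gaussian (2 * h). ?r w) + h * (u <.> b x)"
  using r(1)[OF k0] ip by (subst Bochner_Integration.integral_add) (auto simp: main)
 finally have "(LINT w|gaussian (2 * h). (1 - acc x w) * (u <.> w)) - h * (u <.> b x) = (LINT w|gaussian (2 * h). ?r w)" by simp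
 thus "\<bar>(LINT w|gaussian (2 * h). (1 - acc x w) * (u <.> w)) - h * (u <.> b x)\<bar> <= ?C * norm u * (1 + (norm (b x))^2) * (h * sqrt h)"
  using r(2)[OF k0] by (simp add: ac_simps)
qed

lemma rejection_energy:
 "\<exists>C\<ge>0. \<forall>h x. 0 < h --> h <= 1 -->
   (LINT w|gaussian (2 * h). (1 - acc x w) * (norm w)^2) <= C * (1 + norm (b x)) * (h * sqrt h)"
proof (intro exI conjI allI impI)
 let ?C = "(1 + Lb) * gauss_const TYPE('d)"
 show "?C >= 0" using Lb gauss_const_nonneg[where 'd='d] by (intro mult_nonneg_nonneg) auto
 fix h :: real and x :: "real ^ 'd" assume h: "0 < h" "h <= 1"
 have "\<bar>(1 - acc x w) * (norm w)^2\<bar> <= ((1 + Lb) * (1 + norm (b x))) * (norm w ^ 3 + norm w ^ 6)" for w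
 proof -
  have "\<bar>(1 - acc x w) * (norm w)^2\<bar> <= (norm (b x) * norm w + Lb * norm w ^ 2) * (norm w)^2"
   using acc_bounds[of x w] acc_le[of x w] by (simp add: abs_mult mult_right_mono)
  also have "... = norm (b x) * norm w ^ 3 + Lb * norm w ^ 4"
   by (simp add: power2_eq_square power3_eq_cube algebra_simps eval_nat_numeral)
  also have "... <= norm (b x) * (norm w ^ 3 + norm w ^ 6) + Lb * (norm w ^ 3 + norm w ^ 6)"
   using Lb by (intro mult_left_mono add_mono power_le_3_6) auto
  also have "... = (norm (b x) + Lb) * (norm w ^ 3 + norm w ^ 6)" by (simp add: algebra_simps)
  also have "... <= ((1 + Lb) * (1 + norm (b x))) * (norm w ^ 3 + norm w ^ 6)"
   using Lb by (intro mult_right_mono) (auto simp: algebra_simps)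
  finally show ?thesis .
 qed
 hence "\<bar>\<integral> w. (1 - acc x w) * (norm w)^2 \<partial>gaussian (2 * h)\<bar> <= ((1 + Lb) * (1 + norm (b x))) * gauss_const TYPE('d) * (h * sqrt h)"
  using Lb by (intro gauss_third_order(2)[OF h]) auto
 thus "(LINT w|gaussian (2 * h). (1 - acc x w) * (norm w)^2) <= ?C * (1 + norm (b x)) * (h * sqrt h)"
  by (simp add: ac_simps)
qed

end

locale metropolis_test = metropolis V b Lb for V :: "real ^ 'd => real" and b Lb +
 fixes ph :: "real ^ 'd => 'e::euclidean_space" and R :: real
 assumes ph: "C_k 2 ph" and supp: "norm x >= R ==> ph x = 0"
begin

definition "gen x = laplacian ph x - D1f ph x (b x)"
definition "sqgrad x = (\<Sum>e\<in>Basis. (norm (D1f ph x e))^2)"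

lemma ph': "C_k (Suc (Suc 0)) ph" using ph by (simp add: numeral_2_eq_2)

lemma ph_meas [measurable]: "ph : bmeas borel"
 by (rule borel_measurable_continuous_onI[OF C_k_continuous[OF ph]])

lemma D1_lin: "linear (D1f ph x)" by (rule linear_D1f[OF ph'])

lemma D1_meas [measurable]: "D1f ph x : bmeas borel"
 using linear_continuous_on D1_lin linear_conv_bounded_linear by (intro borel_measurable_continuous_onI) blast

lemma bounds:
 obtains B1 B2 Bb where "B1 >= 0" "B2 >= 0" "Bb >= 0"
  "\<And>x e. e : Basis ==> norm (D1f ph x e) <= B1" "\<And>x w. norm (D1f ph x w) <= B1 * norm w"
  "\<And>x w. norm (D2f ph x w w) <= B2 * norm w ^ 2" "\<And>x. norm x <= R ==> norm (b x) <= Bb"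
  "\<And>x. norm (gen x) <= B2 + B1 * Bb"
proof -
 have "\<forall>e\<in>Basis. \<exists>B\<ge>0. \<forall>x. norm (D1f ph x e) <= B"
  using C_k_2_outside_support(1)[OF ph supp] by (intro ballI compact_support_bounded[OF continuous_D1f[OF ph']]) auto
 then obtain c1 where c1: "\<And>e. e : Basis ==> c1 e >= 0 \<and> (\<forall>x. norm (D1f ph x e) <= c1 e)" by metis
 have "\<forall>e\<in>Basis. \<forall>e'\<in>Basis. \<exists>B\<ge>0. \<forall>x. norm (D2f ph x e e') <= B"
  using C_k_2_outside_support(2)[OF ph supp] by (intro ballI compact_support_bounded[OF continuous_D2f[OF ph]]) auto
 then obtain c2 where c2: "\<And>e e'. e : Basis ==> e' : Basis ==> c2 e e' >= 0 \<and> (\<forall>x. norm (D2f ph x e e') <= c2 e e')" by metis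
 define B1 where "B1 = (\<Sum>e\<in>Basis. c1 e)"
 define B2 where "B2 = (\<Sum>e\<in>Basis. \<Sum>e'\<in>Basis. c2 e e')"
 have "compact (b ` cball 0 R)" by (intro compact_continuous_image continuous_on_subset[OF b_cont]) auto
 then obtain Bb0 where Bb0: "\<And>x. norm x <= R ==> norm (b x) <= Bb0"
  using compact_imp_bounded[THEN bounded_iff[THEN iffD1]] by (metis imageI mem_cball_0)
 define Bb where "Bb = max 0 Bb0"
 have B0: "B1 >= 0" "B2 >= 0" "Bb >= 0" unfolding B1_def B2_def Bb_def using c1 c2 by (auto intro!: sum_nonneg)
 have e1: "norm (D1f ph x e) <= B1" if e: "e : Basis" for x e
 proof -
  have "norm (D1f ph x e) <= c1 e" using c1[OF e] by blast
  also have "... <= B1" unfolding B1_def using e c1 by (intro member_le_sum) auto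
  finally show ?thesis .
 qed
 have w1: "norm (D1f ph x w) <= B1 * norm w" for x w
 proof -
  have "norm (D1f ph x w) <= (\<Sum>e\<in>Basis. norm w * c1 e)"
   unfolding D1f_expand[OF ph', of x w]
  proof (rule sum_norm_le)
   fix e :: "real ^ 'd" assume e: "e : Basis"
   have "\<bar>w <.> e\<bar> * norm (D1f ph x e) <= norm w * c1 e" using c1[OF e] e by (intro mult_mono abs_inner_Basis_le) auto
   thus "norm ((w <.> e) *. D1f ph x e) <= norm w * c1 e" by simp
  qed
  thus ?thesis by (simp add: B1_def sum_distrib_left mult.commute)
 qed
 have w2: "norm (D2f ph x w w) <= B2 * norm w ^ 2" for x w
 proof -
  have "norm (D2f ph x w w) <= (\<Sum>e\<in>Basis. \<Sum>e'\<in>Basis. norm w ^ 2 * c2 e e')"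
   unfolding D2f_expand[OF ph, where x=x and v=w]
  proof (intro sum_norm_le)
   fix e e' :: "real ^ 'd" assume e: "e : Basis" "e' : Basis"
   have "\<bar>w <.> e\<bar> * \<bar>w <.> e'\<bar> * norm (D2f ph x e e') <= norm w * norm w * c2 e e'"
    using c2[OF e] e by (intro mult_mono abs_inner_Basis_le) auto
   thus "norm (((w <.> e) * (w <.> e')) *. D2f ph x e e') <= norm w ^ 2 * c2 e e'" by (simp add: abs_mult power2_eq_square)
  qed
  also have "... = B2 * norm w ^ 2" by (simp add: B2_def sum_distrib_left sum_distrib_right mult.commute)
  finally show ?thesis .
 qed
 have g: "norm (gen x) <= B2 + B1 * Bb" for x
 proof (cases "norm x > R")
  case True
  thus ?thesis using C_k_2_outside_support[OF ph supp True] B0 by (simp add: gen_def)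
 next
  case False
  have "norm (laplacian ph x) <= (\<Sum>e\<in>Basis. \<Sum>e'\<in>Basis. c2 e e')"
   unfolding laplacian_def
  proof (rule sum_norm_le)
   fix e :: "real ^ 'd" assume e: "e : Basis"
   have "norm (D2f ph x e e) <= c2 e e" using c2[OF e e] by blast
   also have "... <= (\<Sum>e'\<in>Basis. c2 e e')" using c2[OF e] e by (intro member_le_sum) auto
   finally show "norm (D2f ph x e e) <= (\<Sum>e'\<in>Basis. c2 e e')" .
  qed
  moreover have "norm (D1f ph x (b x)) <= B1 * Bb"
   using w1[of x "b x"] Bb0[of x] False B0 by (smt (verit) Bb_def mult_left_mono)
  ultimately show ?thesis unfolding gen_def B2_def[symmetric] using norm_triangle_ineq4[of "laplacian ph x" "D1f ph x (b x)"] by linarith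
 qed
 show ?thesis by (rule that[OF B0 e1 w1 w2 _ g]) (use Bb0 in "auto simp: Bb_def le_max_iff_disj")
qed

lemma hessian_gaussian:
 assumes v: "v > 0"
 shows "integrable (gaussian v) (%w. u <.> D2f ph x w w)" "(LINT w|gaussian v. u <.> D2f ph x w w) = v * (u <.> laplacian ph x)"
proof -
 have e: "u <.> D2f ph x w w = (\<Sum>e\<in>Basis. \<Sum>e'\<in>Basis. ((w <.> e) * (w <.> e')) * (u <.> D2f ph x e e'))" for w
  unfolding D2f_expand[OF ph, where x=x and v=w] by (simp add: inner_sum_right)
 show "integrable (gaussian v) (%w. u <.> D2f ph x w w)"
  unfolding e by (intro Bochner_Integration.integrable_sum integrable_mult_left gaussian_covariance(1)[OF v])
 have "(LINT w|gaussian v. u <.> D2f ph x w w) = (\<Sum>e\<in>Basis. \<Sum>e'\<in>Basis. v * (e <.> e') * (u <.> D2f ph x e e'))"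
  unfolding e
  by (simp add: Bochner_Integration.integral_sum Bochner_Integration.integrable_sum gaussian_covariance[OF v])
 also have "... = (\<Sum>e\<in>Basis. v * (u <.> D2f ph x e e))"
  by (intro sum.cong refl) (simp add: inner_Basis if_distrib if_distribR sum.delta cong: if_cong)
 finally show "(LINT w|gaussian v. u <.> D2f ph x w w) = v * (u <.> laplacian ph x)"
  by (simp add: laplacian_def inner_sum_right sum_distrib_left)
qed

lemma D2_meas [measurable]: "(%w. D2f ph x w w) : bmeas borel"
 unfolding D2f_expand[OF ph] by measurable

text \<open>The generator of the chain converges to that of the Langevin diffusion on smooth compactly
 supported functions, uniformly in space.\<close>

lemma generator_approximation:
 assumes et: "et > 0"
 shows "\<exists>C\<ge>0. \<forall>h x u. 0 < h --> h <= 1 -->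
   \<bar>(LINT w|gaussian (2 * h). acc x w * (u <.> (ph (x + w) - ph x))) - h * (u <.> gen x)\<bar> <= norm u * (et * h + C * (h * sqrt h))"
proof -
 obtain B1 B2 Bb where B: "B1 >= 0" "B2 >= 0" "Bb >= 0"
  "\<And>x e. e : Basis ==> norm (D1f ph x e) <= B1" "\<And>x w. norm (D1f ph x w) <= B1 * norm w"
  "\<And>x w. norm (D2f ph x w w) <= B2 * norm w ^ 2" "\<And>x. norm x <= R ==> norm (b x) <= Bb"
  using bounds by metis
 let ?d = "real CARD('d)"
 define et' where "et' = et / (2 * ?d)"
 have et': "et' > 0" using et by (simp add: et'_def)
 obtain Ct where Ct0: "Ct >= 0"
  "\<forall>x w. norm (ph (x + w) - ph x - D1f ph x w - (1/2) *. D2f ph x w w) <= et' * norm w ^ 2 + Ct * norm w ^ 3"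
  using taylor_compact_support[OF ph supp et'] by blast
 note Ct = Ct0(1) Ct0(2)[rule_format]
 obtain Cd where Cd0: "Cd >= 0" "\<forall>h x u. 0 < h --> h <= 1 -->
   \<bar>(LINT w|gaussian (2 * h). (1 - acc x w) * (u <.> w)) - h * (u <.> b x)\<bar> <= Cd * norm u * (1 + (norm (b x))^2) * (h * sqrt h)"
  using rejection_drift by blast
 note Cd = Cd0(1) Cd0(2)[rule_format]
 let ?G = "gauss_const TYPE('d)"
 let ?N = "real (card (Basis :: (real ^ 'd) set))"
 define C where "C = Cd * (?N * B1) * (1 + Bb^2) + (B2 * (Bb + Lb)) * ?G + Ct * ?G"
 have G0: "?G >= 0" by (rule gauss_const_nonneg)
 show ?thesis
 proof (intro exI conjI allI impI)
  show "C >= 0" unfolding C_def using B Cd Ct Lb G0 by (intro add_nonneg_nonneg mult_nonneg_nonneg) auto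
  fix h :: real and x :: "real ^ 'd" and u :: 'e assume h: "0 < h" "h <= 1"
  have v: "2 * h > 0" using h by simp
  let ?g = "gaussian (2 * h) :: (real ^ 'd) measure"
  have hh: "h * sqrt h >= 0" using h by simp
  \<comment> \<open>the derivative, paired with \<open>u\<close>, as a vector\<close>
  define q where "q = (\<Sum>e\<in>Basis. (u <.> D1f ph x e) *. e)"
  have q: "u <.> D1f ph x w = q <.> w" for w
   unfolding D1f_expand[OF ph', of x w] q_def
   by (simp add: inner_sum_right inner_sum_left inner_commute mult.commute)
  have qn: "norm q <= ?N * B1 * norm u"
  proof -
   have "norm q <= (\<Sum>e\<in>(Basis :: (real ^ 'd) set). B1 * norm u)" unfolding q_def
   proof (rule sum_norm_le)
    fix e :: "real ^ 'd" assume e: "e : Basis"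
    have "\<bar>u <.> D1f ph x e\<bar> <= norm u * norm (D1f ph x e)" by (rule Cauchy_Schwarz_ineq2)
    also have "... <= norm u * B1" using B(4)[OF e] by (intro mult_left_mono) auto
    finally show "norm ((u <.> D1f ph x e) *. e) <= B1 * norm u" using e by (simp add: mult.commute)
   qed
   thus ?thesis by (simp add: mult.assoc)
  qed
  let ?A1 = "%w. q <.> w"
  let ?A2 = "%w. (1/2) * (u <.> D2f ph x w w)"
  let ?A3 = "%w. (1 - acc x w) * (q <.> w)"
  let ?A4 = "%w. (1 - acc x w) * ((1/2) * (u <.> D2f ph x w w))"
  let ?A5 = "%w. acc x w * (u <.> (ph (x + w) - ph x - D1f ph x w - (1/2) *. D2f ph x w w))"
  have dec: "acc x w * (u <.> (ph (x + w) - ph x)) = ?A1 w + (?A2 w - (?A3 w + (?A4 w - ?A5 w)))" for w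
   by (simp add: inner_diff_right inner_add_right q field_simps)
  have m1: "?A1 : bmeas borel" by measurable
  have m3: "?A3 : bmeas borel" by measurable
  have m4: "?A4 : bmeas borel" by measurable
  have m5: "?A5 : bmeas borel" by measurable
  have qw: "\<bar>q <.> w\<bar> <= norm q * (1 + norm w ^ 6)" for w
  proof -
   have "\<bar>q <.> w\<bar> <= norm q * norm w" by (rule Cauchy_Schwarz_ineq2)
   also have "... <= norm q * (1 + norm w ^ 6)" using power_le_1_6[of 1 "norm w"] by (intro mult_left_mono) auto
   finally show ?thesis .
  qed
  have i1: "integrable ?g ?A1" by (rule gauss_integrable[OF v m1 qw])
  have i2: "integrable ?g ?A2" using hessian_gaussian(1)[OF v, of u x] by simp
  have i3: "integrable ?g ?A3"
  proof (rule gauss_integrable[OF v m3])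
   fix w
   have "\<bar>?A3 w\<bar> <= 1 * \<bar>q <.> w\<bar>" unfolding abs_mult using acc_bounds[of x w] by (intro mult_right_mono) auto
   thus "\<bar>?A3 w\<bar> <= norm q * (1 + norm w ^ 6)" using qw[of w] by simp
  qed
  have I1: "(LINT w|?g. ?A1 w) = 0" by (rule gauss_odd_integral[OF v m1]) simp
  have I2: "(LINT w|?g. ?A2 w) = h * (u <.> laplacian ph x)" using hessian_gaussian[OF v, of u x] by simp
  have I3: "\<bar>(LINT w|?g. ?A3 w) - h * (u <.> D1f ph x (b x))\<bar> <= norm u * (Cd * (?N * B1) * (1 + Bb^2) * (h * sqrt h))"
  proof (cases "norm x > R")
   case True
   hence "q = 0" using C_k_2_outside_support(1)[OF ph supp] by (simp add: q_def)
   thus ?thesis using q[of "b x"] Cd B hh by (simp add: mult_nonneg_nonneg add_nonneg_nonneg)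
  next
   case False
   have "\<bar>(LINT w|?g. ?A3 w) - h * (q <.> b x)\<bar> <= Cd * norm q * (1 + (norm (b x))^2) * (h * sqrt h)" by (rule Cd(2)[OF h])
   also have "... <= Cd * (?N * B1 * norm u) * (1 + Bb^2) * (h * sqrt h)"
    using Cd(1) B qn False hh by (intro mult_right_mono mult_mono mult_left_mono add_left_mono power_mono) (auto intro!: mult_nonneg_nonneg)
   finally show ?thesis by (simp add: q ac_simps)
  qed
  have b4: "\<bar>?A4 w\<bar> <= (norm u * (B2 * (Bb + Lb))) * (norm w ^ 3 + norm w ^ 6)" for w
  proof (cases "norm x > R")
   case True
   thus ?thesis using C_k_2_outside_support(2)[OF ph supp True] B Lb by (auto intro!: mult_nonneg_nonneg add_nonneg_nonneg)
  next
   case False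
   have "\<bar>(1/2) * (u <.> D2f ph x w w)\<bar> <= norm u * (B2 * norm w ^ 2)"
   proof -
    have "\<bar>u <.> D2f ph x w w\<bar> <= norm u * norm (D2f ph x w w)" by (rule Cauchy_Schwarz_ineq2)
    also have "... <= norm u * (B2 * norm w ^ 2)" by (intro mult_left_mono B) auto
    finally show ?thesis by (simp add: abs_mult)
   qed
   moreover have "\<bar>1 - acc x w\<bar> <= Bb * norm w + Lb * norm w ^ 2"
   proof -
    have "norm (b x) * norm w <= Bb * norm w" using B(7)[of x] False by (intro mult_right_mono) auto
    thus ?thesis using acc_le[of x w] acc_bounds[of x w] by simp
   qed
   ultimately have "\<bar>?A4 w\<bar> <= (Bb * norm w + Lb * norm w ^ 2) * (norm u * (B2 * norm w ^ 2))"
    unfolding abs_mult[of "1 - acc x w"] by (intro mult_mono) (use B Lb in auto)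
   also have "... = norm u * (B2 * (Bb * norm w ^ 3 + Lb * norm w ^ 4))"
    by (simp add: power2_eq_square power3_eq_cube algebra_simps eval_nat_numeral)
   also have "... <= norm u * (B2 * (Bb * (norm w ^ 3 + norm w ^ 6) + Lb * (norm w ^ 3 + norm w ^ 6)))"
    using B Lb by (intro mult_left_mono add_mono power_le_3_6) auto
   finally show ?thesis by (simp add: algebra_simps)
  qed
  have k4: "norm u * (B2 * (Bb + Lb)) >= 0" using B Lb by simp
  note I4 = gauss_third_order[OF h m4 b4 k4]
  have b5: "\<bar>?A5 w\<bar> <= norm u * (et' * norm w ^ 2 + Ct * norm w ^ 3)" for w
  proof -
   have "\<bar>?A5 w\<bar> <= 1 * (norm u * norm (ph (x + w) - ph x - D1f ph x w - (1/2) *. D2f ph x w w))"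
    unfolding abs_mult using acc_bounds[of x w] by (intro mult_mono Cauchy_Schwarz_ineq2) auto
   also have "... <= norm u * (et' * norm w ^ 2 + Ct * norm w ^ 3)"
    using Ct(2)[of x w] by (simp add: mult_left_mono)
   finally show ?thesis .
  qed
  have iw: "integrable ?g (%w. norm w ^ k)" for k by (rule gaussian_abs_moment[OF v])
  have i5: "integrable ?g ?A5"
  proof (rule Bochner_Integration.integrable_bound[where f="%w. norm u * (et' * norm w ^ 2 + Ct * norm w ^ 3)"])
   show "integrable ?g (%w. norm u * (et' * norm w ^ 2 + Ct * norm w ^ 3))" using iw by simp
   show "AE w in ?g. norm (?A5 w) <= norm (norm u * (et' * norm w ^ 2 + Ct * norm w ^ 3))"
    using b5 by (auto intro!: AE_I2 order_trans[OF b5 abs_ge_self])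
  qed (use m5 in simp)
  have I5: "\<bar>\<integral> w. ?A5 w \<partial>?g\<bar> <= norm u * (et * h + Ct * ?G * (h * sqrt h))"
  proof -
   have "\<bar>\<integral> w. ?A5 w \<partial>?g\<bar> <= (LINT w|?g. \<bar>?A5 w\<bar>)" using integral_norm_bound[of ?g ?A5] by simp
   also have "... <= (LINT w|?g. norm u * (et' * norm w ^ 2 + Ct * norm w ^ 3))"
    using iw by (intro Bochner_Integration.integral_mono integrable_abs i5 b5) simp
   also have "... = norm u * (et' * (LINT w|?g. norm w ^ 2) + Ct * (LINT w|?g. norm w ^ 3))" using iw by simp
   also have "(LINT w|?g. norm w ^ 2) = 2 * h * ?d" by (rule gaussian_norm2[OF v])
   also have "(LINT w|?g. norm w ^ 3) <= 1 * ?G * (h * sqrt h)"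
    using gauss_third_order(2)[OF h, of "\<lambda>w :: real ^ 'd. norm w ^ 3" 1] by simp
   also have "et' * (2 * h * ?d) = et * h" by (simp add: et'_def)
   finally show ?thesis using Ct(1) by (simp add: mult_left_mono mult.assoc)
  qed
  have "(LINT w|?g. acc x w * (u <.> (ph (x + w) - ph x)))
   = (LINT w|?g. ?A1 w) + ((LINT w|?g. ?A2 w) - ((LINT w|?g. ?A3 w) + ((LINT w|?g. ?A4 w) - (LINT w|?g. ?A5 w))))"
   unfolding dec using i1 i2 i3 I4(1) i5
   by (simp only: Bochner_Integration.integral_add Bochner_Integration.integral_diff
     Bochner_Integration.integrable_add Bochner_Integration.integrable_diff)
  hence "(LINT w|?g. acc x w * (u <.> (ph (x + w) - ph x))) - h * (u <.> gen x)
   = - ((LINT w|?g. ?A3 w) - h * (u <.> D1f ph x (b x))) - (LINT w|?g. ?A4 w) + (LINT w|?g. ?A5 w)"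
   unfolding I1 I2 by (simp add: gen_def inner_diff_right algebra_simps)
  hence "\<bar>(LINT w|?g. acc x w * (u <.> (ph (x + w) - ph x))) - h * (u <.> gen x)\<bar>
   <= norm u * (Cd * (?N * B1) * (1 + Bb^2) * (h * sqrt h)) + norm u * (B2 * (Bb + Lb)) * ?G * (h * sqrt h)
    + norm u * (et * h + Ct * ?G * (h * sqrt h))"
   using I3 I4(2) I5 by linarith
  also have "... = norm u * (et * h + C * (h * sqrt h))" unfolding C_def by (simp add: algebra_simps)
  finally show "\<bar>(LINT w|?g. acc x w * (u <.> (ph (x + w) - ph x))) - h * (u <.> gen x)\<bar> <= norm u * (et * h + C * (h * sqrt h))" .
 qed
qed

lemma increment_energy:
 "\<exists>C\<ge>0. \<forall>h x. 0 < h --> h <= 1 -->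
   (LINT w|gaussian (2 * h). (norm (ph (x + w) - ph x))^2) <= 2 * h * sqgrad x + C * (h * sqrt h)"
proof -
 obtain B1 B2 where B: "B1 >= 0" "B2 >= 0"
  "\<And>x w. norm (D1f ph x w) <= B1 * norm w" "\<And>x w. norm (D2f ph x w w) <= B2 * norm w ^ 2"
  using bounds by metis
 obtain Ct where Ct0: "Ct >= 0"
  "\<forall>x w. norm (ph (x + w) - ph x - D1f ph x w - (1/2) *. D2f ph x w w) <= 1 * norm w ^ 2 + Ct * norm w ^ 3"
  using taylor_compact_support[OF ph supp zero_less_one] by blast
 note Ct = Ct0(1) Ct0(2)[rule_format]
 define c where "c = 2 * B1 * ((1 + B2) + Ct) + 2 * ((1 + B2)^2 + Ct^2)"
 have c: "c >= 0" unfolding c_def using B Ct by (intro add_nonneg_nonneg mult_nonneg_nonneg) auto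
 show ?thesis
 proof (intro exI conjI allI impI)
  show "c * gauss_const TYPE('d) >= 0" using c gauss_const_nonneg[where 'd='d] by (intro mult_nonneg_nonneg)
  fix h :: real and x :: "real ^ 'd" assume h: "0 < h" "h <= 1"
  have v: "2 * h > 0" using h by simp
  let ?g = "gaussian (2 * h) :: (real ^ 'd) measure"
  let ?r = "%w. (norm (ph (x + w) - ph x))^2 - (norm (D1f ph x w))^2"
  have rb: "\<bar>?r w\<bar> <= c * (norm w ^ 3 + norm w ^ 6)" for w
  proof -
   let ?s = "ph (x + w) - ph x - D1f ph x w"
   have s: "norm ?s <= (1 + B2) * norm w ^ 2 + Ct * norm w ^ 3"
   proof -
    have "norm ?s <= norm (?s - (1/2) *. D2f ph x w w) + norm ((1/2) *. D2f ph x w w)"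
     using norm_triangle_ineq[of "?s - (1/2) *. D2f ph x w w" "(1/2) *. D2f ph x w w"] by simp
    also have "norm ((1/2) *. D2f ph x w w) <= B2 * norm w ^ 2"
    proof -
     have "norm ((1/2) *. D2f ph x w w) = norm (D2f ph x w w) / 2" by simp
     thus ?thesis using B(4)[where x=x and w=w] norm_ge_zero[of "D2f ph x w w"] by linarith
    qed
    finally show ?thesis using Ct(2)[of x w] by (simp add: algebra_simps)
   qed
   have "?r w = 2 * (D1f ph x w <.> ?s) + (norm ?s)^2"
    by (simp add: power2_norm_eq_inner inner_diff_left inner_diff_right inner_commute algebra_simps)
   hence "\<bar>?r w\<bar> <= 2 * (norm (D1f ph x w) * norm ?s) + (norm ?s)^2"
    using Cauchy_Schwarz_ineq2[of "D1f ph x w" ?s] by (smt (verit) zero_le_power2)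
   also have "... <= 2 * ((B1 * norm w) * ((1 + B2) * norm w ^ 2 + Ct * norm w ^ 3)) + (2 * ((1 + B2) * norm w ^ 2)^2 + 2 * (Ct * norm w ^ 3)^2)"
    by (intro add_mono mult_left_mono mult_mono B s square_le_2) (use B in auto)
   also have "... = 2 * B1 * ((1 + B2) * norm w ^ 3 + Ct * norm w ^ 4) + 2 * ((1 + B2)^2 * norm w ^ 4 + Ct^2 * norm w ^ 6)"
    by (simp add: power_mult_distrib power2_eq_square power3_eq_cube algebra_simps eval_nat_numeral)
   also have "... <= 2 * B1 * ((1 + B2) * (norm w ^ 3 + norm w ^ 6) + Ct * (norm w ^ 3 + norm w ^ 6))
     + 2 * ((1 + B2)^2 * (norm w ^ 3 + norm w ^ 6) + Ct^2 * (norm w ^ 3 + norm w ^ 6))"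
    by (intro add_mono mult_left_mono power_le_3_6) (use B Ct in auto)
   also have "... = c * (norm w ^ 3 + norm w ^ 6)" unfolding c_def by (simp add: algebra_simps)
   finally show ?thesis .
  qed
  have rm: "?r : bmeas borel" by measurable
  note r = gauss_third_order[OF h rm rb c]
  have e: "(norm (D1f ph x w))^2 = (\<Sum>e\<in>Basis. \<Sum>e'\<in>Basis. ((w <.> e) * (w <.> e')) * (D1f ph x e <.> D1f ph x e'))" for w
   unfolding power2_norm_eq_inner D1f_expand[OF ph', of x w] by (simp add: inner_sum_left inner_sum_right sum_distrib_left mult.assoc) (simp add: inner_commute)
  have ie: "integrable ?g (%w. (norm (D1f ph x w))^2)" unfolding e
   by (intro Bochner_Integration.integrable_sum integrable_mult_left gaussian_covariance(1)[OF v])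
  have "(LINT w|?g. (norm (D1f ph x w))^2) = (\<Sum>e\<in>Basis. \<Sum>e'\<in>Basis. 2 * h * (e <.> e') * (D1f ph x e <.> D1f ph x e'))"
   unfolding e
   by (simp add: Bochner_Integration.integral_sum Bochner_Integration.integrable_sum gaussian_covariance[OF v])
  also have "... = (\<Sum>e\<in>Basis. 2 * h * (D1f ph x e <.> D1f ph x e))"
   by (intro sum.cong refl) (simp add: inner_Basis if_distrib if_distribR sum.delta cong: if_cong)
  also have "... = 2 * h * sqgrad x" by (simp add: sqgrad_def power2_norm_eq_inner sum_distrib_left)
  finally have "(LINT w|?g. (norm (D1f ph x w))^2) = 2 * h * sqgrad x" .
  moreover have "(LINT w|?g. (norm (ph (x + w) - ph x))^2) = (LINT w|?g. ?r w) + (LINT w|?g. (norm (D1f ph x w))^2)"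
   by (subst Bochner_Integration.integral_add[symmetric, OF r(1) ie]) simp
  ultimately show "(LINT w|?g. (norm (ph (x + w) - ph x))^2) <= 2 * h * sqgrad x + c * gauss_const TYPE('d) * (h * sqrt h)"
   using r(2) by linarith
 qed
qed

end

section \<open>The target distribution\<close>

locale pd_target = pd_problem +
 assumes normalisation_pos: "0 < (LINT x|lborel. exp (- f (K x) - g x))"
  and normalisation_int: "integrable lborel (%x. exp (- f (K x) - g x))"
begin

definition "potential x = f (K x) + g x"
definition "force x = grad g x + KT (grad f (K x))"
abbreviation "Lb \<equiv> Lg + L^2 / wfs"

lemma GDERIV_potential: "GDERIV potential x :> force x"
proof -
 have "(K has_derivative K) (at x)" by (rule bounded_linear_imp_has_derivative[OF bl_K])
 moreover have "(f has_derivative (%h. h <.> grad f (K x))) (at (K x))" using df[of "K x"] by (simp add: gderiv_def)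
 ultimately have "((%x. f (K x)) has_derivative (%h. K h <.> grad f (K x))) (at x)" by (rule has_derivative_compose)
 hence "GDERIV (%x. f (K x)) x :> KT (grad f (K x))" by (simp add: gderiv_def KT_inner)
 from GDERIV_add[OF dg this] show ?thesis
  unfolding potential_def[abs_def] force_def by (simp add: add.commute)
qed

lemma lip_force: "norm (force x - force y) <= Lb * norm (x - y)"
proof -
 have "force x - force y = (grad g x - grad g y) + KT (grad f (K x) - grad f (K y))"
  by (simp add: force_def linear_diff[OF linear_KT])
 also have "norm ... <= norm (grad g x - grad g y) + norm (KT (grad f (K x) - grad f (K y)))" by (rule norm_triangle_ineq)
 also have "... <= Lg * norm (x - y) + L * (L * norm (x - y) / wfs)"
 proof (rule add_mono[OF lip_grad_g])
  have "norm (KT (grad f (K x) - grad f (K y))) <= L * norm (grad f (K x) - grad f (K y))" by (rule norm_KT)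
  also have "... <= L * (norm (K x - K y) / wfs)" by (intro mult_left_mono lip_grad_f L_nonneg)
  also have "K x - K y = K (x - y)" by (simp add: linear_diff[OF linear_K])
  also have "L * (norm (K (x - y)) / wfs) <= L * (L * norm (x - y) / wfs)"
   using wfs by (intro mult_left_mono divide_right_mono norm_K L_nonneg) auto
  finally show "norm (KT (grad f (K x) - grad f (K y))) <= L * (L * norm (x - y) / wfs)" .
 qed
 finally show ?thesis by (simp add: power2_eq_square algebra_simps)
qed

lemma Lb_nonneg: "Lb >= 0" using Lg wfs by (auto intro!: add_nonneg_nonneg)

lemma continuous_force: "continuous_on S force"
proof -
 have "Lb-lipschitz_on UNIV force" using lip_force Lb_nonneg by (intro lipschitz_onI) (auto simp: dist_norm)
 from lipschitz_on_continuous_on[OF this] show ?thesis by (rule continuous_on_subset) simp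
qed

lemma continuous_potential: "continuous_on S potential"
 using GDERIV_potential unfolding gderiv_def
 by (meson continuous_at_imp_continuous_on has_derivative_continuous)

lemma borel_potential [measurable]: "potential : bmeas borel" "force : bmeas borel"
 by (intro borel_measurable_continuous_onI continuous_potential continuous_force)+

sublocale metropolis potential force Lb
proof
 show "0 <= Lb" by (rule Lb_nonneg)
 show "continuous_on UNIV force" by (rule continuous_force)
 show "\<bar>potential (x + w) - potential x - force x <.> w\<bar> <= Lb * (norm w)^2" for x w
 proof -
  have "norm (potential (x + w) - potential x - ((x + w) - x) <.> force x) <= norm ((x + w) - x) * (Lb * norm w)"
  proof (rule differentiable_bound_linearization[where S="closed_segment x (x + w)" and f'="%y h. h <.> force y"])
   show "x + t *. (x + w - x) : closed_segment x (x + w)" if "t : {0..1}" for t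
    using that by (auto simp: in_segment algebra_simps intro!: exI[of _ t])
   show "(potential has_derivative (%h. h <.> force y)) (at y within closed_segment x (x + w))" for y
    using GDERIV_potential[of y] unfolding gderiv_def by (rule has_derivative_at_withinI)
   show "onorm ((%h. h <.> force y) - (%h. h <.> force x)) <= Lb * norm w" if "y : closed_segment x (x + w)" for y
   proof (rule onorm_le)
    fix h :: "real ^ 'b"
    have "norm (y - x) <= norm w"
     using segment_bound(1)[OF that] by (simp add: norm_minus_commute)
    hence "norm (force y - force x) <= Lb * norm w"
     using lip_force[of y x] Lb_nonneg by (meson mult_left_mono order_trans)
    hence "norm h * norm (force y - force x) <= norm h * (Lb * norm w)" by (intro mult_left_mono) auto
    moreover have "((%h. h <.> force y) - (%h. h <.> force x)) h = h <.> (force y - force x)" by (simp add: inner_diff_right)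
    ultimately show "norm (((%h. h <.> force y) - (%h. h <.> force x)) h) <= Lb * norm w * norm h"
     using Cauchy_Schwarz_ineq2[of h "force y - force x"] by (simp add: mult.commute)
   qed
  qed auto
  thus ?thesis by (simp add: inner_commute power2_eq_square ac_simps)
 qed
qed simp

abbreviation "mus \<equiv> target f g K"

definition "Zc = (LINT u|lborel. exp (- f (K u) - g u))"
definition "target_dens x = exp (- potential x) / Zc"

lemma Zc: "Zc > 0" using normalisation_pos by (simp add: Zc_def)

lemma target_eq: "mus = density lborel (%x. ennreal (target_dens x))"
 by (simp add: target_def target_dens_def Zc_def potential_def)

lemma target_dens_pos: "target_dens x > 0" using Zc by (simp add: target_dens_def)

lemma borel_target_dens [measurable]: "target_dens : bmeas borel"
 unfolding target_dens_def[abs_def] by measurable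

lemma sets_target [simp, measurable_cong]: "sets mus = sets borel" by (simp add: target_eq)

lemma prob_space_target: "prob_space mus"
proof
 have "NN lborel (%x. exp (- f (K x) - g x)) = ennreal Zc"
  unfolding Zc_def by (rule nn_integral_eq_integral[OF normalisation_int]) simp
 hence Z: "NN lborel (%x. exp (- potential x)) = ennreal Zc" by (simp add: potential_def)
 have "NN lborel (%x. target_dens x) = (NI lborel (%x. ennreal (exp (- potential x)) / ennreal Zc))"
  using Zc by (simp add: target_dens_def divide_ennreal)
 also have "... = ennreal Zc / ennreal Zc" unfolding Z[symmetric] by (rule nn_integral_divide) measurable
 also have "... = 1" using Zc by (simp add: divide_ennreal)
 finally have "NN lborel (%x. target_dens x) = 1" .
 thus "emeasure mus (space mus) = 1" by (simp add: target_eq emeasure_density)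
qed

lemma prob_distribution_target: "prob_distribution mus"
 using prob_space_target by (simp add: prob_distribution_def)

lemma potential_lower: "potential x >= potential 0 - (norm (force 0))^2 / wg + wg / 4 * (norm x)^2"
proof -
 have f1: "f (K x) >= f (K 0) + grad f (K 0) <.> (K x - K 0)"
  using strongly_convex_ge_tangent[OF scf df, of "K 0" "K x"] wf
  by (smt (verit) divide_nonneg_nonneg mult_nonneg_nonneg zero_le_power2)
 have g1: "g x >= g 0 + grad g 0 <.> (x - 0) + wg / 2 * (norm (x - 0))^2"
  by (rule strongly_convex_ge_tangent[OF scg dg])
 have "grad f (K 0) <.> (K x - K 0) = KT (grad f (K 0)) <.> x"
  by (simp add: KT_inner linear_0[OF linear_K])
 hence 1: "potential x >= potential 0 + force 0 <.> x + wg / 2 * (norm x)^2"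
  using f1 g1 by (simp add: potential_def force_def inner_add_left)
 have "- (2 * (force 0 <.> x)) <= wg / 2 * (norm x)^2 + (norm (force 0))^2 / (wg / 2)"
  using wg by (intro inner_young_neg) simp
 thus ?thesis using 1 by (simp add: field_simps)
qed

lemma gauss_dens_exp:
 assumes "v > 0"
 shows "gauss_dens v x = (1 / sqrt (2 * pi * v)) ^ CARD('z) * exp (- (norm (x :: real ^ 'z))\<^sup>2 / (2 * v))"
proof -
 have "gauss_dens v x = (\<Prod>i\<in>UNIV. (1 / sqrt (2 * pi * v)) * exp (- (x $ i)\<^sup>2 / (2 * v)))"
  unfolding gauss_dens_def normal_density_def using assms by simp
 also have "... = (1 / sqrt (2 * pi * v)) ^ CARD('z) * exp (\<Sum>i\<in>UNIV. - (x $ i)\<^sup>2 / (2 * v))"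
  by (simp add: prod_dividef exp_sum power_divide)
 also have "(\<Sum>i\<in>UNIV. - (x $ i)\<^sup>2 / (2 * v)) = - (norm x)\<^sup>2 / (2 * v)"
 proof -
  have "(norm x)^2 = (\<Sum>i\<in>UNIV. (x $ i)^2)"
   unfolding power2_norm_eq_inner by (simp add: inner_vec_def power2_eq_square)
  thus ?thesis by (simp add: sum_divide_distrib[symmetric] sum_negf)
 qed
 finally show ?thesis .
qed

text \<open>The target has a Gaussian upper bound, hence moments of all orders.\<close>

lemma target_moment: "integrable mus (%x. norm x ^ k)"
proof -
 define v where "v = 2 / wg"
 have v: "v > 0" using wg by (simp add: v_def)
 define c where "c = exp (- (potential 0 - (norm (force 0))^2 / wg)) / Zc / (1 / sqrt (2 * pi * v)) ^ CARD('b)"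
 have c: "c >= 0" using Zc v by (simp add: c_def)
 have dom: "target_dens x <= c * gauss_dens v x" for x
 proof -
  have e: "exp (- (norm x)\<^sup>2 / (2 * v)) = exp (- (wg / 4 * (norm x)^2))" by (simp add: v_def mult.commute)
  have "exp (- potential x) <= exp (- (potential 0 - (norm (force 0))^2 / wg) + - (wg / 4 * (norm x)^2))"
   using potential_lower[of x] by simp
  also have "... = exp (- (potential 0 - (norm (force 0))^2 / wg)) * exp (- (norm x)\<^sup>2 / (2 * v))"
   unfolding e by (rule exp_add)
  finally have "target_dens x <= exp (- (potential 0 - (norm (force 0))^2 / wg)) * exp (- (norm x)\<^sup>2 / (2 * v)) / Zc"
   unfolding target_dens_def using Zc by (intro divide_right_mono) auto
  also have "... = c * gauss_dens v x"
   unfolding c_def gauss_dens_exp[OF v] using v by simp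
  finally show ?thesis .
 qed
 have "NN mus (%x. norm x ^ k) = (NI lborel (%x. ennreal (target_dens x) * ennreal (norm x ^ k)))"
  unfolding target_eq by (subst nn_integral_density) auto
 also have "... <= (NI ((lborel :: (real ^ 'b) measure)) (%x. ennreal c * (ennreal (gauss_dens v x) * ennreal (norm x ^ k))))"
 proof (rule nn_integral_mono)
  fix x :: "real ^ 'b"
  have "ennreal (target_dens x) <= ennreal c * ennreal (gauss_dens v x)"
   using ennreal_leI[OF dom[of x]] c by (simp add: ennreal_mult')
  thus "ennreal (target_dens x) * ennreal (norm x ^ k) <= ennreal c * (ennreal (gauss_dens v x) * ennreal (norm x ^ k))"
   unfolding mult.assoc[symmetric] by (rule mult_right_mono) simp
 qed
 also have "... = ennreal c * NN (gaussian v :: (real ^ 'b) measure) (%x. norm x ^ k)"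
  unfolding gaussian_eq_density by (subst nn_integral_cmult) (auto simp: nn_integral_density)
 also have "... < \<infinity>"
  using gaussian_abs_moment[OF v, of k, where 'd='b] by (simp add: integrable_iff_bounded ennreal_mult_less_top)
 finally show ?thesis by (intro integrableI_nonneg) auto
qed

lemma norm_force_le: "norm (force x) <= norm (force 0) + Lb * norm x"
 using lip_force[of x 0] norm_triangle_ineq2[of "force x" "force 0"] by simp

lemma power4_add_le: "0 <= (a::real) ==> 0 <= b ==> (a + b) ^ 4 <= 8 * (a ^ 4 + b ^ 4)"
proof -
 assume "0 <= a" "0 <= b"
 have "(a + b)^2 <= 2 * a^2 + 2 * b^2" using zero_le_power2[of "a - b"] by (simp add: power2_eq_square algebra_simps)
 hence "((a + b)^2)^2 <= (2 * a^2 + 2 * b^2)^2" by (intro power_mono) auto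
 also have "... <= 8 * ((a^2)^2 + (b^2)^2)" using zero_le_power2[of "a^2 - b^2"] by (simp add: power2_eq_square algebra_simps)
 finally show ?thesis by (simp add: power_mult[symmetric])
qed

lemma integrable_force4: "integrable mus (%x. norm (force x) ^ 4)"
proof (rule Bochner_Integration.integrable_bound)
 interpret prob_space mus by (rule prob_space_target)
 show "integrable mus (%x. 8 * (norm (force 0) ^ 4 + Lb ^ 4 * norm x ^ 4))"
  using target_moment[of 4] by simp
 show "AE x in mus. norm (norm (force x) ^ 4) <= norm (8 * (norm (force 0) ^ 4 + Lb ^ 4 * norm x ^ 4))"
 proof (rule AE_I2)
  fix x
  have "norm (force x) ^ 4 <= (norm (force 0) + Lb * norm x) ^ 4" by (intro power_mono norm_force_le) simp
  also have "... <= 8 * (norm (force 0) ^ 4 + (Lb * norm x) ^ 4)" using Lb_nonneg by (intro power4_add_le) auto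
  finally show "norm (norm (force x) ^ 4) <= norm (8 * (norm (force 0) ^ 4 + Lb ^ 4 * norm x ^ 4))"
   by (simp add: power_mult_distrib)
 qed
qed simp

text \<open>Detailed balance: for a symmetric proposal the flow from \<open>x\<close> to \<open>x + w\<close> is the minimum of the
 two densities, which is unchanged when \<open>x + w\<close> and \<open>- w\<close> are taken for \<open>x\<close> and \<open>w\<close>.\<close>

lemma metropolis_invariant:
 assumes v: "v > 0" and [measurable]: "q : bmeas borel"
 shows "(\<integral>\<^sup>+ x. \<integral>\<^sup>+ w. ennreal (acc x w) * q (x + w) + ennreal (1 - acc x w) * q x \<partial>gaussian v \<partial>mus) = (NI mus (%x. q x))"
proof -
 let ?g = "gaussian v :: (real ^ 'b) measure"
 let ?l = "lborel :: (real ^ 'b) measure"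
 interpret G: prob_space ?g by (rule prob_space_gaussian[OF v])
 interpret LG: pair_sigma_finite ?l ?g ..
 define m where "m x w = min (target_dens x) (target_dens (x + w))" for x w
 have ma: "target_dens x * acc x w = m x w" for x w
 proof -
  have "exp (- potential x) * min 1 (exp (potential x - potential (x + w))) = min (exp (- potential x)) (exp (- potential (x + w)))"
   by (auto simp: min_def exp_add[symmetric] mult_le_cancel_left)
  hence "exp (- potential x) / Zc * min 1 (exp (potential x - potential (x + w))) = min (exp (- potential x)) (exp (- potential (x + w))) / Zc"
   by simp
  also have "... = m x w" unfolding m_def target_dens_def using Zc by (simp add: min_divide_distrib_right)
  finally show ?thesis by (simp add: target_dens_def acc_def)
 qed
 have acc_meas [measurable]: "(%p. acc (fst p) (snd p)) : bmeas (borel >< borel)"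
  unfolding acc_def by measurable
 have accm [measurable]: "(%p. acc (fst p) (snd p)) : bmeas (?l >< ?g)"
  unfolding acc_def by measurable
 have mm [measurable]: "(%p. m (fst p) (snd p)) : bmeas (?l >< ?g)"
  unfolding m_def by measurable
 have mm2: "(%x. m x w) : bmeas borel" for w unfolding m_def by measurable
 note [measurable] = mm2
 have flow: "(\<integral>\<^sup>+ x. \<integral>\<^sup>+ w. ennreal (m x w) * q (x + w) \<partial>?g \<partial>?l) = (\<integral>\<^sup>+ x. \<integral>\<^sup>+ w. ennreal (m x w) * q x \<partial>?g \<partial>?l)"
 proof -
  have "(\<integral>\<^sup>+ x. \<integral>\<^sup>+ w. ennreal (m x w) * q (x + w) \<partial>?g \<partial>?l) = (\<integral>\<^sup>+ w. \<integral>\<^sup>+ x. ennreal (m x w) * q (x + w) \<partial>?l \<partial>?g)"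
   by (rule LG.Fubini'[symmetric]) (simp add: case_prod_unfold)
  also have "... = (\<integral>\<^sup>+ w. \<integral>\<^sup>+ y. ennreal (m y (- w)) * q y \<partial>?l \<partial>?g)"
  proof (rule nn_integral_cong)
   fix w :: "real ^ 'b"
   have "(NI ?l (%y. ennreal (m y (- w)) * q y)) = (NI (distr ?l borel ((+) w)) (%y. ennreal (m y (- w)) * q y))"
    by (simp add: lborel_distr_plus)
   also have "... = (NI ?l (%x. ennreal (m (w + x) (- w)) * q (w + x)))"
    by (subst nn_integral_distr) auto
   also have "... = (NI ?l (%x. ennreal (m x w) * q (x + w)))"
    by (simp add: m_def add.commute min.commute)
   finally show "(NI ?l (%x. ennreal (m x w) * q (x + w))) = (NI ?l (%y. ennreal (m y (- w)) * q y))" ..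
  qed
  also have "... = (\<integral>\<^sup>+ w. \<integral>\<^sup>+ y. ennreal (m y w) * q y \<partial>?l \<partial>distr ?g borel uminus)"
  proof (subst nn_integral_distr)
   have "(%p. ennreal (m (snd p) (fst p)) * q (snd p)) : bmeas (borel >< ?l)" unfolding m_def by measurable
   thus "(%w. \<integral>\<^sup>+ y. ennreal (m y w) * q y \<partial>?l) : bmeas (distr ?g borel uminus)"
    using lborel.borel_measurable_nn_integral[of "%w y. ennreal (m y w) * q y" borel] by (simp add: case_prod_unfold)
  qed auto
  also have "... = (\<integral>\<^sup>+ w. \<integral>\<^sup>+ y. ennreal (m y w) * q y \<partial>?l \<partial>?g)" unfolding gaussian_uminus[OF v] ..
  also have "... = (\<integral>\<^sup>+ x. \<integral>\<^sup>+ w. ennreal (m x w) * q x \<partial>?g \<partial>?l)"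
   by (rule LG.Fubini') (simp add: case_prod_unfold)
  finally show ?thesis .
 qed
 have mx [measurable]: "(%w. m x w) : bmeas borel" for x unfolding m_def by measurable
 have im: "(%x. \<integral>\<^sup>+ w. ennreal (m x w) * q (x + w) \<partial>?g) : bmeas borel"
 proof -
  have "(%p. ennreal (m (fst p) (snd p)) * q (fst p + snd p)) : bmeas (borel >< ?g)" unfolding m_def by measurable
  thus ?thesis using G.borel_measurable_nn_integral[of "%x w. ennreal (m x w) * q (x + w)" borel] by (simp add: case_prod_unfold)
 qed
 have im2: "(%x. \<integral>\<^sup>+ w. ennreal (target_dens x * (1 - acc x w)) * q x \<partial>?g) : bmeas borel"
 proof -
  have "(%p. ennreal (target_dens (fst p) * (1 - acc (fst p) (snd p))) * q (fst p)) : bmeas (borel >< ?g)"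
   unfolding acc_def by measurable
  thus ?thesis using G.borel_measurable_nn_integral[of "%x w. ennreal (target_dens x * (1 - acc x w)) * q x" borel] by (simp add: case_prod_unfold)
 qed
 have im3: "(%x. \<integral>\<^sup>+ w. ennreal (m x w) * q x \<partial>?g) : bmeas borel"
 proof -
  have "(%p. ennreal (m (fst p) (snd p)) * q (fst p)) : bmeas (borel >< ?g)" unfolding m_def by measurable
  thus ?thesis using G.borel_measurable_nn_integral[of "%x w. ennreal (m x w) * q x" borel] by (simp add: case_prod_unfold)
 qed
 have qm: "(%w. q (x + w)) : bmeas borel" for x by measurable
 have kern: "(%x. \<integral>\<^sup>+ w. ennreal (acc x w) * q (x + w) + ennreal (1 - acc x w) * q x \<partial>?g) : bmeas borel"
 proof -
  have "(%p. ennreal (acc (fst p) (snd p)) * q (fst p + snd p) + ennreal (1 - acc (fst p) (snd p)) * q (fst p)) : bmeas (borel >< ?g)"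
   unfolding acc_def by measurable
  thus ?thesis using G.borel_measurable_nn_integral[of "%x w. ennreal (acc x w) * q (x + w) + ennreal (1 - acc x w) * q x" borel]
   by (simp add: case_prod_unfold)
 qed
 have "(\<integral>\<^sup>+ x. \<integral>\<^sup>+ w. ennreal (acc x w) * q (x + w) + ennreal (1 - acc x w) * q x \<partial>?g \<partial>mus)
   = (NI ?l (%x. ennreal (target_dens x) * (NI ?g (%w. ennreal (acc x w) * q (x + w) + ennreal (1 - acc x w) * q x))))"
  unfolding target_eq by (subst nn_integral_density) (use kern in auto)
 also have "... = (NI ?l (%x. (NI ?g (%w. ennreal (m x w) * q (x + w))) + (NI ?g (%w. ennreal (target_dens x * (1 - acc x w)) * q x))))"
 proof (rule nn_integral_cong)
  fix x
  have "ennreal (target_dens x) * (NI ?g (%w. ennreal (acc x w) * q (x + w) + ennreal (1 - acc x w) * q x))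
   = (NI ?g (%w. ennreal (target_dens x) * (ennreal (acc x w) * q (x + w) + ennreal (1 - acc x w) * q x)))"
   by (rule nn_integral_cmult[symmetric]) measurable
  also have "... = (NI ?g (%w. ennreal (m x w) * q (x + w) + ennreal (target_dens x * (1 - acc x w)) * q x))"
  proof (rule nn_integral_cong)
   fix w
   have "ennreal (m x w) = ennreal (target_dens x) * ennreal (acc x w)"
    unfolding ma[symmetric] using target_dens_pos[of x] by (intro ennreal_mult') simp
   moreover have "ennreal (target_dens x * (1 - acc x w)) = ennreal (target_dens x) * ennreal (1 - acc x w)"
    using target_dens_pos[of x] by (intro ennreal_mult') simp
   ultimately show "ennreal (target_dens x) * (ennreal (acc x w) * q (x + w) + ennreal (1 - acc x w) * q x)
    = ennreal (m x w) * q (x + w) + ennreal (target_dens x * (1 - acc x w)) * q x"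
    by (simp add: distrib_left mult.assoc)
  qed
  also have "... = (NI ?g (%w. ennreal (m x w) * q (x + w))) + (NI ?g (%w. ennreal (target_dens x * (1 - acc x w)) * q x))"
   by (rule nn_integral_add) measurable
  finally show "ennreal (target_dens x) * (NI ?g (%w. ennreal (acc x w) * q (x + w) + ennreal (1 - acc x w) * q x))
   = (NI ?g (%w. ennreal (m x w) * q (x + w))) + (NI ?g (%w. ennreal (target_dens x * (1 - acc x w)) * q x))" .
 qed
 also have "... = (\<integral>\<^sup>+ x. \<integral>\<^sup>+ w. ennreal (m x w) * q (x + w) \<partial>?g \<partial>?l) + (\<integral>\<^sup>+ x. \<integral>\<^sup>+ w. ennreal (target_dens x * (1 - acc x w)) * q x \<partial>?g \<partial>?l)"
  by (rule nn_integral_add) (use im im2 in simp_all)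
 also have "... = (NI ?l (%x. (NI ?g (%w. ennreal (m x w) * q x)) + (NI ?g (%w. ennreal (target_dens x * (1 - acc x w)) * q x))))"
  unfolding flow by (rule nn_integral_add[symmetric]) (use im3 im2 in simp_all)
 also have "... = (NI ?l (%x. ennreal (target_dens x) * q x))"
 proof (rule nn_integral_cong)
  fix x
  have "(NI ?g (%w. ennreal (m x w) * q x)) + (NI ?g (%w. ennreal (target_dens x * (1 - acc x w)) * q x))
   = (NI ?g (%w. ennreal (m x w) * q x + ennreal (target_dens x * (1 - acc x w)) * q x))"
   by (rule nn_integral_add[symmetric]) measurable
  also have "... = (NI ?g (%w. ennreal (target_dens x) * q x))"
  proof (rule nn_integral_cong)
   fix w
   have "ennreal (m x w) + ennreal (target_dens x * (1 - acc x w)) = ennreal (m x w + target_dens x * (1 - acc x w))"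
    unfolding ma[symmetric] using target_dens_pos[of x] acc_bounds[of x w] by (intro ennreal_plus[symmetric]) auto
   also have "m x w + target_dens x * (1 - acc x w) = target_dens x" unfolding ma[symmetric] by (simp add: algebra_simps)
   finally show "ennreal (m x w) * q x + ennreal (target_dens x * (1 - acc x w)) * q x = ennreal (target_dens x) * q x"
    by (simp add: distrib_right[symmetric])
  qed
  finally show "(NI ?g (%w. ennreal (m x w) * q x)) + (NI ?g (%w. ennreal (target_dens x * (1 - acc x w)) * q x)) = ennreal (target_dens x) * q x"
   by (simp add: G.emeasure_space_1[simplified])
 qed
 also have "... = (NI mus (%x. q x))" unfolding target_eq by (subst nn_integral_density) auto
 finally show ?thesis .
qed

end

section \<open>One step of the coupled dynamics\<close>

lemma le_1_plus_square: "(t::real) <= 1 + t^2"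
proof -
 have "2 * t <= t^2 + 1" using zero_le_power2[of "t - 1"] by (simp add: power2_diff)
 thus ?thesis using zero_le_power2[of t] by linarith
qed

locale pd_test = pd_target +
 fixes ph :: "real ^ 'b => real ^ 'a" and R lam :: real
 assumes C2: "C_k 2 ph" and supp0: "norm x >= R ==> ph x = 0" and lam0: "lam > 0"
begin

sublocale metropolis_test potential force Lb ph R
 by unfold_locales (use C2 supp0 in auto)

definition "cost z x = (norm (fst z - x))^2 + (norm (snd z - ph x))^2 / lam"
definition "euler h z w = (fst z - h *. Ax z + w, snd z - (h * lam) *. Ay z)"
definition "step_cost h z x w = acc x w * cost (euler h z w) (x + w) + (1 - acc x w) * cost (euler h z w) x"
definition "moment_bound z x = 1 + (norm (fst z - x))^2 + (norm (snd z - ph x))^2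
  + (norm (Ax z))^2 + (norm (Ay z))^2 + norm (force x) ^ 4"

lemma step_cost_eq:
 fixes h z x w
 defines "u \<equiv> fst z - x - h *. Ax z" and "v \<equiv> snd z - ph x - (h * lam) *. Ay z"
 shows "step_cost h z x w = (norm u)^2 + (norm v)^2 / lam + 2 * ((1 - acc x w) * (u <.> w)) + (1 - acc x w) * (norm w)^2
   - 2 / lam * (acc x w * (v <.> (ph (x + w) - ph x))) + 1 / lam * (acc x w * (norm (ph (x + w) - ph x))^2)"
proof -
 have u: "fst (euler h z w) - (x + w) = u" "fst (euler h z w) - x = u + w"
  by (simp_all add: euler_def u_def algebra_simps)
 have v: "snd (euler h z w) - ph (x + w) = v - (ph (x + w) - ph x)" "snd (euler h z w) - ph x = v"
  by (simp_all add: euler_def v_def algebra_simps)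
 have 1: "(norm (u + w))^2 = (norm u)^2 + 2 * (u <.> w) + (norm w)^2"
  by (simp add: power2_norm_eq_inner inner_add_left inner_add_right inner_commute)
 have 2: "(norm (v - d))^2 = (norm v)^2 - 2 * (v <.> d) + (norm d)^2" for d
  by (simp add: power2_norm_eq_inner inner_diff_left inner_diff_right inner_commute)
 show ?thesis unfolding step_cost_def cost_def u v 1 2 using lam0 by (simp add: field_simps)
qed

lemma moment_bound_ge_1: "moment_bound z x >= 1"
 unfolding moment_bound_def by (simp add: add.assoc)

lemma step_cost_integral_le:
 assumes et: "et > 0"
 shows "\<exists>C\<ge>0. \<forall>h z x. 0 < h --> h <= 1 -->
   integrable (gaussian (2 * h)) (step_cost h z x) \<and>
   (LINT w|gaussian (2 * h). step_cost h z x w) <= cost z x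
    - 2 * h * ((fst z - x) <.> (Ax z - force x) + (snd z - ph x) <.> Ay z + (snd z - ph x) <.> gen x / lam)
    + 2 * h * sqgrad x / lam + (et * h + C * (h * sqrt h)) * moment_bound z x"
proof -
 define et' where "et' = et * lam / (2 * (1 + lam))"
 have et': "et' > 0" using et lam0 by (simp add: et'_def)
 obtain c1 where c1: "c1 >= 0" "\<forall>h x u. 0 < h --> h <= 1 -->
   \<bar>(LINT w|gaussian (2 * h). (1 - acc x w) * (u <.> w)) - h * (u <.> force x)\<bar> <= c1 * norm u * (1 + (norm (force x))^2) * (h * sqrt h)"
  using rejection_drift by blast
 obtain c2 where c2: "c2 >= 0" "\<forall>h x. 0 < h --> h <= 1 -->
   (LINT w|gaussian (2 * h). (1 - acc x w) * (norm w)^2) <= c2 * (1 + norm (force x)) * (h * sqrt h)"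
  using rejection_energy by blast
 obtain c3 where c3: "c3 >= 0" "\<forall>h x u. 0 < h --> h <= 1 -->
   \<bar>(LINT w|gaussian (2 * h). acc x w * (u <.> (ph (x + w) - ph x))) - h * (u <.> gen x)\<bar> <= norm u * (et' * h + c3 * (h * sqrt h))"
  using generator_approximation[OF et'] by blast
 obtain c4 where c4: "c4 >= 0" "\<forall>h x. 0 < h --> h <= 1 -->
   (LINT w|gaussian (2 * h). (norm (ph (x + w) - ph x))^2) <= 2 * h * sqgrad x + c4 * (h * sqrt h)"
  using increment_energy by blast
 obtain G where G: "G >= 0" "\<And>x. norm (gen x) <= G"
 proof (rule bounds)
  fix B1 B2 Bb :: real assume "B1 >= 0" "B2 >= 0" "Bb >= 0" "\<And>x. norm (gen x) <= B2 + B1 * Bb"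
  thus thesis by (intro that[of "B2 + B1 * Bb"]) auto
 qed
 obtain B where B: "B >= 0" "\<And>x. norm (ph x) <= B"
  using compact_support_bounded[OF C_k_continuous[OF C2], of R] supp0 by fastforce
 define C where "C = 2 + lam + (1 + G^2) + 2 * c1 + 2 * c2 + 2 * (1 + lam) * c3 / lam + c4 / lam"
 have C: "C >= 0" unfolding C_def using c1 c2 c3 c4 lam0 by (intro add_nonneg_nonneg mult_nonneg_nonneg divide_nonneg_nonneg) auto
 show ?thesis
 proof (intro exI[of _ C] conjI allI impI)
  show "C >= 0" by (rule C)
  fix h :: real and z :: "(real ^ 'b) \<times> (real ^ 'a)" and x :: "real ^ 'b" assume h: "0 < h" "h <= 1"
  have vh: "2 * h > 0" using h by simp
  define u where "u = fst z - x" define v where "v = snd z - ph x"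
  define u' where "u' = u - h *. Ax z" define v' where "v' = v - (h * lam) *. Ay z"
  define b where "b = force x" define Q where "Q = moment_bound z x"
  let ?g = "gaussian (2 * h) :: (real ^ 'b) measure"
  interpret Gs: prob_space ?g by (rule prob_space_gaussian[OF vh])
  have m[measurable]: "acc x : bmeas borel" unfolding acc_def[abs_def] by measurable
  have dB: "norm (ph (x + w) - ph x) <= 2 * B" for w
   using norm_triangle_ineq4[of "ph (x + w)" "ph x"] B(2)[of x] B(2)[of "x + w"] by linarith
  have i1: "integrable ?g (%w. (1 - acc x w) * (u' <.> w))"
  proof (rule gauss_integrable[OF vh, where c="norm u'"])
   fix w :: "real ^ 'b"
   have "\<bar>(1 - acc x w) * (u' <.> w)\<bar> <= 1 * (norm u' * norm w)"
    unfolding abs_mult using acc_bounds[of x w] by (intro mult_mono Cauchy_Schwarz_ineq2) auto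
   also have "... <= norm u' * (1 + norm w ^ 6)" using power_le_1_6[of 1 "norm w"] by (simp add: mult_left_mono)
   finally show "\<bar>(1 - acc x w) * (u' <.> w)\<bar> <= norm u' * (1 + norm w ^ 6)" .
  qed measurable
  have i2: "integrable ?g (%w. (1 - acc x w) * (norm w)^2)"
  proof (rule gauss_integrable[OF vh, where c=1])
   fix w :: "real ^ 'b"
   have "\<bar>(1 - acc x w) * (norm w)^2\<bar> <= 1 * (norm w)^2"
    unfolding abs_mult using acc_bounds[of x w] by (intro mult_mono) auto
   also have "... <= 1 * (1 + norm w ^ 6)" using power_le_1_6[of 2 "norm w"] by simp
   finally show "\<bar>(1 - acc x w) * (norm w)^2\<bar> <= 1 * (1 + norm w ^ 6)" .
  qed measurable
  have i3: "integrable ?g (%w. acc x w * (v' <.> (ph (x + w) - ph x)))"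
  proof (rule Gs.integrable_const_bound[of _ "norm v' * (2 * B)"], rule AE_I2)
   fix w
   have "\<bar>acc x w * (v' <.> (ph (x + w) - ph x))\<bar> <= 1 * (norm v' * norm (ph (x + w) - ph x))"
    unfolding abs_mult using acc_bounds[of x w] by (intro mult_mono Cauchy_Schwarz_ineq2) auto
   also have "... <= norm v' * (2 * B)" using dB by (simp add: mult_left_mono)
   finally show "norm (acc x w * (v' <.> (ph (x + w) - ph x))) <= norm v' * (2 * B)" by simp
  qed measurable
  have i4': "integrable ?g (%w. (norm (ph (x + w) - ph x))^2)"
  proof (rule Gs.integrable_const_bound[of _ "(2 * B)^2"], rule AE_I2)
   show "norm ((norm (ph (x + w) - ph x))^2) <= (2 * B)^2" for w
    using power_mono[OF dB[of w] norm_ge_zero, of 2] by simp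
  qed measurable
  have i4: "integrable ?g (%w. acc x w * (norm (ph (x + w) - ph x))^2)"
  proof (rule Bochner_Integration.integrable_bound[OF i4'])
   show "AE w in ?g. norm (acc x w * (norm (ph (x + w) - ph x))^2) <= norm ((norm (ph (x + w) - ph x))^2)"
    using acc_bounds by (intro AE_I2) (auto simp: abs_mult intro!: mult_left_le_one_le)
  qed measurable
  have eq: "step_cost h z x w = (norm u')^2 + (norm v')^2 / lam + 2 * ((1 - acc x w) * (u' <.> w)) + (1 - acc x w) * (norm w)^2
   - 2 / lam * (acc x w * (v' <.> (ph (x + w) - ph x))) + 1 / lam * (acc x w * (norm (ph (x + w) - ph x))^2)" for w
   unfolding u'_def v'_def u_def v_def by (rule step_cost_eq)
  have eq': "step_cost h z x = (%w. (norm u')^2 + (norm v')^2 / lam + 2 * ((1 - acc x w) * (u' <.> w)) + (1 - acc x w) * (norm w)^2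
   - 2 / lam * (acc x w * (v' <.> (ph (x + w) - ph x))) + 1 / lam * (acc x w * (norm (ph (x + w) - ph x))^2))"
   by (rule ext) (rule eq)
  note ints = integrable_mult_right[OF i1, of 2] i2 integrable_mult_right[OF i3, of "2/lam"] integrable_mult_right[OF i4, of "1/lam"]
  show "integrable ?g (step_cost h z x)" unfolding eq'
   by (intro Bochner_Integration.integrable_add Bochner_Integration.integrable_diff ints) auto
  define E1 E2 E3 E4 where "E1 = (LINT w|?g. (1 - acc x w) * (u' <.> w))" and "E2 = (LINT w|?g. (1 - acc x w) * (norm w)^2)"
   and "E3 = (LINT w|?g. acc x w * (v' <.> (ph (x + w) - ph x)))"
   and "E4 = (LINT w|?g. acc x w * (norm (ph (x + w) - ph x))^2)"
  have I: "(LINT w|?g. step_cost h z x w) = (norm u')^2 + (norm v')^2 / lam + 2 * E1 + E2 - 2 / lam * E3 + 1 / lam * E4"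
  proof (rule has_bochner_integral_integral_eq)
   have hc: "has_bochner_integral ?g (%_. c) c" for c :: real
    using has_bochner_integral_integrable[of ?g "%_. c"] by (simp add: Gs.prob_space[simplified])
   show "has_bochner_integral ?g (step_cost h z x) ((norm u')^2 + (norm v')^2 / lam + 2 * E1 + E2 - 2 / lam * E3 + 1 / lam * E4)"
    unfolding eq' E1_def E2_def E3_def E4_def
    by (intro has_bochner_integral_add has_bochner_integral_diff hc has_bochner_integral_mult_right
      has_bochner_integral_integrable i1 i2 i3 i4)
  qed
  define hs where "hs = h * sqrt h"
  have hs: "hs >= 0" "h^2 <= hs"
  proof -
   show "hs >= 0" using h by (simp add: hs_def)
   have "h <= sqrt h" using h by (intro real_le_rsqrt) (simp add: power2_eq_square mult_left_le_one_le)
   thus "h^2 <= hs" using h by (simp add: hs_def power2_eq_square)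
  qed
  have Qe: "Q = 1 + (norm u)^2 + (norm v)^2 + (norm (Ax z))^2 + (norm (Ay z))^2 + norm b ^ 4"
   unfolding Q_def moment_bound_def u_def v_def b_def ..
  have p4: "norm b ^ 4 = ((norm b)^2)^2" by (simp add: power_mult[symmetric])
  have nn: "0 <= (norm u)^2" "0 <= (norm v)^2" "0 <= (norm (Ax z))^2" "0 <= (norm (Ay z))^2" "0 <= norm b ^ 4" by simp_all
  have b2: "(norm b)^2 <= 1 + norm b ^ 4" unfolding p4 by (rule le_1_plus_square)
  have Q1: "Q >= 1" using nn unfolding Qe by linarith
  have u'b: "norm u' * (1 + (norm b)^2) <= Q"
  proof -
   have "norm u' <= norm u + norm (Ax z)"
   proof -
    have "norm u' <= norm u + norm (h *. Ax z)" unfolding u'_def by (rule norm_triangle_ineq4)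
    moreover have "norm (h *. Ax z) <= norm (Ax z)" using h by (simp add: mult_left_le_one_le)
    ultimately show ?thesis by simp
   qed
   hence "(norm u')^2 <= (norm u + norm (Ax z))^2" by (intro power_mono) auto
   also have "... <= 2 * (norm u)^2 + 2 * (norm (Ax z))^2"
    using zero_le_power2[of "norm u - norm (Ax z)"] by (simp add: power2_sum power2_diff)
   finally have 1: "(norm u')^2 <= 2 * (norm u)^2 + 2 * (norm (Ax z))^2" .
   have 2: "(1 + (norm b)^2)^2 <= 2 + 2 * norm b ^ 4"
    unfolding p4 using zero_le_power2[of "1 - (norm b)^2"] by (simp add: power2_sum power2_diff)
   have "2 * (norm u' * (1 + (norm b)^2)) <= (norm u')^2 + (1 + (norm b)^2)^2"
    using sum_squares_bound[of "norm u'" "1 + (norm b)^2"] by simp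
   with 1 2 nn show ?thesis unfolding Qe by linarith
  qed
  have v'b: "norm v' <= (1 + lam) * Q"
  proof -
   have "norm v' <= norm v + norm ((h * lam) *. Ay z)" unfolding v'_def by (rule norm_triangle_ineq4)
   also have "... <= norm v + lam * norm (Ay z)"
    using h lam0 by (simp add: abs_mult mult_left_le_one_le mult_right_mono)
   also have "... <= (1 + lam) * norm v + (1 + lam) * norm (Ay z)"
    using lam0 by (intro add_mono mult_right_mono) (auto simp: distrib_right)
   also have "... = (1 + lam) * (norm v + norm (Ay z))" by (simp add: distrib_left)
   also have "... <= (1 + lam) * Q"
   proof (intro mult_left_mono)
    have "2 * norm v <= 1 + (norm v)^2" "2 * norm (Ay z) <= 1 + (norm (Ay z))^2"
     using sum_squares_bound[of 1 "norm v"] sum_squares_bound[of 1 "norm (Ay z)"] by simp_all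
    with nn show "norm v + norm (Ay z) <= Q" unfolding Qe by linarith
   qed (use lam0 in simp)
   finally show ?thesis .
  qed
  have A1: "(norm u')^2 <= (norm u)^2 - 2 * h * (u <.> Ax z) + Q * hs"
  proof -
   have "(norm u')^2 = (norm u)^2 - 2 * h * (u <.> Ax z) + (norm (Ax z))^2 * h^2"
    unfolding u'_def power2_norm_eq_inner
    by (simp add: inner_diff_left inner_diff_right inner_commute power2_eq_square)
   moreover have "(norm (Ax z))^2 * h^2 <= Q * hs"
    using hs nn unfolding Qe by (intro mult_mono) (auto simp: algebra_simps)
   ultimately show ?thesis by simp
  qed
  have A2: "(norm v')^2 / lam <= (norm v)^2 / lam - 2 * h * (v <.> Ay z) + lam * (Q * hs)"
  proof -
   have "(norm v')^2 = (norm v)^2 - 2 * (h * lam) * (v <.> Ay z) + (h * lam)^2 * (norm (Ay z))^2"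
    unfolding v'_def power2_norm_eq_inner
    by (simp add: inner_diff_left inner_diff_right inner_commute power2_eq_square)
   hence "(norm v')^2 / lam = (norm v)^2 / lam - 2 * h * (v <.> Ay z) + lam * ((norm (Ay z))^2 * h^2)"
    using lam0 by (simp add: field_simps power2_eq_square)
   moreover have "lam * ((norm (Ay z))^2 * h^2) <= lam * (Q * hs)"
    using hs nn lam0 unfolding Qe by (intro mult_left_mono mult_mono) (auto simp: algebra_simps)
   ultimately show ?thesis by simp
  qed
  have A3: "2 * E1 <= 2 * h * (u <.> b) + Q * hs + 2 * c1 * (Q * hs)"
  proof -
   have "E1 - h * (u' <.> b) <= c1 * norm u' * (1 + (norm b)^2) * hs"
    using c1(2)[rule_format, OF h, of x u'] unfolding E1_def b_def hs_def by (simp add: abs_le_iff)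
   also have "... = c1 * ((norm u' * (1 + (norm b)^2)) * hs)" by (simp add: mult.assoc)
   also have "... <= c1 * (Q * hs)" using c1(1) hs(1) by (intro mult_left_mono mult_right_mono u'b) auto
   finally have 1: "2 * E1 <= 2 * h * (u' <.> b) + 2 * c1 * (Q * hs)" by simp
   have "2 * h * (u' <.> b) = 2 * h * (u <.> b) - 2 * (Ax z <.> b) * h^2"
    by (simp add: u'_def inner_diff_left power2_eq_square algebra_simps)
   moreover have "- (2 * (Ax z <.> b)) * h^2 <= Q * hs"
   proof -
    have "- (2 * (Ax z <.> b)) <= (norm (Ax z))^2 + (norm b)^2"
     using zero_le_power2[of "norm (Ax z + b)"] unfolding power2_norm_eq_inner
     by (simp add: inner_add_left inner_add_right inner_commute)
    also have "... <= Q" using b2 nn unfolding Qe by linarith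
    finally have "- (2 * (Ax z <.> b)) * h^2 <= Q * h^2" by (rule mult_right_mono) simp
    also have "... <= Q * hs" using hs Q1 by (intro mult_left_mono) auto
    finally show ?thesis .
   qed
   ultimately show ?thesis using 1 by simp
  qed
  have A4: "E2 <= 2 * c2 * (Q * hs)"
  proof -
   have "E2 <= c2 * (1 + norm b) * hs" using c2(2)[rule_format, OF h, of x] unfolding E2_def b_def hs_def .
   also have "... <= c2 * (2 * Q) * hs"
   proof (intro mult_right_mono mult_left_mono)
    have "2 * norm b <= 1 + (norm b)^2" using sum_squares_bound[of 1 "norm b"] by simp
    moreover have "(norm b)^2 <= Q" using b2 nn unfolding Qe by linarith
    ultimately show "1 + norm b <= 2 * Q" using Q1 by linarith
   qed (use c2 hs in auto)
   finally show ?thesis by (simp add: ac_simps)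
  qed
  have A5: "- (2 / lam * E3) <= - (2 * h * (v <.> gen x) / lam) + (1 + G^2) * (Q * hs) + et * h * Q + 2 * (1 + lam) * c3 / lam * (Q * hs)"
  proof -
   have "h * (v' <.> gen x) - E3 <= norm v' * (et' * h + c3 * hs)"
    using c3(2)[rule_format, OF h, of x v'] unfolding E3_def hs_def by (simp add: abs_le_iff)
   also have "... <= (1 + lam) * Q * (et' * h + c3 * hs)"
    using c3(1) hs h et' by (intro mult_right_mono v'b) auto
   finally have "2 / lam * (h * (v' <.> gen x) - E3) <= 2 / lam * ((1 + lam) * Q * (et' * h + c3 * hs))"
    using lam0 by (intro mult_left_mono) auto
   also have "... = (2 / lam * (1 + lam) * et') * h * Q + 2 * (1 + lam) * c3 / lam * (Q * hs)"
    using lam0 by (simp add: field_simps)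
   also have "2 / lam * (1 + lam) * et' = et"
   proof -
    have "1 + lam ~= 0" "lam ~= 0" using lam0 by auto
    thus ?thesis by (simp add: et'_def)
   qed
   finally have 1: "- (2 / lam * E3) <= - (2 / lam * (h * (v' <.> gen x))) + et * h * Q + 2 * (1 + lam) * c3 / lam * (Q * hs)"
    by (simp add: right_diff_distrib)
   have v'g: "v' <.> gen x = v <.> gen x - (h * lam) * (Ay z <.> gen x)" by (simp add: v'_def inner_diff_left)
   have "2 / lam * (h * (v' <.> gen x)) = 2 * h * (v <.> gen x) / lam - 2 * (Ay z <.> gen x) * h^2"
    unfolding v'g using lam0 by (simp add: field_simps power2_eq_square)
   moreover have "2 * (Ay z <.> gen x) * h^2 <= (1 + G^2) * (Q * hs)"
   proof -
    have "2 * (Ay z <.> gen x) <= (norm (Ay z))^2 + (norm (gen x))^2"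
     using zero_le_power2[of "norm (Ay z - gen x)"] unfolding power2_norm_eq_inner
     by (simp add: inner_diff_left inner_diff_right inner_commute)
    also have "... <= Q + G^2 * Q"
    proof (rule add_mono)
     show "(norm (Ay z))^2 <= Q" using nn unfolding Qe by linarith
     have "(norm (gen x))^2 <= G^2 * 1" using G(2)[of x] by (simp add: power_mono)
     also have "... <= G^2 * Q" by (intro mult_left_mono Q1) auto
     finally show "(norm (gen x))^2 <= G^2 * Q" .
    qed
    finally have "2 * (Ay z <.> gen x) * h^2 <= (Q + G^2 * Q) * h^2" by (rule mult_right_mono) simp
    also have "... <= (Q + G^2 * Q) * hs" using hs Q1 by (intro mult_left_mono) auto
    finally show ?thesis by (simp add: algebra_simps)
   qed
   ultimately show ?thesis using 1 by linarith
  qed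
  have A6: "1 / lam * E4 <= 2 * h * sqgrad x / lam + c4 / lam * (Q * hs)"
  proof -
   have "E4 <= (LINT w|?g. (norm (ph (x + w) - ph x))^2)" unfolding E4_def
    by (rule integral_mono[OF i4 i4']) (use acc_bounds in "auto intro!: mult_left_le_one_le")
   also have "... <= 2 * h * sqgrad x + c4 * hs" using c4(2)[rule_format, OF h, of x] unfolding hs_def .
   also have "... <= 2 * h * sqgrad x + c4 * (Q * hs)"
    using c4(1) hs Q1 by (intro add_left_mono mult_left_mono) (auto simp: mult_le_cancel_right1)
   finally have "1 / lam * E4 <= 1 / lam * (2 * h * sqgrad x + c4 * (Q * hs))" using lam0 by (intro mult_left_mono) auto
   thus ?thesis by (simp add: add_divide_distrib)
  qed
  have CQ: "C * hs * Q = Q * hs + lam * (Q * hs) + Q * hs + 2 * c1 * (Q * hs) + 2 * c2 * (Q * hs) + (1 + G^2) * (Q * hs)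
    + 2 * (1 + lam) * c3 / lam * (Q * hs) + c4 / lam * (Q * hs)"
   unfolding C_def by (simp add: distrib_right distrib_left mult.commute mult.left_commute)
  have d: "2 * h * (u <.> (Ax z - b) + v <.> Ay z + v <.> gen x / lam)
    = 2 * h * (u <.> Ax z) - 2 * h * (u <.> b) + 2 * h * (v <.> Ay z) + 2 * h * (v <.> gen x) / lam"
   by (simp add: inner_diff_right algebra_simps)
  have "(LINT w|?g. step_cost h z x w) <= (norm u)^2 + (norm v)^2 / lam
    - 2 * h * (u <.> (Ax z - b) + v <.> Ay z + v <.> gen x / lam) + 2 * h * sqgrad x / lam + (et * h + C * hs) * Q"
   unfolding I distrib_right[of "et * h" "C * hs" Q] CQ d using A1 A2 A3 A4 A5 A6 by linarith
  thus "(LINT w|?g. step_cost h z x w) <= cost z x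
    - 2 * h * ((fst z - x) <.> (Ax z - force x) + (snd z - ph x) <.> Ay z + (snd z - ph x) <.> gen x / lam)
    + 2 * h * sqgrad x / lam + (et * h + C * (h * sqrt h)) * moment_bound z x"
   unfolding cost_def u_def v_def b_def hs_def Q_def .
 qed
qed

text \<open>The two bilinear terms cancel, so \<open>ph\<close> enters only through its distance to the map
 \<open>x \<mapsto> grad f (K x)\<close>, at which the conjugate gradient is \<open>K x\<close>.\<close>

lemma drift_monotone:
 "- ((fst z - x) <.> (Ax z - force x) + (snd z - ph x) <.> Ay z)
   <= - wg * (norm (fst z - x))^2 - wfs * (norm (snd z - ph x))^2
    + norm (fst z - x) * (L * norm (ph x - grad f (K x))) + norm (snd z - ph x) * (norm (ph x - grad f (K x)) / wf)"
proof -
 define u v e where "u = fst z - x" and "v = snd z - ph x" and "e = ph x - grad f (K x)"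
 have 1: "Ax z - force x = (grad g (fst z) - grad g x) + (KT v + KT e)"
  by (simp add: Ax_def force_def v_def e_def linear_diff[OF linear_KT])
 have 2: "Ay z = (gfs (snd z) - gfs (ph x)) + (gfs (ph x) - gfs (grad f (K x))) - K u"
  by (simp add: Ay_def u_def linear_diff[OF linear_K])
 have "u <.> (Ax z - force x) + v <.> Ay z
   = (grad g (fst z) - grad g x) <.> u + (gfs (snd z) - gfs (ph x)) <.> v + K u <.> e + v <.> (gfs (ph x) - gfs (grad f (K x)))"
  unfolding 1 2 by (simp add: inner_add_right inner_diff_right KT_inner inner_commute)
 moreover have "(grad g (fst z) - grad g x) <.> u >= wg * (norm u)^2" unfolding u_def by (rule mono_g)
 moreover have "(gfs (snd z) - gfs (ph x)) <.> v >= wfs * (norm v)^2" unfolding v_def by (rule mono_fs)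
 moreover have "- (K u <.> e) <= norm u * (L * norm e)"
 proof -
  have "- (K u <.> e) <= norm (K u) * norm e" using Cauchy_Schwarz_ineq2[of "K u" e] by linarith
  also have "... <= (L * norm u) * norm e" by (intro mult_right_mono norm_K) auto
  finally show ?thesis by (simp add: ac_simps)
 qed
 moreover have "- (v <.> (gfs (ph x) - gfs (grad f (K x)))) <= norm v * (norm e / wf)"
 proof -
  have "- (v <.> (gfs (ph x) - gfs (grad f (K x)))) <= norm v * norm (gfs (ph x) - gfs (grad f (K x)))"
   using Cauchy_Schwarz_ineq2[of v "gfs (ph x) - gfs (grad f (K x))"] by linarith
  also have "... <= norm v * (norm e / wf)" unfolding e_def by (intro mult_left_mono lipfs) auto
  finally show ?thesis .
 qed
 ultimately show ?thesis unfolding u_def[symmetric] v_def[symmetric] e_def[symmetric] by linarith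
qed

definition "residual ep x = sqgrad x / lam + (norm (gen x))^2 / (4 * lam^2 * (wfs - wg / lam))
  + (L^2 / (4 * ep) + lam / (4 * ep * wf^2)) * (norm (ph x - grad f (K x)))^2"

lemma young_le: "c > 0 ==> a * b <= c * a^2 + b^2 / (4 * c)" for a b c :: real
proof -
 assume c: "c > 0"
 have "0 <= (2 * c * a - b)^2" by simp
 hence "4 * c * (a * b) <= 4 * c * (c * a^2) + b^2" by (simp add: power2_eq_square algebra_simps)
 thus ?thesis using c by (simp add: field_simps)
qed

lemma step_cost_contracts:
 assumes et: "et > 0" and ep: "ep > 0" and big: "lam > wg / wfs"
 shows "\<exists>C\<ge>0. \<forall>h z x. 0 < h --> h <= 1 -->
   integrable (gaussian (2 * h)) (step_cost h z x) \<and>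
   (LINT w|gaussian (2 * h). step_cost h z x w) <= (1 - 2 * h * (wg - ep)) * cost z x + 2 * h * residual ep x
    + (et * h + C * (h * sqrt h)) * moment_bound z x"
proof -
 obtain C where C: "C >= 0" "\<forall>h z x. 0 < h --> h <= 1 -->
   integrable (gaussian (2 * h)) (step_cost h z x) \<and>
   (LINT w|gaussian (2 * h). step_cost h z x w) <= cost z x
    - 2 * h * ((fst z - x) <.> (Ax z - force x) + (snd z - ph x) <.> Ay z + (snd z - ph x) <.> gen x / lam)
    + 2 * h * sqgrad x / lam + (et * h + C * (h * sqrt h)) * moment_bound z x"
  using step_cost_integral_le[OF et] by blast
 define ka where "ka = wfs - wg / lam"
 have ka: "ka > 0" using big lam0 wfs wg by (simp add: ka_def field_simps)
 show ?thesis
 proof (intro exI[of _ C] conjI allI impI C(1))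
  fix h :: real and z :: "(real ^ 'b) \<times> (real ^ 'a)" and x :: "real ^ 'b" assume h: "0 < h" "h <= 1"
  show "integrable (gaussian (2 * h)) (step_cost h z x)" using C(2) h by blast
  define u v e n where "u = norm (fst z - x)" and "v = norm (snd z - ph x)" and "e = norm (ph x - grad f (K x))" and "n = norm (gen x)"
  have "u * (L * e) <= ep * u^2 + (L * e)^2 / (4 * ep)" by (rule young_le[OF ep])
  moreover have "v * (e / wf) <= ep / lam * v^2 + (e / wf)^2 / (4 * (ep / lam))" using ep lam0 by (intro young_le) simp
  moreover have "v * (n / lam) <= ka * v^2 + (n / lam)^2 / (4 * ka)" by (rule young_le[OF ka])
  moreover have "- ((snd z - ph x) <.> gen x / lam) <= v * (n / lam)"
  proof -
   have "- ((snd z - ph x) <.> gen x) <= v * n" using Cauchy_Schwarz_ineq2[of "snd z - ph x" "gen x"] unfolding v_def n_def by linarith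
   hence "- ((snd z - ph x) <.> gen x) / lam <= v * n / lam" using lam0 by (intro divide_right_mono) auto
   thus ?thesis by simp
  qed
  moreover have "- ((fst z - x) <.> (Ax z - force x) + (snd z - ph x) <.> Ay z) <= - wg * u^2 - wfs * v^2 + u * (L * e) + v * (e / wf)"
   unfolding u_def v_def e_def by (rule drift_monotone)
  moreover have "wfs * v^2 = ka * v^2 + wg * (v^2 / lam)" using lam0 by (simp add: ka_def field_simps)
  moreover have "residual ep x = sqgrad x / lam + (n / lam)^2 / (4 * ka) + (L * e)^2 / (4 * ep) + (e / wf)^2 / (4 * (ep / lam))"
   unfolding residual_def n_def[symmetric] e_def[symmetric] ka_def[symmetric]
   using lam0 ep wf ka by (simp add: power_mult_distrib power_divide algebra_simps)
  moreover have "(wg - ep) * cost z x = wg * u^2 + wg * (v^2 / lam) - ep * u^2 - ep / lam * v^2"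
   unfolding cost_def u_def v_def by (simp add: algebra_simps diff_divide_distrib)
  ultimately have "- ((fst z - x) <.> (Ax z - force x) + (snd z - ph x) <.> Ay z + (snd z - ph x) <.> gen x / lam) + sqgrad x / lam
    <= - ((wg - ep) * cost z x) + residual ep x" by linarith
  hence "2 * h * (- ((fst z - x) <.> (Ax z - force x) + (snd z - ph x) <.> Ay z + (snd z - ph x) <.> gen x / lam) + sqgrad x / lam)
    <= 2 * h * (- ((wg - ep) * cost z x) + residual ep x)" using h by (intro mult_left_mono) auto
  with C(2)[rule_format, OF h, of z x]
  show "(LINT w|gaussian (2 * h). step_cost h z x w) <= (1 - 2 * h * (wg - ep)) * cost z x + 2 * h * residual ep x
    + (et * h + C * (h * sqrt h)) * moment_bound z x" by (simp add: algebra_simps)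
 qed
qed

end

lemma (in pd_stationary_process) euler_error:
 "\<exists>C\<ge>0. \<forall>h. 0 < h --> h <= 1 -->
   (NN M (%om. (norm (X h om - X 0 om + h *. Ax (Z 0 om) - sqrt 2 *. W h om))^2)) <= ennreal (C * h ^ 3) \<and>
   (NN M (%om. (norm (Y h om - Y 0 om + (h * lam) *. Ay (Z 0 om)))^2)) <= ennreal (C * h ^ 3)"
proof -
 define d where "d = real CARD('b)"
 define ax ay where "ax = 2 * Lg^2 * (2 * D4 + 4 * d) + 2 * L^2 * D4"
  and "ay = 2 / wf^2 * D4 + 2 * L^2 * (2 * D4 + 4 * d)"
 have d: "d >= 0" by (simp add: d_def)
 have a0: "ax >= 0" "ay >= 0" unfolding ax_def ay_def using D4 d by simp_all
 define C where "C = ax + lam^2 * ay"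
 show ?thesis
 proof (intro exI[of _ C] conjI allI impI)
  show "C >= 0" using a0 by (simp add: C_def)
  fix h :: real assume h: "0 < h" "h <= 1"
  have meas [measurable]: "X r : bmeas M" "Y r : bmeas M" "W r : bmeas M" if "r : {0..h}" for r
   using that by auto
  have mZ: "Z r : bmeas M" if "r : {0..h}" for r using that by measurable
  have z0: "0 : {0..h}" using h by simp
  have X2: "NN M (%om. (norm (X r om - X 0 om))^2) <= ennreal ((2 * D4 + 4 * d) * h)"
   and Y2: "NN M (%om. (norm (Y r om - Y 0 om))^2) <= ennreal (D4 * h)" if r: "r : {0..h}" for r
  proof -
   have r0: "0 <= r" "r <= h" using r by auto
   have rh: "r^2 * D4 <= D4 * h"
   proof -
    have "r^2 <= h * 1" unfolding power2_eq_square using r0 h by (intro mult_mono) auto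
    from mult_right_mono[OF this D4] show ?thesis by (simp add: mult.commute)
   qed
   have m: "(%om. (norm (X r om - X 0 om - sqrt 2 *. (W r om - W 0 om)))^2) : bmeas M"
    "(%om. (norm (W r om - W 0 om))^2) : bmeas M"
    using r z0 by measurable
   have "NN M (%om. (norm (X r om - X 0 om))^2)
     <= NN M (%om. 2 * (norm (X r om - X 0 om - sqrt 2 *. (W r om - W 0 om)))^2 + 4 * (norm (W r om - W 0 om))^2)"
   proof (intro nn_integral_mono ennreal_leI)
    fix om
    have "norm (X r om - X 0 om) <= norm (X r om - X 0 om - sqrt 2 *. (W r om - W 0 om)) + sqrt 2 * norm (W r om - W 0 om)"
     using norm_triangle_ineq[of "X r om - X 0 om - sqrt 2 *. (W r om - W 0 om)" "sqrt 2 *. (W r om - W 0 om)"] by simp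
    from square_le_2[OF _ this]
    show "(norm (X r om - X 0 om))^2 <= 2 * (norm (X r om - X 0 om - sqrt 2 *. (W r om - W 0 om)))^2 + 4 * (norm (W r om - W 0 om))^2"
     by (simp add: power_mult_distrib)
   qed
   also have "... <= ennreal (2 * ((r - 0)^2 * D4) + 4 * ((r - 0) * d))"
    using r0 D4 d m drift_increment(1)[of 0 r] W_increment_moment[of 0 r]
    by (intro nn_integral_add_le nn_integral_cmult_le borel_measurable_times borel_measurable_const) (auto simp: d_def)
   also have "... <= ennreal ((2 * D4 + 4 * d) * h)"
    using rh mult_right_mono[OF r0(2) d] by (intro ennreal_leI) (simp add: algebra_simps)
   finally show "NN M (%om. (norm (X r om - X 0 om))^2) <= ennreal ((2 * D4 + 4 * d) * h)" .
   show "NN M (%om. (norm (Y r om - Y 0 om))^2) <= ennreal (D4 * h)"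
    by (rule order_trans[OF drift_increment(2)[of 0 r]]) (use r0 rh in "auto intro: ennreal_leI")
  qed
  have mX: "(%om. (norm (X r om - X 0 om))^2) : bmeas M" "(%om. (norm (Y r om - Y 0 om))^2) : bmeas M"
   if r: "r : {0..h}" for r
   using r z0 by measurable
  have Ax2: "NN M (%om. (norm (Ax (Z r om) - Ax (Z 0 om)))^2) <= ennreal (ax * h)" if r: "r : {0..h}" for r
  proof -
   have "NN M (%om. (norm (Ax (Z r om) - Ax (Z 0 om)))^2)
    <= NN M (%om. 2 * Lg^2 * (norm (X r om - X 0 om))^2 + 2 * L^2 * (norm (Y r om - Y 0 om))^2)"
   proof (intro nn_integral_mono ennreal_leI)
    fix om
    have "norm (Ax (Z r om) - Ax (Z 0 om)) <= Lg * norm (X r om - X 0 om) + L * norm (Y r om - Y 0 om)"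
     using lip_Ax[of "Z r om" "Z 0 om"] by simp
    from square_le_2[OF _ this]
    show "(norm (Ax (Z r om) - Ax (Z 0 om)))^2 <= 2 * Lg^2 * (norm (X r om - X 0 om))^2 + 2 * L^2 * (norm (Y r om - Y 0 om))^2"
     by (simp add: power_mult_distrib)
   qed
   also have "... <= ennreal (2 * Lg^2 * ((2 * D4 + 4 * d) * h) + 2 * L^2 * (D4 * h))"
    using h D4 d mX[OF r] X2[OF r] Y2[OF r]
    by (intro nn_integral_add_le nn_integral_cmult_le borel_measurable_times borel_measurable_const) auto
   finally show ?thesis by (simp add: ax_def algebra_simps)
  qed
  have Ay2: "NN M (%om. (norm (Ay (Z r om) - Ay (Z 0 om)))^2) <= ennreal (ay * h)" if r: "r : {0..h}" for r
  proof -
   have "NN M (%om. (norm (Ay (Z r om) - Ay (Z 0 om)))^2)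
    <= NN M (%om. 2 / wf^2 * (norm (Y r om - Y 0 om))^2 + 2 * L^2 * (norm (X r om - X 0 om))^2)"
   proof (intro nn_integral_mono ennreal_leI)
    fix om
    have "norm (Ay (Z r om) - Ay (Z 0 om)) <= norm (Y r om - Y 0 om) / wf + L * norm (X r om - X 0 om)"
     using lip_Ay[of "Z r om" "Z 0 om"] by simp
    from square_le_2[OF _ this]
    show "(norm (Ay (Z r om) - Ay (Z 0 om)))^2 <= 2 / wf^2 * (norm (Y r om - Y 0 om))^2 + 2 * L^2 * (norm (X r om - X 0 om))^2"
     by (simp add: power_mult_distrib power_divide)
   qed
   also have "... <= ennreal (2 / wf^2 * (D4 * h) + 2 * L^2 * ((2 * D4 + 4 * d) * h))"
    using h D4 d mX[OF r] X2[OF r] Y2[OF r]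
    by (intro nn_integral_add_le nn_integral_cmult_le borel_measurable_times borel_measurable_const) auto
   finally show ?thesis by (simp add: ay_def algebra_simps)
  qed
  have h3: "h^2 * (c * h) = c * h ^ 3" for c by (simp add: power2_eq_square power3_eq_cube)
  have "NN M (%om. (norm (X h om - X 0 om + h *. Ax (Z 0 om) - sqrt 2 *. W h om))^2)
   = NN M (%om. (norm (integral {0..h} (%r. Ax (Z r om) - Ax (Z 0 om))))^2)"
  proof (rule nn_integral_cong_AE, use path_equation W_0 in eventually_elim)
   case (elim om)
   have i: "(%r. Ax (Z r om)) integrable_on {0..h}"
    by (rule integrable_continuous_real, rule continuous_drift_path) (use elim h in auto)
   have "integral {0..h} (%r. Ax (Z r om) - Ax (Z 0 om)) = integral {0..h} (%r. Ax (Z r om)) - h *. Ax (Z 0 om)"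
    using h by (subst Henstock_Kurzweil_Integration.integral_diff[OF i]) auto
   moreover have "X h om = X 0 om - integral {0..h} (%r. Ax (Z r om)) + sqrt 2 *. (W h om - W 0 om)"
    using elim(1) h by auto
   ultimately have "X h om - X 0 om + h *. Ax (Z 0 om) - sqrt 2 *. W h om = - integral {0..h} (%r. Ax (Z r om) - Ax (Z 0 om))"
    using elim by simp
   thus ?case by simp
  qed
  also have "... <= ennreal ((h - 0)^2 * (ax * h))"
  proof (rule nn_integral_path_integral_square_le)
   show "(%om. Ax (Z s om) - Ax (Z 0 om)) : bmeas M" if "s : {0..h}" for s
    by (intro borel_measurable_diff measurable_compose[OF mZ[OF that] borel_A(1)] measurable_compose[OF mZ[OF z0] borel_A(1)])
   show "AE om in M. continuous_on {0..h} (%s. Ax (Z s om) - Ax (Z 0 om))"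
    using path_equation by eventually_elim (auto intro!: continuous_on_diff continuous_on_const continuous_drift_path)
  qed (use h Ax2 in auto)
  also have "... <= ennreal (C * h ^ 3)"
   using a0 h by (intro ennreal_leI) (simp add: h3 C_def mult_right_mono)
  finally show "NN M (%om. (norm (X h om - X 0 om + h *. Ax (Z 0 om) - sqrt 2 *. W h om))^2) <= ennreal (C * h ^ 3)" .
  define E where "E om = (Y h om - Y 0 om) /\<^sub>R lam + h *. Ay (Z 0 om)" for om
  have mE: "(%om. (norm (E om))^2) : bmeas M" unfolding E_def
   using h z0 by (intro borel_measurable_power borel_measurable_norm borel_measurable_add borel_measurable_scaleR
     borel_measurable_diff borel_measurable_const meas measurable_compose[OF mZ[OF z0] borel_A(2)]) auto
  have "NN M (%om. (norm (E om))^2)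
   = NN M (%om. (norm (integral {0..h} (%r. Ay (Z r om) - Ay (Z 0 om))))^2)"
  proof (rule nn_integral_cong_AE, use path_equation in eventually_elim)
   case (elim om)
   have i: "(%r. Ay (Z r om)) integrable_on {0..h}"
    by (rule integrable_continuous_real, rule continuous_drift_path) (use elim h in auto)
   have "integral {0..h} (%r. Ay (Z r om) - Ay (Z 0 om)) = integral {0..h} (%r. Ay (Z r om)) - h *. Ay (Z 0 om)"
    using h by (subst Henstock_Kurzweil_Integration.integral_diff[OF i]) auto
   moreover have "Y h om = Y 0 om - lam *. integral {0..h} (%r. Ay (Z r om))"
    using elim h by auto
   ultimately have "E om = - integral {0..h} (%r. Ay (Z r om) - Ay (Z 0 om))"
    using lam by (simp add: E_def)
   thus ?case by simp
  qed
  also have "... <= ennreal ((h - 0)^2 * (ay * h))"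
  proof (rule nn_integral_path_integral_square_le)
   show "(%om. Ay (Z s om) - Ay (Z 0 om)) : bmeas M" if "s : {0..h}" for s
    by (intro borel_measurable_diff measurable_compose[OF mZ[OF that] borel_A(2)] measurable_compose[OF mZ[OF z0] borel_A(2)])
   show "AE om in M. continuous_on {0..h} (%s. Ay (Z s om) - Ay (Z 0 om))"
    using path_equation by eventually_elim (auto intro!: continuous_on_diff continuous_on_const continuous_drift_path)
  qed (use h Ay2 in auto)
  finally have "NN M (%om. lam^2 * (norm (E om))^2) <= ennreal (lam^2 * ((h - 0)^2 * (ay * h)))"
   by (intro nn_integral_cmult_le mE) simp_all
  also have "... <= ennreal (C * h ^ 3)"
   using a0 h by (intro ennreal_leI) (simp add: h3 C_def distrib_right mult.assoc)
  finally have le: "NN M (%om. lam^2 * (norm (E om))^2) <= ennreal (C * h ^ 3)" .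
  have "Y h om - Y 0 om + (h * lam) *. Ay (Z 0 om) = lam *. E om" for om
   using lam by (simp add: E_def scaleR_add_right mult.commute)
  hence "(norm (Y h om - Y 0 om + (h * lam) *. Ay (Z 0 om)))^2 = lam^2 * (norm (E om))^2" for om
   by (simp add: power_mult_distrib)
  with le show "NN M (%om. (norm (Y h om - Y 0 om + (h * lam) *. Ay (Z 0 om)))^2) <= ennreal (C * h ^ 3)" by simp
 qed
qed


lemma (in pd_test) cost_nonneg: "cost z x >= 0" and step_cost_nonneg: "step_cost h z x w >= 0"
proof -
 show c: "cost z x >= 0" for z x using lam0 by (simp add: cost_def)
 show "step_cost h z x w >= 0" unfolding step_cost_def using acc_bounds[of x w] c by (intro add_nonneg_nonneg mult_nonneg_nonneg) auto
qed

lemma (in pd_test) cost_meas [measurable]: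
 assumes [measurable]: "u : bmeas N" "v : bmeas N"
 shows "(%p. cost (u p) (v p)) : bmeas N"
 unfolding cost_def by measurable

lemma (in pd_test) acc_meas2 [measurable]:
 assumes [measurable]: "u : bmeas N" "v : bmeas N"
 shows "(%p. acc (u p) (v p)) : bmeas N"
 unfolding acc_def by measurable

lemma (in pd_test) step_cost_meas [measurable]:
 assumes [measurable]: "u : bmeas N" "v : bmeas N" "w : bmeas N"
 shows "(%p. step_cost h (u p) (v p) (w p)) : bmeas N"
 unfolding step_cost_def euler_def by measurable

lemma (in pd_test) cost_perturb:
 assumes s: "s > 0"
 shows "cost z x <= (1 + s) * cost z' x + (1 + 1 / s) * ((norm (fst z - fst z'))^2 + (norm (snd z - snd z'))^2 / lam)"
proof -
 have tri: "(norm (a - c))^2 <= (1 + s) * (norm (b - c))^2 + (1 + 1 / s) * (norm (a - b))^2" for a b c :: "'z :: real_normed_vector"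
 proof -
  have "norm (a - c) <= norm (b - c) + norm (a - b)" using norm_triangle_ineq[of "b - c" "a - b"] by simp
  hence "(norm (a - c))^2 <= (norm (b - c) + norm (a - b))^2" by (intro power_mono) auto
  also have "... <= (1 + s) * (norm (b - c))^2 + (1 + 1 / s) * (norm (a - b))^2" by (rule square_perturb_le[OF s])
  finally show ?thesis .
 qed
 have "(norm (snd z - ph x))^2 / lam <= ((1 + s) * (norm (snd z' - ph x))^2 + (1 + 1 / s) * (norm (snd z - snd z'))^2) / lam"
  using lam0 by (intro divide_right_mono tri) auto
 with tri[of "fst z" x "fst z'"] show ?thesis unfolding cost_def
  by (simp add: distrib_left add_divide_distrib)
qed

locale pd_comparison = pd_stationary_process + pd_test
begin

lemma W_law:
 assumes h: "h > 0" shows "distr M borel (W h) = gaussian h"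
proof -
 have "distr M borel (W h) = distr M borel (%om. W h om - W 0 om)"
 proof (rule distr_cong_AE)
  show "AE om in M. W h om = W h om - W 0 om" using W_0 by eventually_elim simp
 qed (use h in auto)
 thus ?thesis using W_increment_law[of 0 h] h by simp
qed

text \<open>The two dynamics share the Brownian increment; the second one accepts or rejects it.\<close>

lemma coupling_step:
 "\<exists>C\<ge>0. \<forall>h. 0 < h --> h <= 1 --> (\<forall>P\<in>couplings pp mus. \<exists>P'\<in>couplings pp mus.
   (NN P' (%p. cost (fst p) (snd p)))
    <= ennreal (1 + h * sqrt h) * NN P (%p. \<integral> w. step_cost h (fst p) (snd p) w \<partial>gaussian (2 * h))
     + ennreal (C * (h * sqrt h)))"
proof -
 obtain Ce where Ce: "Ce >= 0" "\<forall>h. 0 < h --> h <= 1 -->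
   (NN M (%om. (norm (X h om - X 0 om + h *. Ax (Z 0 om) - sqrt 2 *. W h om))^2)) <= ennreal (Ce * h ^ 3) \<and>
   (NN M (%om. (norm (Y h om - Y 0 om + (h * lam) *. Ay (Z 0 om)))^2)) <= ennreal (Ce * h ^ 3)"
  using euler_error by blast
 define kx ky where "kx = 1 + (Lg + L)" and "ky = 1 + lam * (1 / wf + L)"
 have k0: "kx >= 0" "ky >= 0" using Lg L_nonneg lam wf by (auto simp: kx_def ky_def)
 define Cr where "Cr = (2 * Ce + 2 * kx^2) + 1 / lam * (2 * Ce + 2 * ky^2)"
 have Cr: "Cr >= 0" unfolding Cr_def using Ce(1) lam by (intro add_nonneg_nonneg mult_nonneg_nonneg) auto
 obtain Ci where Ci: "\<forall>h z x. 0 < h --> h <= 1 --> integrable (gaussian (2 * h)) (step_cost h z x)"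
  using step_cost_integral_le[of 1] by auto
 show ?thesis
 proof (intro exI[of _ "2 * Cr"] conjI allI impI ballI)
  show "2 * Cr >= 0" using Cr by simp
  fix h :: real and P :: "(((real ^ 'b) \<times> (real ^ 'a)) \<times> (real ^ 'b)) measure"
  assume h: "0 < h" "h <= 1" and P: "P : couplings pp mus"
  note Pp = couplingsD[OF P sets_pp sets_target]
  note [measurable_cong] = Pp(2)
  interpret P: prob_space P by (rule Pp(1))
  let ?g = "gaussian (2 * h) :: (real ^ 'b) measure"
  have vh: "2 * h > 0" using h by simp
  interpret G: prob_space ?g by (rule prob_space_gaussian[OF vh])
  have [measurable]: "X h : bmeas M" "Y h : bmeas M" "W h : bmeas M"
   "X 0 : bmeas M" "Y 0 : bmeas M" using h by auto
  have mZ0: "Z 0 : bmeas M" and mZh[measurable]: "Z h : bmeas M" using h by auto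
  define ep where "ep = h^2"
  have ep: "ep > 0" using h by (simp add: ep_def)
  have "\<exists>R. prob_space R \<and> sets R = sets (P >< M) \<and> distr R P fst = P \<and> distr R M snd = M \<and>
    (AE (n, om) in R. dist (fst n) (Z 0 om) < ep) \<and>
    distr R (P >< borel) (%(n, om). (n, W h om)) = P >< distr M borel (W h)"
  proof (rule approximate_gluing[OF Pp(1) prob_space_M ep])
   show "distr P borel fst = distr M borel (Z 0)" using Pp law[of 0] by simp
   have H: "(%p. p h) : (\<Pi>\<^sub>M t\<in>{0..}. borel) \<rightarrow>\<^sub>M borel" using h by (intro measurable_component_singleton) auto
   show "distr M (borel >< borel) (%om. (Z 0 om, W h om)) = distr M borel (Z 0) >< distr M borel (W h)"
    using indep_initial_functional[OF H] h by simp
   show "Z 0 : bmeas M" by (rule mZ0)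
  qed measurable
  then obtain R where R: "prob_space R" and [measurable_cong]: "sets R = sets (P >< M)"
   and R1: "distr R P fst = P" and R2: "distr R M snd = M"
   and Rd: "AE (n, om) in R. dist (fst n) (Z 0 om) < ep"
   and RW: "distr R (P >< borel) (%(n, om). (n, W h om)) = P >< distr M borel (W h)" by blast
  interpret R: prob_space R by fact
  interpret U: prob_space unit_uniform by (rule prob_space_unit_uniform)
  define wv where "wv r = sqrt 2 *. W h (snd r)" for r :: "(((real ^ 'b) \<times> (real ^ 'a)) \<times> (real ^ 'b)) \<times> 'c"
  have [measurable]: "wv : bmeas R" unfolding wv_def by measurable
  have transfer: "(NI R (%r. H (fst r) (wv r))) = (\<integral>\<^sup>+ n. \<integral>\<^sup>+ w. H n w \<partial>?g \<partial>P)"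
   if H: "(%q. H (fst q) (snd q)) : bmeas (borel >< borel)" for H
  proof -
   interpret G1: prob_space "gaussian h :: (real ^ 'b) measure" by (rule prob_space_gaussian[OF h(1)])
   have mq: "(%q. (fst q, sqrt 2 *. (snd q :: real ^ 'b))) : (P >< borel) \<rightarrow>\<^sub>M (borel >< borel)"
    by measurable
   have H2: "(%q. H (fst q) (sqrt 2 *. snd q)) : bmeas (P >< borel)"
    using measurable_compose[OF mq H] by simp
   have H3: "(%q. H (fst q) (sqrt 2 *. snd q)) : bmeas (P >< gaussian h)"
    using H2 by (subst measurable_cong_sets[OF sets_pair_measure_cong[OF refl sets_gaussian] refl])
   have H4: "H n : bmeas borel" for n using measurable_compose[OF measurable_Pair1' H, of n] by simp
   have "(NI R (%r. H (fst r) (wv r))) = (NI (distr R (P >< borel) (%(n, om). (n, W h om))) (%q. H (fst q) (sqrt 2 *. snd q)))"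
    by (subst nn_integral_distr) (use H2 in "auto simp: case_prod_unfold wv_def")
   also have "... = (NI (P >< gaussian h) (%q. H (fst q) (sqrt 2 *. snd q)))" unfolding RW W_law[OF h(1)] ..
   also have "... = (\<integral>\<^sup>+ n. \<integral>\<^sup>+ w. H n (sqrt 2 *. w) \<partial>gaussian h \<partial>P)"
    using H3 by (subst G1.nn_integral_fst[symmetric]) auto
   also have "... = (\<integral>\<^sup>+ n. \<integral>\<^sup>+ w. H n w \<partial>distr (gaussian h) borel (\<lambda>x :: real ^ 'b. sqrt 2 *. x) \<partial>P)"
    by (intro nn_integral_cong, subst nn_integral_distr) (use H4 in auto)
   also have "distr (gaussian h) borel (\<lambda>x :: real ^ 'b. sqrt 2 *. x) = ?g"
    using gaussian_scaleR[OF h(1), of "sqrt 2", where 'd='b] by simp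
   finally show ?thesis .
  qed
  define a where "a r = acc (snd (fst r)) (wv r)" for r
  have a: "a : bmeas R" unfolding a_def by measurable
  have a01: "0 <= a r \<and> a r <= 1" for r using acc_bounds by (simp add: a_def)
  let ?R = "R >< unit_uniform"
  define x' where "x' p = (if snd p <= a (fst p) then snd (fst (fst p)) + wv (fst p) else snd (fst (fst p)))" for p
  define Z' where "Z' p = Z h (snd (fst p))" for p :: "((((real ^ 'b) \<times> (real ^ 'a)) \<times> (real ^ 'b)) \<times> 'c) \<times> real"
  note [measurable] = a
  have RU: "prob_space ?R" by (rule prob_space_pair) unfold_locales
  have x'm: "x' : bmeas ?R" unfolding x'_def by measurable
  have Z'm: "Z' : bmeas ?R" unfolding Z'_def by measurable
  have lZ: "distr ?R borel Z' = pp"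
  proof (rule distr_eqI[OF Z'm sets_pp])
   fix A :: "((real ^ 'b) \<times> (real ^ 'a)) set" assume A[measurable]: "A : sets borel"
   have "(NI ?R (%p. indicator A (Z' p))) = (NI R (%r. indicator A (Z h (snd r))))"
    unfolding Z'_def by (rule nn_integral_prod_fst[OF prob_space_unit_uniform]) measurable
   also have "... = (NI (distr R M snd) (%om. indicator A (Z h om)))" by (subst nn_integral_distr) auto
   also have "... = (NI pp (%z. indicator A z))" unfolding R2 using h by (intro nn_integral_law) auto
   finally show "(NI ?R (%p. indicator A (Z' p))) = emeasure pp A" by simp
  qed
  have lx: "distr ?R borel x' = mus"
  proof (rule distr_eqI[OF x'm sets_target])
   fix A :: "(real ^ 'b) set" assume A[measurable]: "A : sets borel"
   let ?i = "\<lambda>x :: real ^ 'b. indicator A x :: ennreal"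
   have kern: "(%x. \<integral>\<^sup>+ w. ennreal (acc x w) * ?i (x + w) + ennreal (1 - acc x w) * ?i x \<partial>?g) : bmeas borel"
   proof -
    have "(%q. ennreal (acc (fst q) (snd q)) * ?i (fst q + snd q) + ennreal (1 - acc (fst q) (snd q)) * ?i (fst q)) : bmeas (borel >< ?g)"
     by measurable
    thus ?thesis
     using G.borel_measurable_nn_integral[of "%x w. ennreal (acc x w) * ?i (x + w) + ennreal (1 - acc x w) * ?i x" borel]
     by (simp add: case_prod_unfold)
   qed
   have "(NI ?R (%p. ?i (x' p))) = (NI ?R (%p. (if snd p <= a (fst p) then ?i (snd (fst (fst p)) + wv (fst p)) else ?i (snd (fst (fst p))))))"
    by (rule nn_integral_cong) (simp add: x'_def)
   also have "... = (NI R (%r. ennreal (a r) * ?i (snd (fst r) + wv r) + ennreal (1 - a r) * ?i (snd (fst r))))"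
    by (rule nn_integral_randomised_choice[OF R a a01]) measurable
   also have "... = (\<integral>\<^sup>+ n. \<integral>\<^sup>+ w. ennreal (acc (snd n) w) * ?i (snd n + w) + ennreal (1 - acc (snd n) w) * ?i (snd n) \<partial>?g \<partial>P)"
    unfolding a_def by (rule transfer) measurable
   also have "... = (\<integral>\<^sup>+ x. \<integral>\<^sup>+ w. ennreal (acc x w) * ?i (x + w) + ennreal (1 - acc x w) * ?i x \<partial>?g \<partial>distr P borel snd)"
    by (subst nn_integral_distr) (use kern in auto)
   also have "... = (NI mus (%x. ?i x))" unfolding Pp(4) by (rule metropolis_invariant[OF vh]) measurable
   finally show "(NI ?R (%p. ?i (x' p))) = emeasure mus A" by simp
  qed
  let ?P = "distr ?R (pp >< mus) (%p. (Z' p, x' p))"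
  have Z'm2: "Z' : ?R \<rightarrow>\<^sub>M pp" using Z'm by (subst measurable_cong_sets[OF refl sets_pp])
  have x'm2: "x' : ?R \<rightarrow>\<^sub>M mus" using x'm by (subst measurable_cong_sets[OF refl sets_target])
  have P': "?P : couplings pp mus"
   using lZ lx distr_sets_cong[OF sets_pp, of ?R Z'] distr_sets_cong[OF sets_target, of ?R x']
   by (intro couplings_distr[OF RU Z'm2 x'm2]) auto
  define s where "s = h * sqrt h"
  have s: "s > 0" using h by (simp add: s_def)
  define rr where "rr r = (norm (X h (snd r) - fst (euler h (fst (fst r)) (wv r))))^2
    + 1 / lam * (norm (Y h (snd r) - snd (euler h (fst (fst r)) (wv r))))^2" for r
  have rr0: "rr r >= 0" for r using lam by (simp add: rr_def)
  have rrm[measurable]: "rr : bmeas R" unfolding rr_def euler_def by measurable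
  have costm: "(%p. ennreal (cost (fst p) (snd p))) : bmeas (pp >< mus)"
   by (subst measurable_cong_sets[OF sets_pair_measure_cong[OF sets_pp sets_target] refl]) measurable
  have "NN ?P (%p. cost (fst p) (snd p)) = NN ?R (%p. cost (Z' p) (x' p))"
   using Z'm2 x'm2 costm by (subst nn_integral_distr) auto
  also have "... = (NI ?R (%p. (if snd p <= a (fst p) then ennreal (cost (Z h (snd (fst p))) (snd (fst (fst p)) + wv (fst p)))
    else ennreal (cost (Z h (snd (fst p))) (snd (fst (fst p)))))))"
   by (rule nn_integral_cong) (simp add: x'_def Z'_def)
  also have "... = (NI R (%r. ennreal (a r) * ennreal (cost (Z h (snd r)) (snd (fst r) + wv r))
    + ennreal (1 - a r) * ennreal (cost (Z h (snd r)) (snd (fst r)))))"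
   by (rule nn_integral_randomised_choice[OF R a a01]) measurable
  also have "... <= (NI R (%r. ennreal (1 + s) * ennreal (step_cost h (fst (fst r)) (snd (fst r)) (wv r)) + ennreal (1 + 1 / s) * ennreal (rr r)))"
  proof (rule nn_integral_mono)
   fix r :: "(((real ^ 'b) \<times> (real ^ 'a)) \<times> (real ^ 'b)) \<times> 'c"
   let ?E = "euler h (fst (fst r)) (wv r)"
   have cp: "cost (Z h (snd r)) y <= (1 + s) * cost ?E y + (1 + 1 / s) * rr r" for y
    using cost_perturb[OF s, of "Z h (snd r)" y ?E] by (simp add: rr_def)
   have "a r * cost (Z h (snd r)) (snd (fst r) + wv r) + (1 - a r) * cost (Z h (snd r)) (snd (fst r))
    <= a r * ((1 + s) * cost ?E (snd (fst r) + wv r) + (1 + 1 / s) * rr r) + (1 - a r) * ((1 + s) * cost ?E (snd (fst r)) + (1 + 1 / s) * rr r)"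
    using a01 by (intro add_mono mult_left_mono cp) auto
   also have "... = (1 + s) * step_cost h (fst (fst r)) (snd (fst r)) (wv r) + (1 + 1 / s) * rr r"
   proof -
    have "t * ((1 + s) * c + k * q) + (1 - t) * ((1 + s) * d + k * q) = (1 + s) * (t * c + (1 - t) * d) + k * q" for t c d k q :: real
     by (simp add: algebra_simps)
    thus ?thesis unfolding step_cost_def a_def[symmetric] .
   qed
   finally have "ennreal (a r * cost (Z h (snd r)) (snd (fst r) + wv r) + (1 - a r) * cost (Z h (snd r)) (snd (fst r)))
    <= ennreal ((1 + s) * step_cost h (fst (fst r)) (snd (fst r)) (wv r) + (1 + 1 / s) * rr r)" by (rule ennreal_leI)
   thus "ennreal (a r) * ennreal (cost (Z h (snd r)) (snd (fst r) + wv r)) + ennreal (1 - a r) * ennreal (cost (Z h (snd r)) (snd (fst r)))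
    <= ennreal (1 + s) * ennreal (step_cost h (fst (fst r)) (snd (fst r)) (wv r)) + ennreal (1 + 1 / s) * ennreal (rr r)"
    using s a01[of r] cost_nonneg step_cost_nonneg rr0[of r]
    by (simp add: ennreal_mult[symmetric] ennreal_plus[symmetric] del: ennreal_plus)
  qed
  also have "... = ennreal (1 + s) * NN R (%r. step_cost h (fst (fst r)) (snd (fst r)) (wv r))
    + ennreal (1 + 1 / s) * NN R (%r. rr r)"
   by (subst nn_integral_add, measurable) (simp add: nn_integral_cmult)
  also have "NN R (%r. step_cost h (fst (fst r)) (snd (fst r)) (wv r))
    = (\<integral>\<^sup>+ n. \<integral>\<^sup>+ w. ennreal (step_cost h (fst n) (snd n) w) \<partial>?g \<partial>P)"
   by (rule transfer) measurable
  also have "... = NN P (%n. \<integral> w. step_cost h (fst n) (snd n) w \<partial>?g)"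
   using Ci h step_cost_nonneg by (intro nn_integral_cong nn_integral_eq_integral) auto
  also have "ennreal (1 + 1 / s) * NN R (%r. rr r) <= ennreal (2 * Cr * (h * sqrt h))"
  proof -
   let ?ex = "%om. norm (X h om - X 0 om + h *. Ax (Z 0 om) - sqrt 2 *. W h om)"
   let ?ey = "%om. norm (Y h om - Y 0 om + (h * lam) *. Ay (Z 0 om))"
   have mA: "(%om. Ax (Z 0 om)) : bmeas M" "(%om. Ay (Z 0 om)) : bmeas M"
    by (rule measurable_compose[OF mZ0 borel_A(1)] measurable_compose[OF mZ0 borel_A(2)])+
   note [measurable] = mA
   have h4: "(h^2)^2 <= h ^ 3" using h by (simp add: power_mult[symmetric] power_decreasing)
   have "AE r in R. rr r <= (2 * (?ex (snd r))^2 + 2 * kx^2 * h ^ 3) + 1 / lam * (2 * (?ey (snd r))^2 + 2 * ky^2 * h ^ 3)"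
    using Rd
   proof eventually_elim
    case (elim r)
    define z om where "z = fst (fst r)" and "om = snd r"
    have d: "dist z (Z 0 om) <= h^2" using elim by (simp add: case_prod_unfold z_def om_def ep_def)
    have dx: "norm (X 0 om - fst z) <= h^2"
     using dist_fst_le[of z "Z 0 om"] d by (simp add: dist_norm norm_minus_commute)
    have dy: "norm (Y 0 om - snd z) <= h^2"
     using dist_snd_le[of z "Z 0 om"] d by (simp add: dist_norm norm_minus_commute)
    have dAx: "norm (Ax z - Ax (Z 0 om)) <= (Lg + L) * h^2"
    proof -
     have "norm (Ax z - Ax (Z 0 om)) <= Lg * norm (fst z - X 0 om) + L * norm (snd z - Y 0 om)"
      using lip_Ax[of z "Z 0 om"] by simp
     also have "... <= Lg * h^2 + L * h^2"
      using dx dy Lg L_nonneg by (intro add_mono mult_left_mono) (auto simp: norm_minus_commute)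
     finally show ?thesis by (simp add: distrib_right)
    qed
    have dAy: "norm (Ay z - Ay (Z 0 om)) <= (1 / wf + L) * h^2"
    proof -
     have "norm (Ay z - Ay (Z 0 om)) <= norm (snd z - Y 0 om) / wf + L * norm (fst z - X 0 om)"
      using lip_Ay[of z "Z 0 om"] by simp
     also have "... <= h^2 / wf + L * h^2"
      using dx dy wf L_nonneg by (intro add_mono mult_left_mono divide_right_mono) (auto simp: norm_minus_commute)
     finally show ?thesis by (simp add: distrib_right)
    qed
    have "norm (X h om - fst (euler h z (wv r))) <= ?ex om + kx * h^2"
    proof -
     have "X h om - fst (euler h z (wv r))
      = (X h om - X 0 om + h *. Ax (Z 0 om) - sqrt 2 *. W h om) + ((X 0 om - fst z) + h *. (Ax z - Ax (Z 0 om)))"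
      by (simp add: euler_def wv_def om_def algebra_simps)
     also have "norm ... <= ?ex om + (norm (X 0 om - fst z) + norm (h *. (Ax z - Ax (Z 0 om))))"
      by (intro order_trans[OF norm_triangle_ineq] add_left_mono norm_triangle_ineq)
     also have "norm (h *. (Ax z - Ax (Z 0 om))) <= (Lg + L) * h^2"
      using h dAx mult_mono[of h 1 "norm (Ax z - Ax (Z 0 om))" "(Lg + L) * h^2"] by simp
     finally show ?thesis using dx by (simp add: kx_def distrib_right)
    qed
    hence 1: "(norm (X h om - fst (euler h z (wv r))))^2 <= 2 * (?ex om)^2 + 2 * (kx * h^2)^2"
     by (rule square_le_2[rotated]) simp
    have "norm (Y h om - snd (euler h z (wv r))) <= ?ey om + ky * h^2"
    proof -
     have "Y h om - snd (euler h z (wv r))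
      = (Y h om - Y 0 om + (h * lam) *. Ay (Z 0 om)) + ((Y 0 om - snd z) + (h * lam) *. (Ay z - Ay (Z 0 om)))"
      by (simp add: euler_def algebra_simps)
     also have "norm ... <= ?ey om + (norm (Y 0 om - snd z) + norm ((h * lam) *. (Ay z - Ay (Z 0 om))))"
      by (intro order_trans[OF norm_triangle_ineq] add_left_mono norm_triangle_ineq)
     also have "norm ((h * lam) *. (Ay z - Ay (Z 0 om))) <= lam * ((1 / wf + L) * h^2)"
      using h lam dAy mult_mono[of "h * lam" lam "norm (Ay z - Ay (Z 0 om))" "(1 / wf + L) * h^2"]
      by (simp add: mult_left_le_one_le)
     finally show ?thesis using dy by (simp add: ky_def algebra_simps)
    qed
    hence 2: "(norm (Y h om - snd (euler h z (wv r))))^2 <= 2 * (?ey om)^2 + 2 * (ky * h^2)^2"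
     by (rule square_le_2[rotated]) simp
    have k: "2 * (k * h^2)^2 <= 2 * k^2 * h ^ 3" for k
     using mult_left_mono[OF h4, of "2 * k^2"] by (simp add: power_mult_distrib)
    show ?case unfolding rr_def z_def[symmetric] om_def[symmetric]
     using lam 1 2 k[of kx] k[of ky] by (intro add_mono mult_left_mono) (auto intro: order_trans)
   qed
   hence "NN R (%r. rr r) <= NN R (%r. (2 * (?ex (snd r))^2 + 2 * kx^2 * h ^ 3) + 1 / lam * (2 * (?ey (snd r))^2 + 2 * ky^2 * h ^ 3))"
    by (intro nn_integral_mono_AE) (auto elim!: eventually_mono intro: ennreal_leI)
   also have "... = NN (distr R M snd) (%om. (2 * (?ex om)^2 + 2 * kx^2 * h ^ 3) + 1 / lam * (2 * (?ey om)^2 + 2 * ky^2 * h ^ 3))"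
    by (subst nn_integral_distr) auto
   also have "... <= ennreal ((2 * (Ce * h ^ 3) + 2 * kx^2 * h ^ 3) + 1 / lam * (2 * (Ce * h ^ 3) + 2 * ky^2 * h ^ 3))"
   proof -
    have mex: "(%om. (?ex om)^2) : bmeas M" "(%om. (?ey om)^2) : bmeas M" by measurable
    have cc: "(NI M (%om. ennreal c)) <= ennreal c" for c by (simp add: emeasure_space_1)
    show ?thesis unfolding R2
     using Ce h lam mex
     by (intro nn_integral_add_le nn_integral_cmult_le borel_measurable_times borel_measurable_add borel_measurable_const cc) auto
   qed
   also have "... = ennreal (Cr * h ^ 3)" unfolding Cr_def by (simp add: algebra_simps)
   finally have "ennreal (1 + 1 / s) * NN R (%r. rr r) <= ennreal (1 + 1 / s) * ennreal (Cr * h ^ 3)"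
    by (rule mult_left_mono) simp
   also have "... = ennreal ((1 + 1 / s) * (Cr * h ^ 3))" using s Cr h by (simp add: ennreal_mult')
   also have "... <= ennreal (2 * Cr * (h * sqrt h))"
   proof (rule ennreal_leI)
    have sq: "sqrt h * sqrt h = h" using h by simp
    have "s * s = h ^ 3" unfolding s_def using sq by (simp add: power3_eq_cube ac_simps)
    moreover have "s <= 1" unfolding s_def using h by (simp add: mult_le_one)
    hence "s * s <= s" using s by simp
    moreover have "1 / s * (s * s) = s" using s by simp
    moreover have "(1 + 1 / s) * (s * s) = s * s + 1 / s * (s * s)" by (simp only: distrib_right mult_1_left)
    ultimately have "(1 + 1 / s) * h ^ 3 <= 2 * s" by simp
    from mult_left_mono[OF this Cr] show "(1 + 1 / s) * (Cr * h ^ 3) <= 2 * Cr * (h * sqrt h)"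
     unfolding s_def by (simp add: ac_simps)
   qed
   finally show ?thesis .
  qed
  finally have "NN ?P (%p. cost (fst p) (snd p))
    <= ennreal (1 + h * sqrt h) * NN P (%p. \<integral> w. step_cost h (fst p) (snd p) w \<partial>gaussian (2 * h))
     + ennreal (2 * Cr * (h * sqrt h))" unfolding s_def by (simp add: add_left_mono)
  with P' show "\<exists>P'\<in>couplings pp mus. (NN P' (%p. cost (fst p) (snd p)))
    <= ennreal (1 + h * sqrt h) * NN P (%p. \<integral> w. step_cost h (fst p) (snd p) w \<partial>gaussian (2 * h))
     + ennreal (2 * Cr * (h * sqrt h))" by blast
 qed
qed

end

context pd_comparison
begin

lemma product_coupling: "pp >< mus : couplings pp mus"
proof -
 interpret A: prob_space pp using prob_distribution_pp by (simp add: prob_distribution_def)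
 interpret B: prob_space mus by (rule prob_space_target)
 interpret AB: pair_prob_space pp mus ..
 have "distr (pp >< mus) pp fst = pp" by (rule B.distr_pair_fst)
 moreover have "distr (pp >< mus) mus snd = mus"
 proof (rule measure_eqI)
  fix S assume "S : sets (distr (pp >< mus) mus snd)"
  hence S: "S : sets mus" by simp
  have "snd -` S \<inter> space (pp >< mus) = space pp \<times> S" using sets.sets_into_space[OF S] by (auto simp: space_pair_measure)
  moreover have "emeasure (pp >< mus) (space pp \<times> S) = emeasure pp (space pp) * emeasure mus S"
   by (rule B.emeasure_pair_measure_Times[OF sets.top S])
  ultimately show "emeasure (distr (pp >< mus) mus snd) S = emeasure mus S"
   by (subst emeasure_distr[OF measurable_snd S]) (simp add: A.emeasure_space_1)
 qed simp
 ultimately show ?thesis unfolding couplings_def using AB.prob_space_axioms by simp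
qed

lemma cost_integral_product: "NN (pp >< mus) (%p. cost (fst p) (snd p)) < \<infinity>"
proof -
 note P = couplingsD[OF product_coupling sets_pp sets_target]
 note [measurable_cong] = P(2)
 interpret P: prob_space "pp >< mus" by (rule P)
 obtain B where B: "B >= 0" "\<And>x. norm (ph x) <= B"
  using compact_support_bounded[OF C_k_continuous[OF C2], of R] supp0 by fastforce
 have le: "cost z x <= (2 + 2 / lam) * (norm z)^2 + (2 * (norm x)^2 + 2 * B^2 / lam)" for z x
 proof -
  have "(norm (fst z - x))^2 <= 2 * (norm (fst z))^2 + 2 * (norm x)^2"
   by (rule square_le_2[OF _ norm_triangle_ineq4]) simp
  moreover have "(norm (fst z))^2 <= (norm z)^2" using power_mono[OF norm_fst_le[of "fst z" "snd z"] norm_ge_zero, of 2] by simp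
  ultimately have 1: "(norm (fst z - x))^2 <= 2 * (norm z)^2 + 2 * (norm x)^2" by linarith
  have "(norm (snd z - ph x))^2 <= 2 * (norm (snd z))^2 + 2 * (norm (ph x))^2"
   by (rule square_le_2[OF _ norm_triangle_ineq4]) simp
  also have "... <= 2 * (norm z)^2 + 2 * B^2"
   using power_mono[OF norm_snd_le[of "snd z" "fst z"] norm_ge_zero, of 2] power_mono[OF B(2)[of x] norm_ge_zero, of 2]
   unfolding prod.collapse by linarith
  finally have "(norm (snd z - ph x))^2 / lam <= (2 * (norm z)^2 + 2 * B^2) / lam" using lam by (simp add: divide_right_mono)
  with 1 show ?thesis by (simp add: cost_def algebra_simps add_divide_distrib)
 qed
 have f1: "NN (pp >< mus) (%p. (norm (fst p))^2) < \<infinity>"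
 proof -
  have "NN (pp >< mus) (%p. (norm (fst p))^2) = NN (distr (pp >< mus) borel fst) (%z. (norm z)^2)"
   by (subst nn_integral_distr) auto
  thus ?thesis unfolding P(3) using finite_second_moment_pp by (simp add: finite_second_moment_def)
 qed
 have f2: "NN (pp >< mus) (%p. (norm (snd p))^2) < \<infinity>"
 proof -
  have "NN (pp >< mus) (%p. (norm (snd p))^2) = NN (distr (pp >< mus) borel snd) (%z. (norm z)^2)"
   by (subst nn_integral_distr) auto
  thus ?thesis unfolding P(4) using target_moment[of 2] by (simp add: integrable_iff_bounded)
 qed
 have "NN (pp >< mus) (%p. cost (fst p) (snd p))
   <= (NI (pp >< mus) (%p. ennreal (2 + 2 / lam) * ennreal ((norm (fst p))^2) + (2 * ennreal ((norm (snd p))^2) + ennreal (2 * B^2 / lam))))"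
 proof (rule nn_integral_mono)
  fix p :: "((real ^ 'b) \<times> (real ^ 'a)) \<times> (real ^ 'b)"
  have "ennreal (cost (fst p) (snd p)) <= ennreal ((2 + 2 / lam) * (norm (fst p))^2 + (2 * (norm (snd p))^2 + 2 * B^2 / lam))"
   by (rule ennreal_leI[OF le])
  also have "... = ennreal (2 + 2 / lam) * ennreal ((norm (fst p))^2) + (2 * ennreal ((norm (snd p))^2) + ennreal (2 * B^2 / lam))"
   using lam by (simp add: ennreal_mult')
  finally show "ennreal (cost (fst p) (snd p)) <= ..." .
 qed
 also have "... = ennreal (2 + 2 / lam) * NN (pp >< mus) (%p. (norm (fst p))^2)
   + (2 * NN (pp >< mus) (%p. (norm (snd p))^2) + ennreal (2 * B^2 / lam))"
  by (subst nn_integral_add, measurable, subst nn_integral_add, measurable) (simp add: nn_integral_cmult P.emeasure_space_1)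
 also have "... < \<infinity>" using f1 f2 by (simp add: ennreal_mult_less_top)
 finally show ?thesis .
qed

lemma residual_facts:
 assumes ep: "ep > 0" and big: "lam > wg / wfs"
 shows "residual ep x >= 0" "residual ep : bmeas borel"
proof -
 have ka: "wfs - wg / lam > 0" using big lam wfs wg by (simp add: field_simps)
 show "residual ep x >= 0" unfolding residual_def sqgrad_def
  using ep ka lam by (intro add_nonneg_nonneg mult_nonneg_nonneg divide_nonneg_nonneg sum_nonneg) auto
 have [measurable]: "(%x. D1f ph x v) : bmeas borel" for v
  by (rule borel_measurable_continuous_onI[OF continuous_D1f[OF ph']])
 have [measurable]: "laplacian ph : bmeas borel"
  by (rule borel_measurable_continuous_onI[OF continuous_laplacian[OF C2]])
 have "gen = (%x. laplacian ph x - (\<Sum>e\<in>Basis. (force x <.> e) *. D1f ph x e))"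
  by (rule ext) (simp add: gen_def D1f_expand[OF ph', of _ "force _"])
 hence [measurable]: "gen : bmeas borel" by simp
 show "residual ep : bmeas borel" unfolding residual_def[abs_def] sqgrad_def by measurable
qed

lemma moment_bound_integral:
 assumes P: "P : couplings pp mus" and t: "t >= 0" "NN P (%p. cost (fst p) (snd p)) <= ennreal t"
 shows "NN P (%p. moment_bound (fst p) (snd p))
  <= ennreal ((1 + lam) * t + (D4 + (1 / lam^2 * D4 + ((LINT x|mus. norm (force x) ^ 4) + 1))))"
proof -
 note Pp = couplingsD[OF P sets_pp sets_target]
 note [measurable_cong] = Pp(2)
 interpret P: prob_space P by (rule Pp(1))
 have le: "moment_bound z x <= (1 + lam) * cost z x + ((norm (Ax z))^2 + (1 / lam^2 * (norm (lam *. Ay z))^2 + (norm (force x) ^ 4 + 1)))" for z x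
 proof -
  define u v where "u = (norm (fst z - x))^2" and "v = (norm (snd z - ph x))^2"
  have "(1 + lam) * cost z x = u + v + (lam * u + v / lam)" unfolding cost_def u_def v_def using lam by (simp add: field_simps)
  moreover have "lam * u + v / lam >= 0" using lam by (simp add: u_def v_def)
  moreover have "1 / lam^2 * (norm (lam *. Ay z))^2 = (norm (Ay z))^2" using lam by (simp add: power_mult_distrib)
  ultimately show ?thesis unfolding moment_bound_def u_def[symmetric] v_def[symmetric] by simp
 qed
 have "NN P (%p. moment_bound (fst p) (snd p))
  <= NN P (%p. (1 + lam) * cost (fst p) (snd p) + ((norm (Ax (fst p)))^2 + (1 / lam^2 * (norm (lam *. Ay (fst p)))^2 + (norm (force (snd p)) ^ 4 + 1))))"
  by (intro nn_integral_mono ennreal_leI le)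
 also have "... <= ennreal ((1 + lam) * t + (D4 + (1 / lam^2 * D4 + ((LINT x|mus. norm (force x) ^ 4) + 1))))"
 proof -
  have 1: "NN P (%p. (norm (Ax (fst p)))^2) <= ennreal D4"
  proof -
   have "NN P (%p. (norm (Ax (fst p)))^2) = NN (distr P borel fst) (%z. (norm (Ax z))^2)"
    by (subst nn_integral_distr) auto
   thus ?thesis unfolding Pp(3) using drift_moments(1) by simp
  qed
  have 2: "NN P (%p. (norm (lam *. Ay (fst p)))^2) <= ennreal D4"
  proof -
   have "NN P (%p. (norm (lam *. Ay (fst p)))^2) = NN (distr P borel fst) (%z. (norm (lam *. Ay z))^2)"
    by (subst nn_integral_distr) auto
   thus ?thesis unfolding Pp(3) using drift_moments(2) by simp
  qed
  have 3: "NN P (%p. norm (force (snd p)) ^ 4) <= ennreal (LINT x|mus. norm (force x) ^ 4)"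
  proof -
   have "NN P (%p. norm (force (snd p)) ^ 4) = NN (distr P borel snd) (%x. norm (force x) ^ 4)"
    by (subst nn_integral_distr) auto
   also have "... = ennreal (LINT x|mus. norm (force x) ^ 4)"
    unfolding Pp(4) by (rule nn_integral_eq_integral[OF integrable_force4]) simp
   finally show ?thesis by simp
  qed
  have 4: "(NI P (%p. ennreal 1)) <= ennreal 1" by (simp add: P.emeasure_space_1)
  have F4: "(LINT x|mus. norm (force x) ^ 4) >= 0" by (intro Bochner_Integration.integral_nonneg) simp
  show ?thesis
  proof (intro nn_integral_add_le nn_integral_cmult_le 1 2 3 4 t(2))
   show "0 <= (1 + lam) * t" "0 <= D4 + (1 / lam^2 * D4 + ((LINT x|mus. norm (force x) ^ 4) + 1))"
    "0 <= D4" "0 <= 1 / lam^2 * D4 + ((LINT x|mus. norm (force x) ^ 4) + 1)" "0 <= 1 / lam^2 * D4"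
    "0 <= (LINT x|mus. norm (force x) ^ 4) + 1" "0 <= (LINT x|mus. norm (force x) ^ 4)"
    using lam t D4 F4 by auto
  qed (use lam D4 cost_nonneg in auto)
 qed
 finally show ?thesis .
qed

text \<open>At a nearly optimal coupling one step cannot lower the cost by much. This bounds the optimal
 cost, whether or not it is attained.\<close>

lemma optimal_cost_le:
 assumes ep: "0 < ep" "ep < wg" and big: "lam > wg / wfs"
  and kb: "kb >= 0" "NN mus (%x. residual ep x) <= ennreal kb" and de: "de > 0"
 shows "\<exists>P\<in>couplings pp mus. (NN P (%p. cost (fst p) (snd p))) <= ennreal (kb / (wg - ep) + de)"
proof -
 define T where "T P = NN P (%p. cost (fst p) (snd p))" for P
 define m where "m = wg - ep"
 have m: "m > 0" using ep by (simp add: m_def)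
 have fin: "(INF P\<in>couplings pp mus. T P) < \<infinity>"
  using cost_integral_product product_coupling unfolding T_def by (meson INF_lower2 le_less_trans order_refl)
 then obtain t0 where t0: "t0 >= 0" "(INF P\<in>couplings pp mus. T P) = ennreal t0"
  by (cases "INF P\<in>couplings pp mus. T P") auto
 have lower: "ennreal t0 <= T P" if "P : couplings pp mus" for P
  unfolding t0(2)[symmetric] by (rule INF_lower[OF that])
 have near: "\<exists>P\<in>couplings pp mus. T P <= ennreal (t0 + e)" if "e > 0" for e
 proof -
  have "(INF P\<in>couplings pp mus. T P) < ennreal (t0 + e)" unfolding t0(2) using t0(1) that by (simp add: ennreal_less_iff)
  thus ?thesis unfolding INF_less_iff by (auto intro: less_imp_le)
 qed
 define F4 where "F4 = (LINT x|mus. norm (force x) ^ 4)"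
 have F4: "F4 >= 0" unfolding F4_def by (intro Bochner_Integration.integral_nonneg) simp
 define Qc where "Qc = (1 + lam) * (t0 + 1) + (D4 + (1 / lam^2 * D4 + (F4 + 1)))"
 have Qc: "Qc >= 0" unfolding Qc_def using lam t0(1) D4 F4 by (intro add_nonneg_nonneg mult_nonneg_nonneg) auto
 obtain Cr where Cr: "Cr >= 0" "\<forall>h. 0 < h --> h <= 1 --> (\<forall>P\<in>couplings pp mus. \<exists>P'\<in>couplings pp mus.
   (NN P' (%p. cost (fst p) (snd p)))
    <= ennreal (1 + h * sqrt h) * NN P (%p. \<integral> w. step_cost h (fst p) (snd p) w \<partial>gaussian (2 * h))
     + ennreal (Cr * (h * sqrt h)))"
  using coupling_step by blast
 have main: "2 * m * t0 <= 2 * kb + et * Qc" if et: "et > 0" for et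
 proof (rule field_le_epsilon)
  fix e :: real assume e: "0 < e"
  obtain C where C: "C >= 0" "\<forall>h z x. 0 < h --> h <= 1 -->
   integrable (gaussian (2 * h)) (step_cost h z x) \<and>
   (LINT w|gaussian (2 * h). step_cost h z x w) <= (1 - 2 * h * (wg - ep)) * cost z x + 2 * h * residual ep x
    + (et * h + C * (h * sqrt h)) * moment_bound z x"
   using step_cost_contracts[OF et ep(1) big] by blast
  define D where "D = t0 + 1 + 2 * kb + et * Qc + C * Qc"
  have D: "D >= 0" unfolding D_def using t0 kb et Qc C by (intro add_nonneg_nonneg mult_nonneg_nonneg) auto
  define B where "B = 1 + C * Qc + D + Cr"
  have B: "B >= 1" unfolding B_def using C Qc D Cr by simp
  define h where "h = min (min 1 (1 / (2 * m))) ((e / B)^2)"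
  have h: "0 < h" "h <= 1" "h <= 1 / (2 * m)" "h <= (e / B)^2" using m e B by (auto simp: h_def)
  have hm: "2 * h * m <= 1" using h(3) m by (simp add: field_simps)
  define s where "s = h * sqrt h"
  have s: "s > 0" "s <= 1" "h^2 <= s"
  proof -
   show "s > 0" using h by (simp add: s_def)
   show "s <= 1" using h by (simp add: s_def mult_le_one)
   have "h <= sqrt h" using h by (intro real_le_rsqrt) (simp add: power2_eq_square mult_left_le_one_le)
   thus "h^2 <= s" using h by (simp add: s_def power2_eq_square)
  qed
  obtain P where P: "P : couplings pp mus" "T P <= ennreal (t0 + h^2)" using near[of "h^2"] h by auto
  note Pp = couplingsD[OF P(1) sets_pp sets_target]
  note [measurable_cong] = Pp(2)
  have h21: "h^2 <= 1" using s by linarith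
  obtain P' where P': "P' : couplings pp mus"
   "T P' <= ennreal (1 + s) * NN P (%p. \<integral> w. step_cost h (fst p) (snd p) w \<partial>gaussian (2 * h)) + ennreal (Cr * s)"
   using Cr(2) h P(1) unfolding T_def s_def by blast
  define A where "A = (1 - 2 * h * m) * (t0 + h^2) + (2 * h * kb + (et * h + C * s) * Qc)"
  have A0: "A >= 0" unfolding A_def using hm t0 h kb et C s Qc by (intro add_nonneg_nonneg mult_nonneg_nonneg) auto
  have "NN P (%p. \<integral> w. step_cost h (fst p) (snd p) w \<partial>gaussian (2 * h))
   <= NN P (%p. (1 - 2 * h * m) * cost (fst p) (snd p) + (2 * h * residual ep (snd p) + (et * h + C * s) * moment_bound (fst p) (snd p)))"
   using C(2)[rule_format, OF h(1,2)] unfolding m_def s_def by (intro nn_integral_mono ennreal_leI) (simp add: add.assoc)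
  also have "... <= ennreal A" unfolding A_def
  proof (intro nn_integral_add_le nn_integral_cmult_le)
   show "NN P (%p. cost (fst p) (snd p)) <= ennreal (t0 + h^2)" using P(2) unfolding T_def .
   have "NN P (%p. residual ep (snd p)) = NN (distr P borel snd) (%x. residual ep x)"
    using residual_facts(2)[OF ep(1) big] by (subst nn_integral_distr) auto
   thus "NN P (%p. residual ep (snd p)) <= ennreal kb" unfolding Pp(4) using kb(2) by simp
   have "NN P (%p. cost (fst p) (snd p)) <= ennreal (t0 + 1)"
    using P(2) h21 unfolding T_def by (meson add_left_mono ennreal_leI order_trans)
   from moment_bound_integral[OF P(1) _ this] t0(1)
   show "NN P (%p. moment_bound (fst p) (snd p)) <= ennreal Qc" unfolding Qc_def F4_def by simp
   have [measurable]: "residual ep : bmeas borel" by (rule residual_facts(2)[OF ep(1) big])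
   show "(%p. residual ep (snd p)) : bmeas P" by measurable
   thus "(%p. 2 * h * residual ep (snd p)) : bmeas P" by measurable
   show mb: "(%p. moment_bound (fst p) (snd p)) : bmeas P" unfolding moment_bound_def by measurable
   show "(%p. (et * h + C * s) * moment_bound (fst p) (snd p)) : bmeas P" unfolding moment_bound_def by measurable
   show "(%p. (1 - 2 * h * m) * cost (fst p) (snd p)) : bmeas P"
    "(%p. cost (fst p) (snd p)) : bmeas P"
    "(%p. 2 * h * residual ep (snd p) + (et * h + C * s) * moment_bound (fst p) (snd p)) : bmeas P"
    unfolding moment_bound_def by measurable
   have mb0: "moment_bound z x >= 0" for z x using moment_bound_ge_1[of z x] by simp
   show "0 <= (1 - 2 * h * m) * cost (fst p) (snd p)" for p using hm cost_nonneg by simp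
   show "0 <= 2 * h * residual ep (snd p) + (et * h + C * s) * moment_bound (fst p) (snd p)"
    "0 <= 2 * h * residual ep (snd p)" "0 <= (et * h + C * s) * moment_bound (fst p) (snd p)" for p
    using h s et C residual_facts(1)[OF ep(1) big] mb0 by (simp_all add: add_nonneg_nonneg mult_nonneg_nonneg)
   show "0 <= (1 - 2 * h * m) * (t0 + h^2)" "0 <= 2 * h * kb + (et * h + C * s) * Qc" "0 <= 2 * h * kb" "0 <= (et * h + C * s) * Qc"
    "0 <= 1 - 2 * h * m" "0 <= 2 * h" "0 <= et * h + C * s"
    using hm t0 h kb et C s Qc by (simp_all add: add_nonneg_nonneg mult_nonneg_nonneg)
  qed
  finally have IA: "NN P (%p. \<integral> w. step_cost h (fst p) (snd p) w \<partial>gaussian (2 * h)) <= ennreal A" .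
  have "ennreal t0 <= T P'" by (rule lower[OF P'(1)])
  also have "... <= ennreal (1 + s) * ennreal A + ennreal (Cr * s)"
   by (rule order_trans[OF P'(2)]) (intro add_right_mono mult_left_mono IA, simp)
  also have "... = ennreal ((1 + s) * A + Cr * s)"
   using s A0 Cr(1) by (simp add: ennreal_mult')
  finally have t0le: "t0 <= (1 + s) * A + Cr * s"
   using s A0 Cr(1) by (subst (asm) ennreal_le_iff) (auto intro!: add_nonneg_nonneg mult_nonneg_nonneg)
  have A1: "A <= t0 - 2 * h * m * t0 + s + 2 * h * kb + et * h * Qc + C * s * Qc"
  proof -
   have "A = t0 - 2 * h * m * t0 + h^2 - 2 * h * m * h^2 + 2 * h * kb + et * h * Qc + C * s * Qc"
    unfolding A_def by (simp add: algebra_simps)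
   moreover have "2 * h * m * h^2 >= 0" using h m by simp
   ultimately show ?thesis using s(3) by linarith
  qed
  have A2: "A <= D"
  proof -
   have "(1 - 2 * h * m) * (t0 + h^2) <= 1 * (t0 + 1)"
    using hm h m t0 h21 by (intro mult_mono) auto
   moreover have "2 * h * kb <= 2 * 1 * kb" using h kb by (intro mult_right_mono mult_left_mono) auto
   moreover have "(et * h + C * s) * Qc <= (et * 1 + C * 1) * Qc"
    using h et C s Qc by (intro mult_right_mono add_mono mult_left_mono) auto
   ultimately show ?thesis unfolding A_def D_def by (simp add: distrib_right)
  qed
  have "(1 + s) * A <= A + s * D" using A2 s by (simp add: distrib_right)
  with t0le A1 have "2 * h * m * t0 <= s + 2 * h * kb + et * h * Qc + C * s * Qc + s * D + Cr * s" by linarith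
  also have "... = h * (2 * kb + et * Qc + sqrt h * B)" unfolding B_def s_def by (simp add: algebra_simps)
  finally have "h * (2 * m * t0) <= h * (2 * kb + et * Qc + sqrt h * B)" by (simp add: ac_simps)
  hence 1: "2 * m * t0 <= 2 * kb + et * Qc + sqrt h * B" using h(1) by simp
  have "sqrt h <= e / B" using h(4) e B by (intro real_le_lsqrt) auto
  hence "sqrt h * B <= e" using B by (simp add: field_simps)
  with 1 show "2 * m * t0 <= 2 * kb + et * Qc + e" by linarith
 qed
 have "2 * m * t0 <= 2 * kb"
 proof (rule field_le_epsilon)
  fix e :: real assume e: "0 < e"
  have "2 * m * t0 <= 2 * kb + e / (Qc + 1) * Qc" using e Qc by (intro main) simp
  also have "e / (Qc + 1) * Qc <= e" using e Qc by (simp add: field_simps)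
  finally show "2 * m * t0 <= 2 * kb + e" by simp
 qed
 hence "t0 <= kb / m" using m by (simp add: field_simps)
 moreover obtain P where "P : couplings pp mus" "T P <= ennreal (t0 + de)" using near[OF de] by blast
 ultimately show ?thesis unfolding T_def m_def by (meson add_right_mono ennreal_leI order_trans)
qed

lemma wasserstein_target_le:
 assumes ep: "0 < ep" "ep < wg" and big: "lam > wg / wfs"
  and kb: "kb >= 0" "NN mus (%x. residual ep x) <= ennreal kb"
 shows "wasserstein2 (x_marginal pp) mus <= ennreal (sqrt (kb / (wg - ep)))"
proof (rule wasserstein2_le'[OF _ refl])
 show "0 <= kb / (wg - ep)" using kb ep by simp
 show "sets (x_marginal pp) = sets borel" by (simp add: x_marginal_def)
 show "sets mus = sets borel" by (rule sets_target)
 fix de :: real assume "de > 0"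
 from optimal_cost_le[OF ep big kb this] obtain P where P: "P : couplings pp mus"
  "NN P (%p. cost (fst p) (snd p)) <= ennreal (kb / (wg - ep) + de)" by blast
 note Pp = couplingsD[OF P(1) sets_pp sets_target]
 note [measurable_cong] = Pp(2)
 show "\<exists>R :: (((real ^ 'b) \<times> (real ^ 'a)) \<times> (real ^ 'b)) measure. \<exists>X Y. prob_space R \<and> X : bmeas R \<and> Y : bmeas R \<and>
    distr R borel X = x_marginal pp \<and> distr R borel Y = mus \<and>
    (NN R (%om. (norm (X om - Y om))^2)) <= ennreal (kb / (wg - ep) + de)"
 proof -
  have "distr P borel (%p. fst (fst p)) = distr (distr P borel fst) borel fst"
   by (subst distr_distr) (auto simp: comp_def)
  hence 1: "distr P borel (%p. fst (fst p)) = x_marginal pp" unfolding Pp(3) x_marginal_def .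
  have "NN P (%p. (norm (fst (fst p) - snd p))^2) <= NN P (%p. cost (fst p) (snd p))"
   using lam by (intro nn_integral_mono ennreal_leI) (simp add: cost_def)
  with P(2) have 2: "NN P (%p. (norm (fst (fst p) - snd p))^2) <= ennreal (kb / (wg - ep) + de)"
   by (rule order_trans[rotated])
  show ?thesis
   by (intro exI[of _ P] exI[of _ "%p. fst (fst p)"] exI[of _ snd] conjI Pp(1) Pp(4) 1 2) measurable
 qed
qed

end

section \<open>Removing the cutoff\<close>

locale pd_smooth = pd_target +
 assumes C3: "C_k 3 f"
begin

abbreviation "F \<equiv> %x. grad f (K x)"
abbreviation "J \<equiv> %x. jacobian F (at x)"

lemma C2_F: "C_k 2 F"
proof -
 have g: "grad f y = (\<Sum>e\<in>Basis. D1f f y e *. e)" for y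
 proof -
  have "(f has_derivative (%h. h <.> grad f y)) (at y)" using df[of y] by (simp add: gderiv_def)
  hence "D1f f y = (%h. h <.> grad f y)" by (rule frechet_derivative_at[symmetric])
  thus ?thesis using euclidean_representation[of "grad f y"] by (simp add: inner_commute)
 qed
 have C3': "C_k (Suc 2) f" using C3 by (simp add: eval_nat_numeral)
 have "C_k 2 (%y. \<Sum>e\<in>Basis. D1f f y e *. e)"
  by (intro C_k_sum C_k_scaleR C_k_const C_k_D1[OF C3'])
 hence "C_k 2 (grad f)" by (simp add: g[symmetric])
 thus ?thesis by (rule C_k_compose_linear[OF linear_K])
qed

lemma C2_F': "C_k (Suc (Suc 0)) F" using C2_F by (simp add: numeral_2_eq_2)

lemma jacobian_vec: "J x *v v = D1f F x v"
proof -
 have "(%v. matrix (D1f F x) *v v) = D1f F x" by (rule matrix_vector_mul(2)[OF linear_D1f[OF C2_F']])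
 thus ?thesis unfolding jacobian_def by (rule fun_cong)
qed

lemma frobenius_norm_jacobian: "(frobenius_norm (J x))^2 = (\<Sum>e\<in>Basis. (norm (D1f F x e))^2)"
proof -
 have "(\<Sum>e\<in>Basis. (norm (D1f F x e))^2) = (\<Sum>j\<in>UNIV. (norm (D1f F x (axis j 1)))^2)"
 proof -
  have B: "(Basis :: (real ^ 'b) set) = range (%j. axis j 1)" by (auto simp: Basis_vec_def)
  have "inj (\<lambda>j :: 'b. axis j (1 :: real))" by (auto simp: inj_on_def axis_eq_axis)
  thus ?thesis unfolding B by (subst sum.reindex) auto
 qed
 also have "... = (\<Sum>j\<in>UNIV. \<Sum>i\<in>UNIV. (J x $ i $ j)^2)"
 proof (rule sum.cong[OF refl])
  fix j :: 'b
  have "(norm (D1f F x (axis j 1)))^2 = (\<Sum>i\<in>UNIV. (D1f F x (axis j 1) $ i)^2)"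
   by (simp add: norm_vec_def L2_set_def sum_nonneg)
  also have "... = (\<Sum>i\<in>UNIV. (J x $ i $ j)^2)" by (simp add: jacobian_def matrix_def)
  finally show "(norm (D1f F x (axis j 1)))^2 = (\<Sum>i\<in>UNIV. (J x $ i $ j)^2)" .
 qed
 also have "... = (frobenius_norm (J x))^2"
  unfolding frobenius_norm_def by (subst sum.swap) (simp add: sum_nonneg)
 finally show ?thesis ..
qed

definition "gen_F x = laplacian F x - D1f F x (force x)"
abbreviation "SF x \<equiv> \<Sum>e\<in>Basis. (norm (D1f F x e))^2"

lemma lip_F: "norm (F x - F y) <= L / wfs * norm (x - y)"
proof -
 have "norm (F x - F y) <= norm (K x - K y) / wfs" by (rule lip_grad_f)
 also have "K x - K y = K (x - y)" by (simp add: linear_diff[OF linear_K])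
 also have "norm (K (x - y)) / wfs <= L * norm (x - y) / wfs" using wfs by (intro divide_right_mono norm_K) simp
 finally show ?thesis by simp
qed

lemma borel_F [measurable]: "F : bmeas borel"
 by (rule borel_measurable_continuous_onI[OF C_k_continuous[OF C2_F]])

lemma integrable_F4: "integrable mus (%x. norm (F x) ^ 4)"
proof (rule Bochner_Integration.integrable_bound)
 interpret prob_space mus by (rule prob_space_target)
 show "integrable mus (%x. 8 * (norm (F 0) ^ 4 + (L / wfs) ^ 4 * norm x ^ 4))"
  using target_moment[of 4] by simp
 show "AE x in mus. norm (norm (F x) ^ 4) <= norm (8 * (norm (F 0) ^ 4 + (L / wfs) ^ 4 * norm x ^ 4))"
 proof (rule AE_I2)
  fix x
  have "norm (F x) <= norm (F 0) + L / wfs * norm x"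
   using lip_F[of x 0] norm_triangle_ineq2[of "F x" "F 0"] by simp
  hence "norm (F x) ^ 4 <= (norm (F 0) + L / wfs * norm x) ^ 4" by (intro power_mono) auto
  also have "... <= 8 * (norm (F 0) ^ 4 + (L / wfs * norm x) ^ 4)"
   using L_nonneg wfs by (intro power4_add_le) auto
  finally have "norm (F x) ^ 4 <= 8 * (norm (F 0) ^ 4 + (L / wfs) ^ 4 * norm x ^ 4)"
   by (simp only: power_mult_distrib)
  thus "norm (norm (F x) ^ 4) <= norm (8 * (norm (F 0) ^ 4 + (L / wfs) ^ 4 * norm x ^ 4))" by simp
 qed
qed simp

definition "trunc n x = cutoff (real (Suc n)) x *. F x"

lemma C2_trunc: "C_k 2 (trunc n)"
 unfolding trunc_def[abs_def] by (intro C_k_scaleR C_k_cutoff C2_F) simp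

lemma trunc_outside: "norm x >= real (Suc n) ==> trunc n x = 0"
 unfolding trunc_def by (subst cutoff_outside) auto

lemma D1f_trunc: "D1f (trunc n) x v = cutoff (real (Suc n)) x *. D1f F x v + D1f (cutoff (real (Suc n))) x v *. F x"
 unfolding trunc_def[abs_def] by (rule laplacian_scaleR(2)[OF C_k_cutoff C2_F]) simp

lemma laplacian_trunc: "laplacian (trunc n) x = cutoff (real (Suc n)) x *. laplacian F x
  + 2 *. (\<Sum>e\<in>Basis. D1f (cutoff (real (Suc n))) x e *. D1f F x e) + laplacian (cutoff (real (Suc n))) x *. F x"
 unfolding trunc_def[abs_def] by (rule laplacian_scaleR(1)[OF C_k_cutoff C2_F]) simp

definition "gen_trunc n x = laplacian (trunc n) x - D1f (trunc n) x (force x)"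
definition "sqgrad_trunc n x = (\<Sum>e\<in>Basis. (norm (D1f (trunc n) x e))^2)"

lemma tendsto_cutoff_derivatives:
 "(%n. D1f (cutoff (real (Suc n))) x v) \<longlonglongrightarrow> 0" "(%n. laplacian (cutoff (real (Suc n))) x) \<longlonglongrightarrow> 0"
 for x v :: "real ^ 'b"
proof -
 show "(%n. D1f (cutoff (real (Suc n))) x v) \<longlonglongrightarrow> 0"
 proof (rule Lim_null_comparison)
  show "eventually (%n. norm (D1f (cutoff (real (Suc n))) x v) <= 6 / real (Suc n) * norm v) sequentially"
   using cutoff_D_bounds(1)[of _ x v] by (intro always_eventually) auto
  have "(%n. (6 * norm v) * inverse (real (Suc n))) \<longlonglongrightarrow> (6 * norm v) * 0"
   by (intro tendsto_mult tendsto_const LIMSEQ_inverse_real_of_nat)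
  thus "(%n. 6 / real (Suc n) * norm v) \<longlonglongrightarrow> 0" by (simp add: divide_inverse ac_simps)
 qed
 show "(%n. laplacian (cutoff (real (Suc n))) x) \<longlonglongrightarrow> 0"
 proof (rule Lim_null_comparison)
  show "eventually (%n. norm (laplacian (cutoff (real (Suc n))) x) <= 30 * real DIM(real ^ 'b) / (real (Suc n))^2) sequentially"
   using cutoff_D_bounds(2)[of _ x] by (intro always_eventually) auto
  have "(%n. (30 * real DIM(real ^ 'b)) * (inverse (real (Suc n)) * inverse (real (Suc n)))) \<longlonglongrightarrow> (30 * real DIM(real ^ 'b)) * (0 * 0)"
   by (intro tendsto_mult tendsto_const LIMSEQ_inverse_real_of_nat)
  thus "(%n. 30 * real DIM(real ^ 'b) / (real (Suc n))^2) \<longlonglongrightarrow> 0"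
   by (simp add: divide_inverse power2_eq_square ac_simps)
 qed
qed

lemma trunc_tendsto:
 "(%n. trunc n x) \<longlonglongrightarrow> F x" "(%n. sqgrad_trunc n x) \<longlonglongrightarrow> SF x" "(%n. gen_trunc n x) \<longlonglongrightarrow> gen_F x"
proof -
 have "(%n. cutoff (real (Suc n)) x *. F x) \<longlonglongrightarrow> 1 *. F x" by (intro tendsto_intros cutoff_tendsto)
 thus "(%n. trunc n x) \<longlonglongrightarrow> F x" by (simp add: trunc_def)
 have D: "(%n. D1f (trunc n) x v) \<longlonglongrightarrow> D1f F x v" for v
 proof -
  have "(%n. cutoff (real (Suc n)) x *. D1f F x v + D1f (cutoff (real (Suc n))) x v *. F x) \<longlonglongrightarrow> 1 *. D1f F x v + 0 *. F x"
   by (intro tendsto_intros cutoff_tendsto tendsto_cutoff_derivatives)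
  thus ?thesis by (simp add: D1f_trunc)
 qed
 show "(%n. sqgrad_trunc n x) \<longlonglongrightarrow> SF x" unfolding sqgrad_trunc_def by (intro tendsto_intros D)
 have "(%n. cutoff (real (Suc n)) x *. laplacian F x
  + 2 *. (\<Sum>e\<in>Basis. D1f (cutoff (real (Suc n))) x e *. D1f F x e) + laplacian (cutoff (real (Suc n))) x *. F x)
  \<longlonglongrightarrow> 1 *. laplacian F x + 2 *. (\<Sum>e\<in>Basis. 0 *. D1f F x e) + 0 *. F x"
  by (intro tendsto_intros cutoff_tendsto tendsto_cutoff_derivatives)
 hence "(%n. laplacian (trunc n) x) \<longlonglongrightarrow> laplacian F x" by (simp add: laplacian_trunc)
 thus "(%n. gen_trunc n x) \<longlonglongrightarrow> gen_F x" unfolding gen_trunc_def gen_F_def by (intro tendsto_intros D)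
qed

lemma trunc_bounds:
 defines "d \<equiv> real DIM(real ^ 'b)"
 shows "(norm (trunc n x - F x))^2 <= 1 + norm (F x) ^ 4"
  and "sqgrad_trunc n x <= 2 * SF x + 72 * d * (1 + norm (F x) ^ 4)"
  and "(norm (gen_trunc n x))^2 <= 6 * (norm (laplacian F x))^2 + 6 * (norm (D1f F x (force x)))^2 + 432 * d * SF x
    + 5400 * d^2 * (1 + norm (F x) ^ 4) + 216 * (norm (force x) ^ 4 + norm (F x) ^ 4)"
proof -
 define r where "r = real (Suc n)"
 have r: "r >= 1" by (simp add: r_def)
 define p where "p = norm (F x)"
 define q where "q = norm (force x)"
 define c where "c = cutoff r x"
 have c: "0 <= c" "c <= 1" using cutoff_bounds[of r x] by (simp_all add: c_def)
 have p0: "p >= 0" "q >= 0" by (simp_all add: p_def q_def)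
 have p2: "p^2 <= 1 + p ^ 4" using le_1_plus_square[of "p^2"] by (simp add: power_mult[symmetric])
 have d1: "\<bar>D1f (cutoff r) x v\<bar> <= 6 * norm v" for v
 proof -
  have "\<bar>D1f (cutoff r) x v\<bar> <= 6 / r * norm v" by (rule cutoff_D_bounds(1)[OF r])
  also have "... <= 6 * norm v" using r by (intro mult_right_mono) (auto simp: field_simps)
  finally show ?thesis .
 qed
 have d2: "\<bar>laplacian (cutoff r) x\<bar> <= 30 * d"
 proof -
  have "\<bar>laplacian (cutoff r) x\<bar> <= 30 * real DIM(real ^ 'b) / r^2" by (rule cutoff_D_bounds(2)[OF r])
  also have "... <= 30 * real DIM(real ^ 'b) / 1" using r by (intro divide_left_mono) (auto simp: one_le_power)
  finally show ?thesis by (simp add: d_def)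
 qed
 have "trunc n x - F x = - ((1 - c) *. F x)" by (simp add: trunc_def c_def r_def scaleR_diff_left)
 hence "norm (trunc n x - F x) = (1 - c) * p" using c by (simp add: p_def)
 also have "... <= p" using c p0 by (simp add: mult_left_le_one_le)
 finally have "(norm (trunc n x - F x))^2 <= p^2" by (rule power_mono) simp
 with p2 show "(norm (trunc n x - F x))^2 <= 1 + norm (F x) ^ 4" unfolding p_def by linarith
 have Dn: "norm (D1f (trunc n) x v) <= norm (D1f F x v) + 6 * norm v * p" for v
 proof -
  have "norm (D1f (trunc n) x v) <= norm (c *. D1f F x v) + norm (D1f (cutoff r) x v *. F x)"
   unfolding D1f_trunc c_def r_def by (rule norm_triangle_ineq)
  also have "... = c * norm (D1f F x v) + \<bar>D1f (cutoff r) x v\<bar> * p" using c by (simp add: p_def)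
  also have "... <= 1 * norm (D1f F x v) + 6 * norm v * p"
   using c p0 by (intro add_mono mult_right_mono d1) auto
  finally show ?thesis by simp
 qed
 have "sqgrad_trunc n x <= (\<Sum>e\<in>(Basis :: (real ^ 'b) set). 2 * (norm (D1f F x e))^2 + 72 * p^2)"
  unfolding sqgrad_trunc_def
 proof (rule sum_mono)
  fix e :: "real ^ 'b" assume "e : Basis"
  hence "norm (D1f (trunc n) x e) <= norm (D1f F x e) + 6 * p" using Dn[of e] by simp
  from square_le_2[OF _ this] show "(norm (D1f (trunc n) x e))^2 <= 2 * (norm (D1f F x e))^2 + 72 * p^2"
   by (simp add: power_mult_distrib)
 qed
 also have "... = 2 * SF x + 72 * d * p^2" by (simp add: sum.distrib sum_distrib_left d_def)
 also have "... <= 2 * SF x + 72 * d * (1 + p ^ 4)" by (intro add_left_mono mult_left_mono p2) (simp add: d_def)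
 finally show "sqgrad_trunc n x <= 2 * SF x + 72 * d * (1 + norm (F x) ^ 4)" unfolding p_def .
 define s where "s = (\<Sum>e\<in>(Basis :: (real ^ 'b) set). norm (D1f F x e))"
 have s2: "s^2 <= d * SF x"
  using sum_squared_le_sum_of_squares[of "%e. norm (D1f F x e)" "Basis :: (real ^ 'b) set"] by (simp add: s_def d_def mult.commute)
 have "norm (gen_trunc n x) <= norm (laplacian (trunc n) x) + norm (D1f (trunc n) x (force x))"
  unfolding gen_trunc_def by (rule norm_triangle_ineq4)
 also have "norm (laplacian (trunc n) x) <= norm (laplacian F x) + 12 * s + 30 * d * p"
 proof -
  have "norm (laplacian (trunc n) x) <= norm (c *. laplacian F x) + norm (2 *. (\<Sum>e\<in>Basis. D1f (cutoff r) x e *. D1f F x e)) + norm (laplacian (cutoff r) x *. F x)"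
   unfolding laplacian_trunc c_def r_def by (intro order_trans[OF norm_triangle_ineq] add_right_mono norm_triangle_ineq)
  also have "norm (c *. laplacian F x) <= norm (laplacian F x)" using c by (simp add: mult_left_le_one_le)
  also have "norm (2 *. (\<Sum>e\<in>Basis. D1f (cutoff r) x e *. D1f F x e)) <= 12 * s"
  proof -
   have "norm (\<Sum>e\<in>(Basis :: (real ^ 'b) set). D1f (cutoff r) x e *. D1f F x e) <= (\<Sum>e\<in>(Basis :: (real ^ 'b) set). 6 * norm (D1f F x e))"
   proof (rule sum_norm_le)
    fix e :: "real ^ 'b" assume "e : Basis"
    thus "norm (D1f (cutoff r) x e *. D1f F x e) <= 6 * norm (D1f F x e)"
     using d1[of e] by (simp add: mult_right_mono)
   qed
   thus ?thesis by (simp add: s_def sum_distrib_left[symmetric])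
  qed
  also have "norm (laplacian (cutoff r) x *. F x) <= 30 * d * p" using d2 p0 by (simp add: p_def mult_right_mono)
  finally show ?thesis by simp
 qed
 also have "norm (D1f (trunc n) x (force x)) <= norm (D1f F x (force x)) + 6 * q * p" using Dn[of "force x"] by (simp add: q_def)
 finally have "norm (gen_trunc n x) <= (norm (laplacian F x) + norm (D1f F x (force x))) + 12 * s + (30 * d * p + 6 * q * p)" by simp
 hence "(norm (gen_trunc n x))^2 <= 3 * (norm (laplacian F x) + norm (D1f F x (force x)))^2 + 3 * (12 * s)^2 + 3 * (30 * d * p + 6 * q * p)^2"
  by (rule square_le_3[rotated]) simp
 also have "... <= 3 * (2 * (norm (laplacian F x))^2 + 2 * (norm (D1f F x (force x)))^2) + 3 * (144 * (d * SF x))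
   + 3 * (2 * (30 * d * p)^2 + 2 * (6 * q * p)^2)"
 proof (intro add_mono mult_left_mono)
  show "(norm (laplacian F x) + norm (D1f F x (force x)))^2 <= 2 * (norm (laplacian F x))^2 + 2 * (norm (D1f F x (force x)))^2"
   by (rule square_le_2) auto
  show "(12 * s)^2 <= 144 * (d * SF x)" using s2 by (simp add: power_mult_distrib)
  show "(30 * d * p + 6 * q * p)^2 <= 2 * (30 * d * p)^2 + 2 * (6 * q * p)^2"
   by (rule square_le_2) (use p0 in "auto simp: d_def")
 qed auto
 also have "... = 6 * (norm (laplacian F x))^2 + 6 * (norm (D1f F x (force x)))^2 + 432 * d * SF x
    + 5400 * d^2 * p^2 + 216 * (q^2 * p^2)"
  by (simp add: power_mult_distrib)
 also have "... <= 6 * (norm (laplacian F x))^2 + 6 * (norm (D1f F x (force x)))^2 + 432 * d * SF x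
    + 5400 * d^2 * (1 + p ^ 4) + 216 * (q ^ 4 + p ^ 4)"
 proof (intro add_mono mult_left_mono order_refl p2)
  have "2 * (q^2 * p^2) <= (q^2)^2 + (p^2)^2" using sum_squares_bound[of "q^2" "p^2"] by simp
  moreover have "0 <= q^2 * p^2" by simp
  ultimately have "q^2 * p^2 <= (q^2)^2 + (p^2)^2" by linarith
  thus "q^2 * p^2 <= q ^ 4 + p ^ 4" by (simp add: power_mult[symmetric])
 qed (auto simp: d_def)
 finally show "(norm (gen_trunc n x))^2 <= 6 * (norm (laplacian F x))^2 + 6 * (norm (D1f F x (force x)))^2 + 432 * d * SF x
    + 5400 * d^2 * (1 + norm (F x) ^ 4) + 216 * (norm (force x) ^ 4 + norm (F x) ^ 4)" unfolding p_def q_def .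
qed

end

locale pd_moments = pd_smooth +
 assumes int_D1: "integrable mus (%x. (frobenius_norm (J x))^2)"
  and int_D2: "integrable mus (%x. (norm (laplacian F x))^2)"
  and int_D3: "integrable mus (%x. (norm (J x *v (grad g x + KT (F x))))^2)"
begin

definition "jacobian_moment = (LINT x|mus. SF x)"
definition "generator_moment = (LINT x|mus. (norm (gen_F x))^2)"

lemma int_SF: "integrable mus (%x. SF x)"
 using int_D1 by (simp add: frobenius_norm_jacobian)

lemma int_drift: "integrable mus (%x. (norm (D1f F x (force x)))^2)"
 using int_D3 by (simp add: jacobian_vec force_def)

lemma moments_nonneg: "jacobian_moment >= 0" "generator_moment >= 0"
 unfolding jacobian_moment_def generator_moment_def by (auto intro!: Bochner_Integration.integral_nonneg sum_nonneg)

lemma trunc_measurable: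
 "trunc n : bmeas borel" "sqgrad_trunc n : bmeas borel" "gen_trunc n : bmeas borel"
 "(%x. SF x) : bmeas borel" "gen_F : bmeas borel"
proof -
 have gm: "(%x. laplacian G x - D1f G x (force x)) : bmeas borel" "(%x. \<Sum>e\<in>Basis. (norm (D1f G x e))^2) : bmeas borel"
  if G: "C_k 2 G" for G :: "real ^ 'b => real ^ 'a"
 proof -
  have G': "C_k (Suc (Suc 0)) G" using G by (simp add: numeral_2_eq_2)
  have [measurable]: "(%x. D1f G x v) : bmeas borel" for v
   by (rule borel_measurable_continuous_onI[OF continuous_D1f[OF G']])
  have [measurable]: "laplacian G : bmeas borel"
   by (rule borel_measurable_continuous_onI[OF continuous_laplacian[OF G]])
  have "(%x. laplacian G x - D1f G x (force x)) = (%x. laplacian G x - (\<Sum>e\<in>Basis. (force x <.> e) *. D1f G x e))"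
   by (rule ext) (simp add: D1f_expand[OF G', of _ "force _"])
  thus "(%x. laplacian G x - D1f G x (force x)) : bmeas borel" by simp
  show "(%x. \<Sum>e\<in>Basis. (norm (D1f G x e))^2) : bmeas borel" by measurable
 qed
 show "trunc n : bmeas borel" by (rule borel_measurable_continuous_onI[OF C_k_continuous[OF C2_trunc]])
 show "sqgrad_trunc n : bmeas borel" "gen_trunc n : bmeas borel"
  unfolding sqgrad_trunc_def[abs_def] gen_trunc_def[abs_def] by (rule gm[OF C2_trunc])+
 show "(%x. SF x) : bmeas borel" "gen_F : bmeas borel"
  unfolding gen_F_def[abs_def] by (rule gm[OF C2_F])+
qed

lemma trunc_integrals:
 "integrable mus (sqgrad_trunc n)" "integrable mus (%x. (norm (gen_trunc n x))^2)" "integrable mus (%x. (norm (trunc n x - F x))^2)"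
 "(%n. \<integral> x. sqgrad_trunc n x \<partial>mus) \<longlonglongrightarrow> jacobian_moment"
 "(%n. \<integral> x. (norm (gen_trunc n x))^2 \<partial>mus) \<longlonglongrightarrow> generator_moment"
 "(%n. \<integral> x. (norm (trunc n x - F x))^2 \<partial>mus) \<longlonglongrightarrow> 0"
proof -
 interpret prob_space mus by (rule prob_space_target)
 note [measurable] = trunc_measurable
 define d where "d = real DIM(real ^ 'b)"
 let ?w1 = "%x. 2 * SF x + 72 * d * (1 + norm (F x) ^ 4)"
 let ?w2 = "%x. 6 * (norm (laplacian F x))^2 + 6 * (norm (D1f F x (force x)))^2 + 432 * d * SF x
    + 5400 * d^2 * (1 + norm (F x) ^ 4) + 216 * (norm (force x) ^ 4 + norm (F x) ^ 4)"
 let ?w3 = "%x. 1 + norm (F x) ^ 4"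
 have w3: "integrable mus ?w3" by (intro Bochner_Integration.integrable_add integrable_F4) simp
 have w1: "integrable mus ?w1" by (intro Bochner_Integration.integrable_add integrable_mult_right int_SF w3)
 have w2: "integrable mus ?w2"
  by (intro Bochner_Integration.integrable_add integrable_mult_right int_SF w3 int_D2 int_drift integrable_F4 integrable_force4)
 have s0: "sqgrad_trunc n x >= 0" for n x unfolding sqgrad_trunc_def by (intro sum_nonneg) simp
 have b1: "AE x in mus. norm (sqgrad_trunc n x) <= ?w1 x" for n
  using trunc_bounds(2)[of n] s0 unfolding d_def by (intro AE_I2) simp
 have b2: "AE x in mus. norm ((norm (gen_trunc n x))^2) <= ?w2 x" for n
  using trunc_bounds(3)[of n] unfolding d_def by (intro AE_I2) simp
 have b3: "AE x in mus. norm ((norm (trunc n x - F x))^2) <= ?w3 x" for n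
  using trunc_bounds(1)[of n] by (intro AE_I2) simp
 have l1: "AE x in mus. (%n. sqgrad_trunc n x) \<longlonglongrightarrow> SF x" by (intro AE_I2 trunc_tendsto)
 have l2: "AE x in mus. (%n. (norm (gen_trunc n x))^2) \<longlonglongrightarrow> (norm (gen_F x))^2" by (intro AE_I2 tendsto_intros trunc_tendsto)
 have l3: "AE x in mus. (%n. (norm (trunc n x - F x))^2) \<longlonglongrightarrow> 0"
 proof (rule AE_I2)
  fix x
  have "(%n. (norm (trunc n x - F x))^2) \<longlonglongrightarrow> (norm (F x - F x))^2" by (intro tendsto_intros trunc_tendsto)
  thus "(%n. (norm (trunc n x - F x))^2) \<longlonglongrightarrow> 0" by simp
 qed
 have m1: "(%x. SF x) : bmeas mus" "sqgrad_trunc n : bmeas mus" for n by measurable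
 have m2: "(%x. (norm (gen_F x))^2) : bmeas mus" "(%x. (norm (gen_trunc n x))^2) : bmeas mus" for n by measurable
 have m3: "(%x. 0 :: real) : bmeas mus" "(%x. (norm (trunc n x - F x))^2) : bmeas mus" for n by measurable
 show "integrable mus (sqgrad_trunc n)" by (rule integrable_dominated_convergence2[OF m1 w1 l1 b1])
 show "integrable mus (%x. (norm (gen_trunc n x))^2)" by (rule integrable_dominated_convergence2[OF m2 w2 l2 b2])
 show "integrable mus (%x. (norm (trunc n x - F x))^2)" by (rule integrable_dominated_convergence2[OF m3 w3 l3 b3])
 show "(%n. \<integral> x. sqgrad_trunc n x \<partial>mus) \<longlonglongrightarrow> jacobian_moment"
  unfolding jacobian_moment_def by (rule integral_dominated_convergence[OF m1 w1 l1 b1])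
 show "(%n. \<integral> x. (norm (gen_trunc n x))^2 \<partial>mus) \<longlonglongrightarrow> generator_moment"
  unfolding generator_moment_def by (rule integral_dominated_convergence[OF m2 w2 l2 b2])
 show "(%n. \<integral> x. (norm (trunc n x - F x))^2 \<partial>mus) \<longlonglongrightarrow> 0"
  using integral_dominated_convergence[OF m3 w3 l3 b3] by simp
qed

text \<open>The target has full support, so a vanishing mean square of the Jacobian makes it vanish.\<close>

lemma generator_moment_zero:
 assumes "jacobian_moment = 0" shows "generator_moment = 0"
proof -
 have S0: "SF x >= 0" for x by (intro sum_nonneg) simp
 have cont: "continuous_on UNIV (%x. SF x)" by (intro continuous_intros continuous_D1f[OF C2_F'])
 have "AE x in mus. SF x = 0"
  using assms S0 integral_nonneg_eq_0_iff_AE[OF int_SF] unfolding jacobian_moment_def by simp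
 hence "AE x in lborel. SF x = 0"
  unfolding target_eq using target_dens_pos by (subst (asm) AE_density) auto
 moreover have o: "open {x. SF x ~= 0}" by (intro open_Collect_neq cont continuous_on_const)
 ultimately have "{x. SF x ~= 0} : null_sets lborel" by (subst AE_iff_null_sets) auto
 hence "negligible {x. SF x ~= 0}" unfolding negligible_iff_null_sets by (rule null_sets_completionI)
 hence "{x. SF x ~= 0} = {}" using o open_not_negligible by blast
 hence S: "SF x = 0" for x by blast
 have De: "D1f F x e = 0" if "e : Basis" for x e
  using S[of x] that by (subst (asm) sum_nonneg_eq_0_iff) auto
 have D: "D1f F x v = 0" for x v
  unfolding D1f_expand[OF C2_F', of x v] by (intro sum.neutral) (simp add: De)
 have "laplacian F x = 0" for x unfolding laplacian_def
  by (intro sum.neutral ballI) (simp add: D frechet_derivative_const)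
 thus ?thesis by (simp add: generator_moment_def gen_F_def D)
qed

end

locale pd_full = pd_stationary_process + pd_moments
begin

text \<open>The truncations of \<open>x \<mapsto> grad f (K x)\<close> are admissible test maps, and both error terms pass to
 the limit in mean square.\<close>

lemma stationary_target_distance:
 assumes big: "lam > wg / wfs"
 shows "wasserstein2 (x_marginal pp) mus
  <= ennreal (sqrt ((jacobian_moment / lam + generator_moment / (4 * lam^2 * (wfs - wg / lam))) / wg))"
proof -
 define c2 where "c2 = 1 / (4 * lam^2 * (wfs - wg / lam))"
 define k where "k = jacobian_moment / lam + c2 * generator_moment"
 have ka: "wfs - wg / lam > 0" using big lam wfs wg by (simp add: field_simps)
 have c2: "c2 >= 0" using ka lam by (simp add: c2_def)
 have k0: "k >= 0" unfolding k_def using moments_nonneg lam c2 by simp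
 have eps: "wasserstein2 (x_marginal pp) mus <= ennreal (sqrt (k / (wg - ep)))" if ep: "0 < ep" "ep < wg" for ep
 proof -
  define c3 where "c3 = L^2 / (4 * ep) + lam / (4 * ep * wf^2)"
  define kb where "kb n = (LINT x|mus. sqgrad_trunc n x) / lam + c2 * (LINT x|mus. (norm (gen_trunc n x))^2) + c3 * (LINT x|mus. (norm (trunc n x - F x))^2)" for n
  have "kb \<longlonglongrightarrow> jacobian_moment / lam + c2 * generator_moment + c3 * 0"
   unfolding kb_def using lam by (intro tendsto_intros trunc_integrals) auto
  hence "kb \<longlonglongrightarrow> k" by (simp add: k_def)
  hence "(%n. ennreal (sqrt (kb n / (wg - ep)))) \<longlonglongrightarrow> ennreal (sqrt (k / (wg - ep)))"
   using ep by (intro tendsto_intros) auto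
  moreover have "wasserstein2 (x_marginal pp) mus <= ennreal (sqrt (kb n / (wg - ep)))" for n
  proof -
   interpret T: pd_comparison f g K wf wg wfs Lg lam D4 M W X Y pp "trunc n" "real (Suc n)"
    by unfold_locales (use C2_trunc trunc_outside lam in auto)
   have r: "T.residual ep x = sqgrad_trunc n x / lam + c2 * (norm (gen_trunc n x))^2 + c3 * (norm (trunc n x - F x))^2" for x
    unfolding T.residual_def T.sqgrad_def T.gen_def sqgrad_trunc_def gen_trunc_def c2_def c3_def by simp
   have ri: "integrable mus (%x. T.residual ep x)"
    unfolding r by (intro Bochner_Integration.integrable_add integrable_mult_right integrable_divide trunc_integrals)
   have "(LINT x|mus. T.residual ep x) = kb n"
    unfolding r kb_def
    by (simp add: Bochner_Integration.integral_add Bochner_Integration.integrable_add trunc_integrals)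
   hence nn: "NN mus (%x. T.residual ep x) = ennreal (kb n)"
    using nn_integral_eq_integral[OF ri] T.residual_facts(1)[OF ep(1) big] by simp
   have "kb n >= 0"
    using \<open>(LINT x|mus. T.residual ep x) = kb n\<close> T.residual_facts(1)[OF ep(1) big]
    by (metis Bochner_Integration.integral_nonneg)
   thus ?thesis using nn by (intro T.wasserstein_target_le[OF ep big]) auto
  qed
  ultimately show ?thesis by (intro LIMSEQ_le_const) auto
 qed
 have "(%n. ennreal (sqrt (k / (wg - wg / 2 * inverse (real (Suc n)))))) \<longlonglongrightarrow> ennreal (sqrt (k / (wg - wg / 2 * 0)))"
  using wg by (intro tendsto_intros LIMSEQ_inverse_real_of_nat) auto
 moreover have "wasserstein2 (x_marginal pp) mus <= ennreal (sqrt (k / (wg - wg / 2 * inverse (real (Suc n)))))" for n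
 proof (rule eps)
  show "0 < wg / 2 * inverse (real (Suc n))" using wg by simp
  have "wg / 2 * inverse (real (Suc n)) <= wg / 2 * 1" using wg by (intro mult_left_mono) (auto simp: field_simps)
  also have "... < wg" using wg by simp
  finally show "wg / 2 * inverse (real (Suc n)) < wg" .
 qed
 ultimately have "wasserstein2 (x_marginal pp) mus <= ennreal (sqrt (k / (wg - wg / 2 * 0)))" by (intro LIMSEQ_le_const) auto
 thus ?thesis by (simp add: k_def c2_def)
qed

end

section \<open>The two error constants\<close>

lemma powr_minus_half: "0 < x ==> x powr (- 1/2) = 1 / sqrt x" for x :: real
proof -
 assume x: "0 < x"
 have "x powr (- 1/2) = x powr (- (1/2))" by simp
 also have "... = inverse (x powr (1/2))" by (rule powr_minus)
 also have "x powr (1/2) = sqrt x" using x by (intro powr_half_sqrt) simp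
 finally show ?thesis by (simp only: inverse_eq_divide)
qed

context pd_moments
begin

definition "bias lam = (if lam > wg / wfs
  then sqrt ((jacobian_moment / lam + generator_moment / (4 * lam^2 * (wfs - wg / lam))) / wg) else 0)"

lemma bias_nonneg: "bias lam >= 0"
proof (cases "lam > wg / wfs")
 case True
 moreover have "wg / wfs > 0" using wg wfs by simp
 ultimately have lam: "lam > 0" by linarith
 hence "wfs - wg / lam > 0" using True wfs wg by (simp add: field_simps)
 with lam show ?thesis unfolding bias_def using moments_nonneg wg
  by (auto intro!: divide_nonneg_nonneg add_nonneg_nonneg)
qed (simp add: bias_def)

lemma bias_asymptotics:
 "(%lam. bias lam - (jacobian_moment / wg) powr (1/2) * lam powr (- 1/2)) : O[at_top](%lam. lam powr (- 3/2))"
proof (cases "jacobian_moment = 0")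
 case True
 have "bias lam = 0" for lam using True generator_moment_zero[OF True] by (simp add: bias_def)
 thus ?thesis using True by simp
next
 case False
 define a where "a = jacobian_moment / wg"
 have a: "a > 0" using False moments_nonneg wg by (simp add: a_def)
 define b where "b = generator_moment / (2 * wfs * wg)"
 have b: "b >= 0" using moments_nonneg wg wfs by (simp add: b_def)
 have "norm (bias lam - a powr (1/2) * lam powr (- 1/2)) <= b / sqrt a * norm (lam powr (- 3/2))"
  if l: "lam >= max 1 (2 * wg / wfs)" for lam
 proof -
  have l1: "lam >= 1" "lam >= 2 * wg / wfs" using l by auto
  have l0: "lam > 0" using l1 by simp
  have big: "lam > wg / wfs"
  proof -
   have "wg / wfs > 0" using wg wfs by simp
   moreover have "2 * wg / wfs = wg / wfs + wg / wfs" by simp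
   ultimately show ?thesis using l1(2) by linarith
  qed
  define c where "c = generator_moment / (4 * lam^2 * (wfs - wg / lam)) / wg"
  have k: "wfs - wg / lam >= wfs / 2" using l1(2) l0 wfs by (simp add: field_simps)
  have "wfs - wg / lam >= 0" using k wfs by linarith
  hence c0: "c >= 0" unfolding c_def using l0 moments_nonneg wg wfs by (intro divide_nonneg_nonneg mult_nonneg_nonneg) auto
  have cb: "c <= b / lam^2"
  proof -
   have "generator_moment / (4 * lam^2 * (wfs - wg / lam)) <= generator_moment / (4 * lam^2 * (wfs / 2))"
   proof (intro divide_left_mono mult_left_mono mult_pos_pos)
    show "0 < wfs - wg / lam" using k wfs by linarith
   qed (use k l0 moments_nonneg wfs in auto)
   hence "c <= generator_moment / (4 * lam^2 * (wfs / 2)) / wg" unfolding c_def using wg by (intro divide_right_mono) auto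
   also have "... = b / lam^2" by (simp add: b_def field_simps)
   finally show ?thesis .
  qed
  define r where "r = sqrt (a / lam)"
  have r: "r > 0" using a l0 by (simp add: r_def)
  have B: "bias lam = sqrt (a / lam + c)"
   using big wg by (simp add: bias_def a_def c_def add_divide_distrib mult.commute)
  have "lam powr (- 1/2) = 1 / sqrt lam" by (rule powr_minus_half[OF l0])
  hence R: "a powr (1/2) * lam powr (- 1/2) = r" using a by (simp add: powr_half_sqrt r_def real_sqrt_divide)
  have "sqrt (a / lam + c) <= r + c / r"
  proof (rule real_le_lsqrt)
   have "r^2 = a / lam" using a l0 by (simp add: r_def)
   moreover have "(r + c / r)^2 = r^2 + 2 * c + (c / r)^2" using r by (simp add: power2_sum)
   ultimately show "a / lam + c <= (r + c / r)^2" using c0 by simp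
  qed (use r c0 a l0 in auto)
  moreover have "r <= sqrt (a / lam + c)" using c0 by (simp add: r_def)
  ultimately have "norm (bias lam - a powr (1/2) * lam powr (- 1/2)) <= c / r" unfolding R B by simp
  also have "... <= b / lam^2 / r" using cb r by (intro divide_right_mono) auto
  also have "... = b / sqrt a * (sqrt lam / lam^2)" using a l0 by (simp add: r_def real_sqrt_divide)
  also have "sqrt lam / lam^2 = lam powr (- 3/2)"
  proof -
   have "lam powr (- 3/2) = lam powr (1/2 - 2)" by simp
   also have "... = lam powr (1/2) / lam powr 2" by (rule powr_diff)
   finally show ?thesis using l0 by (simp add: powr_half_sqrt)
  qed
  finally show ?thesis by simp
 qed
 hence "eventually (%lam. norm (bias lam - a powr (1/2) * lam powr (- 1/2)) <= b / sqrt a * norm (lam powr (- 3/2))) at_top"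
  by (rule eventually_mono[OF eventually_ge_at_top])
 thus ?thesis unfolding a_def[symmetric] by (rule bigoI)
qed

end

lemma transport_dist_refl:
 fixes pp :: "('a::euclidean_space \<times> 'b::euclidean_space) measure"
 assumes "prob_distribution pp" shows "transport_dist a b pp pp = 0"
proof -
 have s: "sets pp = sets borel" and p: "prob_space pp" using assms by (auto simp: prob_distribution_def)
 let ?P = "distr pp (pp >< pp) (%z. (z, z))"
 have P: "?P : couplings pp pp" by (rule couplings_distr[OF p]) (simp_all add: distr_id2)
 have sp: "sets (pp >< pp) = sets (borel >< borel)" by (rule sets_pair_measure_cong[OF s s])
 have "(%p. ennreal (a * (norm (fst (fst p) - fst (snd p)))^2 + b * (norm (snd (fst p) - snd (snd p)))^2))
   : bmeas ((borel :: ('a \<times> 'b) measure) >< (borel :: ('a \<times> 'b) measure))"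
  by measurable
 hence m: "(%((x, y), (x', y')). ennreal (a * (norm (x - x'))^2 + b * (norm (y - y'))^2)) : bmeas (pp >< pp)"
  by (subst measurable_cong_sets[OF sp refl]) (simp add: case_prod_unfold)
 have "(\<integral>\<^sup>+ ((x, y), (x', y')). ennreal (a * (norm (x - x'))^2 + b * (norm (y - y'))^2) \<partial>?P) = 0"
  by (subst nn_integral_distr) (use m in "auto simp: case_prod_unfold")
 hence "transport_dist a b pp pp <= ennreal_sqrt 0"
  unfolding transport_dist_def by (intro INF_lower2[OF P]) simp
 thus ?thesis by (simp add: ennreal_sqrt_def)
qed

lemma converges_weakly_x_marginal:
 fixes pp :: "nat => ('a::second_countable_topology \<times> 'b::second_countable_topology) measure"
 assumes w: "converges_weakly pp pp'" and s: "\<And>n. sets (pp n) = sets borel" "sets pp' = sets borel"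
 shows "converges_weakly (%n. x_marginal (pp n)) (x_marginal pp')"
 unfolding converges_weakly_def
proof (intro allI impI)
 fix h :: "'a => real" assume h: "continuous_on UNIV h \<and> bounded (range h)"
 hence [measurable]: "h : bmeas borel" by (intro borel_measurable_continuous_onI) simp
 have e: "(LINT x|x_marginal ka. h x) = (LINT z|ka. h (fst z))" if "sets ka = sets borel" for ka :: "('a \<times> 'b) measure"
 proof -
  have "fst : bmeas ka" using borel_measurable_fst_snd(1) by (subst measurable_cong_sets[OF that refl])
  thus ?thesis unfolding x_marginal_def by (subst integral_distr) auto
 qed
 have "continuous_on UNIV (\<lambda>z :: 'a \<times> 'b. h (fst z))"
  by (rule continuous_on_compose2[OF conjunct1[OF h] continuous_on_fst[OF continuous_on_id]]) simp
 moreover have "bounded (range (\<lambda>z :: 'a \<times> 'b. h (fst z)))" using h by (auto intro: bounded_subset)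
 ultimately show "(%n. LINT x|x_marginal (pp n). h x) \<longlonglongrightarrow> (LINT x|x_marginal pp'. h x)"
  unfolding e[OF s(1)] e[OF s(2)] using w unfolding converges_weakly_def by blast
qed

context pd_full
begin

definition "discretisation_error tht ta = err_A tht powr (1/2) * (1 - tht) powr (- 1/2) * \<bar>ta\<bar>
  + sqrt err_B * ((1 - tht) powr (- 1/2) * \<bar>ta\<bar> powr (3/2))"

lemma discretisation_error_nonneg: "discretisation_error tht ta >= 0"
 unfolding discretisation_error_def using err_nonneg by (intro add_nonneg_nonneg mult_nonneg_nonneg) auto

lemma discretisation_error_asymptotics:
 "ta > 0 ==> norm (discretisation_error tht ta - err_A tht powr (1/2) * (1 - tht) powr (- 1/2) * ta)
   <= sqrt err_B * norm ((1 - tht) powr (- 1/2) * ta powr (3/2))"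
 using err_nonneg by (simp add: discretisation_error_def)

lemma sqrt_step_le:
 assumes ta: "ta > 0" and tht: "tht < 1"
 shows "sqrt (ta / (1 - tht) * (err_A tht * ta + err_B * ta^2)) <= discretisation_error tht ta"
proof -
 have p: "(1 - tht) powr (- 1/2) = 1 / sqrt (1 - tht)" using tht by (intro powr_minus_half) simp
 have t: "ta powr (3/2) = ta * sqrt ta"
 proof -
  have "ta powr (3/2) = ta powr (1 + 1/2)" by simp
  also have "... = ta powr 1 * ta powr (1/2)" by (rule powr_add)
  finally show ?thesis using ta by (simp add: powr_half_sqrt)
 qed
 have "ta / (1 - tht) * (err_A tht * ta + err_B * ta^2) = err_A tht * ta^2 / (1 - tht) + err_B * (ta^2 * ta) / (1 - tht)"
  by (simp add: power2_eq_square distrib_left add_divide_distrib ac_simps)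
 also have "sqrt ... <= sqrt (err_A tht * ta^2 / (1 - tht)) + sqrt (err_B * (ta^2 * ta) / (1 - tht))"
  using err_nonneg ta tht by (intro sqrt_add_le_add_sqrt) auto
 also have "... = sqrt (err_A tht) * (1 / sqrt (1 - tht)) * ta + sqrt err_B * (1 / sqrt (1 - tht) * (ta * sqrt ta))"
  using ta by (simp add: real_sqrt_mult real_sqrt_divide)
 also have "... = discretisation_error tht ta"
  unfolding discretisation_error_def abs_of_pos[OF ta] p t powr_half_sqrt[OF err_nonneg(1)] ..
 finally show ?thesis .
qed

lemma step_param_pos: "ta > 0 ==> inverse (1 + wg * ta) <= tht ==> tht > 0"
 using wg by (smt (verit) inverse_positive_iff_positive mult_pos_pos)

lemma iteration_target_distance:
 assumes big: "lam > wg / wfs" and ta: "ta > 0" and tht: "tht < 1" and st: "tht * (lam * ta) * ta * L^2 <= 1"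
  and th: "inverse (1 + wg * ta) <= tht" "inverse (1 + wfs * (lam * ta)) <= tht"
  and pp0: "prob_distribution pp0"
 shows "wasserstein2 (x_marginal (pd_law f g K (lam * ta) ta tht pp0 N)) mus
  <= ennreal (tht powr (real N / 2)) * transport_dist 1 (weight ta) pp0 pp + ennreal (bias lam + discretisation_error tht ta)"
proof -
 note tht0 = step_param_pos[OF ta th(1)]
 have si: "lam * ta > 0" using lam ta by simp
 let ?mu = "x_marginal (pd_law f g K (lam * ta) ta tht pp0 N)"
 have "wasserstein2 ?mu mus <= wasserstein2 ?mu (x_marginal pp) + wasserstein2 (x_marginal pp) mus"
  by (intro wasserstein2_triangle prob_distribution_x_marginal prob_distribution_pd_law ta si pp0 prob_distribution_pp prob_distribution_target)
 also have "... <= (ennreal (tht powr (real N / 2)) * transport_dist 1 (weight ta) pp0 pp + ennreal (discretisation_error tht ta)) + ennreal (bias lam)"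
 proof (rule add_mono)
  show "wasserstein2 ?mu (x_marginal pp) <= ennreal (tht powr (real N / 2)) * transport_dist 1 (weight ta) pp0 pp + ennreal (discretisation_error tht ta)"
   by (rule order_trans[OF discretisation_wasserstein[OF ta tht0 tht st th pp0]])
     (intro add_left_mono ennreal_leI sqrt_step_le ta tht)
  show "wasserstein2 (x_marginal pp) mus <= ennreal (bias lam)"
   using stationary_target_distance[OF big] big by (simp add: bias_def)
 qed
 also have "... = ennreal (tht powr (real N / 2)) * transport_dist 1 (weight ta) pp0 pp + ennreal (bias lam + discretisation_error tht ta)"
  using bias_nonneg discretisation_error_nonneg by (simp add: add.assoc add.commute)
 finally show ?thesis .
qed

text \<open>Started at \<open>pp\<close> the transient term vanishes at every step, and the bound survives the weak
 limit.\<close>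

lemma limit_target_distance:
 assumes big: "lam > wg / wfs" and ta: "ta > 0" and tht: "tht < 1" and st: "tht * (lam * ta) * ta * L^2 <= 1"
  and th: "inverse (1 + wg * ta) <= tht" "inverse (1 + wfs * (lam * ta)) <= tht"
  and lim: "pd_law_limit f g K (lam * ta) ta tht pp'"
 shows "wasserstein2 (x_marginal pp') mus <= ennreal (bias lam + discretisation_error tht ta)"
proof -
 have si: "lam * ta > 0" using lam ta by simp
 have p: "prob_distribution (pd_law f g K (lam * ta) ta tht pp n)" for n by (rule prob_distribution_pd_law[OF ta si prob_distribution_pp])
 have p': "prob_distribution pp'" and w: "converges_weakly (pd_law f g K (lam * ta) ta tht pp) pp'"
  using lim prob_distribution_pp finite_second_moment_pp unfolding pd_law_limit_def by blast+
 show ?thesis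
 proof (rule weak_limit_of_iteration[OF ta si step_param_pos[OF ta th(1)] tht st th prob_distribution_pp finite_second_moment_pp
    prob_distribution_x_marginal[OF p'] prob_distribution_target])
  show "converges_weakly (%n. x_marginal (pd_law f g K (lam * ta) ta tht pp n)) (x_marginal pp')"
   using p p' by (intro converges_weakly_x_marginal w) (auto simp: prob_distribution_def)
  show "wasserstein2 (x_marginal (pd_law f g K (lam * ta) ta tht pp n)) mus <= ennreal (bias lam + discretisation_error tht ta)" for n
   using iteration_target_distance[OF big ta tht st th prob_distribution_pp, of n] by (simp add: transport_dist_refl prob_distribution_pp)
 qed
qed

end

theorem corollary4p10:
  fixes f :: "real ^ 'm \<Rightarrow> real" and g :: "real ^ 'd \<Rightarrow> real" and K :: "real ^ 'd \<Rightarrow> real ^ 'm"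
    and \<omega>f \<omega>g \<omega>fs Lg L D1 D5 :: real and D6 :: "real \<Rightarrow> real"
    and F :: "real ^ 'd \<Rightarrow> real ^ 'm" and J :: "real ^ 'd \<Rightarrow> real ^ 'd ^ 'm"
  defines "L \<equiv> onorm K"
    and "F \<equiv> \<lambda>x. grad f (K x)"
    and "J \<equiv> \<lambda>x. jacobian F (at x)"
    and "D1 \<equiv> LINT x|target f g K. (frobenius_norm (J x))\<^sup>2"
    and "D5 \<equiv> (D1 / \<omega>g) powr (1/2)"
    and "D6 \<equiv> \<lambda>\<theta>. (4 * real CARD('d) * Lg\<^sup>2 / \<omega>g
                    + 6 * real CARD('d) * L\<^sup>2 * (1 + 2 * \<theta>\<^sup>2) / \<omega>fs) powr (1/2)
                   * (1 - \<theta>) powr (- 1/2)"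
  assumes "linear K"
    and "0 < (LINT x|lborel. exp (- f (K x) - g x))"
    and "integrable lborel (\<lambda>x. exp (- f (K x) - g x))"
    and "C_k 3 f" and "\<omega>f > 0" and "strongly_convex \<omega>f f"
    and "C_k 1 g" and "Lg > 0" and "Lg-lipschitz_on UNIV (grad g)"
    and "\<omega>g > 0" and "strongly_convex \<omega>g g"
    and "\<omega>fs > 0" and "strongly_convex \<omega>fs (convex_conjugate f)"
    and "integrable (target f g K) (\<lambda>x. (frobenius_norm (J x))\<^sup>2)"
    and "integrable (target f g K) (\<lambda>x. (norm (laplacian F x))\<^sup>2)"
    and "integrable (target f g K) (\<lambda>x. (norm (J x *v (grad g x + adjoint K (F x))))\<^sup>2)"
  shows "\<exists>C1 :: real \<Rightarrow> real.
    (\<forall>lam. C1 lam \<ge> 0) \<and>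
    (\<lambda>lam. C1 lam - D5 * lam powr (- 1/2)) \<in> O[at_top](\<lambda>lam. lam powr (- 3/2)) \<and>
    (\<forall>lam \<pi>lam D4.
       lam > \<omega>g / \<omega>fs \<and> pd_stationary f g K lam \<pi>lam \<and>
       (\<integral>\<^sup>+ z. ennreal ((norm (A_PD f g K lam z))\<^sup>2) \<partial>\<pi>lam) \<le> ennreal D4 \<longrightarrow>
       (\<exists>C2 :: real \<Rightarrow> real \<Rightarrow> real.
          (\<forall>\<theta> \<tau>. C2 \<theta> \<tau> \<ge> 0) \<and>
          (\<forall>\<theta>\<in>{0<..<1}. (\<lambda>\<tau>. C2 \<theta> \<tau> - D6 \<theta> * \<tau>) \<in> O[at_right 0](\<lambda>\<tau>. \<tau> powr (3/2))) \<and>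
          (\<lambda>(\<theta>, \<tau>). C2 \<theta> \<tau> - D6 \<theta> * \<tau>)
             \<in> O[principal {0<..<1} \<times>\<^sub>F at_right 0](\<lambda>(\<theta>, \<tau>). (1 - \<theta>) powr (- 1/2) * \<tau> powr (3/2)) \<and>
          (\<forall>\<sigma> \<tau> \<theta>.
             \<sigma> > 0 \<and> \<tau> > 0 \<and> \<sigma> = lam * \<tau> \<and> \<theta> * \<sigma> * \<tau> * L\<^sup>2 \<le> 1 \<and>
             max (inverse (1 + \<omega>g * \<tau>)) (inverse (1 + \<omega>fs * \<sigma>)) \<le> \<theta> \<and> \<theta> < 1 \<longrightarrow>
             (\<forall>\<pi>0 N. prob_distribution \<pi>0 \<and> finite_second_moment \<pi>0 \<longrightarrow>
                wasserstein2 (x_marginal (pd_law f g K \<sigma> \<tau> \<theta> \<pi>0 N)) (target f g K)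
                \<le> ennreal (\<theta> powr (real N / 2))
                     * transport_dist 1 (inverse ((1 + \<omega>g * \<tau>) / (1 + \<omega>fs * \<sigma>) * lam)) \<pi>0 \<pi>lam
                   + ennreal (C1 lam + C2 \<theta> \<tau>)) \<and>
             (\<theta> * \<sigma> * \<tau> * L\<^sup>2 < 1 \<longrightarrow>
                (\<forall>\<pi>lim. pd_law_limit f g K \<sigma> \<tau> \<theta> \<pi>lim \<longrightarrow>
                   wasserstein2 (x_marginal \<pi>lim) (target f g K) \<le> ennreal (C1 lam + C2 \<theta> \<tau>))))))"
proof -
 have df: "GDERIV f y :> grad f y" for y
  using \<open>C_k 3 f\<close> by (intro differentiable_imp_GDERIV_grad) (simp add: numeral_3_eq_3)
 have dg: "GDERIV g x :> grad g x" for x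
  using \<open>C_k 1 g\<close> by (intro differentiable_imp_GDERIV_grad) simp
 note int = \<open>integrable (target f g K) (\<lambda>x. (frobenius_norm (J x))\<^sup>2)\<close>[unfolded J_def F_def]
  \<open>integrable (target f g K) (\<lambda>x. (norm (laplacian F x))\<^sup>2)\<close>[unfolded F_def]
  \<open>integrable (target f g K) (\<lambda>x. (norm (J x *v (grad g x + adjoint K (F x))))\<^sup>2)\<close>[unfolded J_def F_def]
 have PM: "pd_moments f g K \<omega>f \<omega>g \<omega>fs Lg"
  by (intro pd_moments.intro pd_smooth.intro pd_target.intro pd_problem.intro pd_target_axioms.intro
    pd_smooth_axioms.intro pd_moments_axioms.intro df dg int; fact)
 interpret PM: pd_moments f g K \<omega>f \<omega>g \<omega>fs Lg by (rule PM)
 have D1: "D1 = PM.jacobian_moment"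
  unfolding D1_def J_def F_def PM.jacobian_moment_def PM.frobenius_norm_jacobian ..
 show ?thesis
 proof (intro exI[of _ PM.bias] conjI allI impI, goal_cases)
  case 1
  show ?case by (rule PM.bias_nonneg)
 next
  case 2
  show ?case unfolding D5_def D1 by (rule PM.bias_asymptotics)
 next
  case (3 lam \<pi>lam D4)
  obtain M :: "(((real ^ 'd) \<times> (real ^ 'm)) \<times> (real \<Rightarrow> real ^ 'd)) measure" and W X Y
   where MW: "pd_diffusion f g K lam M W X Y" "\<And>t. t \<ge> 0 \<Longrightarrow> distr M borel (\<lambda>\<omega>. (X t \<omega>, Y t \<omega>)) = \<pi>lam"
   using 3 unfolding pd_stationary_def by blast
  have big: "lam > \<omega>g / \<omega>fs" using 3 by blast
  have "\<omega>g / \<omega>fs > 0" using \<open>\<omega>g > 0\<close> \<open>\<omega>fs > 0\<close> by simp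
  hence lam: "lam > 0" using big by linarith
  have D4: "(\<integral>\<^sup>+ z. ennreal ((norm (A_PD f g K lam z))\<^sup>2) \<partial>\<pi>lam) \<le> ennreal (max D4 0)"
   using 3 by (meson ennreal_leI max.cobounded1 order_trans)
  interpret P: pd_full f g K \<omega>f \<omega>g \<omega>fs Lg lam "max D4 0" M W X Y \<pi>lam
   by unfold_locales (use lam MW D4 in auto)
  have D6: "D6 \<theta> = P.err_A \<theta> powr (1/2) * (1 - \<theta>) powr (- 1/2)" for \<theta>
   by (simp add: D6_def P.err_A_def L_def)
  note asym = P.discretisation_error_asymptotics[folded D6]
  show ?case
  proof (intro exI[of _ P.discretisation_error] conjI allI ballI impI, goal_cases)
   case 1
   show ?case by (rule P.discretisation_error_nonneg)
  next
   case (2 \<theta>)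
   show ?case
   proof (rule bigoI, rule eventually_mono[OF eventually_at_right_less])
    show "norm (P.discretisation_error \<theta> \<tau> - D6 \<theta> * \<tau>) \<le> (sqrt P.err_B * (1 - \<theta>) powr (- 1/2)) * norm (\<tau> powr (3/2))" if "0 < \<tau>" for \<tau>
     using asym[OF that, of \<theta>] by (simp add: mult.assoc)
   qed
  next
   case 3
   have "eventually (\<lambda>p. snd p > 0) (principal {0<..<1::real} \<times>\<^sub>F at_right (0::real))"
    by (rule eventually_compose_filterlim[OF eventually_at_right_less filterlim_snd])
   hence "eventually (\<lambda>p. norm (case p of (\<theta>, \<tau>) \<Rightarrow> P.discretisation_error \<theta> \<tau> - D6 \<theta> * \<tau>)
     \<le> sqrt P.err_B * norm (case p of (\<theta>, \<tau>) \<Rightarrow> (1 - \<theta>) powr (- 1/2) * \<tau> powr (3/2))) (principal {0<..<1} \<times>\<^sub>F at_right 0)"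
    by (rule eventually_mono) (use asym in \<open>simp add: case_prod_unfold\<close>)
   thus ?case by (rule bigoI)
  next
   case (4 \<sigma> \<tau> \<theta> \<pi>0 N)
   hence "\<sigma> = lam * \<tau>" by blast
   with 4 P.iteration_target_distance[OF big, of \<tau> \<theta> \<pi>0 N] show ?case by (simp add: P.weight_def L_def)
  next
   case (5 \<sigma> \<tau> \<theta> \<pi>lim)
   hence "\<sigma> = lam * \<tau>" by blast
   with 5 P.limit_target_distance[OF big, of \<tau> \<theta> \<pi>lim] show ?case by (simp add: L_def)
  qed
 qed
qed

end
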